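(* In the finite-volume marked cycle model described in the context, let $x\mapsto\eta_x$ ($x>0$) be a family of finite positive Borel measures on $\mathsf M$, put $\phi(x):=\eta_x(\mathsf M)$, and let $\nu^{(\kappa)},\Pi^{(\kappa)},T^{(\kappa)}$ be the associated objects defined in the context. Assume the following. (1) [Limiting kernel] $x\mapsto\int f\,d\eta_x$ is continuous on $(0,\infty)$ for every $f\in C_b(\mathsf M)$; there is a finite positive measure $\Sigma$ on $[0,\infty)$ with $\phi(x)=\int_{[0,\infty)}e^{-\beta x\lambda}\,\Sigma(d\lambda)$ for all $x>0$; and $\int_0^\infty(1\wedge x)e^{-\kappa' x}\frac{\phi(x)}{x}dx<\infty$ for every $\kappa'>0$. (2) [Density] For every $\kappa'>0$, $T^{(\kappa')}$ has a density $f_0^{(\kappa')}$ that is continuous on $(0,\infty)$. (3) [Effective trace convergence] For all $0<\delta<R<\infty$ and every $F\in C_b([0,1]\times[\delta,R]\times\mathsf M)$, $$\sup_{x\in[\delta,R]}\Big|\int_0^1\!\!\int_{\mathsf M}F(u,x,m)\,\mu^{\mathrm{eff}}_{L,\lfloor xV_L\rfloor}(dm)\,du-\int_0^1\!\!\int_{\mathsf M}F(u,x,m)\,\eta_x(dm)\,du\Big|\to0\quad(L\to\infty),$$ and $\sup_L\sup_{j\ge1}q^{\mathrm{eff}}_{L,j}<\infty$. (4) [Spectral criterion] At least one of the following holds. (A) There are finite positive measures $\Sigma_L$ on $[0,\infty)$ with $q^{\mathrm{eff}}_{L,j}=\int e^{-\beta(j/V_L)\lambda}\Sigma_L(d\lambda)$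 for all $L$ and $j\ge1$, such that, with $\Theta_L:=\Sigma_L([0,\infty))$: $\sup_L\Theta_L<\infty$; for all $0<\delta<R<\infty$, $\sup_{x\in[\delta,R]}\big|\int e^{-\beta(\lfloor xV_L\rfloor/V_L)\lambda}\Sigma_L(d\lambda)-\int e^{-\beta x\lambda}\Sigma(d\lambda)\big|\to0$; there is $\Theta_*>1$ with $\Theta_L\ge\Theta_*$ for all large $L$; and $\sup_L\int\log(1+\kappa'+\beta\lambda)\,\Sigma_L(d\lambda)<\infty$ for every $\kappa'>0$. (B) There are $Q\ge1$, weights $\theta_1,\dots,\theta_Q>0$ with $\sum_{r=1}^Q\theta_r=1$, and $\lambda_{L,r}\in[0,\infty)$ with $\lambda_{L,r}\to\lambda_r\in[0,\infty)$ such that $q^{\mathrm{eff}}_{L,j}=\sum_{r=1}^Q\theta_re^{-\beta\lambda_{L,r}j/V_L}$ for all $L$ and $j\ge1$ (and then $\phi(x)=\sum_r\theta_re^{-\beta\lambda_rx}$). (5) [Background] $\kappa>0$ and $\rho_{\mathrm{bg}}\in[0,\infty)$ are such that $$\frac1{V_L}\sum_{j\ge1}e^{-\kappa j/V_L}q^{\mathrm{bg}}_{L,j}\to\rho_{\mathrm{bg}},\qquad \frac1{V_L^2}\sum_{j\ge1}j\,e^{-\kappa j/V_L}q^{\mathrm{bg}}_{L,j}\to0.$$ (6) [Density regime] $N_L/V_L\to\rho\in(0,\infty)$ with $\rho>\rho_{\mathrm{bg}}$; set $\rho_{\mathrm{eff}}:=\rho-\rho_{\mathrm{bg}}$; and,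 for the $\kappa$ of (5), $f_0^{(\kappa)}(\rho_{\mathrm{eff}})>0$. Then, under the canonical law with $N_L$ particles, as $L\to\infty$: (i) $\Xi_L:=\Xi_{L,N_L}\Rightarrow\Pi^{\mathrm{br}}_{\rho_{\mathrm{eff}}}=\mathcal L(\Pi^{(\kappa)}\mid T^{(\kappa)}=\rho_{\mathrm{eff}})$ in $\mathcal N_\ell(\mathsf E)$. (ii) For all $0<\delta<R<\infty$, $\mathbb P\big(\Xi_{L,\mathrm{bg}}([0,1]\times[\delta,R]\times\mathsf M)>0\big)\to0$. (iii) $(B_L/V_L,\;G_L/V_L)\to(\rho_{\mathrm{bg}},\rho_{\mathrm{eff}})$ in probability.
   Context: Finite-volume model. $L$ runs through a sequence tending to infinity; $V_L>0$ with $V_L\to\infty$; $\beta>0$ is fixed. $K_L$ is a nonnegative self-adjoint operator on a Hilbert space $\mathcal H_L$ with discrete spectrum and lowest eigenvalue $0$, and $e^{-tK_L}$ is trace class for all $t>0$. Put $q_{L,j}=\operatorname{Tr}e^{-\beta jK_L}$, $j\ge1$. $\mathsf M$ is a Polish space, and $\mu_{L,j}=\mu^{\mathrm{eff}}_{L,j}+\mu^{\mathrm{bg}}_{L,j}$ are finite positive Borel measures on $\mathsf M$ with $\mu_{L,j}(\mathsf M)=q_{L,j}$; $q^{\mathrm{eff}}_{L,j}=\mu^{\mathrm{eff}}_{L,j}(\mathsf M)$, $q^{\mathrm{bg}}_{L,j}=\mu^{\mathrm{bg}}_{L,j}(\mathsf M)$. (Quantities indexed by $\lfloor xV_L\rfloor$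 with $x\ge\delta$ are considered for $L$ large enough that $\delta V_L\ge1$.) Canonical marked cycle process. For $N\in\mathbb N$, the canonical law of the cycle counts $(n_j)_{j\ge1}$ (nonnegative integers with $\sum_jjn_j=N$) is $\frac1{Z_{L,N}}\prod_j\frac1{n_j!}(q_{L,j}/j)^{n_j}$, $Z_{L,N}$ being the normalizing constant. Given the counts, each cycle $c$ of length $|c|=j$ independently receives a label $\sigma(c)\in\{\mathrm{eff},\mathrm{bg}\}$ with probabilities $q^{\mathrm{eff}}_{L,j}/q_{L,j}$ and $q^{\mathrm{bg}}_{L,j}/q_{L,j}$, then a mark $m_c$ with law $\mu^{\sigma(c)}_{L,j}/q^{\sigma(c)}_{L,j}$, and an independent $U_c\sim\mathrm{Unif}[0,1]$. With $\mathsf E=[0,1]\times(0,\infty)\times\mathsf M$, set $\Xi_{L,N}=\sum_c\delta_{(U_c,|c|/V_L,m_c)}$; $\Xi_{L,\mathrm{eff}}$ and $\Xi_{L,\mathrm{bg}}$ are the sub-sums over cycles with label eff, resp. bg, when $N=N_L$ ($N_L\in\mathbb N$ a given sequence). $G_L=V_L\int x\,d\Xi_{L,\mathrm{eff}}$, $B_L=V_L\int x\,d\Xi_{L,\mathrm{bg}}$, so $G_L+B_L=N_L$. Topology. $\mathcal N_\ell(\mathsf E)$ is the space of Borel point measures on $\mathsf E$ that are finite on $[0,1]\times[\delta,R]\times\mathsf M$ for all $0<\delta<R<\infty$, with the coarsest topology making $\xi\mapsto\int f\,d\xi$ continuous for every bounded continuous $f:\mathsf E\to\mathbb R$ that vanishes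 for $x\notin[\delta,R]$ for some $0<\delta<R<\infty$. $\mathcal H$ is the set of nonnegative such $f$. $\Rightarrow$ is weak convergence of laws. Limit object. For $\kappa>0$, $\nu^{(\kappa)}(du,dx,dm)=du\,e^{-\kappa x}\frac{dx}x\,\eta_x(dm)$ on $\mathsf E$; $\Pi^{(\kappa)}$ is a Poisson point process with intensity $\nu^{(\kappa)}$; $T^{(\kappa)}=\int x\,d\Pi^{(\kappa)}$. The marked Poisson–Kingman bridge $\Pi^{\mathrm{br}}_a$ ($a>0$, $f_0^{(\kappa)}(a)>0$) is the conditional law of $\Pi^{(\kappa)}$ given $T^{(\kappa)}=a$, defined by disintegration: $\mathbf E[\Phi(\Pi^{(\kappa)})g(T^{(\kappa)})]=\int_0^\infty g(a)\,\mathbf E[\Phi(\Pi^{\mathrm{br}}_a)]\,f_0^{(\kappa)}(a)\,da$ for bounded measurable $\Phi,g$; at individual points $a$ one takes the version for which $a\mapsto\mathbf E[e^{-\int h\,d\Pi_a^{\mathrm{br}}}]$ is continuous for every $h\in\mathcal H$. *)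

theory Defs
  imports "HOL-Probability.Probability"
begin

section \<open>Complex Hilbert spaces and unbounded self-adjoint operators\<close>

class complex_hilbert_space = real_inner + complete_space +
  fixes scaleC :: "complex \<Rightarrow> 'a \<Rightarrow> 'a"  (infixr "*\<^sub>C" 75)
    and cinner :: "'a \<Rightarrow> 'a \<Rightarrow> complex"
  assumes scaleC_add_right: "a *\<^sub>C (x + y) = a *\<^sub>C x + a *\<^sub>C y"
    and scaleC_add_left: "(a + b) *\<^sub>C x = a *\<^sub>C x + b *\<^sub>C x"
    and scaleC_scaleC: "a *\<^sub>C (b *\<^sub>C x) = (a * b) *\<^sub>C x"
    and scaleR_scaleC: "r *\<^sub>R x = complex_of_real r *\<^sub>C x"
    and cinner_commute: "cinner x y = cnj (cinner y x)"
    and cinner_add_right: "cinner x (y + z) = cinner x y + cinner x z"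
    and cinner_scaleC_right: "cinner x (a *\<^sub>C y) = a * cinner x y"
    and inner_eq_Re_cinner: "inner x y = Re (cinner x y)"

definition csubspace :: "'h::complex_hilbert_space set \<Rightarrow> bool" where
  "csubspace S \<longleftrightarrow> 0 \<in> S \<and> (\<forall>x\<in>S. \<forall>y\<in>S. x + y \<in> S) \<and> (\<forall>a. \<forall>x\<in>S. a *\<^sub>C x \<in> S)"

text \<open>Hilbert spaces occur as closed subspaces \<open>H\<close> of an ambient Hilbert space, so that a sequence of
  different Hilbert spaces can be treated inside one type (their Hilbert sum). An operator on \<open>H\<close> is
  a function together with its domain \<open>D \<subseteq> H\<close>; its values outside \<open>D\<close> are irrelevant.\<close>

definition clinear_on :: "'h::complex_hilbert_space set \<Rightarrow> ('h \<Rightarrow> 'h) \<Rightarrow> bool" where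
  "clinear_on S T \<longleftrightarrow>
     (\<forall>x\<in>S. \<forall>y\<in>S. T (x + y) = T x + T y) \<and> (\<forall>a. \<forall>x\<in>S. T (a *\<^sub>C x) = a *\<^sub>C T x)"

text \<open>The equivalence below says that the graph of the adjoint of \<open>K\<close> is the graph of \<open>K\<close>.\<close>

definition self_adjoint_on ::
    "'h::complex_hilbert_space set \<Rightarrow> 'h set \<Rightarrow> ('h \<Rightarrow> 'h) \<Rightarrow> bool" where
  "self_adjoint_on H D K \<longleftrightarrow>
     csubspace H \<and> closed H \<and>
     csubspace D \<and> D \<subseteq> H \<and> H \<subseteq> closure D \<and>
     clinear_on D K \<and> K ` D \<subseteq> H \<and>
     (\<forall>y\<in>H. \<forall>z\<in>H. (\<forall>x\<in>D. cinner (K x) y = cinner x z) \<longleftrightarrow> y \<in> D \<and> K y = z)"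

definition nonnegative_op :: "'h::complex_hilbert_space set \<Rightarrow> ('h \<Rightarrow> 'h) \<Rightarrow> bool" where
  "nonnegative_op D K \<longleftrightarrow> (\<forall>x\<in>D. cinner x (K x) \<in> \<real> \<and> 0 \<le> Re (cinner x (K x)))"

definition eigenspace :: "'h::complex_hilbert_space set \<Rightarrow> ('h \<Rightarrow> 'h) \<Rightarrow> complex \<Rightarrow> 'h set" where
  "eigenspace D K z = {x \<in> D. K x = z *\<^sub>C x}"

definition spectrum ::
    "'h::complex_hilbert_space set \<Rightarrow> 'h set \<Rightarrow> ('h \<Rightarrow> 'h) \<Rightarrow> complex set" where
  "spectrum H D K =
     {z. \<not> (bij_betw (\<lambda>x. K x - z *\<^sub>C x) D H \<and>
            (\<exists>C. \<forall>x\<in>D. norm x \<le> C * norm (K x - z *\<^sub>C x)))}"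

definition finite_cdim :: "'h::complex_hilbert_space set \<Rightarrow> bool" where
  "finite_cdim S \<longleftrightarrow> (\<exists>F. finite F \<and> (\<forall>x\<in>S. \<exists>a. x = (\<Sum>b\<in>F. a b *\<^sub>C b)))"

text \<open>Every point of the spectrum is an isolated eigenvalue of finite multiplicity.\<close>

definition discrete_spectrum ::
    "'h::complex_hilbert_space set \<Rightarrow> 'h set \<Rightarrow> ('h \<Rightarrow> 'h) \<Rightarrow> bool" where
  "discrete_spectrum H D K \<longleftrightarrow>
     (\<forall>z\<in>spectrum H D K. \<not> z islimpt spectrum H D K \<and>
        eigenspace D K z \<noteq> {0} \<and> finite_cdim (eigenspace D K z))"

definition eigenvalues :: "'h::complex_hilbert_space set \<Rightarrow> ('h \<Rightarrow> 'h) \<Rightarrow> real set" where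
  "eigenvalues D K = {r. eigenspace D K (complex_of_real r) \<noteq> {0}}"

definition orth_proj :: "'h::complex_hilbert_space set \<Rightarrow> 'h \<Rightarrow> 'h" where
  "orth_proj S v = (THE w. w \<in> S \<and> (\<forall>s\<in>S. cinner s (v - w) = 0))"

text \<open>\<open>exp (-t K)\<close> by the functional calculus \<open>f(K) = \<Sum>\<^sub>r f(r) P\<^sub>r\<close>, the sum being over the eigenvalues
  and \<open>P\<^sub>r\<close> the spectral projections; this form is only meant for self-adjoint \<open>K\<close> with discrete
  spectrum.\<close>

definition exp_op ::
    "'h::complex_hilbert_space set \<Rightarrow> ('h \<Rightarrow> 'h) \<Rightarrow> real \<Rightarrow> 'h \<Rightarrow> 'h" where
  "exp_op D K t v =
     (\<Sum>\<^sub>\<infinity>r\<in>eigenvalues D K. exp (- t * r) *\<^sub>R orth_proj (eigenspace D K (complex_of_real r)) v)"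

definition orthonormal_basis :: "'h::complex_hilbert_space set \<Rightarrow> 'h set \<Rightarrow> bool" where
  "orthonormal_basis H B \<longleftrightarrow>
     B \<subseteq> H \<and> (\<forall>e\<in>B. \<forall>e'\<in>B. cinner e e' = (if e = e' then 1 else 0)) \<and>
     (\<forall>x\<in>H. (\<forall>e\<in>B. cinner e x = 0) \<longrightarrow> x = 0)"

definition bounded_op :: "'h::complex_hilbert_space set \<Rightarrow> ('h \<Rightarrow> 'h) \<Rightarrow> bool" where
  "bounded_op H T \<longleftrightarrow> clinear_on H T \<and> T ` H \<subseteq> H \<and> (\<exists>C. \<forall>x\<in>H. norm (T x) \<le> C * norm x)"

text \<open>In the definition of trace class, \<open>A\<close> is the absolute value \<open>|T|\<close>, that is, the bounded
  nonnegative operator whose square is the product of the adjoint of \<open>T\<close> with \<open>T\<close>.\<close>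

definition trace_class :: "'h::complex_hilbert_space set \<Rightarrow> ('h \<Rightarrow> 'h) \<Rightarrow> bool" where
  "trace_class H T \<longleftrightarrow> bounded_op H T \<and>
     (\<exists>A. bounded_op H A \<and> nonnegative_op H A \<and>
          (\<forall>x\<in>H. \<forall>y\<in>H. cinner (A x) (A y) = cinner (T x) (T y)) \<and>
          (\<exists>B. orthonormal_basis H B \<and> (\<lambda>e. cinner e (A e)) summable_on B))"

definition op_trace :: "'h::complex_hilbert_space set \<Rightarrow> ('h \<Rightarrow> 'h) \<Rightarrow> complex" where
  "op_trace H T = (\<Sum>\<^sub>\<infinity>e\<in>(SOME B. orthonormal_basis H B). cinner e (T e))"


section \<open>Finite-volume model\<close>

abbreviation mass :: "'a measure \<Rightarrow> real" where
  "mass M \<equiv> measure M (space M)"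

definition finite_borel :: "'a::topological_space measure \<Rightarrow> bool" where
  "finite_borel M \<longleftrightarrow> sets M = sets borel \<and> finite_measure M"

text \<open>Finite Borel measures on \<open>[0,\<infinity>)\<close>.\<close>

definition finite_borel_halfline :: "real measure \<Rightarrow> bool" where
  "finite_borel_halfline M \<longleftrightarrow> sets M = sets (restrict_space borel {0..}) \<and> finite_measure M"

text \<open>The index \<open>n\<close> enumerates the sequence of values of \<open>L\<close>; only cycle lengths \<open>j \<ge> 1\<close> matter.\<close>

locale finite_volume_model =
  fixes V :: "nat \<Rightarrow> real" and \<beta> :: real
    and H :: "nat \<Rightarrow> 'h::complex_hilbert_space set"
    and D :: "nat \<Rightarrow> 'h set" and K :: "nat \<Rightarrow> 'h \<Rightarrow> 'h"
    and \<mu> \<mu>eff \<mu>bg :: "nat \<Rightarrow> nat \<Rightarrow> 'm::polish_space measure"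
  assumes V_pos: "\<And>n. 0 < V n"
    and V_at_top: "filterlim V at_top sequentially"
    and beta_pos: "0 < \<beta>"
    and self_adjoint: "\<And>n. self_adjoint_on (H n) (D n) (K n)"
    and nonnegative: "\<And>n. nonnegative_op (D n) (K n)"
    and discrete: "\<And>n. discrete_spectrum (H n) (D n) (K n)"
    and lowest_eigenvalue: "\<And>n. 0 \<in> eigenvalues (D n) (K n)"
      "\<And>n r. r \<in> eigenvalues (D n) (K n) \<Longrightarrow> 0 \<le> r"
    and heat_trace_class: "\<And>n t. 0 < t \<Longrightarrow> trace_class (H n) (exp_op (D n) (K n) t)"
    and finite_borel_mu: "\<And>n j. 1 \<le> j \<Longrightarrow> finite_borel (\<mu> n j)"
      "\<And>n j. 1 \<le> j \<Longrightarrow> finite_borel (\<mu>eff n j)"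
      "\<And>n j. 1 \<le> j \<Longrightarrow> finite_borel (\<mu>bg n j)"
    and mu_split: "\<And>n j A. 1 \<le> j \<Longrightarrow> A \<in> sets borel \<Longrightarrow>
      emeasure (\<mu> n j) A = emeasure (\<mu>eff n j) A + emeasure (\<mu>bg n j) A"
    and mu_trace: "\<And>n j. 1 \<le> j \<Longrightarrow>
      complex_of_real (mass (\<mu> n j)) = op_trace (H n) (exp_op (D n) (K n) (\<beta> * real j))"


section \<open>Point measures on \<open>[0,1] \<times> (0,\<infinity>) \<times> M\<close>\<close>

definition E :: "(real \<times> real \<times> 'm) set" where
  "E = {0..1} \<times> {0<..} \<times> UNIV"

definition strip :: "real \<Rightarrow> real \<Rightarrow> (real \<times> real \<times> 'm) set" where
  "strip \<delta> R = {0..1} \<times> {\<delta>..R} \<times> UNIV"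

definition borel_E :: "(real \<times> real \<times> 'm::polish_space) measure" where
  "borel_E = restrict_space borel E"

text \<open>The image of a counting measure under \<open>p\<close> is the sum of the Dirac masses at the points \<open>p i\<close>.\<close>

definition is_point_measure :: "(real \<times> real \<times> 'm::polish_space) measure \<Rightarrow> bool" where
  "is_point_measure \<xi> \<longleftrightarrow>
     (\<exists>(I::nat set) p. p ` I \<subseteq> E \<and> \<xi> = distr (count_space I) borel_E p)"

definition locally_finite_point_measures :: "(real \<times> real \<times> 'm::polish_space) measure set" where
  "locally_finite_point_measures =
     {\<xi>. is_point_measure \<xi> \<and> (\<forall>\<delta> R. 0 < \<delta> \<longrightarrow> \<delta> < R \<longrightarrow> emeasure \<xi> (strip \<delta> R) < \<infinity>)}"

definition test_functions :: "(real \<times> real \<times> 'm::polish_space \<Rightarrow> real) set" where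
  "test_functions =
     {f. continuous_on E f \<and> bounded (f ` E) \<and>
         (\<exists>\<delta> R. 0 < \<delta> \<and> \<delta> < R \<and> (\<forall>z\<in>E. z \<notin> strip \<delta> R \<longrightarrow> f z = 0))}"

definition nonneg_test_functions :: "(real \<times> real \<times> 'm::polish_space \<Rightarrow> real) set" where
  "nonneg_test_functions = {f \<in> test_functions. \<forall>z\<in>E. 0 \<le> f z}"

definition point_topology :: "(real \<times> real \<times> 'm::polish_space) measure topology" where
  "point_topology = topology_generated_by
     {{\<xi> \<in> locally_finite_point_measures. (\<integral>z. f z \<partial>\<xi>) \<in> U} | f U. f \<in> test_functions \<and> open U}"

definition borel_points :: "(real \<times> real \<times> 'm::polish_space) measure measure" where
  "borel_points = sigma (topspace point_topology) {U. openin point_topology U}"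

definition weakly_converges ::
    "'a topology \<Rightarrow> (nat \<Rightarrow> 'a measure) \<Rightarrow> 'a measure \<Rightarrow> bool" where
  "weakly_converges X P Q \<longleftrightarrow>
     (\<forall>\<Phi>. continuous_map X euclideanreal \<Phi> \<and> bounded (\<Phi> ` topspace X) \<longrightarrow>
        (\<lambda>n. \<integral>\<xi>. \<Phi> \<xi> \<partial>P n) \<longlonglongrightarrow> (\<integral>\<xi>. \<Phi> \<xi> \<partial>Q))"

text \<open>The Bochner integral is \<open>0\<close> when \<open>\<integral> x d\<xi> = \<infinity>\<close>; this happens with probability zero for the
  processes considered here.\<close>

definition total_size :: "(real \<times> real \<times> 'm::polish_space) measure \<Rightarrow> real" where
  "total_size \<xi> = (\<integral>z. fst (snd z) \<partial>\<xi>)"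


section \<open>Canonical marked cycle process\<close>

definition cycle_counts :: "nat \<Rightarrow> (nat \<Rightarrow> nat) set" where
  "cycle_counts N = {c. (\<forall>j. j \<notin> {1..N} \<longrightarrow> c j = 0) \<and> (\<Sum>j=1..N. j * c j) = N}"

definition count_weight :: "(nat \<Rightarrow> real) \<Rightarrow> nat \<Rightarrow> (nat \<Rightarrow> nat) \<Rightarrow> real" where
  "count_weight q N c = (\<Prod>j=1..N. (q j / real j) ^ c j / fact (c j))"

definition partition_function :: "(nat \<Rightarrow> real) \<Rightarrow> nat \<Rightarrow> real" where
  "partition_function q N = (\<Sum>c\<in>cycle_counts N. count_weight q N c)"

definition count_law :: "(nat \<Rightarrow> real) \<Rightarrow> nat \<Rightarrow> (nat \<Rightarrow> nat) measure" where
  "count_law q N = point_measure (cycle_counts N)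
     (\<lambda>c. ennreal (count_weight q N c / partition_function q N))"

datatype label = Eff | Bg

text \<open>The law \<open>\<mu> / \<mu>(M)\<close>; it is the zero measure if \<open>\<mu>(M) = 0\<close>, in which case the corresponding label
  has probability zero.\<close>

definition normalized :: "'m measure \<Rightarrow> 'm measure" where
  "normalized M = scale_measure (inverse (emeasure M (space M))) M"

definition label_law :: "'m measure \<Rightarrow> 'm measure \<Rightarrow> label pmf" where
  "label_law \<mu> \<mu>eff =
     map_pmf (\<lambda>b. if b then Eff else Bg) (bernoulli_pmf (mass \<mu>eff / mass \<mu>))"

text \<open>Joint law of label, mark and uniform variable of a single cycle.\<close>

definition cycle_law ::
    "'m measure \<Rightarrow> 'm measure \<Rightarrow> 'm measure \<Rightarrow> ((label \<times> 'm::polish_space) \<times> real) measure" where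
  "cycle_law \<mu> \<mu>eff \<mu>bg =
     (measure_pmf (label_law \<mu> \<mu>eff) \<bind>
        (\<lambda>s. distr (normalized (case s of Eff \<Rightarrow> \<mu>eff | Bg \<Rightarrow> \<mu>bg))
                   (count_space UNIV \<Otimes>\<^sub>M borel) (\<lambda>m. (s, m))))
     \<Otimes>\<^sub>M restrict_space lborel {0..1}"

text \<open>A sample is a pair \<open>(c, a)\<close> of cycle counts \<open>c\<close> and cycle attributes \<open>a\<close>. The cycles of length \<open>j\<close>
  are \<open>(j, i)\<close>, \<open>i < c j\<close>. The attributes are drawn independently of \<open>c\<close> for all conceivable cycles,
  i.e. for all \<open>(j, i)\<close> with \<open>1 \<le> j \<le> N\<close> and \<open>i < N\<close>, and only those of actual cycles are used below;
  hence given \<open>c\<close> the attributes of the actual cycles are independent with the prescribed laws.\<close>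

definition canonical_space ::
    "(nat \<Rightarrow> 'm::polish_space measure) \<Rightarrow> (nat \<Rightarrow> 'm measure) \<Rightarrow> (nat \<Rightarrow> 'm measure) \<Rightarrow> nat \<Rightarrow>
       ((nat \<Rightarrow> nat) \<times> (nat \<times> nat \<Rightarrow> (label \<times> 'm) \<times> real)) measure" where
  "canonical_space \<mu> \<mu>eff \<mu>bg N =
     count_law (\<lambda>j. mass (\<mu> j)) N \<Otimes>\<^sub>M
     PiM ({1..N} \<times> {..<N}) (\<lambda>(j, i). cycle_law (\<mu> j) (\<mu>eff j) (\<mu>bg j))"

text \<open>The sum of the Dirac masses at \<open>(U\<^sub>c, |c| / V, m\<^sub>c)\<close> over the cycles with label in \<open>S\<close>.\<close>

definition cycle_process ::
    "real \<Rightarrow> label set \<Rightarrow> (nat \<Rightarrow> nat) \<times> (nat \<times> nat \<Rightarrow> (label \<times> 'm::polish_space) \<times> real) \<Rightarrow>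
       (real \<times> real \<times> 'm) measure" where
  "cycle_process V S = (\<lambda>(c, a).
     distr (count_space {(j, i). 1 \<le> j \<and> i < c j \<and> fst (fst (a (j, i))) \<in> S}) borel_E
       (\<lambda>(j, i). (snd (a (j, i)), real j / V, snd (fst (a (j, i))))))"


text \<open>\<open>V \<integral> x d\<Xi>\<close>, the number of particles in cycles with label in \<open>S\<close>.\<close>

definition particle_number ::
    "real \<Rightarrow> label set \<Rightarrow> (nat \<Rightarrow> nat) \<times> (nat \<times> nat \<Rightarrow> (label \<times> 'm::polish_space) \<times> real) \<Rightarrow>
       real" where
  "particle_number V S \<omega> = V * total_size (cycle_process V S \<omega>)"


section \<open>Poisson process and bridge\<close>

definition intensity ::
    "(real \<Rightarrow> 'm::polish_space measure) \<Rightarrow> real \<Rightarrow> (real \<times> real \<times> 'm) measure" where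
  "intensity \<eta> \<kappa> = measure_of (space borel_E) (sets borel_E)
     (\<lambda>A. \<integral>\<^sup>+u\<in>{0..1}. (\<integral>\<^sup>+x\<in>{0<..}.
        ennreal (exp (- \<kappa> * x) / x) * emeasure (\<eta> x) {m. (u, x, m) \<in> A} \<partial>lborel) \<partial>lborel)"

text \<open>\<open>P\<close> is the law of a Poisson point process with intensity measure \<open>\<nu>\<close>.\<close>

definition poisson_process_law ::
    "(real \<times> real \<times> 'm::polish_space) measure \<Rightarrow> (real \<times> real \<times> 'm) measure measure \<Rightarrow> bool" where
  "poisson_process_law \<nu> P \<longleftrightarrow>
     prob_space P \<and> sets P = sets borel_points \<and>
     (\<forall>A\<in>sets borel_E. emeasure \<nu> A < \<infinity> \<longrightarrow>
        (\<forall>k::nat. measure P {\<xi> \<in> space P. emeasure \<xi> A = of_nat k} =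
                  measure \<nu> A ^ k / fact k * exp (- measure \<nu> A))) \<and>
     (\<forall>A\<in>sets borel_E. emeasure \<nu> A = \<infinity> \<longrightarrow> (AE \<xi> in P. emeasure \<xi> A = \<infinity>)) \<and>
     (\<forall>(I::nat set) A. finite I \<and> A ` I \<subseteq> sets borel_E \<and> disjoint_family_on A I \<longrightarrow>
        prob_space.indep_vars P (\<lambda>_. borel) (\<lambda>i \<xi>. emeasure \<xi> (A i)) I)"

text \<open>\<open>Br a\<close> is the law of \<open>P\<close> conditioned on \<open>total_size = a\<close>, where \<open>f\<close> is the density of \<open>total_size\<close>
  under \<open>P\<close>. It is meaningful only where \<open>f a > 0\<close>; elsewhere \<open>Br a\<close> is arbitrary, and does not
  contribute to the disintegration. The last clause singles out the version at individual points.\<close>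

definition bridge_law ::
    "(real \<times> real \<times> 'm::polish_space) measure measure \<Rightarrow> (real \<Rightarrow> real) \<Rightarrow>
       (real \<Rightarrow> (real \<times> real \<times> 'm) measure measure) \<Rightarrow> bool" where
  "bridge_law P f Br \<longleftrightarrow>
     (\<forall>a. 0 < a \<and> 0 < f a \<longrightarrow> prob_space (Br a) \<and> sets (Br a) = sets borel_points) \<and>
     (\<forall>(\<Phi> :: (real \<times> real \<times> 'm) measure \<Rightarrow> real) (g :: real \<Rightarrow> real).
        \<Phi> \<in> borel_measurable borel_points \<and> bounded (\<Phi> ` space borel_points) \<and>
        g \<in> borel_measurable borel \<and> bounded (range g) \<longrightarrow>
        (\<integral>\<xi>. \<Phi> \<xi> * g (total_size \<xi>) \<partial>P) =
        (LINT a:{0<..}|lborel. g a * (\<integral>\<xi>. \<Phi> \<xi> \<partial>Br a) * f a)) \<and>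
     (\<forall>h\<in>nonneg_test_functions.
        continuous_on {a. 0 < a \<and> 0 < f a} (\<lambda>a. \<integral>\<xi>. exp (- (\<integral>z. h z \<partial>\<xi>)) \<partial>Br a))"


section \<open>Spectral criterion\<close>

text \<open>The two alternatives for \<open>q n j\<close>, the effective traces; \<open>\<Sigma>\<close> is the limiting spectral measure.\<close>

definition spectral_criterion_A ::
    "(nat \<Rightarrow> real) \<Rightarrow> real \<Rightarrow> (nat \<Rightarrow> nat \<Rightarrow> real) \<Rightarrow> real measure \<Rightarrow> bool" where
  "spectral_criterion_A V \<beta> q \<Sigma> \<longleftrightarrow>
     (\<exists>\<Sigma>L :: nat \<Rightarrow> real measure.
        (\<forall>n. finite_borel_halfline (\<Sigma>L n)) \<and>
        (\<forall>n. \<forall>j\<ge>1. q n j = (\<integral>l. exp (- \<beta> * (real j / V n) * l) \<partial>\<Sigma>L n)) \<and>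
        bdd_above (range (\<lambda>n. mass (\<Sigma>L n))) \<and>
        (\<forall>\<delta> R. 0 < \<delta> \<longrightarrow> \<delta> < R \<longrightarrow>
           uniform_limit {\<delta>..R}
             (\<lambda>n x. \<integral>l. exp (- \<beta> * (real_of_int \<lfloor>x * V n\<rfloor> / V n) * l) \<partial>\<Sigma>L n)
             (\<lambda>x. \<integral>l. exp (- \<beta> * x * l) \<partial>\<Sigma>) sequentially) \<and>
        (\<exists>\<Theta>>1. \<forall>\<^sub>F n in sequentially. \<Theta> \<le> mass (\<Sigma>L n)) \<and>
        (\<forall>\<kappa>'>0. (SUP n. \<integral>\<^sup>+l. ennreal (ln (1 + \<kappa>' + \<beta> * l)) \<partial>\<Sigma>L n) < \<infinity>))"

definition spectral_criterion_B ::
    "(nat \<Rightarrow> real) \<Rightarrow> real \<Rightarrow> (nat \<Rightarrow> nat \<Rightarrow> real) \<Rightarrow> bool" where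
  "spectral_criterion_B V \<beta> q \<longleftrightarrow>
     (\<exists>(Q::nat) (\<theta> :: nat \<Rightarrow> real) (lamL :: nat \<Rightarrow> nat \<Rightarrow> real) (lam :: nat \<Rightarrow> real).
        1 \<le> Q \<and> (\<forall>r\<in>{1..Q}. 0 < \<theta> r) \<and> (\<Sum>r=1..Q. \<theta> r) = 1 \<and>
        (\<forall>r\<in>{1..Q}. (\<forall>n. 0 \<le> lamL n r) \<and> 0 \<le> lam r \<and> (\<lambda>n. lamL n r) \<longlonglongrightarrow> lam r) \<and>
        (\<forall>n. \<forall>j\<ge>1. q n j = (\<Sum>r=1..Q. \<theta> r * exp (- \<beta> * lamL n r * real j / V n))))"

end

theory Submission
  imports Defs "HOL-Computational_Algebra.Formal_Power_Series"
begin

text \<open>The generating function of the partition function is \<open>exp (\<Sum>j. q j z\<^sup>j / j)\<close>, so that Laplace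
  transforms of the marked cycle process and of its background part are quotients of partition functions
  with modified weights. The weights of the two labels add, hence such a partition function is a
  convolution of a background and an effective factor. Tilted by \<open>exp (- \<kappa> j / V)\<close>, the background
  factor has total mass at most \<open>1\<close> and concentrates at \<open>\<rho>bg V\<close>. The effective factor satisfies a local
  limit theorem: \<open>V\<close> times its value at \<open>a V\<close> tends to the density of the Poisson process weighted by the
  conditional Laplace functional, that is, to \<open>f0 \<kappa> a\<close> times the Laplace functional of the bridge. Indeed its
  Laplace transform converges, and the recursion \<open>m Z m = (\<Sum>j=1..m. q j Z (m - j))\<close>, a Riemann sum in the
  limit, makes the rescaled weights equicontinuous. The spectral criterion enters only through a bound on
  the effective weights near \<open>0\<close>. In the quotients the common factors cancel, and all three claims follow.\<close>

section \<open>The topology of point measures\<close>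

text \<open>The bound near 0 is forced by the convolution: where the background total is atypical,
  the effective factor is evaluated at an arbitrary index up to \<open>N\<close>, and the recursion
  alone only bounds \<open>V\<close> times its value at \<open>m\<close> by \<open>C V / m\<close>,
  useless for \<open>m\<close> of smaller order than \<open>V\<close>. Near 0 the normalization has
  to compensate a growth like \<open>m powr (\<Theta> - 1)\<close>, where \<open>\<Theta>\<close>
  bounds the weights; at index 0 what remains is \<open>V powr (1 - \<Theta>)\<close>, whence
  \<open>\<Theta> \<ge> 1\<close>. At fixed \<open>N\<close> the tilt by
  \<open>exp (- \<kappa> j / V)\<close> is a constant factor, so it costs nothing in quotients and
  buys integrability at infinity. At 0, where the intensity has the singularity
  \<open>1 / x\<close>, integrability comes from test functions that vanish for small
  \<open>x\<close>: there modified and original weights agree. The mark space is only Polish, so no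
  local compactness is at hand. Laplace functionals still decide weak convergence, because the
  topology is induced by countably many functions \<open>exp (- \<integral> g d\<xi>)\<close>, whose
  products are of the same form, and because the limit is a given probability law on the same
  space.\<close>

definition bump :: "'a::metric_space \<times> nat \<times> rat => 'a => real" where
 "bump = (\<lambda>(z, k, r) w. of_rat \<bar>r\<bar> * max 0 (1 - real k * dist w z))"

text \<open>\<open>bump (z, k, r)\<close> is a cone with apex over \<open>z\<close>, height
  \<open>\<bar>r\<bar>\<close> and, for \<open>k > 0\<close>, support radius \<open>1 / k\<close>;
  with apexes in a countable dense set there are countably many cones. Finite maxima stay countable,
  and starting the fold at 0 keeps them nonnegative even for the empty list.\<close>

definition bump_max :: "('a::metric_space \<times> nat \<times> rat) list => 'a => real" where
 "bump_max xs w = foldr (\<lambda>t. max (bump t w)) xs 0"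

lemma bump_max_simps [simp]: "bump_max [] w = 0" "bump_max (t # xs) w = max (bump t w) (bump_max xs w)"
 by (auto simp: bump_max_def)

lemma bump_nonneg: "0 \<le> bump t w" by (auto simp: bump_def split: prod.splits)

lemma bump_max_nonneg: "0 \<le> bump_max xs w"
 by (induction xs) (auto simp: bump_nonneg le_max_iff_disj)

lemma bump_max_append: "bump_max (xs @ ys) w = max (bump_max xs w) (bump_max ys w)"
 by (induction xs) (auto simp: bump_max_nonneg)

lemma bump_max_le: "0 \<le> y ==> (\<And>t. t \<in> set xs ==> bump t w \<le> y) ==> bump_max xs w \<le> y"
 by (induction xs) auto

lemma bump_max_ge: "t \<in> set xs ==> bump t w \<le> bump_max xs w"
 by (induction xs) (auto simp: le_max_iff_disj)

lemma bump_lipschitz: "\<exists>L\<ge>0. \<forall>w v. \<bar>bump t w - bump t v\<bar> \<le> L * dist w v"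
proof -
 obtain z k r where t: "t = (z, k, r)" by (cases t)
 have "\<bar>bump t w - bump t v\<bar> \<le> of_rat \<bar>r\<bar> * real k * dist w v" for w v
 proof -
  have "\<bar>bump t w - bump t v\<bar> = of_rat \<bar>r\<bar> * \<bar>max 0 (1 - real k * dist w z) - max 0 (1 - real k * dist v z)\<bar>"
   unfolding t bump_def by (simp add: right_diff_distrib[symmetric] abs_mult)
  also have "\<dots> \<le> of_rat \<bar>r\<bar> * \<bar>real k * dist v z - real k * dist w z\<bar>"
   by (intro mult_left_mono) auto
  also have "\<dots> = of_rat \<bar>r\<bar> * (real k * \<bar>dist v z - dist w z\<bar>)"
   by (simp add: right_diff_distrib[symmetric] abs_mult)
  also have "\<dots> \<le> of_rat \<bar>r\<bar> * (real k * dist w v)"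
   using abs_dist_diff_le[of v z w] by (intro mult_left_mono) (auto simp: dist_commute)
  finally show ?thesis by (simp add: mult.assoc)
 qed
 then show ?thesis by (intro exI[of _ "of_rat \<bar>r\<bar> * real k"]) auto
qed

lemma bump_bounded: "\<exists>K\<ge>0. \<forall>w. bump t w \<le> K"
proof -
 obtain z k r where t: "t = (z, k, r)" by (cases t)
 have "of_rat \<bar>r\<bar> * max 0 (1 - real k * dist w z) \<le> (of_rat \<bar>r\<bar> * 1 :: real)" for w
  by (intro mult_left_mono) auto
 then show ?thesis by (intro exI[of _ "of_rat \<bar>r\<bar>"]) (auto simp: t bump_def)
qed

lemma bump_max_lipschitz: "\<exists>L\<ge>0. \<forall>w v. \<bar>bump_max xs w - bump_max xs v\<bar> \<le> L * dist w v"
proof (induction xs)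
 case (Cons t xs)
 obtain L1 where L1: "L1 \<ge> 0" "\<And>w v. \<bar>bump t w - bump t v\<bar> \<le> L1 * dist w v"
  using bump_lipschitz by blast
 obtain L2 where L2: "L2 \<ge> 0" "\<And>w v. \<bar>bump_max xs w - bump_max xs v\<bar> \<le> L2 * dist w v"
  using Cons by blast
 have "\<bar>bump_max (t # xs) w - bump_max (t # xs) v\<bar> \<le> (L1 + L2) * dist w v" for w v
 proof -
  have "\<bar>bump_max (t # xs) w - bump_max (t # xs) v\<bar> \<le> \<bar>bump t w - bump t v\<bar> + \<bar>bump_max xs w - bump_max xs v\<bar>"
   by auto
  also have "\<dots> \<le> (L1 + L2) * dist w v" using L1(2)[of w v] L2(2)[of w v] by (simp add: distrib_right)
  finally show ?thesis .
 qed
 then show ?case using L1(1) L2(1) by (intro exI[of _ "L1 + L2"]) auto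
qed (auto intro: exI[of _ 0])

lemma bump_max_bounded: "\<exists>K\<ge>0. \<forall>w. bump_max xs w \<le> K"
proof (induction xs)
 case (Cons t xs)
 obtain K1 where K1: "K1 \<ge> 0" "\<And>w. bump t w \<le> K1" using bump_bounded by blast
 obtain K2 where K2: "K2 \<ge> 0" "\<And>w. bump_max xs w \<le> K2" using Cons by blast
 have "bump_max (t # xs) w \<le> max K1 K2" for w using K1(2)[of w] K2(2)[of w] by auto
 then show ?case using K1 by (intro exI[of _ "max K1 K2"]) auto
qed auto

text \<open>A rational height between \<open>c\<close> and \<open>f w\<close> and a steepness
  \<open>k\<close> with \<open>2 / k < \<rho>\<close> place the cone under \<open>f\<close>, since
  its support lies in the ball around \<open>w\<close> where \<open>f\<close> exceeds that height.
  The apex is only near \<open>w\<close>, which costs a little of the height.\<close>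

lemma bump_below:
 fixes f :: "'a::metric_space => real"
 assumes D: "\<And>X. open X ==> X \<noteq> {} ==> \<exists>d\<in>D. d \<in> X"
  and f: "continuous_on S f" "\<And>w. w \<in> S ==> 0 \<le> f w" and w: "w \<in> S" and c: "0 \<le> c" "c < f w"
 shows "\<exists>t\<in>D \<times> UNIV \<times> UNIV. (\<forall>v\<in>S. bump t v \<le> f v) \<and> c < bump t w"
proof -
 obtain r where r: "c < of_rat r" "of_rat r < f w" using c of_rat_dense by blast
 then have r0: "0 < (of_rat r :: real)" using c by linarith
 then have rabs: "\<bar>r\<bar> = r" by simp
 obtain \<rho> where \<rho>: "0 < \<rho>" "\<And>v. v \<in> S ==> dist v w < \<rho> ==> of_rat r < f v"
 proof -
  have "0 < f w - of_rat r" using r by simp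
  then obtain d where "0 < d" "\<And>v. v \<in> S ==> dist v w < d ==> dist (f v) (f w) < f w - of_rat r"
   using f(1) w unfolding continuous_on_iff by blast
  then show ?thesis using that[of d] by (fastforce simp: dist_real_def abs_less_iff)
 qed
 obtain k :: nat where k: "2 / \<rho> < real k" using reals_Archimedean2 by blast
 then have k0: "0 < real k" using \<rho>(1) by (meson divide_pos_pos less_trans zero_less_numeral)
 have k2: "2 / real k < \<rho>" using k k0 \<rho>(1) by (simp add: field_simps)
 \<comment> \<open>An apex within \<open>s\<close> of \<open>w\<close> lowers the cone at
   \<open>w\<close> by less than \<open>r - c\<close>, and \<open>s \<le> 1 / k\<close> keeps its
   support inside the ball of radius \<open>\<rho>\<close>.\<close>
 define s where "s = (1 - c / of_rat r) / real k"
 have s0: "0 < s" using r r0 k0 by (simp add: s_def)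
 have s1: "s \<le> 1 / real k" using c r0 k0 by (simp add: s_def divide_right_mono)
 obtain z where z: "z \<in> D" "dist w z < s" using D[of "ball w s"] s0 by auto
 have "bump (z, k, r) v \<le> f v" if v: "v \<in> S" for v
 proof (cases "real k * dist v z \<ge> 1")
  case True
  then show ?thesis using f(2)[OF v] by (simp add: bump_def)
 next
  case False
  then have "dist v z < 1 / real k" using k0 by (simp add: field_simps)
  moreover have "dist v w \<le> dist v z + dist w z" by (metis dist_commute dist_triangle)
  moreover have "2 / real k = 1 / real k + 1 / real k" by (simp add: field_simps)
  ultimately have "dist v w < \<rho>" using z s1 k2 by linarith
  then have "of_rat r < f v" using v by (intro \<rho>(2))
  moreover have "of_rat r * max 0 (1 - real k * dist v z) \<le> (of_rat r * 1 :: real)"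
   using r0 by (intro mult_left_mono) auto
  ultimately show ?thesis by (simp add: bump_def rabs)
 qed
 moreover have "c < bump (z, k, r) w"
 proof -
  have "real k * dist w z < 1 - c / of_rat r" using z(2) k0 by (simp add: s_def field_simps)
  then have "c / of_rat r < 1 - real k * dist w z" by simp
  then have "c < of_rat r * (1 - real k * dist w z)" using r0 by (simp add: field_simps)
  also have "\<dots> \<le> bump (z, k, r) w" using r0 unfolding bump_def rabs by (auto intro!: mult_left_mono)
  finally show ?thesis .
 qed
 ultimately show ?thesis using z(1) by (intro bexI[of _ "(z, k, r)"]) auto
qed

text \<open>One countable family serves all domains \<open>S\<close> and all nonnegative continuous
  \<open>f\<close> on them: the running maxima of an enumeration of the cones below \<open>f\<close>
  increase, and by \<open>bump_below\<close> their supremum at each point is \<open>f\<close>. The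
  Lipschitz property allows the argument of an approximant to be moved at a controlled cost.\<close>

lemma countable_lipschitz_approximation:
 "\<exists>G :: ('a::{metric_space, second_countable_topology} => real) set. countable G \<and>
  (\<forall>g\<in>G. (\<forall>w. 0 \<le> g w) \<and> (\<exists>K. \<forall>w. g w \<le> K) \<and> (\<exists>L\<ge>0. \<forall>w v. \<bar>g w - g v\<bar> \<le> L * dist w v)) \<and>
  (\<forall>S f. continuous_on S f \<longrightarrow> (\<forall>w\<in>S. 0 \<le> f w) \<longrightarrow>
   (\<exists>h. range h \<subseteq> G \<and> (\<forall>n. \<forall>w\<in>S. h n w \<le> f w) \<and> (\<forall>w. incseq (\<lambda>n. h n w)) \<and> (\<forall>w\<in>S. (\<lambda>n. h n w) \<longlonglongrightarrow> f w)))"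
proof -
 obtain D :: "'a set" where D: "countable D" "\<And>X. open X ==> X \<noteq> {} ==> \<exists>d\<in>D. d \<in> X"
  by (erule countable_dense_setE)
 obtain z0 where z0: "z0 \<in> D" using D(2)[of UNIV] by auto
 let ?T = "D \<times> (UNIV :: nat set) \<times> (UNIV :: rat set)"
 define G where "G = bump_max ` lists ?T"
 have cT: "countable ?T" using D(1) by auto
 have "countable G" unfolding G_def using cT by auto
 moreover have "\<forall>g\<in>G. (\<forall>w. 0 \<le> g w) \<and> (\<exists>K. \<forall>w. g w \<le> K) \<and> (\<exists>L\<ge>0. \<forall>w v. \<bar>g w - g v\<bar> \<le> L * dist w v)"
  unfolding G_def using bump_max_nonneg bump_max_bounded bump_max_lipschitz by blast
 moreover have "\<exists>h. range h \<subseteq> G \<and> (\<forall>n. \<forall>w\<in>S. h n w \<le> f w) \<and> (\<forall>w. incseq (\<lambda>n. h n w)) \<and> (\<forall>w\<in>S. (\<lambda>n. h n w) \<longlonglongrightarrow> f w)"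
  if f: "continuous_on S f" "\<forall>w\<in>S. 0 \<le> f w" for S f
 proof -
  define F where "F = {t \<in> ?T. \<forall>w\<in>S. bump t w \<le> f w}"
  \<comment> \<open>The cone of height 0 lies below every nonnegative \<open>f\<close>, so the set
    to be enumerated is not empty.\<close>
  have t0: "(z0, 0, 0) \<in> F" using z0 f(2) by (auto simp: F_def bump_def)
  have cF: "countable F" using cT by (auto simp: F_def)
  define t where "t = from_nat_into F"
  have tF: "t i \<in> F" for i using from_nat_into[of F i] t0 by (auto simp: t_def)
  define h where "h n = bump_max (map t [0..<n])" for n
  have "range h \<subseteq> G"
  proof safe
   fix n
   have "map t [0..<n] \<in> lists ?T" proof -
    have "t i \<in> ?T" for i using tF[of i] unfolding F_def by blast
    then have "set (map t [0..<n]) \<subseteq> ?T" unfolding set_map by blast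
    then show ?thesis by (simp only: lists_eq_set mem_Collect_eq)
   qed
   then show "h n \<in> G" unfolding G_def h_def by blast
  qed
  moreover have le: "h n w \<le> f w" if "w \<in> S" for n w
   unfolding h_def using f(2) that tF by (intro bump_max_le) (auto simp: F_def)
  moreover have inc: "incseq (\<lambda>n. h n w)" for w
   by (intro incseq_SucI) (simp add: h_def bump_max_append)
  moreover have "(\<lambda>n. h n w) \<longlonglongrightarrow> f w" if w: "w \<in> S" for w
  proof (rule LIMSEQ_I)
   fix \<epsilon> :: real assume \<epsilon>: "0 < \<epsilon>"
   have "\<exists>n. f w - \<epsilon> < h n w"
   proof (cases "f w - \<epsilon> < 0")
    case True then show ?thesis by (intro exI[of _ 0]) (simp add: h_def)
   next
    case False
    then obtain s where s: "s \<in> ?T" "\<forall>v\<in>S. bump s v \<le> f v" "f w - \<epsilon> < bump s w"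
     using bump_below[OF D(2) f(1) _ w, of "f w - \<epsilon>"] f(2) \<epsilon> by auto
    then have "s \<in> F" by (auto simp: F_def)
    then obtain i where i: "t i = s" unfolding t_def using cF from_nat_into_surj by metis
    have "bump s w \<le> h (Suc i) w" unfolding h_def using i by (intro bump_max_ge) auto
    then show ?thesis using s(3) by (intro exI[of _ "Suc i"]) auto
   qed
   then obtain n0 where n0: "f w - \<epsilon> < h n0 w" by blast
   have "norm (h n w - f w) < \<epsilon>" if "n0 \<le> n" for n
   proof -
    have "h n0 w \<le> h n w" using inc[of w] that by (simp add: incseq_def)
    then show ?thesis using le[OF w, of n] n0 unfolding real_norm_def by linarith
   qed
   then show "\<exists>n0. \<forall>n\<ge>n0. norm (h n w - f w) < \<epsilon>" by blast
  qed
  ultimately show ?thesis by blast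
 qed
 ultimately show ?thesis by (intro exI[of _ G]) blast
qed

section \<open>The Borel sets of \<open>E\<close>, test functions and point measures\<close>

lemma space_borel_E [simp]: "space borel_E = E"
 by (simp add: borel_E_def space_restrict_space)

lemma E_in_borel [measurable]: "(E :: (real \<times> real \<times> 'm::polish_space) set) \<in> sets borel"
proof -
 have "E = {z :: real \<times> real \<times> 'm. 0 \<le> fst z} \<inter> {z. fst z \<le> 1} \<inter> {z. 0 < fst (snd z)}"
  by (auto simp: E_def)
 moreover have "\<dots> \<in> sets borel"
  by (intro sets.Int borel_closed borel_open closed_Collect_le open_Collect_less continuous_intros)
 ultimately show ?thesis by simp
qed

lemma strip_subset_E: "0 < \<delta> ==> strip \<delta> R \<subseteq> E"
 by (auto simp: strip_def E_def)

lemma strip_in_borel_E: "0 < \<delta> ==> strip \<delta> R \<in> sets (borel_E :: (real \<times> real \<times> 'm::polish_space) measure)"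
proof -
 assume \<delta>: "0 < \<delta>"
 have "strip \<delta> R = {z :: real \<times> real \<times> 'm. 0 \<le> fst z} \<inter> {z. fst z \<le> 1} \<inter> {z. \<delta> \<le> fst (snd z)} \<inter> {z. fst (snd z) \<le> R}"
  by (auto simp: strip_def)
 moreover have "\<dots> \<in> sets borel"
  by (intro sets.Int borel_closed closed_Collect_le continuous_intros)
 ultimately have "strip \<delta> R \<in> sets (borel :: (real \<times> real \<times> 'm) measure)" by (simp only:)
 then show ?thesis using strip_subset_E[OF \<delta>, of R] E_in_borel
  unfolding borel_E_def by (subst sets_restrict_space_iff) auto
qed

lemma test_function_measurable: "f \<in> test_functions ==> f \<in> borel_measurable borel_E"
 unfolding borel_E_def test_functions_def by (auto intro: borel_measurable_continuous_on_restrict)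

lemma point_measureD:
 assumes "\<xi> \<in> locally_finite_point_measures"
 shows "sets \<xi> = sets borel_E" "space \<xi> = E" "0 < \<delta> ==> \<delta> < R ==> emeasure \<xi> (strip \<delta> R) < \<infinity>"
 using assms by (auto simp: locally_finite_point_measures_def is_point_measure_def)

lemma test_function_integrable:
 assumes \<xi>: "\<xi> \<in> locally_finite_point_measures" and f: "f \<in> test_functions"
 shows "integrable \<xi> f"
proof -
 obtain \<delta> R where dR: "0 < \<delta>" "\<delta> < R" "\<And>z. z \<in> E ==> z \<notin> strip \<delta> R ==> f z = 0"
  using f by (auto simp: test_functions_def)
 obtain K where K: "\<And>z. z \<in> E ==> \<bar>f z\<bar> \<le> K"
  using f by (auto simp: test_functions_def bounded_iff)
 note S = point_measureD[OF \<xi>]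
 have meas: "strip \<delta> R \<in> sets \<xi>" using strip_in_borel_E[OF dR(1)] S(1) by simp
 show ?thesis
 proof (rule Bochner_Integration.integrable_bound)
  show "integrable \<xi> (\<lambda>z. K * indicator (strip \<delta> R) z)"
   using S(3)[OF dR(1,2)] meas by (intro integrable_mult_right integrable_real_indicator) auto
  show "f \<in> borel_measurable \<xi>"
   using test_function_measurable[OF f] measurable_cong_sets[OF S(1) refl] by blast
  show "AE z in \<xi>. norm (f z) \<le> norm (K * indicator (strip \<delta> R) z)"
   using K dR(3) by (intro AE_I2) (force simp: S(2) indicator_def)
 qed
qed

lemma test_function_combine:
 fixes f g :: "real \<times> real \<times> 'm::polish_space => real"
 assumes f: "f \<in> test_functions" and g: "g \<in> test_functions"
 shows "(\<lambda>z. a * f z + b * g z) \<in> test_functions"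
proof -
 obtain \<delta> R where d: "0 < \<delta>" "\<delta> < R" "\<And>z. z \<in> E ==> z \<notin> strip \<delta> R ==> f z = 0"
  using f by (auto simp: test_functions_def)
 obtain \<delta>' R' where d': "0 < \<delta>'" "\<delta>' < R'" "\<And>z. z \<in> E ==> z \<notin> strip \<delta>' R' ==> g z = 0"
  using g by (auto simp: test_functions_def)
 obtain K K' where K: "\<And>z. z \<in> E ==> \<bar>f z\<bar> \<le> K" "\<And>z. z \<in> E ==> \<bar>g z\<bar> \<le> K'"
  using f g by (auto simp: test_functions_def bounded_iff)
 have "\<bar>a * f z + b * g z\<bar> \<le> \<bar>a\<bar> * K + \<bar>b\<bar> * K'" if "z \<in> E" for z
 proof -
  have "\<bar>a * f z + b * g z\<bar> \<le> \<bar>a\<bar> * \<bar>f z\<bar> + \<bar>b\<bar> * \<bar>g z\<bar>"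
   by (metis abs_mult abs_triangle_ineq)
  also have "\<dots> \<le> \<bar>a\<bar> * K + \<bar>b\<bar> * K'" using K that by (intro add_mono mult_left_mono) auto
  finally show ?thesis .
 qed
 then have "bounded ((\<lambda>z. a * f z + b * g z) ` E)"
  unfolding bounded_iff by (intro exI[of _ "\<bar>a\<bar> * K + \<bar>b\<bar> * K'"]) auto
 moreover have "continuous_on E (\<lambda>z. a * f z + b * g z)"
  using f g by (auto simp: test_functions_def intro!: continuous_intros)
 moreover have "\<exists>\<delta> R. 0 < \<delta> \<and> \<delta> < R \<and> (\<forall>z\<in>E. z \<notin> strip \<delta> R \<longrightarrow> a * f z + b * g z = 0)"
 proof (rule exI[of _ "min \<delta> \<delta>'"], rule exI[of _ "max R R'"], intro conjI ballI impI)
  fix z :: "real \<times> real \<times> 'm" assume "z \<in> E" "z \<notin> strip (min \<delta> \<delta>') (max R R')"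
  then have "z \<notin> strip \<delta> R" "z \<notin> strip \<delta>' R'" by (auto simp: strip_def)
  then show "a * f z + b * g z = 0" using d(3) d'(3) \<open>z \<in> E\<close> by simp
 qed (use d d' in auto)
 ultimately show ?thesis by (simp add: test_functions_def)
qed

lemma nonneg_test_functionsD: "h \<in> nonneg_test_functions ==> h \<in> test_functions"
 by (simp add: nonneg_test_functions_def)

lemma zero_test_function: "(\<lambda>_. 0) \<in> (nonneg_test_functions :: (real \<times> real \<times> 'm::polish_space => real) set)"
proof -
 have "bounded ((\<lambda>_. 0 :: real) ` S)" for S :: "(real \<times> real \<times> 'm) set"
  unfolding bounded_iff by auto
 moreover have "\<exists>\<delta> R :: real. 0 < \<delta> \<and> \<delta> < R" by (rule exI[of _ 1], rule exI[of _ 2]) auto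
 ultimately show ?thesis by (auto simp: nonneg_test_functions_def test_functions_def)
qed

lemma nonneg_test_function_sum_list:
 "set hs \<subseteq> nonneg_test_functions ==> (\<lambda>z. \<Sum>h\<leftarrow>hs. h z) \<in> nonneg_test_functions"
proof (induction hs)
 case (Cons h hs)
 then show ?case
  using test_function_combine[of h "\<lambda>z. \<Sum>h\<leftarrow>hs. h z" 1 1]
  by (auto simp: nonneg_test_functions_def intro!: add_nonneg_nonneg)
qed (simp add: zero_test_function)

text \<open>A trapezoid in the size \<open>x\<close>, equal to 1 for
  \<open>2 / k \<le> x \<le> k\<close> and to 0 outside \<open>1 / k \<le> x \<le> k + 1\<close>.
  These countably many functions dominate, up to a factor, every bounded function supported in a
  strip.\<close>

definition cutoff :: "nat => real \<times> real \<times> 'm => real" where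
 "cutoff k z = max 0 (min 1 (min (real k * fst (snd z) - 1) (real k + 1 - fst (snd z))))"

lemma cutoff_test_function: "1 \<le> k ==> cutoff k \<in> (nonneg_test_functions :: (real \<times> real \<times> 'm::polish_space => real) set)"
proof -
 assume k: "1 \<le> k"
 have "continuous_on E (cutoff k :: real \<times> real \<times> 'm => real)"
  unfolding cutoff_def by (intro continuous_intros)
 moreover have "bounded (cutoff k ` (E :: (real \<times> real \<times> 'm) set))"
  unfolding bounded_iff by (intro exI[of _ 1]) (auto simp: cutoff_def)
 moreover have "\<exists>\<delta> R. 0 < \<delta> \<and> \<delta> < R \<and> (\<forall>z\<in>(E :: (real \<times> real \<times> 'm) set). z \<notin> strip \<delta> R \<longrightarrow> cutoff k z = 0)"
 proof (rule exI[of _ "1 / real k"], rule exI[of _ "real k + 1"], intro conjI ballI impI)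
  have "1 / real k \<le> 1" "1 \<le> real k" using k by auto
  then show "1 / real k < real k + 1" by linarith
  fix z :: "real \<times> real \<times> 'm" assume "z \<in> E" "z \<notin> strip (1 / real k) (real k + 1)"
  then have "fst (snd z) < 1 / real k \<or> real k + 1 < fst (snd z)" by (auto simp: strip_def E_def)
  then have "real k * fst (snd z) < 1 \<or> real k + 1 < fst (snd z)" using k by (simp add: field_simps)
  then show "cutoff k z = 0" by (auto simp: cutoff_def)
 qed (use k in simp)
 ultimately show ?thesis by (auto simp: nonneg_test_functions_def test_functions_def cutoff_def)
qed

lemma cutoff_eq_1: "2 \<le> real k * \<delta> ==> R \<le> real k ==> z \<in> strip \<delta> R ==> cutoff k z = 1"
proof -
 assume k: "2 \<le> real k * \<delta>" "R \<le> real k" "z \<in> strip \<delta> R"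
 have "real k * \<delta> \<le> real k * fst (snd z)" using k(3) by (intro mult_left_mono) (auto simp: strip_def)
 then show ?thesis using k by (auto simp: cutoff_def strip_def)
qed

lemma topspace_point_topology [simp]: "topspace point_topology = locally_finite_point_measures"
proof -
 have "(\<lambda>_. 0) \<in> (test_functions :: (real \<times> real \<times> 'a => real) set)"
  using nonneg_test_functionsD[OF zero_test_function] .
 then show ?thesis unfolding point_topology_def topology_generated_by_topspace
  by (auto intro!: exI[of _ UNIV])
qed

lemma openin_points_subset: "openin point_topology U ==> U \<subseteq> locally_finite_point_measures"
 using openin_subset[of point_topology U] by simp

lemma space_borel_points [simp]: "space borel_points = locally_finite_point_measures"
 unfolding borel_points_def by (subst space_measure_of) (use openin_points_subset in auto)

lemma sets_borel_points: "sets borel_points = sigma_sets locally_finite_point_measures {U. openin point_topology U}"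
 unfolding borel_points_def by (subst sets_measure_of) (use openin_points_subset in auto)

lemma open_in_borel_points: "openin point_topology U ==> U \<in> sets borel_points"
 unfolding sets_borel_points by auto

lemma integral_test_function_measurable:
 assumes f: "f \<in> test_functions"
 shows "(\<lambda>\<xi>. \<integral>z. f z \<partial>\<xi>) \<in> borel_measurable borel_points"
proof (rule borel_measurableI)
 fix U :: "real set" assume U: "open U"
 have "openin point_topology {\<xi> \<in> locally_finite_point_measures. (\<integral>z. f z \<partial>\<xi>) \<in> U}"
  unfolding point_topology_def using f U by (intro topology_generated_by_Basis) blast
 then have "{\<xi> \<in> locally_finite_point_measures. (\<integral>z. f z \<partial>\<xi>) \<in> U} \<in> sets borel_points"
  by (rule open_in_borel_points)
 moreover have "(\<lambda>\<xi>. \<integral>z. f z \<partial>\<xi>) -` U \<inter> space borel_points = {\<xi> \<in> locally_finite_point_measures. (\<integral>z. f z \<partial>\<xi>) \<in> U}"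
  by auto
 ultimately show "(\<lambda>\<xi>. \<integral>z. f z \<partial>\<xi>) -` U \<inter> space borel_points \<in> sets borel_points" by simp
qed

text \<open>The topology on point measures is the initial topology of one map into \<open>[0,1]\<^sup>\<nat>\<close>: integrals of a
 nonnegative test function are limits from below of integrals over a countable family, and the
 cutoffs turn this into an approximation from above. In particular the topology is second
 countable.\<close>

definition coordinates :: "(nat => real \<times> real \<times> 'm => real) => (real \<times> real \<times> 'm::polish_space) measure => nat => real" where
 "coordinates gs \<xi> i = exp (- (\<integral>z. gs i z \<partial>\<xi>))"

lemma coordinates_in_01:
 assumes "range gs \<subseteq> nonneg_test_functions" "\<xi> \<in> locally_finite_point_measures"
 shows "coordinates gs \<xi> i \<in> {0..1}"
proof -
 have "gs i \<in> nonneg_test_functions" using assms by auto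
 then have "0 \<le> (\<integral>z. gs i z \<partial>\<xi>)"
  using point_measureD(2)[OF assms(2)] by (intro Bochner_Integration.integral_nonneg_AE AE_I2) (auto simp: nonneg_test_functions_def)
 then show ?thesis by (simp add: coordinates_def)
qed

lemma borel_E_extend_measurable:
 fixes h :: "real \<times> real \<times> 'm::polish_space => real"
 assumes "h \<in> borel_measurable borel_E"
 shows "(\<lambda>z. if z \<in> E then h z else 0) \<in> borel_measurable borel"
proof -
 have "(\<lambda>z. indicator E z *\<^sub>R h z) \<in> borel_measurable borel"
  using assms E_in_borel unfolding borel_E_def
  by (subst (asm) borel_measurable_restrict_space_iff) (auto simp: mult.commute)
 also have "(\<lambda>z. indicator E z *\<^sub>R h z) = (\<lambda>z. if z \<in> E then h z else 0)" by auto
 finally show ?thesis .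
qed

section \<open>Partition functions\<close>

lemma finite_cycle_counts [simp]: "finite (cycle_counts N)"
proof (rule finite_subset)
 show "cycle_counts N \<subseteq> {c. \<forall>j. (j \<in> {1..N} \<longrightarrow> c j \<in> {..N}) \<and> (j \<notin> {1..N} \<longrightarrow> c j = 0)}"
 proof safe
  fix c j assume c: "c \<in> cycle_counts N" and j: "j \<in> {1..N}"
  have "j * c j \<le> (\<Sum>i=1..N. i * c i)"
   using j by (intro member_le_sum) auto
  also have "\<dots> = N" using c by (simp add: cycle_counts_def)
  finally show "c j \<le> N" using j by (cases j) auto
 qed (auto simp: cycle_counts_def)
qed (intro finite_set_of_finite_funs; simp)

lemma cycle_counts_le: "c \<in> cycle_counts N ==> c j \<le> N"
proof -
 assume c: "c \<in> cycle_counts N"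
 show ?thesis
 proof (cases "j \<in> {1..N}")
  case True
  have "j * c j \<le> (\<Sum>i=1..N. i * c i)"
   using True by (intro member_le_sum) auto
  also have "\<dots> = N" using c by (simp add: cycle_counts_def)
  finally show "c j \<le> N" using True by (cases j) auto
 qed (use c in \<open>auto simp: cycle_counts_def\<close>)
qed

lemma cycle_counts_0: "cycle_counts 0 = {\<lambda>_. 0}"
 by (auto simp: cycle_counts_def)

lemma partition_function_0 [simp]: "partition_function q 0 = 1"
 by (simp add: partition_function_def cycle_counts_0 count_weight_def)

lemma cycle_counts_Suc_upd:
 assumes j: "j \<in> {1..m}" and c: "c \<in> cycle_counts (m - j)"
 shows "c(j := Suc (c j)) \<in> cycle_counts m"
proof -
 have z: "c i = 0" if "i \<notin> {1..m - j}" for i using c that by (auto simp: cycle_counts_def)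
 have s: "(\<Sum>i=1..m. i * c i) = m - j"
 proof -
  have "(\<Sum>i=1..m. i * c i) = (\<Sum>i=1..m-j. i * c i)"
   by (intro sum.mono_neutral_right) (auto simp: z)
  then show ?thesis using c by (simp add: cycle_counts_def)
 qed
 have "(\<Sum>i=1..m. i * (c(j := Suc (c j))) i) = (\<Sum>i=1..m. i * c i + (if i = j then j else 0))"
  by (intro sum.cong) auto
 also have "\<dots> = m" using j s by (simp add: sum.distrib)
 finally show ?thesis using j z by (auto simp: cycle_counts_def)
qed

lemma cycle_counts_pred_upd:
 assumes c: "c \<in> cycle_counts m" and p: "0 < c j"
 shows "c(j := c j - 1) \<in> cycle_counts (m - j)" and "j \<in> {1..m}"
proof -
 show j: "j \<in> {1..m}" using c p by (auto simp: cycle_counts_def)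
 have s: "(\<Sum>i=1..m. i * c i) = m" using c by (simp add: cycle_counts_def)
 let ?c = "c(j := c j - 1)"
 have "(\<Sum>i=1..m. i * c i) = (\<Sum>i=1..m. i * ?c i + (if i = j then j else 0))"
 proof (intro sum.cong refl)
  fix i show "i * c i = i * ?c i + (if i = j then j else 0)"
   using p by (cases "c j") auto
 qed
 also have "\<dots> = (\<Sum>i=1..m. i * ?c i) + j" using j by (simp add: sum.distrib)
 finally have t: "(\<Sum>i=1..m. i * ?c i) = m - j" using s by simp
 have z: "?c i = 0" if "i \<notin> {1..m - j}" for i
 proof (cases "i \<in> {1..m}")
  case True
  have "i * ?c i \<le> (\<Sum>i=1..m. i * ?c i)" using True by (intro member_le_sum) auto
  then have "i * ?c i \<le> m - j" using t by simp
  moreover have "i > m - j" using that True by auto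
  ultimately show ?thesis by (cases "?c i") auto
 next
  case False then show ?thesis using c j by (auto simp: cycle_counts_def)
 qed
 have "(\<Sum>i=1..m-j. i * ?c i) = (\<Sum>i=1..m. i * ?c i)"
  using z by (intro sum.mono_neutral_left ballI) (force simp del: fun_upd_apply)+
 then show "?c \<in> cycle_counts (m - j)" using t z
  by (auto simp: cycle_counts_def simp del: fun_upd_apply)
qed

text \<open>Adding one cycle of length \<open>j\<close> changes only the factor of \<open>j\<close>,
  from one term of an exponential series to the next; the factor \<open>j\<close> times the new
  count undoes the two new denominators.\<close>

lemma count_weight_Suc_upd:
 assumes j: "j \<in> {1..m}" and c: "c \<in> cycle_counts (m - j)"
 shows "real j * real (Suc (c j)) * count_weight q m (c(j := Suc (c j))) = q j * count_weight q (m - j) c"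
proof -
 let ?w = "\<lambda>c i. (q i / real i) ^ c i / fact (c i)"
 have z: "c i = 0" if "i \<notin> {1..m - j}" for i using c that by (auto simp: cycle_counts_def)
 have 1: "count_weight q (m - j) c = (\<Prod>i=1..m. ?w c i)"
  unfolding count_weight_def by (intro prod.mono_neutral_left) (auto simp: z)
 have "count_weight q m (c(j := Suc (c j))) = ?w (c(j := Suc (c j))) j * (\<Prod>i\<in>{1..m}-{j}. ?w (c(j := Suc (c j))) i)"
  unfolding count_weight_def using j by (intro prod.remove) auto
 also have "(\<Prod>i\<in>{1..m}-{j}. ?w (c(j := Suc (c j))) i) = (\<Prod>i\<in>{1..m}-{j}. ?w c i)"
  by (intro prod.cong) auto
 finally have 2: "count_weight q m (c(j := Suc (c j))) =
  ((q j / real j) ^ Suc (c j) / fact (Suc (c j))) * (\<Prod>i\<in>{1..m}-{j}. ?w c i)" by (simp only: fun_upd_same)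
 have 3: "(\<Prod>i=1..m. ?w c i) = ?w c j * (\<Prod>i\<in>{1..m}-{j}. ?w c i)"
  using j by (intro prod.remove) auto
 define P where "P = (\<Prod>i\<in>{1..m}-{j}. ?w c i)"
 have "real j * real (Suc (c j)) * ((q j / real j) ^ Suc (c j) / fact (Suc (c j)) * P) =
   q j * ((q j / real j) ^ c j / fact (c j) * P)"
  using j by (simp add: field_simps del: of_nat_Suc)
 then show ?thesis unfolding P_def by (subst 2, subst 1, subst 3)
qed

text \<open>Inserting \<open>m = (\<Sum>j. j * c j)\<close> under the sum marks a cycle. Removing
  one cycle of length \<open>j\<close> is a bijection from the configurations with
  \<open>c j > 0\<close> onto those of total length \<open>m - j\<close>, and
  \<open>count_weight_Suc_upd\<close> compares the weights. Both the generating function and the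
  local limit theorem start from this recursion.\<close>

lemma partition_function_rec:
 "real m * partition_function q m = (\<Sum>j=1..m. q j * partition_function q (m - j))"
proof -
 have "real m * partition_function q m = (\<Sum>c\<in>cycle_counts m. (\<Sum>j=1..m. real j * real (c j)) * count_weight q m c)"
  unfolding partition_function_def sum_distrib_left
 proof (intro sum.cong refl)
  fix c assume "c \<in> cycle_counts m"
  then have "(\<Sum>j=1..m. j * c j) = m" by (simp add: cycle_counts_def)
  then have "real (\<Sum>j=1..m. j * c j) = real m" by simp
  then show "real m * count_weight q m c = (\<Sum>j=1..m. real j * real (c j)) * count_weight q m c" by simp
 qed
 also have "\<dots> = (\<Sum>j=1..m. \<Sum>c\<in>cycle_counts m. real j * real (c j) * count_weight q m c)"
  by (simp add: sum_distrib_right) (rule sum.swap)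
 also have "\<dots> = (\<Sum>j=1..m. q j * partition_function q (m - j))"
 proof (intro sum.cong refl)
  fix j assume j: "j \<in> {1..m}"
  have "(\<Sum>c\<in>cycle_counts m. real j * real (c j) * count_weight q m c) =
     (\<Sum>c\<in>{c\<in>cycle_counts m. 0 < c j}. real j * real (c j) * count_weight q m c)"
   by (intro sum.mono_neutral_right) auto
  also have "\<dots> = (\<Sum>c\<in>cycle_counts (m - j). q j * count_weight q (m - j) c)"
  proof (rule sum.reindex_bij_witness[of _ "\<lambda>c. c(j := Suc (c j))" "\<lambda>c. c(j := c j - 1)"])
   fix c assume c: "c \<in> {c \<in> cycle_counts m. 0 < c j}"
   then show "c(j := c j - 1) \<in> cycle_counts (m - j)" using cycle_counts_pred_upd(1) by blast
   then have "real j * real (Suc ((c(j := c j - 1)) j)) *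
     count_weight q m ((c(j := c j - 1))(j := Suc ((c(j := c j - 1)) j))) =
     q j * count_weight q (m - j) (c(j := c j - 1))"
    by (rule count_weight_Suc_upd[OF j])
   then show "q j * count_weight q (m - j) (c(j := c j - 1)) = real j * real (c j) * count_weight q m c"
    using c by (simp del: of_nat_Suc)
  qed (use cycle_counts_Suc_upd[OF j] in auto)
  finally show "(\<Sum>c\<in>cycle_counts m. real j * real (c j) * count_weight q m c) = q j * partition_function q (m - j)"
   by (simp add: partition_function_def sum_distrib_left)
 qed
 finally show ?thesis .
qed

lemma partition_function_nonneg: "(\<And>j. 1 \<le> j ==> 0 \<le> q j) ==> 0 \<le> partition_function q m"
 unfolding partition_function_def count_weight_def
 by (intro sum_nonneg prod_nonneg divide_nonneg_nonneg zero_le_power) auto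

lemma partition_function_mono:
 assumes "\<And>j. 1 \<le> j ==> 0 \<le> q j" "\<And>j. 1 \<le> j ==> q j \<le> q' j"
 shows "partition_function q m \<le> partition_function q' m"
 unfolding partition_function_def count_weight_def
 by (intro sum_mono prod_mono conjI divide_right_mono divide_nonneg_nonneg power_mono zero_le_power assms) auto

lemma partition_function_cong:
 assumes "\<And>j. 1 \<le> j ==> j \<le> m ==> q j = q' j"
 shows "partition_function q m = partition_function q' m"
 unfolding partition_function_def count_weight_def using assms
 by (intro sum.cong prod.cong) auto

lemma partition_function_unique:
 assumes "a 0 = 1" and "\<And>m. 0 < m ==> real m * a m = (\<Sum>j=1..m. q j * a (m - j))"
 shows "partition_function q m = a m"
proof (induction m rule: less_induct)
 case (less m)
 show ?case
 proof (cases "m = 0")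
  case False
  have "real m * partition_function q m = real m * a m"
   unfolding partition_function_rec using False assms(2)[of m]
   by (auto intro!: sum.cong simp: less)
  then show ?thesis using False by simp
 qed (simp add: assms)
qed

text \<open>All configurations have the same total length, so a factor \<open>r ^ j\<close> for each
  cycle of length \<open>j\<close> amounts to the constant \<open>r ^ m\<close>.\<close>

lemma partition_function_tilt:
 "partition_function (\<lambda>j. q j * r ^ j) m = r ^ m * partition_function q m"
proof (rule partition_function_unique)
 fix m :: nat assume "0 < m"
 have "real m * (r ^ m * partition_function q m) = r ^ m * (\<Sum>j=1..m. q j * partition_function q (m - j))"
  by (simp only: partition_function_rec[symmetric] mult.left_commute)
 also have "\<dots> = (\<Sum>j=1..m. (q j * r ^ j) * (r ^ (m - j) * partition_function q (m - j)))"
  unfolding sum_distrib_left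
  by (intro sum.cong refl) (simp add: power_add[symmetric] mult.assoc mult.left_commute)
 finally show "real m * (r ^ m * partition_function q m) =
   (\<Sum>j=1..m. (q j * r ^ j) * (r ^ (m - j) * partition_function q (m - j)))" .
qed simp

text \<open>The recursion read as the differential equation \<open>z A' = Q A\<close> for the
  generating function. The coefficient of \<open>Q\<close> at 0 is set to 0, because
  \<open>q 0\<close> is an arbitrary value that never enters a partition function.\<close>

lemma fps_partition_function_deriv:
 "fps_X * fps_deriv (Abs_fps (partition_function q)) =
  Abs_fps (\<lambda>j. if j = 0 then 0 else q j) * Abs_fps (partition_function q)"
proof (rule fps_ext)
 fix m
 have "fps_nth (Abs_fps (\<lambda>j. if j = 0 then 0 else q j) * Abs_fps (partition_function q)) m =
  (\<Sum>j=0..m. (if j = 0 then 0 else q j) * partition_function q (m - j))"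
  by (simp add: fps_mult_nth)
 also have "\<dots> = (\<Sum>j=1..m. (if j = 0 then 0 else q j) * partition_function q (m - j))"
  by (intro sum.mono_neutral_right) auto
 also have "\<dots> = real m * partition_function q m"
  unfolding partition_function_rec by (intro sum.cong) auto
 finally show "fps_nth (fps_X * fps_deriv (Abs_fps (partition_function q))) m =
  fps_nth (Abs_fps (\<lambda>j. if j = 0 then 0 else q j) * Abs_fps (partition_function q)) m"
  by (cases m) auto
qed

text \<open>The differential equation and the value 1 at 0 determine all coefficients; closed forms
  of generating functions are identified by checking these two.\<close>

lemma partition_function_fpsI:
 assumes "fps_nth a 0 = 1" "fps_X * fps_deriv a = Abs_fps (\<lambda>j. if j = 0 then 0 else q j) * a"
 shows "partition_function q m = fps_nth a m"
proof (rule partition_function_unique)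
 fix m :: nat assume m: "0 < m"
 have "real m * fps_nth a m = fps_nth (fps_X * fps_deriv a) m" using m by (cases m) auto
 also have "\<dots> = (\<Sum>j=0..m. (if j = 0 then 0 else q j) * fps_nth a (m - j))"
  by (simp add: assms(2) fps_mult_nth)
 also have "\<dots> = (\<Sum>j=1..m. (if j = 0 then 0 else q j) * fps_nth a (m - j))"
  by (intro sum.mono_neutral_right) auto
 also have "\<dots> = (\<Sum>j=1..m. q j * fps_nth a (m - j))"
  by (intro sum.cong) auto
 finally show "real m * fps_nth a m = (\<Sum>j=1..m. q j * fps_nth a (m - j))" .
qed (use assms in auto)

text \<open>By the product rule \<open>z (A B)' = (Q + Q') A B\<close>, so the product of the two
  generating functions solves the equation of the summed weights.\<close>

lemma partition_function_add:
 "partition_function (\<lambda>j. q j + q' j) m =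
  (\<Sum>k\<le>m. partition_function q k * partition_function q' (m - k))"
proof -
 let ?A = "Abs_fps (partition_function q)" and ?B = "Abs_fps (partition_function q')"
 have "partition_function (\<lambda>j. q j + q' j) m = fps_nth (?A * ?B) m"
 proof (rule partition_function_fpsI)
  have "fps_X * fps_deriv (?A * ?B) = (fps_X * fps_deriv ?A) * ?B + ?A * (fps_X * fps_deriv ?B)"
   by (simp add: algebra_simps)
  also have "\<dots> = (Abs_fps (\<lambda>j. if j = 0 then 0 else q j) + Abs_fps (\<lambda>j. if j = 0 then 0 else q' j)) * (?A * ?B)"
   unfolding fps_partition_function_deriv by (simp add: algebra_simps)
  also have "Abs_fps (\<lambda>j. if j = 0 then 0 else q j) + Abs_fps (\<lambda>j. if j = 0 then 0 else q' j) =
    Abs_fps (\<lambda>j. if j = 0 then 0 else q j + q' j)" by (rule fps_ext) simp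
  finally show "fps_X * fps_deriv (?A * ?B) = Abs_fps (\<lambda>j. if j = 0 then 0 else q j + q' j) * (?A * ?B)" .
 qed (simp add: fps_mult_nth)
 then show ?thesis by (simp add: fps_mult_nth atLeast0AtMost)
qed

lemma sums_fps_power:
 fixes b :: "real fps"
 assumes nn: "\<And>j. 0 \<le> fps_nth b j" and s: "(\<lambda>j. fps_nth b j) sums B"
 shows "(\<lambda>j. fps_nth (b ^ k) j) sums (B ^ k) \<and> (\<forall>j. 0 \<le> fps_nth (b ^ k) j)"
proof (induction k)
 case 0
 have "(\<lambda>j. fps_nth (1 :: real fps) j) sums (\<Sum>j\<in>{0}. fps_nth (1 :: real fps) j)"
  by (intro sums_finite) auto
 then show ?case by simp
next
 case (Suc k)
 have "summable (\<lambda>j. norm (fps_nth b j))" "summable (\<lambda>j. norm (fps_nth (b ^ k) j))"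
  using s Suc nn by (auto simp: sums_iff)
 from Cauchy_product_sums[OF this]
 have "(\<lambda>m. \<Sum>i\<le>m. fps_nth b i * fps_nth (b ^ k) (m - i)) sums (B * B ^ k)"
  using s Suc by (auto simp: sums_iff)
 then show ?case using nn Suc by (auto simp: fps_mult_nth atLeast0AtMost intro!: sum_nonneg)
qed

lemma ennreal_suminf_swap:
 fixes f :: "nat => nat => ennreal"
 shows "(\<Sum>i. \<Sum>j. f i j) = (\<Sum>j. \<Sum>i. f i j)"
proof -
 have "(\<Sum>i. \<Sum>j. f i j) = (\<Sum>i. \<integral>\<^sup>+j. f i j \<partial>count_space UNIV)"
  by (simp add: nn_integral_count_space_nat)
 also have "\<dots> = (\<integral>\<^sup>+j. (\<Sum>i. f i j) \<partial>count_space UNIV)"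
  by (intro nn_integral_suminf[symmetric]) auto
 finally show ?thesis by (simp add: nn_integral_count_space_nat)
qed

text \<open>The composition of \<open>exp\<close> with the series \<open>b\<close> of
  \<open>q j / j\<close> solves the differential equation, and its value at 1 is
  \<open>exp B\<close>. As all terms are nonnegative, this evaluation is an interchange of two sums
  in the extended reals, over the powers of \<open>b\<close> and over the coefficients.\<close>

lemma partition_function_sums:
 assumes nn: "\<And>j. 1 \<le> j ==> 0 \<le> q j" and s: "(\<lambda>j. q (Suc j) / real (Suc j)) sums B"
 shows "partition_function q sums exp B"
proof -
 define b where "b = Abs_fps (\<lambda>j. q j / real j)"
 have b0: "fps_nth b 0 = 0" by (simp add: b_def)
 have bnn: "0 \<le> fps_nth b j" for j using nn[of j] by (cases j) (auto simp: b_def)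
 have bs: "(\<lambda>j. fps_nth b j) sums B"
 proof -
  have "(\<lambda>j. fps_nth b (Suc j)) sums B" using s by (simp add: b_def)
  from this[unfolded sums_Suc_iff] show ?thesis unfolding b0 by simp
 qed
 have B: "0 \<le> B" using sums_le[OF _ sums_zero bs] bnn by auto
 define a where "a = fps_exp 1 oo b"
 have Z: "partition_function q m = fps_nth a m" for m
 proof (rule partition_function_fpsI)
  show "fps_nth a 0 = 1" unfolding a_def fps_compose_nth by simp
  have "fps_deriv a = a * fps_deriv b"
   unfolding a_def fps_compose_deriv[OF b0] by simp
  moreover have "fps_X * fps_deriv b = Abs_fps (\<lambda>j. if j = 0 then 0 else q j)"
  proof (rule fps_ext)
   fix m show "fps_nth (fps_X * fps_deriv b) m = fps_nth (Abs_fps (\<lambda>j. if j = 0 then 0 else q j)) m"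
    by (cases m) (auto simp: b_def simp del: of_nat_Suc)
  qed
  moreover have "fps_X * (a * fps_deriv b) = (fps_X * fps_deriv b) * a" by (simp only: ac_simps)
  ultimately show "fps_X * fps_deriv a = Abs_fps (\<lambda>j. if j = 0 then 0 else q j) * a"
   by (simp only:)
 qed
 have pw: "(\<lambda>m. fps_nth (b ^ k) m) sums (B ^ k)" "0 \<le> fps_nth (b ^ k) m" for k m
  using sums_fps_power[OF bnn bs] by auto
 \<comment> \<open>Since \<open>b\<close> has no constant term, \<open>b ^ k\<close> contributes to
   the coefficient \<open>m\<close> only for \<open>k \<le> m\<close>; hence the finite sum that
   defines the composition is a full series in \<open>k\<close>.\<close>
 have am: "ennreal (fps_nth a m) = (\<Sum>k. ennreal (fps_nth (b ^ k) m / fact k))" for m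
 proof -
  have "fps_nth a m = (\<Sum>k=0..m. fps_nth (b ^ k) m / fact k)"
   unfolding a_def fps_compose_nth by (intro sum.cong) (auto simp: field_simps)
  moreover have "fps_nth (b ^ k) m = 0" if "k \<notin> {0..m}" for k
   using that startsby_zero_power_prefix[OF b0, of k] by auto
  moreover from this have "(\<Sum>k. ennreal (fps_nth (b ^ k) m / fact k)) = (\<Sum>k=0..m. ennreal (fps_nth (b ^ k) m / fact k))"
   by (intro suminf_finite) auto
  ultimately show ?thesis using pw(2) by (simp only: sum_ennreal divide_nonneg_pos fact_gt_zero)
 qed
 have "(\<Sum>m. ennreal (fps_nth a m)) = (\<Sum>k. \<Sum>m. ennreal (fps_nth (b ^ k) m / fact k))"
  unfolding am by (rule ennreal_suminf_swap)
 also have "\<dots> = (\<Sum>k. ennreal (B ^ k / fact k))"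
 proof (intro suminf_cong)
  fix k
  show "(\<Sum>m. ennreal (fps_nth (b ^ k) m / fact k)) = ennreal (B ^ k / fact k)"
   using sums_divide[OF pw(1)[of k], of "fact k"] pw(2) by (intro suminf_ennreal_eq) auto
 qed
 also have "\<dots> = ennreal (exp B)"
 proof (intro suminf_ennreal_eq)
  have "(\<lambda>k. B ^ k / fact k) = (\<lambda>k. B ^ k /\<^sub>R fact k)"
   by (simp add: fun_eq_iff divide_inverse)
  then show "(\<lambda>k. B ^ k / fact k) sums exp B" using exp_converges[of B] by (simp only:)
 qed (use B in auto)
 finally have fin: "(\<Sum>m. ennreal (fps_nth a m)) = ennreal (exp B)" .
 have ann: "0 \<le> fps_nth a m" for m using partition_function_nonneg[where q=q and m=m] nn Z[of m] by simp
 have "summable (\<lambda>m. fps_nth a m)"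
  using fin ann by (intro summable_suminf_not_top) simp_all
 moreover from this have "(\<Sum>m. fps_nth a m) = exp B"
  using fin suminf_ennreal2[OF ann] suminf_nonneg[OF _ ann] by simp
 moreover have "partition_function q = fps_nth a" using Z by blast
 ultimately show ?thesis by (simp only: sums_iff conj_absorb simp_thms)
qed

section \<open>A local limit theorem\<close>

text \<open>The right-hand side of the recursion is at most \<open>C\<close> times a partial sum of
  a series with sum at most 1.\<close>

lemma recursive_bound:
 fixes q p :: "nat => real"
 assumes qC: "\<And>j. 1 \<le> j ==> q j \<le> C" and p0: "\<And>m. 0 \<le> p m"
  and ps: "summable p" "suminf p \<le> 1"
  and rec: "real m * p m = (\<Sum>j=1..m. q j * p (m - j))" and C: "0 \<le> C"
 shows "real m * p m \<le> C"
proof -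
 have "real m * p m \<le> (\<Sum>j=1..m. C * p (m - j))"
  unfolding rec by (intro sum_mono mult_right_mono qC p0) auto
 also have "\<dots> = C * (\<Sum>j=1..m. p (m - j))" by (simp add: sum_distrib_left)
 also have "(\<Sum>j=1..m. p (m - j)) = (\<Sum>i<m. p i)"
  by (rule sum.reindex_bij_witness[of _ "\<lambda>i. m - i" "\<lambda>j. m - j"]) auto
 also have "C * (\<Sum>i<m. p i) \<le> C * 1"
  using ps p0 by (intro mult_left_mono C order_trans[OF sum_le_suminf ps(2)]) auto
 finally show ?thesis by simp
qed

text \<open>The recursion writes \<open>m * p m\<close> as
  \<open>(\<Sum>i<m. q (m - i) * p i)\<close>, an average of \<open>q\<close> against total mass at
  most 1. Passing from \<open>m\<close> to a nearby \<open>m'\<close> changes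
  \<open>q (m - i)\<close> little as long as \<open>m - i\<close> is at least
  \<open>\<delta> V\<close>, by uniform continuity of \<open>\<psi>\<close>; the other indices
  number at most \<open>(2 \<eta> + \<delta>) V\<close>, and there \<open>p i\<close> is of order
  \<open>1 / V\<close> by \<open>recursive_bound\<close>.\<close>

lemma local_limit_equicontinuous:
 fixes V :: "nat => real" and q p :: "nat => nat => real" and \<psi> :: "real => real"
 assumes V: "\<And>n. 0 < V n"
  and q0: "\<And>n j. 1 \<le> j ==> 0 \<le> q n j" and qC: "\<And>n j. 1 \<le> j ==> q n j \<le> C"
  and p0: "\<And>n m. 0 \<le> p n m" and ps: "\<And>n. summable (p n)" "\<And>n. suminf (p n) \<le> 1"
  and rec: "\<And>n m. real m * p n m = (\<Sum>j=1..m. q n j * p n (m - j))"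
  and \<psi>c: "continuous_on {0<..} \<psi>"
  and \<psi>l: "\<And>\<delta> R \<epsilon>. 0 < \<delta> ==> \<delta> < R ==> 0 < \<epsilon> ==>
   \<forall>\<^sub>F n in sequentially. \<forall>j. \<delta> \<le> real j / V n \<and> real j / V n \<le> R \<longrightarrow> \<bar>q n j - \<psi> (real j / V n)\<bar> < \<epsilon>"
  and C: "0 < C" and a: "0 < a" and \<epsilon>: "0 < \<epsilon>"
 shows "\<exists>\<eta>>0. \<eta> < a \<and> (\<forall>\<^sub>F n in sequentially. \<forall>m m'. \<bar>real m / V n - a\<bar> < \<eta> \<and> \<bar>real m' / V n - a\<bar> < \<eta> \<longrightarrow>
  \<bar>V n * p n m - V n * p n m'\<bar> \<le> \<epsilon>)"
proof -
 \<comment> \<open>\<open>C1\<close> bounds \<open>V * p i\<close> for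
   \<open>i / V \<ge> a / 2\<close>. The constants \<open>e\<close>, \<open>\<delta>\<close> and
   \<open>\<eta>\<close> are sized so that each of the four error terms at the end is at most
   \<open>\<epsilon> / 4\<close>.\<close>
 define C1 where "C1 = 2 * C / a"
 define e where "e = \<epsilon> * a / 24"
 define \<delta> where "\<delta> = min (a / 4) (\<epsilon> * a / (8 * C * C1))"
 have C1: "0 < C1" using C a by (simp add: C1_def)
 have e: "0 < e" using \<epsilon> a by (simp add: e_def)
 have \<delta>: "0 < \<delta>" "\<delta> \<le> a / 4" "\<delta> \<le> \<epsilon> * a / (8 * C * C1)" using \<epsilon> a C C1 by (auto simp: \<delta>_def)
 have "uniformly_continuous_on {\<delta>..2 * a} \<psi>"
  using \<delta> by (intro compact_uniformly_continuous continuous_on_subset[OF \<psi>c]) auto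
 then obtain d where d: "0 < d" and ud: "\<And>x y. x \<in> {\<delta>..2 * a} ==> y \<in> {\<delta>..2 * a} ==> \<bar>y - x\<bar> < d ==> \<bar>\<psi> y - \<psi> x\<bar> < e"
  unfolding uniformly_continuous_on_def dist_real_def using e by metis
 define \<eta> where "\<eta> = Min {a / 4, d / 2, \<epsilon> * a / (16 * C * C1), \<epsilon> * a\<^sup>2 / (32 * C)}"
 have \<eta>: "0 < \<eta>" "\<eta> \<le> a / 4" "\<eta> \<le> d / 2" "\<eta> \<le> \<epsilon> * a / (16 * C * C1)" "\<eta> \<le> \<epsilon> * a\<^sup>2 / (32 * C)"
  using a d \<epsilon> C C1 by (auto simp: \<eta>_def)
 have main: "\<bar>V n * p n m - V n * p n m'\<bar> \<le> \<epsilon>"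
  if qn: "\<And>j. \<delta> \<le> real j / V n ==> real j / V n \<le> 2 * a ==> \<bar>q n j - \<psi> (real j / V n)\<bar> < e"
   and m: "\<bar>real m / V n - a\<bar> < \<eta>" "\<bar>real m' / V n - a\<bar> < \<eta>" and le: "m \<le> m'"
  for n m m'
 proof -
  have Vn: "0 < V n" by (rule V)
  have mV: "a / 2 \<le> real m / V n" "a / 2 \<le> real m' / V n" "real m' / V n \<le> 2 * a"
   using m \<eta>(2) a by (auto simp: abs_less_iff)
  have diff: "(real m' - real m) / V n \<le> 2 * \<eta>" "(real m' - real m) / V n < d"
   using m \<eta>(3) by (auto simp: diff_divide_distrib abs_less_iff)
  have bd: "real i * p n i \<le> C" for i
   using qC p0 ps rec C by (intro recursive_bound[of "q n"]) auto
  have pb: "p n i \<le> C1 / V n" if "a / 2 \<le> real i / V n" for i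
  proof -
   have "a / 2 * (V n * p n i) \<le> real i / V n * (V n * p n i)"
    using that p0 Vn by (intro mult_right_mono) auto
   also have "\<dots> = real i * p n i" using Vn by simp
   also have "\<dots> \<le> C" by (rule bd)
   finally show ?thesis using Vn a by (simp add: C1_def field_simps)
  qed
  define D where "D m = real m * p n m" for m
  \<comment> \<open>Extension by 0 beyond \<open>m\<close> puts both recursions on the common range
    \<open>i < m'\<close>.\<close>
  define qq where "qq i = (if i < m then q n (m - i) else 0)" for i
  have Dsum: "D k = (\<Sum>i<k. q n (k - i) * p n i)" for k
   unfolding D_def rec by (rule sum.reindex_bij_witness[of _ "\<lambda>i. k - i" "\<lambda>j. k - j"]) auto
  have Dm: "D m = (\<Sum>i<m'. qq i * p n i)"
   unfolding Dsum using le by (intro sum.mono_neutral_cong_left) (auto simp: qq_def)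
  \<comment> \<open>The indices at which \<open>m - i\<close> is too small for the convergence of
    \<open>q\<close> to \<open>\<psi>\<close>, which is uniform only away from 0.\<close>
  define B where "B = {i. i < m' \<and> real m - \<delta> * V n < real i}"
  have finB: "finite B" by (auto simp: B_def)
  have cB: "real (card B) \<le> real m' - real m + \<delta> * V n"
  proof -
   have "real m - \<delta> * V n \<ge> 0"
   proof -
    have "\<delta> \<le> real m / V n" using mV \<delta>(2) a by simp
    then show ?thesis using Vn by (simp add: field_simps)
   qed
   then have "B \<subseteq> {nat \<lfloor>real m - \<delta> * V n\<rfloor> + 1..<m'}"
    by (auto simp: B_def) linarith
   then have "card B \<le> m' - (nat \<lfloor>real m - \<delta> * V n\<rfloor> + 1)"
    using card_mono[of "{nat \<lfloor>real m - \<delta> * V n\<rfloor> + 1..<m'}" B] by simp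
   moreover have "real (nat \<lfloor>real m - \<delta> * V n\<rfloor> + 1) > real m - \<delta> * V n" by linarith
   moreover have "real m' - real m + \<delta> * V n \<ge> 0" using le \<delta> Vn by (simp add: add_nonneg_nonneg)
   ultimately show ?thesis by linarith
  qed
  have trm: "\<bar>q n (m' - i) - qq i\<bar> * p n i \<le> 3 * e * p n i + (if i \<in> B then C * C1 / V n else 0)"
   if i: "i < m'" for i
  proof (cases "i \<in> B")
   case True
   have q1: "0 \<le> q n (m' - i)" "q n (m' - i) \<le> C" using i by (auto intro: q0 qC)
   have q2: "0 \<le> qq i" "qq i \<le> C" using C by (auto simp: qq_def intro: q0 qC)
   have "a / 2 \<le> real i / V n"
   proof -
    have "real m / V n - \<delta> < real i / V n" using divide_strict_right_mono[of "real m - \<delta> * V n" "real i" "V n"] True Vn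
     by (simp add: B_def diff_divide_distrib)
    then show ?thesis using m \<eta>(2) \<delta>(2) by (simp add: abs_less_iff)
   qed
   then have "\<bar>q n (m' - i) - qq i\<bar> * p n i \<le> C * (C1 / V n)"
    using q1 q2 pb[of i] p0[of n i] C by (intro mult_mono) auto
   then show ?thesis using True e p0[of n i] by (simp add: add_nonneg_nonneg add_increasing)
  next
   case False
   then have il: "real i \<le> real m - \<delta> * V n" using i by (auto simp: B_def)
   moreover have "\<delta> * V n > 0" using \<delta> Vn by simp
   ultimately have im: "i < m" by linarith
   have k: "real (m - i) = real m - real i" "real (m' - i) = real m' - real i" using im le by auto
   have k1: "\<delta> \<le> real (m - i) / V n" using il Vn unfolding k by (simp add: field_simps)
   have k2: "real (m - i) / V n \<le> real (m' - i) / V n" unfolding k using le Vn by (intro divide_right_mono) auto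
   have k3: "real (m' - i) / V n \<le> 2 * a"
   proof -
    have "real (m' - i) / V n \<le> real m' / V n" using Vn by (intro divide_right_mono) auto
    then show ?thesis using mV by simp
   qed
   have k4: "\<bar>real (m' - i) / V n - real (m - i) / V n\<bar> < d"
    using diff k2 unfolding k by (simp add: diff_divide_distrib)
   have 1: "\<bar>\<psi> (real (m' - i) / V n) - \<psi> (real (m - i) / V n)\<bar> < e"
    using k1 k2 k3 k4 by (intro ud) auto
   have 2: "\<bar>q n (m - i) - \<psi> (real (m - i) / V n)\<bar> < e" "\<bar>q n (m' - i) - \<psi> (real (m' - i) / V n)\<bar> < e"
    using k1 k2 k3 by (intro qn; simp)+
   have "\<bar>q n (m' - i) - qq i\<bar> \<le> 3 * e" using 1 2 im unfolding qq_def if_P[OF im] by linarith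
   then show ?thesis using False p0[of n i] by (simp add: mult_right_mono)
  qed
  have DD: "\<bar>D m' - D m\<bar> \<le> 3 * e + C * C1 * (2 * \<eta> + \<delta>)"
  proof -
   have "\<bar>D m' - D m\<bar> = \<bar>\<Sum>i<m'. (q n (m' - i) - qq i) * p n i\<bar>"
    unfolding Dm by (simp add: Dsum[of m'] sum_subtractf left_diff_distrib)
   also have "\<dots> \<le> (\<Sum>i<m'. \<bar>q n (m' - i) - qq i\<bar> * p n i)"
    using p0 by (intro order_trans[OF sum_abs] sum_mono) (simp add: abs_mult)
   also have "\<dots> \<le> (\<Sum>i<m'. 3 * e * p n i + (if i \<in> B then C * C1 / V n else 0))"
    by (intro sum_mono trm) auto
   also have "\<dots> = 3 * e * (\<Sum>i<m'. p n i) + real (card B) * (C * C1 / V n)"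
   proof -
    have "{i. i < m' \<and> i \<in> B} = B" by (auto simp: B_def)
    then show ?thesis by (simp add: sum.distrib sum_distrib_left sum.If_cases lessThan_def Int_def)
   qed
   also have "\<dots> \<le> 3 * e * 1 + (real m' - real m + \<delta> * V n) * (C * C1 / V n)"
    using ps p0 e cB C C1 Vn
    by (intro add_mono mult_left_mono mult_right_mono order_trans[OF sum_le_suminf ps(2)]) auto
   also have "(real m' - real m + \<delta> * V n) * (C * C1 / V n) = C * C1 * ((real m' - real m) / V n + \<delta>)"
    using Vn by (simp add: field_simps)
   also have "\<dots> \<le> C * C1 * (2 * \<eta> + \<delta>)"
    using diff C C1 by (intro mult_left_mono) auto
   finally show ?thesis by simp
  qed
  have "0 < real m / V n" "0 < real m' / V n" using mV a by linarith+
  then have pos: "0 < real m" "0 < real m'" using Vn by (auto simp: zero_less_divide_iff)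
  define x y where "x = real m / V n" and "y = real m' / V n"
  have xy: "a / 2 \<le> x" "a / 2 \<le> y" "\<bar>y - x\<bar> \<le> 2 * \<eta>" using mV m by (auto simp: x_def y_def abs_less_iff)
  then have xy0: "0 < x" "0 < y" using a by auto
  have e1: "V n * p n m = D m / x" "V n * p n m' = D m' / y"
   using Vn pos by (auto simp: D_def x_def y_def)
  have D0: "0 \<le> D m'" "D m' \<le> C" using bd[of m'] p0 by (auto simp: D_def)
  \<comment> \<open>Return from \<open>m * p m\<close> to \<open>V * p m\<close>: besides the
    difference of the numerators there is that of the denominators \<open>x\<close> and
    \<open>y\<close>, both at least \<open>a / 2\<close>.\<close>
  have "\<bar>D m / x - D m' / y\<bar> = \<bar>(D m - D m') / x + D m' * ((y - x) / (x * y))\<bar>"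
   using xy0 by (simp add: field_simps)
  also have "\<dots> \<le> \<bar>(D m - D m') / x\<bar> + \<bar>D m' * ((y - x) / (x * y))\<bar>" by (rule abs_triangle_ineq)
  also have "\<dots> = \<bar>D m' - D m\<bar> / x + D m' * (\<bar>y - x\<bar> / (x * y))"
   using xy0 D0 by (simp add: abs_mult abs_divide abs_minus_commute)
  also have "\<dots> \<le> (3 * e + C * C1 * (2 * \<eta> + \<delta>)) / (a / 2) + C * (2 * \<eta> / (a / 2 * (a / 2)))"
   using DD D0 xy xy0 a C \<eta>(1)
   by (intro add_mono frac_le mult_mono) (auto intro: order_trans[OF abs_ge_zero])
  also have "\<dots> = 6 * e / a + 4 * C * C1 * \<eta> / a + 2 * C * C1 * \<delta> / a + 8 * C * \<eta> / a\<^sup>2"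
   using a by (simp add: field_simps power2_eq_square)
  also have "\<dots> \<le> \<epsilon> / 4 + \<epsilon> / 4 + \<epsilon> / 4 + \<epsilon> / 4"
  proof (intro add_mono)
   show "6 * e / a \<le> \<epsilon> / 4" using a by (simp add: e_def)
   show "4 * C * C1 * \<eta> / a \<le> \<epsilon> / 4" using \<eta>(4) a C C1 by (simp add: field_simps)
   show "2 * C * C1 * \<delta> / a \<le> \<epsilon> / 4" using \<delta>(3) a C C1 by (simp add: field_simps)
   show "8 * C * \<eta> / a\<^sup>2 \<le> \<epsilon> / 4" using \<eta>(5) a C by (simp add: field_simps)
  qed
  finally show ?thesis using e1 by simp
 qed
 have "\<forall>\<^sub>F n in sequentially. \<forall>j. \<delta> \<le> real j / V n \<and> real j / V n \<le> 2 * a \<longrightarrow> \<bar>q n j - \<psi> (real j / V n)\<bar> < e"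
  using \<delta> e a by (intro \<psi>l) auto
 then have "\<forall>\<^sub>F n in sequentially. \<forall>m m'. \<bar>real m / V n - a\<bar> < \<eta> \<and> \<bar>real m' / V n - a\<bar> < \<eta> \<longrightarrow>
  \<bar>V n * p n m - V n * p n m'\<bar> \<le> \<epsilon>"
 proof eventually_elim
  case (elim n)
  show ?case
  proof (intro allI impI)
   fix m m' assume *: "\<bar>real m / V n - a\<bar> < \<eta> \<and> \<bar>real m' / V n - a\<bar> < \<eta>"
   show "\<bar>V n * p n m - V n * p n m'\<bar> \<le> \<epsilon>"
   proof (cases "m \<le> m'")
    case True then show ?thesis using main[of n m m'] elim * by auto
   next
    case False then show ?thesis using main[of n m' m] elim * by (auto simp: abs_minus_commute)
   qed
  qed
 qed
 moreover have "\<eta> < a" using \<eta>(2) a by simp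
 ultimately show ?thesis using \<eta>(1) by blast
qed

text \<open>The integrand is constant on each cell from \<open>j / V\<close> to
  \<open>(j + 1) / V\<close>, and the integral begins at \<open>1 / V\<close> because
  \<open>j = 0\<close> is not summed. In this form convergence of the sums is a matter of dominated
  convergence.\<close>

lemma suminf_eq_floor_integral:
 fixes G :: "nat => real"
 assumes V: "0 < V"
  and int: "integrable lborel (\<lambda>x. indicator {1 / V..} x * G (nat \<lfloor>x * V\<rfloor>))"
 shows "(\<Sum>i. G (Suc i) / V) = (\<integral>x. indicator {1 / V..} x * G (nat \<lfloor>x * V\<rfloor>) \<partial>lborel)"
proof -
 define A where "A i = {real (Suc i) / V..<real (Suc (Suc i)) / V}" for i
 have Aiff: "x \<in> A i \<longleftrightarrow> 1 / V \<le> x \<and> nat \<lfloor>x * V\<rfloor> = Suc i" for x i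
 proof -
  have "x \<in> A i \<longleftrightarrow> real (Suc i) \<le> x * V \<and> x * V < real (Suc i) + 1"
   using V by (auto simp: A_def field_simps)
  also have "\<dots> \<longleftrightarrow> \<lfloor>x * V\<rfloor> = int (Suc i)" by (subst floor_eq_iff) auto
  also have "\<dots> \<longleftrightarrow> 1 \<le> x * V \<and> nat \<lfloor>x * V\<rfloor> = Suc i" by safe linarith+
  finally show ?thesis using V by (simp add: field_simps)
 qed
 have U: "(\<Union>i. A i) = {1 / V..}"
 proof (intro set_eqI iffI)
  fix x assume "x \<in> {1 / V..}"
  then have x: "1 / V \<le> x" "1 \<le> x * V" using V by (auto simp: field_simps)
  then have "1 \<le> \<lfloor>x * V\<rfloor>" by (simp add: le_floor_iff)
  then have "nat \<lfloor>x * V\<rfloor> = Suc (nat \<lfloor>x * V\<rfloor> - 1)" by linarith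
  then show "x \<in> (\<Union>i. A i)" using x Aiff by blast
 qed (use Aiff in auto)
 have "(\<integral>x. indicator {1 / V..} x * G (nat \<lfloor>x * V\<rfloor>) \<partial>lborel) = (LINT x:(\<Union>i. A i)|lborel. G (nat \<lfloor>x * V\<rfloor>))"
  unfolding U set_lebesgue_integral_def by simp
 also have "\<dots> = (\<Sum>i. LINT x:A i|lborel. G (nat \<lfloor>x * V\<rfloor>))"
 proof (rule lebesgue_integral_countable_add)
  show "\<And>i. A i \<in> sets lborel" by (simp add: A_def)
  show "\<And>i j. i \<noteq> j ==> A i \<inter> A j = {}" using Aiff by auto
  show "set_integrable lborel (\<Union>i. A i) (\<lambda>x. G (nat \<lfloor>x * V\<rfloor>))"
   using int unfolding U set_integrable_def by simp
 qed
 also have "\<dots> = (\<Sum>i. G (Suc i) / V)"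
 proof (intro suminf_cong)
  fix i
  have "(LINT x:A i|lborel. G (nat \<lfloor>x * V\<rfloor>)) = (LINT x:A i|lborel. G (Suc i))"
   by (intro set_lebesgue_integral_cong) (auto simp: Aiff, simp add: A_def)
  also have "\<dots> = measure lborel (A i) * G (Suc i)"
   using V by (simp add: set_lebesgue_integral_def A_def divide_right_mono)
  also have "measure lborel (A i) = 1 / V" using V by (simp add: A_def divide_right_mono field_simps)
  finally show "(LINT x:A i|lborel. G (nat \<lfloor>x * V\<rfloor>)) = G (Suc i) / V" by simp
 qed
 finally show ?thesis by simp
qed

text \<open>The bound \<open>x / 2\<close> holds since
  \<open>\<lfloor>y\<rfloor> \<ge> y / 2\<close> for \<open>y \<ge> 1\<close>; it lets a dominating
  function of \<open>x\<close> replace one of the lattice point.\<close>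

lemma floor_quotient_bounds:
 fixes x V :: real
 assumes "0 < V" "1 / V \<le> x"
 shows "x / 2 \<le> real (nat \<lfloor>x * V\<rfloor>) / V" "real (nat \<lfloor>x * V\<rfloor>) / V \<le> x" "x - 1 / V < real (nat \<lfloor>x * V\<rfloor>) / V"
  "1 \<le> nat \<lfloor>x * V\<rfloor>"
proof -
 have 1: "1 \<le> x * V" using assms by (simp add: field_simps)
 then show "1 \<le> nat \<lfloor>x * V\<rfloor>" by (simp add: le_nat_iff le_floor_iff)
 have n: "real (nat \<lfloor>x * V\<rfloor>) = of_int \<lfloor>x * V\<rfloor>" using 1 by simp
 have "x * V / 2 \<le> real (nat \<lfloor>x * V\<rfloor>)" proof -
  have "1 \<le> \<lfloor>x * V\<rfloor>" using 1 by (simp add: le_floor_iff)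
  then have "1 \<le> real_of_int \<lfloor>x * V\<rfloor>" by linarith
  moreover have "x * V - 1 < real_of_int \<lfloor>x * V\<rfloor>" by linarith
  ultimately show ?thesis unfolding n by linarith
 qed
 then show "x / 2 \<le> real (nat \<lfloor>x * V\<rfloor>) / V" using assms by (simp add: field_simps)
 have "real (nat \<lfloor>x * V\<rfloor>) \<le> x * V" unfolding n by linarith
 then show "real (nat \<lfloor>x * V\<rfloor>) / V \<le> x" using assms by (simp add: field_simps)
 have "x * V - 1 < real (nat \<lfloor>x * V\<rfloor>)" unfolding n by linarith
 then show "x - 1 / V < real (nat \<lfloor>x * V\<rfloor>) / V"
  using assms divide_strict_right_mono[of "x * V - 1" "real (nat \<lfloor>x * V\<rfloor>)" V] by (simp add: diff_divide_distrib)
qed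

lemma floor_quotient_tendsto:
 fixes V :: "nat => real"
 assumes "\<And>n. 0 < V n" "filterlim V at_top sequentially" "0 < x"
 shows "(\<lambda>n. real (nat \<lfloor>x * V n\<rfloor>) / V n) \<longlonglongrightarrow> x" "\<forall>\<^sub>F n in sequentially. 1 / V n \<le> x"
proof -
 have l: "(\<lambda>n. 1 / V n) \<longlonglongrightarrow> 0"
  using tendsto_inverse_0_at_top[OF assms(2)] by (simp add: inverse_eq_divide)
 show ev: "\<forall>\<^sub>F n in sequentially. 1 / V n \<le> x"
  using order_tendstoD(2)[OF l assms(3)] by eventually_elim auto
 have "(\<lambda>n. x - 1 / V n) \<longlonglongrightarrow> x - 0" by (intro tendsto_intros l)
 then have l': "(\<lambda>n. x - 1 / V n) \<longlonglongrightarrow> x" by simp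
 show "(\<lambda>n. real (nat \<lfloor>x * V n\<rfloor>) / V n) \<longlonglongrightarrow> x"
 proof (rule tendsto_sandwich[OF _ _ l' tendsto_const])
  show "\<forall>\<^sub>F n in sequentially. x - 1 / V n \<le> real (nat \<lfloor>x * V n\<rfloor>) / V n"
   using ev by eventually_elim (use floor_quotient_bounds(3) assms(1) in \<open>auto intro: less_imp_le\<close>)
  show "\<forall>\<^sub>F n in sequentially. real (nat \<lfloor>x * V n\<rfloor>) / V n \<le> x"
   using ev by eventually_elim (use floor_quotient_bounds(2) assms(1) in auto)
 qed
qed

lemma riemann_sum_tendsto:
 fixes V :: "nat => real" and G :: "nat => nat => real"
 assumes V: "\<And>n. 0 < V n"
  and lim: "\<And>x. 0 < x ==> (\<lambda>n. indicator {1 / V n..} x * G n (nat \<lfloor>x * V n\<rfloor>)) \<longlonglongrightarrow> g x"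
  and bnd: "\<forall>\<^sub>F n in sequentially. \<forall>x\<ge>1 / V n. \<bar>G n (nat \<lfloor>x * V n\<rfloor>)\<bar> \<le> B x"
  and B: "set_integrable lborel {0<..} B" and g: "g \<in> borel_measurable borel"
 shows "(\<lambda>n. \<Sum>i. G n (Suc i) / V n) \<longlonglongrightarrow> (LINT x:{0<..}|lborel. g x)"
proof -
 obtain N where N: "\<And>n x. N \<le> n ==> 1 / V n \<le> x ==> \<bar>G n (nat \<lfloor>x * V n\<rfloor>)\<bar> \<le> B x"
  using bnd unfolding eventually_sequentially by blast
 define s where "s n x = indicator {1 / V n..} x * G n (nat \<lfloor>x * V n\<rfloor>)" for n x
 have m: "s n \<in> borel_measurable lborel" for n
 proof -
  have "(\<lambda>x. G n (nat \<lfloor>x * V n\<rfloor>)) \<in> borel_measurable borel"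
   by (rule measurable_compose[of "\<lambda>x. \<lfloor>x * V n\<rfloor>" _ "count_space UNIV" "\<lambda>i. G n (nat i)"]) measurable
  then show ?thesis unfolding s_def by measurable
 qed
 have pos: "x \<in> {0<..}" if "1 / V n \<le> x" for n x
 proof -
  have "0 < 1 / V n" using V by simp
  then show ?thesis using that by (metis greaterThan_iff less_le_trans)
 qed
 have bd: "norm (s n x) \<le> indicator {0<..} x * \<bar>B x\<bar>" if "N \<le> n" for n x
 proof (cases "1 / V n \<le> x")
  case True
  then show ?thesis using N[OF that True] pos[OF True] by (simp add: s_def)
 qed (simp add: s_def)
 have BI: "integrable lborel (\<lambda>x. indicator {0<..} x * \<bar>B x\<bar>)"
  using set_integrable_abs[OF B] by (simp add: set_integrable_def)
 \<comment> \<open>The domination holds only from some \<open>N\<close> on, whence the shifted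
   sequence.\<close>
 have "(\<lambda>n. \<integral>x. s (n + N) x \<partial>lborel) \<longlonglongrightarrow> (\<integral>x. indicator {0<..} x * g x \<partial>lborel)"
 proof (rule integral_dominated_convergence[OF _ _ BI])
  show "AE x in lborel. (\<lambda>n. s (n + N) x) \<longlonglongrightarrow> indicator {0<..} x * g x"
  proof (intro AE_I2)
   fix x :: real
   show "(\<lambda>n. s (n + N) x) \<longlonglongrightarrow> indicator {0<..} x * g x"
   proof (cases "0 < x")
    case True
    then show ?thesis using LIMSEQ_ignore_initial_segment[OF lim[OF True], of N] by (simp add: s_def)
   next
    case False
    then have "s n x = 0" for n using pos[of n x] by (auto simp: s_def indicator_def)
    then show ?thesis using False by simp
   qed
  qed
  show "\<And>n. AE x in lborel. norm (s (n + N) x) \<le> indicator {0<..} x * \<bar>B x\<bar>"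
   using bd by auto
 qed (use m g in auto)
 moreover have "(\<integral>x. s (n + N) x \<partial>lborel) = (\<Sum>i. G (n + N) (Suc i) / V (n + N))" for n
 proof -
  have "integrable lborel (s (n + N))"
   by (rule Bochner_Integration.integrable_bound[OF BI m]) (use bd in \<open>auto intro: order_trans\<close>)
  then show ?thesis
   unfolding s_def by (rule suminf_eq_floor_integral[OF V, symmetric])
 qed
 ultimately have "(\<lambda>n. \<Sum>i. G (n + N) (Suc i) / V (n + N)) \<longlonglongrightarrow> (\<integral>x. indicator {0<..} x * g x \<partial>lborel)"
  by simp
 from LIMSEQ_offset[OF this] show ?thesis by (simp add: set_lebesgue_integral_def)
qed

text \<open>The substitution \<open>y = exp (- x)\<close> maps the half-line into
  \<open>{0..1}\<close> and turns Laplace transforms at integers into moments. Polynomials are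
  uniformly dense in the continuous functions on \<open>{0..1}\<close>, and the masses on both sides
  are bounded.\<close>

lemma laplace_imp_continuous_limit:
 fixes V :: "nat => real" and p :: "nat => nat => real" and g :: "real => real"
 assumes V: "\<And>n. 0 < V n"
  and p0: "\<And>n m. 0 \<le> p n m" and ps: "\<And>n. summable (p n)" "\<And>n. suminf (p n) \<le> 1"
  and g: "set_integrable lborel {0<..} g"
  and lap: "\<And>k::nat. (\<lambda>n. \<Sum>m. p n m * exp (- (real m / V n)) ^ k) \<longlonglongrightarrow> (LINT x:{0<..}|lborel. g x * exp (- x) ^ k)"
  and F: "continuous_on {0..1} F"
 shows "(\<lambda>n. \<Sum>m. p n m * F (exp (- (real m / V n)))) \<longlonglongrightarrow> (LINT x:{0<..}|lborel. g x * F (exp (- x)))"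
proof -
 define I where "I n H = (\<Sum>m. p n m * H (exp (- (real m / V n))))" for n and H :: "real => real"
 define J where "J H = (LINT x:{0<..}|lborel. g x * H (exp (- x)))" for H :: "real => real"
 have y: "exp (- (real m / V n)) \<in> {0..1}" for m n using V[of n] by simp
 have bdd: "\<exists>K. \<forall>y\<in>{0..1}. \<bar>H y\<bar> \<le> K" if "continuous_on {0..1} H" for H :: "real => real"
  using compact_imp_bounded[OF compact_continuous_image[OF that compact_Icc]] by (auto simp: bounded_iff)
 have sI: "summable (\<lambda>m. p n m * H (exp (- (real m / V n))))" if H: "continuous_on {0..1} H" for n H
 proof -
  obtain K where K: "\<And>y. y\<in>{0..1} ==> \<bar>H y\<bar> \<le> K" using bdd[OF H] by blast
  show ?thesis
   by (rule summable_comparison_test'[OF summable_mult[OF ps(1), of K n], of 0])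
    (auto simp: abs_mult p0 mult.commute[of K] intro!: mult_left_mono K y p0)
 qed
 have iJ: "set_integrable lborel {0<..} (\<lambda>x. g x * H (exp (- x)))" if H: "continuous_on {0..1} H" for H
 proof -
  obtain K where K: "\<And>y. y\<in>{0..1} ==> \<bar>H y\<bar> \<le> K" using bdd[OF H] by blast
  have m1: "(\<lambda>x. indicator {0<..} x * H (exp (- x))) \<in> borel_measurable borel"
  proof -
   have "continuous_on {0<..} (\<lambda>x. H (exp (- x)))"
    by (rule continuous_on_compose2[OF H]) (auto intro!: continuous_intros)
   then have "(\<lambda>x. indicator {0<..} x *\<^sub>R H (exp (- x))) \<in> borel_measurable borel"
    by (rule borel_measurable_continuous_on_indicator[rotated]) auto
   then show ?thesis by simp
  qed
  show ?thesis
   unfolding set_integrable_def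
  proof (rule Bochner_Integration.integrable_bound)
   show "integrable lborel (\<lambda>x. K * (indicator {0<..} x *\<^sub>R g x))"
    using g unfolding set_integrable_def by (rule integrable_mult_right)
   have "(\<lambda>x. indicator {0<..} x *\<^sub>R g x) \<in> borel_measurable lborel"
    using g unfolding set_integrable_def by (rule borel_measurable_integrable)
   then have "(\<lambda>x. (indicator {0<..} x *\<^sub>R g x) * (indicator {0<..} x * H (exp (- x)))) \<in> borel_measurable lborel"
    using m1 by measurable
   also have "(\<lambda>x. (indicator {0<..} x *\<^sub>R g x) * (indicator {0<..} x * H (exp (- x)))) =
     (\<lambda>x. indicator {0<..} x *\<^sub>R (g x * H (exp (- x))))" by (auto simp: indicator_def)
   finally show "(\<lambda>x. indicator {0<..} x *\<^sub>R (g x * H (exp (- x)))) \<in> borel_measurable lborel" .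
   show "AE x in lborel. norm (indicator {0<..} x *\<^sub>R (g x * H (exp (- x)))) \<le> norm (K * (indicator {0<..} x *\<^sub>R g x))"
   proof (intro AE_I2)
    fix x :: real
    have "\<bar>H (exp (- x))\<bar> \<le> \<bar>K\<bar>" if "0 < x" using K[of "exp (- x)"] that by auto
    then show "norm (indicator {0<..} x *\<^sub>R (g x * H (exp (- x)))) \<le> norm (K * (indicator {0<..} x *\<^sub>R g x))"
     by (auto simp: indicator_def abs_mult mult.commute[of "\<bar>K\<bar>"] intro!: mult_left_mono)
   qed
  qed
 qed
 define Cg where "Cg = (LINT x:{0<..}|lborel. \<bar>g x\<bar>)"
 have Cg: "0 \<le> Cg" unfolding Cg_def set_lebesgue_integral_def by (intro Bochner_Integration.integral_nonneg) (auto simp: indicator_def)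
 have poly: "(\<lambda>n. I n H) \<longlonglongrightarrow> J H" if "H = (\<lambda>y. \<Sum>i\<le>d. c i * y ^ i)" for H and c :: "nat => real" and d
 proof -
  have "I n H = (\<Sum>i\<le>d. c i * (\<Sum>m. p n m * exp (- (real m / V n)) ^ i))" for n
  proof -
   have s: "summable (\<lambda>m. p n m * exp (- (real m / V n)) ^ i)" for i
    by (rule sI) (intro continuous_intros)
   have "I n H = (\<Sum>m. \<Sum>i\<le>d. c i * (p n m * exp (- (real m / V n)) ^ i))"
    unfolding I_def that sum_distrib_left by (simp only: mult.left_commute)
   also have "\<dots> = (\<Sum>i\<le>d. \<Sum>m. c i * (p n m * exp (- (real m / V n)) ^ i))"
    by (intro suminf_sum summable_mult s)
   also have "\<dots> = (\<Sum>i\<le>d. c i * (\<Sum>m. p n m * exp (- (real m / V n)) ^ i))"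
    by (intro sum.cong refl suminf_mult s)
   finally show ?thesis .
  qed
  moreover have "J H = (\<Sum>i\<le>d. c i * (LINT x:{0<..}|lborel. g x * exp (- x) ^ i))"
  proof -
   have s: "set_integrable lborel {0<..} (\<lambda>x. g x * exp (- x) ^ i)" for i
    by (rule iJ) (intro continuous_intros)
   have "J H = (LINT x:{0<..}|lborel. \<Sum>i\<le>d. c i * (g x * exp (- x) ^ i))"
    unfolding J_def that sum_distrib_left by (simp only: mult.left_commute)
   also have "\<dots> = (\<Sum>i\<le>d. LINT x:{0<..}|lborel. c i * (g x * exp (- x) ^ i))"
    using s unfolding set_lebesgue_integral_def set_integrable_def scaleR_sum_right
    by (intro Bochner_Integration.integral_sum) (simp add: mult.left_commute)
   finally show ?thesis by simp
  qed
  ultimately show ?thesis by (auto intro!: tendsto_intros lap)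
 qed
 have "(\<lambda>n. I n F) \<longlonglongrightarrow> J F"
 proof (rule LIMSEQ_I)
  fix r :: real assume r: "0 < r"
  \<comment> \<open>With \<open>Cg\<close> the integral of \<open>\<bar>g\<bar>\<close>, both
    approximation errors, \<open>e\<close> and \<open>e * Cg\<close>, are at most
    \<open>r / 3\<close>.\<close>
  define e where "e = r / (3 * (1 + Cg))"
  have e: "0 < e" "e \<le> r / 3" "e * Cg \<le> r / 3" using r Cg by (auto simp: e_def field_simps)
  obtain H where H: "real_polynomial_function H" and HF: "\<And>x. x \<in> {0..1} ==> \<bar>F x - H x\<bar> < e"
   using Stone_Weierstrass_real_polynomial_function[OF compact_Icc F e(1)] by blast
  obtain c d where "H = (\<lambda>y. \<Sum>i\<le>d. c i * y ^ i)"
   using H unfolding real_polynomial_function_iff_sum by blast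
  note lim = poly[OF this]
  have Hc: "continuous_on {0..1} H"
   using H by (intro continuous_on_polymonial_function) (simp add: real_polynomial_function_eq[symmetric])
  obtain N where N: "\<And>n. N \<le> n ==> \<bar>I n H - J H\<bar> < r / 3"
   using LIMSEQ_D[OF lim, of "r / 3"] r by auto
  have b1: "\<bar>I n F - I n H\<bar> \<le> e" for n
  proof -
   have "I n F - I n H = (\<Sum>m. p n m * F (exp (- (real m / V n))) - p n m * H (exp (- (real m / V n))))"
    unfolding I_def by (intro suminf_diff sI F Hc)
   also have "\<bar>\<dots>\<bar> \<le> (\<Sum>m. p n m * e)"
   proof -
    have sm: "summable (\<lambda>m. p n m * e)" using ps(1) by (rule summable_mult2)
    have le: "\<bar>p n m * F (exp (- (real m / V n))) - p n m * H (exp (- (real m / V n)))\<bar> \<le> p n m * e" for m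
     using HF[OF y[of m n]] p0[of n m]
     by (simp add: right_diff_distrib[symmetric] abs_mult mult_left_mono)
    have sa: "summable (\<lambda>m. \<bar>p n m * F (exp (- (real m / V n))) - p n m * H (exp (- (real m / V n)))\<bar>)"
     by (rule summable_comparison_test'[OF sm, of 0]) (use le in auto)
    show ?thesis
     by (rule order_trans[OF summable_rabs[OF sa] suminf_le[OF le sa sm]])
   qed
   also have "\<dots> = suminf (p n) * e" using ps(1) by (rule suminf_mult2[symmetric])
   also have "\<dots> \<le> 1 * e" using ps(2) e by (intro mult_right_mono) auto
   finally show ?thesis by simp
  qed
  have b2: "\<bar>J F - J H\<bar> \<le> e * Cg"
  proof -
   have "J F - J H = (LINT x:{0<..}|lborel. g x * F (exp (- x)) - g x * H (exp (- x)))"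
    unfolding J_def by (intro set_integral_diff(2)[symmetric] iJ F Hc)
   also have "\<bar>\<dots>\<bar> \<le> (LINT x:{0<..}|lborel. e * \<bar>g x\<bar>)"
   proof -
    have "\<bar>LINT x:{0<..}|lborel. g x * F (exp (- x)) - g x * H (exp (- x))\<bar> \<le>
     (LINT x:{0<..}|lborel. \<bar>g x * F (exp (- x)) - g x * H (exp (- x))\<bar>)"
     using set_integral_norm_bound[OF set_integral_diff(1)[OF iJ[OF F] iJ[OF Hc]]] by simp
    also have "\<dots> \<le> (LINT x:{0<..}|lborel. e * \<bar>g x\<bar>)"
    proof (rule set_integral_mono)
     show "set_integrable lborel {0<..} (\<lambda>x. \<bar>g x * F (exp (- x)) - g x * H (exp (- x))\<bar>)"
      by (intro set_integrable_abs set_integral_diff(1) iJ F Hc)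
     show "set_integrable lborel {0<..} (\<lambda>x. e * \<bar>g x\<bar>)" using g by (intro set_integrable_mult_right set_integrable_abs)
     fix x :: real assume "x \<in> {0<..}"
     then have "\<bar>F (exp (- x)) - H (exp (- x))\<bar> \<le> e" using HF[of "exp (- x)"] by simp
     then have "\<bar>F (exp (- x)) - H (exp (- x))\<bar> * \<bar>g x\<bar> \<le> e * \<bar>g x\<bar>" by (intro mult_right_mono) auto
     then show "\<bar>g x * F (exp (- x)) - g x * H (exp (- x))\<bar> \<le> e * \<bar>g x\<bar>"
      by (simp add: right_diff_distrib[symmetric] abs_mult mult.commute)
    qed
    finally show ?thesis .
   qed
   also have "\<dots> = e * Cg" unfolding Cg_def by (rule set_integral_mult_right)
   finally show ?thesis .
  qed
  have "norm (I n F - J F) < r" if "N \<le> n" for n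
   using N[OF that] b1[of n] b2 e unfolding real_norm_def by linarith
  then show "\<exists>no. \<forall>n\<ge>no. norm (I n F - J F) < r" by blast
 qed
 then show ?thesis by (simp add: I_def J_def)
qed

section \<open>Averages over tent functions and the local limit\<close>

definition tent :: "real => real => real => real" where
 "tent a \<eta> x = max 0 (\<eta> - \<bar>x - a\<bar>)"

lemma tent_nonneg: "0 \<le> tent a \<eta> x" by (simp add: tent_def)

lemma tent_le: "0 \<le> \<eta> ==> tent a \<eta> x \<le> \<eta>" by (simp add: tent_def)

lemma tent_pos_iff: "tent a \<eta> x \<noteq> 0 \<longleftrightarrow> \<bar>x - a\<bar> < \<eta>" by (auto simp: tent_def)

lemma continuous_tent [continuous_intros]: "continuous_on S (tent a \<eta>)"
 unfolding tent_def by (intro continuous_intros)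

text \<open>The cutoff at \<open>exp (- (a + \<eta>))\<close> keeps the argument of
  \<open>ln\<close> away from 0 and alters nothing, as the tent vanishes beyond
  \<open>a + \<eta>\<close>; so the tent becomes a function of \<open>exp (- x)\<close> that is
  continuous on all of \<open>{0..1}\<close>.\<close>

lemma tent_exp: "tent a \<eta> x = max 0 (\<eta> - \<bar>ln (max (exp (- x)) (exp (- (a + \<eta>)))) + a\<bar>)"
 unfolding tent_def by (cases "x \<le> a + \<eta>") (auto simp: max_def abs_minus_commute)

lemma tent_riemann_sum:
 fixes V :: "nat => real"
 assumes V: "\<And>n. 0 < V n" "filterlim V at_top sequentially" and \<eta>: "0 < \<eta>" "\<eta> < a"
 shows "(\<lambda>n. \<Sum>m. tent a \<eta> (real m / V n) / V n) \<longlonglongrightarrow> (LINT x:{0<..}|lborel. tent a \<eta> x)"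
proof -
 have "(\<lambda>n. \<Sum>i. tent a \<eta> (real (Suc i) / V n) / V n) \<longlonglongrightarrow> (LINT x:{0<..}|lborel. tent a \<eta> x)"
 proof (rule riemann_sum_tendsto[where B = "\<lambda>x. \<eta> * indicator {..a + \<eta> + 1} x"])
  show "\<And>n. 0 < V n" by (rule V)
  fix x :: real assume x: "0 < x"
  have "isCont (tent a \<eta>) x" using continuous_tent[of UNIV] by (simp add: continuous_on_eq_continuous_at)
  from isCont_tendsto_compose[OF this floor_quotient_tendsto(1)[OF V x]]
  have l: "(\<lambda>n. tent a \<eta> (real (nat \<lfloor>x * V n\<rfloor>) / V n)) \<longlonglongrightarrow> tent a \<eta> x" .
  show "(\<lambda>n. indicator {1 / V n..} x * tent a \<eta> (real (nat \<lfloor>x * V n\<rfloor>) / V n)) \<longlonglongrightarrow> tent a \<eta> x"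
   by (rule Lim_transform_eventually[OF l])
    (use floor_quotient_tendsto(2)[OF V x] in \<open>eventually_elim, simp\<close>)
 next
  have "\<forall>\<^sub>F n in sequentially. 1 \<le> V n" using V(2) by (simp add: filterlim_at_top)
  then show "\<forall>\<^sub>F n in sequentially. \<forall>x\<ge>1 / V n. \<bar>tent a \<eta> (real (nat \<lfloor>x * V n\<rfloor>) / V n)\<bar> \<le> \<eta> * indicator {..a + \<eta> + 1} x"
  proof eventually_elim
   case (elim n)
   show ?case
   proof (intro allI impI)
    fix x assume x: "1 / V n \<le> x"
    let ?y = "real (nat \<lfloor>x * V n\<rfloor>) / V n"
    show "\<bar>tent a \<eta> ?y\<bar> \<le> \<eta> * indicator {..a + \<eta> + 1} x"
    proof (cases "tent a \<eta> ?y = 0")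
     case False
     then have "?y < a + \<eta>" using tent_pos_iff by (metis abs_less_iff add.commute diff_less_eq)
     moreover have "x - 1 / V n < ?y" by (rule floor_quotient_bounds(3)[OF V(1) x])
     moreover have "1 / V n \<le> 1" using elim V(1)[of n] by simp
     ultimately have "x \<le> a + \<eta> + 1" by linarith
     then show ?thesis using tent_le[of \<eta> a ?y] tent_nonneg[of a \<eta> ?y] \<eta> by simp
    qed (use \<eta> in simp)
   qed
  qed
  have "integrable lborel (\<lambda>x::real. \<eta> * indicator {0<..a + \<eta> + 1} x)"
   using \<eta> by (intro integrable_mult_right integrable_real_indicator) (auto simp: ennreal_less_top)
  then show "set_integrable lborel {0<..} (\<lambda>x. \<eta> * indicator {..a + \<eta> + 1} x)"
   unfolding set_integrable_def
   by (rule Bochner_Integration.integrable_cong[THEN iffD1, rotated -1]) (auto simp: indicator_def)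
  show "tent a \<eta> \<in> borel_measurable borel"
   by (intro borel_measurable_continuous_onI continuous_tent)
 qed
 \<comment> \<open>The only further term is \<open>m = 0\<close>, where the tent vanishes because
   \<open>\<eta> < a\<close>.\<close>
 moreover have "(\<Sum>i. tent a \<eta> (real (Suc i) / V n) / V n) = (\<Sum>m. tent a \<eta> (real m / V n) / V n)" for n
 proof -
  obtain M :: nat where M: "(a + \<eta>) * V n \<le> real M" using real_arch_simple by blast
  have "tent a \<eta> (real m / V n) = 0" if "M \<le> m" for m
  proof -
   have "(a + \<eta>) * V n \<le> real m" using M that by linarith
   then have "a + \<eta> \<le> real m / V n" using V(1)[of n] by (simp add: field_simps)
   then show ?thesis by (simp add: tent_def)
  qed
  then have "summable (\<lambda>m. tent a \<eta> (real m / V n) / V n)"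
   by (intro summable_finite[of "{..<M}"]) auto
  from suminf_split_head[OF this] show ?thesis using \<eta> by (simp add: tent_def)
 qed
 ultimately show ?thesis by simp
qed

lemma tent_integral_pos:
 assumes \<eta>: "0 < \<eta>" "\<eta> < a"
 shows "set_integrable lborel {0<..} (tent a \<eta>)" "0 < (LINT x:{0<..}|lborel. tent a \<eta> x)"
proof -
 have i: "set_integrable lborel {a - \<eta>..a + \<eta>} (tent a \<eta>)"
  by (rule borel_integrable_atLeastAtMost') (rule continuous_tent)
 show i': "set_integrable lborel {0<..} (tent a \<eta>)"
  using i unfolding set_integrable_def
  by (rule Bochner_Integration.integrable_cong[THEN iffD1, rotated -1]) (use \<eta> in \<open>auto simp: indicator_def tent_def\<close>)
 have "(LINT x:{a - \<eta> / 2..a + \<eta> / 2}|lborel. \<eta> / 2) = \<eta> * (\<eta> / 2)"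
  using \<eta> by (simp add: set_lebesgue_integral_def)
 moreover have "(LINT x:{a - \<eta> / 2..a + \<eta> / 2}|lborel. \<eta> / 2) \<le> (LINT x:{0<..}|lborel. tent a \<eta> x)"
  unfolding set_lebesgue_integral_def
 proof (rule integral_mono)
  show "integrable lborel (\<lambda>x. indicat_real {0<..} x *\<^sub>R tent a \<eta> x)" using i' by (simp add: set_integrable_def)
  show "integrable lborel (\<lambda>x. indicat_real {a - \<eta> / 2..a + \<eta> / 2} x *\<^sub>R (\<eta> / 2))"
   by (intro integrable_scaleR_left integrable_real_indicator) (auto simp: emeasure_lborel_Icc_eq)
  fix x :: real
  have "\<eta> / 2 \<le> tent a \<eta> x \<and> 0 < x" if "a - \<eta> / 2 \<le> x" "x \<le> a + \<eta> / 2"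
  proof -
   have "\<bar>x - a\<bar> \<le> \<eta> / 2" using that by linarith
   then show ?thesis using that \<eta> by (simp add: tent_def le_max_iff_disj)
  qed
  then show "indicat_real {a - \<eta> / 2..a + \<eta> / 2} x *\<^sub>R (\<eta> / 2) \<le> indicat_real {0<..} x *\<^sub>R tent a \<eta> x"
   using tent_nonneg[of a \<eta> x] by (auto simp: indicator_def)
 qed
 moreover have "0 < \<eta> * (\<eta> / 2)" using \<eta> by simp
 ultimately show "0 < (LINT x:{0<..}|lborel. tent a \<eta> x)" by linarith
qed

text \<open>By equicontinuity \<open>V * p m\<close> differs little from its average
  \<open>Jn / In\<close> over the lattice points under the tent around \<open>a\<close>. The average
  converges to \<open>J / I\<close>, its numerator through the Laplace transforms and its
  denominator as a Riemann sum, and continuity of \<open>g\<close> at \<open>a\<close> brings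
  \<open>J / I\<close> close to \<open>g a\<close>.\<close>

theorem local_limit:
 fixes V :: "nat => real" and q p :: "nat => nat => real" and \<psi> g :: "real => real"
 assumes V: "\<And>n. 0 < V n" and Vinf: "filterlim V at_top sequentially"
  and q0: "\<And>n j. 1 \<le> j ==> 0 \<le> q n j" and qC: "\<And>n j. 1 \<le> j ==> q n j \<le> C"
  and p0: "\<And>n m. 0 \<le> p n m" and ps: "\<And>n. summable (p n)" "\<And>n. suminf (p n) \<le> 1"
  and rec: "\<And>n m. real m * p n m = (\<Sum>j=1..m. q n j * p n (m - j))"
  and \<psi>c: "continuous_on {0<..} \<psi>"
  and \<psi>l: "\<And>\<delta> R \<epsilon>. 0 < \<delta> ==> \<delta> < R ==> 0 < \<epsilon> ==>
   \<forall>\<^sub>F n in sequentially. \<forall>j. \<delta> \<le> real j / V n \<and> real j / V n \<le> R \<longrightarrow> \<bar>q n j - \<psi> (real j / V n)\<bar> < \<epsilon>"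
  and g: "set_integrable lborel {0<..} g" and gc: "isCont g a"
  and lap: "\<And>k::nat. (\<lambda>n. \<Sum>m. p n m * exp (- (real m / V n)) ^ k) \<longlonglongrightarrow> (LINT x:{0<..}|lborel. g x * exp (- x) ^ k)"
  and a: "0 < a" and \<epsilon>: "0 < \<epsilon>"
 shows "\<exists>\<eta>>0. \<forall>\<^sub>F n in sequentially. \<forall>m. \<bar>real m / V n - a\<bar> < \<eta> \<longrightarrow> \<bar>V n * p n m - g a\<bar> < \<epsilon>"
proof -
 define e where "e = \<epsilon> / 4"
 have e: "0 < e" using \<epsilon> by (simp add: e_def)
 have "\<exists>\<eta>>0. \<eta> < a \<and> (\<forall>\<^sub>F n in sequentially. \<forall>m m'. \<bar>real m / V n - a\<bar> < \<eta> \<and> \<bar>real m' / V n - a\<bar> < \<eta> \<longrightarrow>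
  \<bar>V n * p n m - V n * p n m'\<bar> \<le> e)"
 proof (rule local_limit_equicontinuous[OF V q0 _ p0 ps rec \<psi>c \<psi>l _ a e])
  \<comment> \<open>The equicontinuity lemma asks for a positive bound.\<close>
  show "q n j \<le> max C 1" if "1 \<le> j" for n j using qC[OF that, of n] by simp
 qed auto
 then obtain \<eta>1 where \<eta>1: "0 < \<eta>1" "\<eta>1 < a" and eq1: "\<forall>\<^sub>F n in sequentially. \<forall>m m'. \<bar>real m / V n - a\<bar> < \<eta>1 \<and> \<bar>real m' / V n - a\<bar> < \<eta>1 \<longrightarrow>
  \<bar>V n * p n m - V n * p n m'\<bar> \<le> e" by blast
 obtain \<eta>2 where \<eta>2: "0 < \<eta>2" and g2: "\<And>x. \<bar>x - a\<bar> < \<eta>2 ==> \<bar>g x - g a\<bar> < e"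
  using gc e unfolding continuous_at_eps_delta dist_real_def by blast
 define \<eta> where "\<eta> = min \<eta>1 \<eta>2"
 have \<eta>: "0 < \<eta>" "\<eta> < a" "\<eta> \<le> \<eta>1" "\<eta> \<le> \<eta>2" using \<eta>1 \<eta>2 by (auto simp: \<eta>_def)
 define T where "T = tent a \<eta>"
 define I where "I = (LINT x:{0<..}|lborel. T x)"
 define J where "J = (LINT x:{0<..}|lborel. g x * T x)"
 have I0: "0 < I" unfolding I_def T_def by (rule tent_integral_pos(2)[OF \<eta>(1,2)])
 have iT: "set_integrable lborel {0<..} T" unfolding T_def by (rule tent_integral_pos(1)[OF \<eta>(1,2)])
 define In where "In n = (\<Sum>m. T (real m / V n) / V n)" for n
 define Jn where "Jn n = (\<Sum>m. p n m * T (real m / V n))" for n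
 have In: "In \<longlonglongrightarrow> I" unfolding In_def I_def T_def by (rule tent_riemann_sum[OF V Vinf \<eta>(1,2)])
 define F where "F y = max 0 (\<eta> - \<bar>ln (max y (exp (- (a + \<eta>)))) + a\<bar>)" for y :: real
 have TF: "T x = F (exp (- x))" for x unfolding T_def F_def by (rule tent_exp)
 have Fc: "continuous_on {0..1} F"
  unfolding F_def by (intro continuous_intros) (auto simp: max_def)
 have Jn: "Jn \<longlonglongrightarrow> J" unfolding Jn_def J_def TF
  by (rule laplace_imp_continuous_limit[OF V p0 ps g lap Fc])
 have JI: "\<bar>J - g a * I\<bar> \<le> e * I"
 proof -
  have igT: "set_integrable lborel {0<..} (\<lambda>x. g x * T x)"
   unfolding set_integrable_def
  proof (rule Bochner_Integration.integrable_bound)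
   show "integrable lborel (\<lambda>x. \<eta> * (indicator {0<..} x *\<^sub>R g x))"
    using g unfolding set_integrable_def by (rule integrable_mult_right)
   have "(\<lambda>x. indicator {0<..} x *\<^sub>R g x) \<in> borel_measurable lborel"
    using g unfolding set_integrable_def by (rule borel_measurable_integrable)
   moreover have "T \<in> borel_measurable lborel"
    unfolding T_def using borel_measurable_continuous_onI[OF continuous_tent] by simp
   ultimately have "(\<lambda>x. (indicator {0<..} x *\<^sub>R g x) * T x) \<in> borel_measurable lborel" by measurable
   then show "(\<lambda>x. indicator {0<..} x *\<^sub>R (g x * T x)) \<in> borel_measurable lborel" by (simp add: mult.assoc)
   show "AE x in lborel. norm (indicator {0<..} x *\<^sub>R (g x * T x)) \<le> norm (\<eta> * (indicator {0<..} x *\<^sub>R g x))"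
    using \<eta> tent_nonneg[of a \<eta>] tent_le[of \<eta> a]
    by (intro AE_I2) (auto simp: indicator_def abs_mult T_def mult.commute[of \<eta>] intro!: mult_left_mono)
  qed
  have igI: "set_integrable lborel {0<..} (\<lambda>x. g a * T x)" using iT by (rule set_integrable_mult_right)
  have "J - g a * I = (LINT x:{0<..}|lborel. g x * T x - g a * T x)"
   unfolding J_def I_def set_integral_diff(2)[OF igT igI] by simp
  also have "\<bar>\<dots>\<bar> \<le> (LINT x:{0<..}|lborel. \<bar>g x * T x - g a * T x\<bar>)"
   using set_integral_norm_bound[OF set_integral_diff(1)[OF igT igI]] by simp
  also have "\<dots> \<le> (LINT x:{0<..}|lborel. e * T x)"
  proof (rule set_integral_mono)
   show "set_integrable lborel {0<..} (\<lambda>x. \<bar>g x * T x - g a * T x\<bar>)"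
    by (intro set_integrable_abs set_integral_diff(1) igT igI)
   show "set_integrable lborel {0<..} (\<lambda>x. e * T x)" using iT by (intro set_integrable_mult_right)
   fix x :: real
   have T0: "0 \<le> T x" by (simp add: T_def tent_nonneg)
   have "\<bar>g x - g a\<bar> * T x \<le> e * T x"
   proof (cases "T x = 0")
    case False
    then have "\<bar>x - a\<bar> < \<eta>" unfolding T_def tent_pos_iff .
    then have "\<bar>g x - g a\<bar> < e" using \<eta> by (intro g2) auto
    then show ?thesis using T0 by (intro mult_right_mono) auto
   qed simp
   then show "\<bar>g x * T x - g a * T x\<bar> \<le> e * T x"
    using T0 by (simp add: left_diff_distrib[symmetric] abs_mult)
  qed
  also have "\<dots> = e * I" unfolding I_def by (rule set_integral_mult_right)
  finally show ?thesis .
 qed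
 have ratio: "(\<lambda>n. Jn n / In n) \<longlonglongrightarrow> J / I" using I0 by (intro tendsto_divide Jn In) auto
 have JI': "\<bar>J / I - g a\<bar> \<le> e"
 proof -
  have "J / I - g a = (J - g a * I) / I" using I0 by (simp add: field_simps)
  then show ?thesis using JI I0 by (simp add: abs_divide field_simps)
 qed
 have ev1: "\<forall>\<^sub>F n in sequentially. \<bar>Jn n / In n - J / I\<bar> < e"
  using tendstoD[OF ratio e] by (simp add: dist_real_def)
 have ev2: "\<forall>\<^sub>F n in sequentially. 0 < In n" by (rule order_tendstoD(1)[OF In I0])
 have "\<forall>\<^sub>F n in sequentially. \<forall>m. \<bar>real m / V n - a\<bar> < \<eta> \<longrightarrow> \<bar>V n * p n m - g a\<bar> < \<epsilon>"
  using eq1 ev1 ev2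
 proof eventually_elim
  case (elim n)
  show ?case
  proof (intro allI impI)
   fix m0 assume m0: "\<bar>real m0 / V n - a\<bar> < \<eta>"
   have Vn: "0 < V n" by (rule V)
   obtain M :: nat where M: "(a + \<eta>) * V n \<le> real M" using real_arch_simple by blast
   have T0: "T (real m / V n) = 0" if "m \<notin> {..<M}" for m
   proof -
    have "(a + \<eta>) * V n \<le> real m" using M that by auto
    then have "a + \<eta> \<le> real m / V n" using V[of n] by (simp add: field_simps)
    then show ?thesis by (simp add: T_def tent_def)
   qed
   have In': "In n = (\<Sum>m<M. T (real m / V n) / V n)" unfolding In_def by (rule suminf_finite) (auto simp: T0)
   have Jn': "Jn n = (\<Sum>m<M. p n m * T (real m / V n))" unfolding Jn_def by (rule suminf_finite) (auto simp: T0)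
   have "V n * p n m0 * In n - Jn n = (\<Sum>m<M. (V n * p n m0 - V n * p n m) * (T (real m / V n) / V n))"
    unfolding In' Jn' sum_distrib_left sum_subtractf[symmetric]
    using Vn by (intro sum.cong refl) (simp add: field_simps)
   also have "\<bar>\<dots>\<bar> \<le> (\<Sum>m<M. e * (T (real m / V n) / V n))"
   proof (intro order_trans[OF sum_abs] sum_mono)
    fix m
    have T0: "0 \<le> T (real m / V n) / V n" using Vn by (simp add: T_def tent_nonneg)
    show "\<bar>(V n * p n m0 - V n * p n m) * (T (real m / V n) / V n)\<bar> \<le> e * (T (real m / V n) / V n)"
    proof (cases "T (real m / V n) = 0")
     case False
     then have "\<bar>real m / V n - a\<bar> < \<eta>" unfolding T_def tent_pos_iff .
     then have "\<bar>V n * p n m0 - V n * p n m\<bar> \<le> e" using elim(1) m0 \<eta> by auto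
     then show ?thesis using T0 unfolding abs_mult abs_of_nonneg[OF T0] by (rule mult_right_mono)
    qed simp
   qed
   also have "\<dots> = e * In n" unfolding In' by (simp add: sum_distrib_left)
   finally have "\<bar>V n * p n m0 * In n - Jn n\<bar> \<le> e * In n" .
   moreover have "V n * p n m0 - Jn n / In n = (V n * p n m0 * In n - Jn n) / In n"
    using elim(3) by (simp add: field_simps)
   ultimately have "\<bar>V n * p n m0 - Jn n / In n\<bar> \<le> e"
    using elim(3) by (simp add: abs_divide field_simps)
   then show "\<bar>V n * p n m0 - g a\<bar> < \<epsilon>" using elim(2) JI' e unfolding e_def by linarith
  qed
 qed
 then show ?thesis using \<eta>(1) by blast
qed

section \<open>Weak convergence and Laplace functionals\<close>

lemma point_topology_initial:
 "\<exists>gs :: nat => real \<times> real \<times> 'm::polish_space => real. range gs \<subseteq> nonneg_test_functions \<and>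
  (\<forall>U. openin point_topology U \<longrightarrow>
    (\<exists>W. open W \<and> U = {\<xi> \<in> locally_finite_point_measures. coordinates gs \<xi> \<in> W}))"
proof -
 from countable_lipschitz_approximation[where 'a="real \<times> real \<times> 'm"]
 obtain G :: "(real \<times> real \<times> 'm => real) set" where GG: "countable G \<and>
  (\<forall>g\<in>G. (\<forall>w. 0 \<le> g w) \<and> (\<exists>K. \<forall>w. g w \<le> K) \<and> (\<exists>L\<ge>0. \<forall>w v. \<bar>g w - g v\<bar> \<le> L * dist w v)) \<and>
  (\<forall>S f. continuous_on S f \<longrightarrow> (\<forall>w\<in>S. 0 \<le> f w) \<longrightarrow>
   (\<exists>h. range h \<subseteq> G \<and> (\<forall>n. \<forall>w\<in>S. h n w \<le> f w) \<and> (\<forall>w. incseq (\<lambda>n. h n w)) \<and> (\<forall>w\<in>S. (\<lambda>n. h n w) \<longlonglongrightarrow> f w)))"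
  by (rule exE)
 note G1 = GG[THEN conjunct1]
 note G2 = GG[THEN conjunct2, THEN conjunct1, THEN bspec]
 note Gnn = G2[THEN conjunct1, THEN spec]
 note GK = G2[THEN conjunct2, THEN conjunct1]
 note GL = G2[THEN conjunct2, THEN conjunct2]
 note G3 = GG[THEN conjunct2, THEN conjunct2, THEN spec, THEN spec, THEN mp, THEN mp]
 \<comment> \<open>Only the members of the Lipschitz family that are test functions qualify. The
   approximants \<open>h n\<close> of a test function \<open>f\<close> are among them, because
   \<open>0 \<le> h n \<le> f\<close> forces them to vanish outside the strip of
   \<open>f\<close>.\<close>
 define C :: "(real \<times> real \<times> 'm => real) set" where "C = (G \<inter> nonneg_test_functions) \<union> cutoff ` {1..}"
 have C: "countable C" "C \<noteq> {}" "C \<subseteq> nonneg_test_functions"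
  using G1 cutoff_test_function by (auto simp: C_def)
 define gs where "gs = from_nat_into C"
 have gsC: "range gs = C" unfolding gs_def by (rule range_from_nat_into[OF C(2,1)])
 have gsn: "range gs \<subseteq> nonneg_test_functions" using gsC C by simp
 let ?N = "locally_finite_point_measures :: (real \<times> real \<times> 'm) measure set"
 have proj: "open {y :: nat => real. y i < c}" "open {y :: nat => real. c < y i}" for i c
  by (intro open_Collect_less continuous_intros continuous_on_product_coordinates)+
 \<comment> \<open>For nonnegative \<open>f\<close> a lower bound on its integral follows from an
   open condition on one coordinate: some \<open>h n \<le> f\<close> has nearly the same integral at
   \<open>\<xi>0\<close>, and \<open>h n\<close> belongs to the countable family.\<close>
 have lower: "\<exists>W. open W \<and> coordinates gs \<xi>0 \<in> W \<and> (\<forall>\<xi>\<in>?N. coordinates gs \<xi> \<in> W \<longrightarrow> (\<integral>z. f z \<partial>\<xi>0) - \<epsilon> < (\<integral>z. f z \<partial>\<xi>))"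
  if f: "f \<in> nonneg_test_functions" and \<xi>0: "\<xi>0 \<in> ?N" and \<epsilon>: "0 < \<epsilon>" for f \<xi>0 \<epsilon>
 proof -
  have f': "f \<in> test_functions" "\<And>z. z \<in> E ==> 0 \<le> f z" "continuous_on E f"
   using f by (auto simp: nonneg_test_functions_def test_functions_def)
  have "\<forall>w\<in>E. 0 \<le> f w" using f'(2) by blast
  from G3[OF f'(3) this] obtain h where hh: "range h \<subseteq> G \<and> (\<forall>n. \<forall>w\<in>E. h n w \<le> f w) \<and>
    (\<forall>w. incseq (\<lambda>n. h n w)) \<and> (\<forall>w\<in>E. (\<lambda>n. h n w) \<longlonglongrightarrow> f w)" by (rule exE)
  then have h: "range h \<subseteq> G" "\<And>n w. w \<in> E ==> h n w \<le> f w" "\<And>w. w \<in> E ==> (\<lambda>n. h n w) \<longlonglongrightarrow> f w"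
   by simp_all
  have hG: "h n \<in> G" for n using h(1) by auto
  have ht: "h n \<in> nonneg_test_functions" for n
  proof -
   obtain \<delta> R where d: "0 < \<delta>" "\<delta> < R" "\<And>z. z \<in> E ==> z \<notin> strip \<delta> R ==> f z = 0"
    using f'(1) by (auto simp: test_functions_def)
   obtain L where L: "L \<ge> 0" "\<And>w v. \<bar>h n w - h n v\<bar> \<le> L * dist w v" using GL[OF hG[of n]] by auto
   have "L-lipschitz_on E (h n)" using L by (intro lipschitz_onI) (auto simp: dist_real_def)
   then have "continuous_on E (h n)" by (rule lipschitz_on_continuous_on)
   moreover have "bounded (h n ` E)"
   proof -
    obtain K where "\<And>w. h n w \<le> K" using GK[OF hG[of n]] by auto
    then have "\<bar>h n w\<bar> \<le> K" for w using Gnn[OF hG[of n]] by (simp add: abs_of_nonneg)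
    then show ?thesis unfolding bounded_iff by (intro exI[of _ K]) auto
   qed
   moreover have "h n z = 0" if "z \<in> E" "z \<notin> strip \<delta> R" for z
   proof (rule order_antisym)
    show "h n z \<le> 0" using h(2)[OF that(1), of n] d(3)[OF that] by simp
    show "0 \<le> h n z" using Gnn[OF hG[of n]] .
   qed
   moreover have "\<forall>z\<in>E. 0 \<le> h n z" using Gnn[OF hG[of n]] by simp
   ultimately show ?thesis using d(1,2)
    unfolding nonneg_test_functions_def test_functions_def by blast
  qed
  note S = point_measureD[OF \<xi>0]
  have "(\<lambda>n. \<integral>z. h n z \<partial>\<xi>0) \<longlonglongrightarrow> (\<integral>z. f z \<partial>\<xi>0)"
  proof (rule integral_dominated_convergence[where w = f])
   show "f \<in> borel_measurable \<xi>0" "\<And>n. h n \<in> borel_measurable \<xi>0"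
    using test_function_integrable[OF \<xi>0] nonneg_test_functionsD[OF ht] f' by auto
   show "integrable \<xi>0 f" by (rule test_function_integrable[OF \<xi>0 f'(1)])
   show "AE z in \<xi>0. (\<lambda>n. h n z) \<longlonglongrightarrow> f z" using h(3) S by (intro AE_I2) auto
   show "AE z in \<xi>0. norm (h n z) \<le> f z" for n
    using h(2) Gnn[OF hG[of n]] S by (intro AE_I2) auto
  qed
  then have "\<forall>\<^sub>F n in sequentially. (\<integral>z. f z \<partial>\<xi>0) - \<epsilon> < (\<integral>z. h n z \<partial>\<xi>0)"
   using \<epsilon> by (intro order_tendstoD) auto
  then obtain n where n: "(\<integral>z. f z \<partial>\<xi>0) - \<epsilon> < (\<integral>z. h n z \<partial>\<xi>0)"
   using eventually_happens'[OF sequentially_bot] by blast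
  have "h n \<in> range gs" unfolding gsC C_def using hG ht by auto
  then obtain i where i: "h n = gs i" by blast
  define W where "W = {y :: nat => real. y i < exp (- ((\<integral>z. f z \<partial>\<xi>0) - \<epsilon>))}"
  have "open W" unfolding W_def by (rule proj)
  moreover have "coordinates gs \<xi>0 \<in> W" using n by (simp add: W_def coordinates_def i)
  moreover have "(\<integral>z. f z \<partial>\<xi>0) - \<epsilon> < (\<integral>z. f z \<partial>\<xi>)" if "\<xi> \<in> ?N" "coordinates gs \<xi> \<in> W" for \<xi>
  proof -
   have "(\<integral>z. f z \<partial>\<xi>0) - \<epsilon> < (\<integral>z. h n z \<partial>\<xi>)" using that(2) by (simp add: W_def coordinates_def i)
   also have "\<dots> \<le> (\<integral>z. f z \<partial>\<xi>)"
    using test_function_integrable[OF that(1)] nonneg_test_functionsD[OF ht] f' h(2) point_measureD(2)[OF that(1)]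
    by (intro integral_mono_AE AE_I2) auto
   finally show ?thesis .
  qed
  ultimately show ?thesis by blast
 qed
 have lower': "\<exists>W. open W \<and> coordinates gs \<xi>0 \<in> W \<and> (\<forall>\<xi>\<in>?N. coordinates gs \<xi> \<in> W \<longrightarrow> (\<integral>z. f z \<partial>\<xi>0) - \<epsilon> < (\<integral>z. f z \<partial>\<xi>))"
  if f: "f \<in> test_functions" and \<xi>0: "\<xi>0 \<in> ?N" and \<epsilon>: "0 < \<epsilon>" for f \<xi>0 \<epsilon>
 proof -
  obtain \<delta> R where d: "0 < \<delta>" "\<delta> < R" "\<And>z. z \<in> E ==> z \<notin> strip \<delta> R ==> f z = 0"
   using f by (auto simp: test_functions_def)
  obtain K where K: "\<And>z. z \<in> E ==> \<bar>f z\<bar> \<le> K"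
   using f by (auto simp: test_functions_def bounded_iff)
  obtain k :: nat where "max (max (2 / \<delta>) R) 1 \<le> real k" using real_arch_simple by blast
  then have k: "2 / \<delta> \<le> real k" "R \<le> real k" "1 \<le> k" by auto
  then have k': "2 \<le> real k * \<delta>" using d(1) by (simp add: pos_divide_le_eq)
  \<comment> \<open>\<open>f + B * ct\<close> is a nonnegative test function, to which
    \<open>lower\<close> applies. The second open set bounds the integral of \<open>ct\<close> from
    above, so that the lower bound passes back to \<open>f\<close>; each part costs
    \<open>\<epsilon> / 2\<close>.\<close>
  define B where "B = \<bar>K\<bar> + 1"
  have B: "0 < B" "K \<le> B" by (auto simp: B_def)
  define ct :: "real \<times> real \<times> 'm => real" where "ct = cutoff k"
  have ct: "ct \<in> nonneg_test_functions" "ct \<in> test_functions" using cutoff_test_function[OF k(3)] nonneg_test_functionsD by (auto simp: ct_def)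
  define F where "F = (\<lambda>z. 1 * f z + B * ct z)"
  have Ft: "F \<in> test_functions" unfolding F_def by (rule test_function_combine[OF f ct(2)])
  moreover have "0 \<le> F z" if z: "z \<in> E" for z
  proof (cases "z \<in> strip \<delta> R")
   case True
   then have "ct z = 1" unfolding ct_def by (rule cutoff_eq_1[OF k' k(2)])
   then show ?thesis using K[OF z] B by (auto simp: F_def abs_le_iff)
  next
   case False
   then show ?thesis using d(3)[OF z False] ct z B by (auto simp: F_def nonneg_test_functions_def)
  qed
  ultimately have F: "F \<in> nonneg_test_functions" by (simp add: nonneg_test_functions_def)
  obtain W1 where W1: "open W1" "coordinates gs \<xi>0 \<in> W1" "\<And>\<xi>. \<xi> \<in> ?N ==> coordinates gs \<xi> \<in> W1 ==> (\<integral>z. F z \<partial>\<xi>0) - \<epsilon> / 2 < (\<integral>z. F z \<partial>\<xi>)"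
   using lower[OF F \<xi>0, of "\<epsilon> / 2"] \<epsilon> by auto
  have "ct \<in> range gs" unfolding gsC C_def ct_def using k by auto
  then obtain i where i: "ct = gs i" by blast
  define W2 where "W2 = {y :: nat => real. exp (- ((\<integral>z. ct z \<partial>\<xi>0) + \<epsilon> / (2 * B))) < y i}"
  have "open (W1 \<inter> W2)" unfolding W2_def by (intro open_Int W1(1) proj)
  moreover have "coordinates gs \<xi>0 \<in> W1 \<inter> W2" using W1(2) \<epsilon> B by (simp add: W2_def coordinates_def i)
  moreover have "(\<integral>z. f z \<partial>\<xi>0) - \<epsilon> < (\<integral>z. f z \<partial>\<xi>)" if \<xi>: "\<xi> \<in> ?N" "coordinates gs \<xi> \<in> W1 \<inter> W2" for \<xi>
  proof -
   have 1: "(\<integral>z. ct z \<partial>\<xi>) < (\<integral>z. ct z \<partial>\<xi>0) + \<epsilon> / (2 * B)" using \<xi>(2) by (simp add: W2_def coordinates_def i)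
   have "(\<integral>z. F z \<partial>\<xi>') = (\<integral>z. f z \<partial>\<xi>') + B * (\<integral>z. ct z \<partial>\<xi>')" if "\<xi>' \<in> ?N" for \<xi>'
    unfolding F_def using test_function_integrable[OF that f] test_function_integrable[OF that ct(2)] by simp
   then have "(\<integral>z. f z \<partial>\<xi>0) + B * (\<integral>z. ct z \<partial>\<xi>0) - \<epsilon> / 2 < (\<integral>z. f z \<partial>\<xi>) + B * (\<integral>z. ct z \<partial>\<xi>)"
    using W1(3)[of \<xi>] \<xi> \<xi>0 by simp
   moreover have "B * (\<integral>z. ct z \<partial>\<xi>) \<le> B * (\<integral>z. ct z \<partial>\<xi>0) + \<epsilon> / 2"
   proof -
    have "B * (\<integral>z. ct z \<partial>\<xi>) \<le> B * ((\<integral>z. ct z \<partial>\<xi>0) + \<epsilon> / (2 * B))" using 1 B by (intro mult_left_mono) auto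
    also have "\<dots> = B * (\<integral>z. ct z \<partial>\<xi>0) + \<epsilon> / 2" using B by (simp add: distrib_left)
    finally show ?thesis .
   qed
   ultimately show ?thesis by linarith
  qed
  ultimately show ?thesis by blast
 qed
 have basic: "\<exists>W. open W \<and> {\<xi> \<in> ?N. (\<integral>z. f z \<partial>\<xi>) \<in> U} = {\<xi> \<in> ?N. coordinates gs \<xi> \<in> W}"
  if f: "f \<in> test_functions" and U: "open U" for f U
 proof -
  let ?S = "{\<xi> \<in> ?N. (\<integral>z. f z \<partial>\<xi>) \<in> U}"
  \<comment> \<open>An upper bound on the integral of \<open>f\<close> is a lower bound for
    \<open>- f\<close>, written as a combination covered by
    \<open>test_function_combine\<close>.\<close>
  have mf: "(\<lambda>z. (-1) * f z + 0 * f z) \<in> test_functions" using test_function_combine[OF f f] .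
  have loc: "\<exists>W. open W \<and> coordinates gs \<xi>0 \<in> W \<and> (\<forall>\<xi>\<in>?N. coordinates gs \<xi> \<in> W \<longrightarrow> (\<integral>z. f z \<partial>\<xi>) \<in> U)"
   if \<xi>0: "\<xi>0 \<in> ?S" for \<xi>0
  proof -
   have n0: "\<xi>0 \<in> ?N" using \<xi>0 by simp
   obtain \<epsilon> where \<epsilon>: "0 < \<epsilon>" "\<And>y. dist y (\<integral>z. f z \<partial>\<xi>0) < \<epsilon> ==> y \<in> U"
   proof -
    have "(\<integral>z. f z \<partial>\<xi>0) \<in> U" using \<xi>0 by simp
    then show ?thesis using U that unfolding open_dist by blast
   qed
   obtain W1 where W1: "open W1" "coordinates gs \<xi>0 \<in> W1" "\<And>\<xi>. \<xi> \<in> ?N ==> coordinates gs \<xi> \<in> W1 ==> (\<integral>z. f z \<partial>\<xi>0) - \<epsilon> < (\<integral>z. f z \<partial>\<xi>)"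
    using lower'[OF f n0 \<epsilon>(1)] by auto
   obtain W2 where W2: "open W2" "coordinates gs \<xi>0 \<in> W2" "\<And>\<xi>. \<xi> \<in> ?N ==> coordinates gs \<xi> \<in> W2 ==>
     (\<integral>z. (-1) * f z + 0 * f z \<partial>\<xi>0) - \<epsilon> < (\<integral>z. (-1) * f z + 0 * f z \<partial>\<xi>)"
    using lower'[OF mf n0 \<epsilon>(1)] by (elim exE conjE) (rule that, assumption, assumption, drule bspec, assumption, erule mp, assumption)
   have "(\<integral>z. f z \<partial>\<xi>) \<in> U" if \<xi>: "\<xi> \<in> ?N" "coordinates gs \<xi> \<in> W1 \<inter> W2" for \<xi>
    using W1(3)[OF \<xi>(1)] W2(3)[OF \<xi>(1)] \<xi>(2) by (intro \<epsilon>(2)) (auto simp: dist_real_def)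
   then show ?thesis using W1(1,2) W2(1,2) by (intro exI[of _ "W1 \<inter> W2"]) auto
  qed
  \<comment> \<open>The largest open set whose preimage lies in \<open>?S\<close>; by
    \<open>loc\<close> it contains the image of every point of \<open>?S\<close>.\<close>
  define WW where "WW = \<Union>{W. open W \<and> (\<forall>\<xi>\<in>?N. coordinates gs \<xi> \<in> W \<longrightarrow> (\<integral>z. f z \<partial>\<xi>) \<in> U)}"
  have "open WW" unfolding WW_def by (intro open_Union) auto
  moreover have "?S = {\<xi> \<in> ?N. coordinates gs \<xi> \<in> WW}"
  proof (intro set_eqI iffI)
   fix \<xi>0 assume x: "\<xi>0 \<in> ?S"
   from loc[OF x] obtain W where "open W \<and> coordinates gs \<xi>0 \<in> W \<and> (\<forall>\<xi>\<in>?N. coordinates gs \<xi> \<in> W \<longrightarrow> (\<integral>z. f z \<partial>\<xi>) \<in> U)"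
    by (rule exE)
   then have "coordinates gs \<xi>0 \<in> WW" unfolding WW_def by (intro UnionI[of W]) simp_all
   then show "\<xi>0 \<in> {\<xi> \<in> ?N. coordinates gs \<xi> \<in> WW}" using x by simp
  next
   fix \<xi> assume x: "\<xi> \<in> {\<xi> \<in> ?N. coordinates gs \<xi> \<in> WW}"
   then obtain W where "coordinates gs \<xi> \<in> W" "\<forall>\<xi>\<in>?N. coordinates gs \<xi> \<in> W \<longrightarrow> (\<integral>z. f z \<partial>\<xi>) \<in> U"
    unfolding WW_def by auto
   then show "\<xi> \<in> ?S" using x by simp
  qed
  ultimately show ?thesis by blast
 qed
 have "\<exists>W. open W \<and> U = {\<xi> \<in> ?N. coordinates gs \<xi> \<in> W}" if "openin point_topology U" for U
  using that unfolding point_topology_def openin_topology_generated_by_iff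
 proof (induction rule: generate_topology_on.induct)
  case Empty then show ?case by (intro exI[of _ "{}"]) auto
 next
  case (Int a b)
  then obtain W1 W2 where "open W1" "a = {\<xi> \<in> ?N. coordinates gs \<xi> \<in> W1}" "open W2" "b = {\<xi> \<in> ?N. coordinates gs \<xi> \<in> W2}" by blast
  then show ?case by (intro exI[of _ "W1 \<inter> W2"]) auto
 next
  case (UN K)
  have "\<forall>k\<in>K. \<exists>W. open W \<and> k = {\<xi> \<in> ?N. coordinates gs \<xi> \<in> W}" using UN by blast
  from bchoice[OF this] obtain w where "\<forall>k\<in>K. open (w k) \<and> k = {\<xi> \<in> ?N. coordinates gs \<xi> \<in> w k}" by (rule exE)
  then have w: "\<And>k. k \<in> K ==> open (w k) \<and> k = {\<xi> \<in> ?N. coordinates gs \<xi> \<in> w k}" by (rule bspec)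
  then have "open (\<Union>k\<in>K. w k)" by auto
  moreover have "\<Union>K = {\<xi> \<in> ?N. coordinates gs \<xi> \<in> (\<Union>k\<in>K. w k)}"
  proof (intro set_eqI iffI)
   fix \<xi> assume "\<xi> \<in> \<Union>K"
   then obtain k where k: "k \<in> K" "\<xi> \<in> k" by blast
   have "\<xi> \<in> {\<xi> \<in> ?N. coordinates gs \<xi> \<in> w k}" using k(2) w[OF k(1)] by simp
   then show "\<xi> \<in> {\<xi> \<in> ?N. coordinates gs \<xi> \<in> (\<Union>k\<in>K. w k)}" using k(1) by blast
  next
   fix \<xi> assume "\<xi> \<in> {\<xi> \<in> ?N. coordinates gs \<xi> \<in> (\<Union>k\<in>K. w k)}"
   then obtain k where k: "k \<in> K" "\<xi> \<in> {\<xi> \<in> ?N. coordinates gs \<xi> \<in> w k}" by blast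
   have "\<xi> \<in> k" using k(2) w[OF k(1)] by simp
   then show "\<xi> \<in> \<Union>K" using k(1) by blast
  qed
  ultimately show ?case by blast
 next
  case (Basis s)
  then show ?case using basic by blast
 qed
 then show ?thesis using gsn by blast
qed

lemma point_topology_initialE:
 obtains gs :: "nat => real \<times> real \<times> 'm::polish_space => real" where "range gs \<subseteq> nonneg_test_functions"
  "\<And>U. openin point_topology U ==> \<exists>W. open W \<and> U = {\<xi> \<in> locally_finite_point_measures. coordinates gs \<xi> \<in> W}"
 using point_topology_initial
 by (elim exE conjE) (rule that, assumption, drule spec, erule mp, assumption)

lemma coordinates_measurable:
 assumes "range gs \<subseteq> nonneg_test_functions"
 shows "coordinates gs \<in> measurable borel_points borel"
proof (rule measurable_coordinatewise_then_product)
 fix i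
 have "gs i \<in> test_functions" using assms nonneg_test_functionsD by auto
 from integral_test_function_measurable[OF this]
 show "(\<lambda>\<xi>. coordinates gs \<xi> i) \<in> borel_measurable borel_points"
  unfolding coordinates_def by measurable
qed

text \<open>The generating open sets are preimages of open sets under \<open>coordinates\<close>,
  and the Borel sets of a countable product are generated by the coordinates; so measurability of
  countably many integrals suffices.\<close>

lemma measurable_borel_pointsI:
 fixes X :: "'a => (real \<times> real \<times> 'm::polish_space) measure"
 assumes X: "\<And>\<omega>. \<omega> \<in> space M ==> X \<omega> \<in> locally_finite_point_measures"
  and m: "\<And>h. h \<in> nonneg_test_functions ==> (\<lambda>\<omega>. \<integral>z. h z \<partial>X \<omega>) \<in> borel_measurable M"
 shows "X \<in> measurable M borel_points"
 unfolding borel_points_def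
proof (rule measurable_measure_of)
 show "{U. openin point_topology U} \<subseteq> Pow (topspace point_topology)" using openin_points_subset by auto
 show "X \<in> space M \<rightarrow> topspace point_topology" using X by auto
 fix U :: "(real \<times> real \<times> 'm) measure set" assume "U \<in> {U. openin point_topology U}"
 then have U: "openin point_topology U" by simp
 obtain gs :: "nat => real \<times> real \<times> 'm => real" where gs: "range gs \<subseteq> nonneg_test_functions"
  "\<And>U. openin point_topology U ==> \<exists>W. open W \<and> U = {\<xi> \<in> locally_finite_point_measures. coordinates gs \<xi> \<in> W}"
  by (rule point_topology_initialE) (rule that; assumption)
 obtain W where W: "open W" "U = {\<xi> \<in> locally_finite_point_measures. coordinates gs \<xi> \<in> W}"
  using gs(2)[OF U] by auto
 have "(\<lambda>\<omega>. coordinates gs (X \<omega>)) \<in> measurable M borel"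
 proof (rule measurable_coordinatewise_then_product)
  fix i
  have "gs i \<in> nonneg_test_functions" using gs(1) by auto
  from m[OF this] show "(\<lambda>\<omega>. coordinates gs (X \<omega>) i) \<in> borel_measurable M"
   unfolding coordinates_def by measurable
 qed
 then have "(\<lambda>\<omega>. coordinates gs (X \<omega>)) -` W \<inter> space M \<in> sets M"
  using W(1) by (auto intro: measurable_sets)
 moreover have "X -` U \<inter> space M = (\<lambda>\<omega>. coordinates gs (X \<omega>)) -` W \<inter> space M"
  unfolding W(2) using X by auto
 ultimately show "X -` U \<inter> space M \<in> sets M" by simp
qed

text \<open>Polynomials in countably many variables; a list of indices encodes a monomial with
  multiplicities. A monomial in the values of \<open>coordinates\<close> is again a Laplace
  functional, that of the sum of the listed test functions.\<close>

inductive_set poly_functions :: "((nat => real) => real) set" where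
 monomial: "(\<lambda>y. c * (\<Prod>i\<leftarrow>xs. y i)) \<in> poly_functions"
| add: "f \<in> poly_functions ==> g \<in> poly_functions ==> (\<lambda>y. f y + g y) \<in> poly_functions"

lemma poly_functions_mult:
 assumes "f \<in> poly_functions" "g \<in> poly_functions"
 shows "(\<lambda>y. f y * g y) \<in> poly_functions"
 using assms
proof (induction arbitrary: g)
 case (monomial c xs)
 from monomial show ?case
 proof induction
  case (monomial d ys)
  have "(\<lambda>y. c * (\<Prod>i\<leftarrow>xs. y i) * (d * (\<Prod>i\<leftarrow>ys. y i))) = (\<lambda>y. (c * d) * (\<Prod>i\<leftarrow>xs @ ys. y i))"
   by (simp add: fun_eq_iff mult_ac)
  then show ?case by (simp only: poly_functions.monomial)
 next
  case (add f g)
  then show ?case using poly_functions.add by (simp add: distrib_left)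
 qed
next
 case (add f1 f2)
 then show ?case using poly_functions.add[of "\<lambda>y. f1 y * g y" "\<lambda>y. f2 y * g y"] by (simp add: distrib_right)
qed

lemma continuous_poly_functions: "f \<in> poly_functions ==> continuous_on S f"
proof (induction rule: poly_functions.induct)
 case (monomial c xs)
 have "continuous_on S (\<lambda>y. (\<Prod>i\<leftarrow>xs. y i) :: real)"
  by (induction xs) (auto intro!: continuous_intros continuous_on_subset[OF continuous_on_product_coordinates])
 then show ?case by (intro continuous_intros)
qed (intro continuous_intros)

lemma compact_cube: "compact {y :: nat => real. \<forall>i. y i \<in> {0..1}}"
proof -
 have "compactin (product_topology (\<lambda>i. euclidean) UNIV) (PiE UNIV (\<lambda>_ :: nat. {0..1 :: real}))"
  unfolding compactin_PiE by auto
 moreover have "PiE UNIV (\<lambda>_ :: nat. {0..1 :: real}) = {y. \<forall>i. y i \<in> {0..1}}" by auto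
 ultimately show ?thesis unfolding euclidean_product_topology by simp
qed

lemma cube_Stone_Weierstrass:
 assumes "continuous_on {y :: nat => real. \<forall>i. y i \<in> {0..1}} F" "0 < (e :: real)"
 shows "\<exists>H\<in>poly_functions. \<forall>y. (\<forall>i. y i \<in> {0..1}) \<longrightarrow> \<bar>F y - H y\<bar> < e"
proof -
 interpret function_ring_on poly_functions "{y :: nat => real. \<forall>i. y i \<in> {0..1}}"
 proof
  show "compact {y :: nat => real. \<forall>i. y i \<in> {0..1}}" by (rule compact_cube)
  show "\<And>f. f \<in> poly_functions ==> continuous_on {y. \<forall>i. y i \<in> {0..1}} f" by (rule continuous_poly_functions)
  show "\<And>f g. f \<in> poly_functions ==> g \<in> poly_functions ==> (\<lambda>x. f x + g x) \<in> poly_functions" by (rule poly_functions.add)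
  show "\<And>f g. f \<in> poly_functions ==> g \<in> poly_functions ==> (\<lambda>x. f x * g x) \<in> poly_functions" by (rule poly_functions_mult)
  show "(\<lambda>_. c) \<in> poly_functions" for c using poly_functions.monomial[of c "[]"] by simp
  fix x y :: "nat => real" assume "x \<noteq> y"
  then obtain i where i: "x i \<noteq> y i" by auto
  then show "\<exists>f\<in>poly_functions. f x \<noteq> f y"
   using poly_functions.monomial[of 1 "[i]"] by (intro bexI[of _ "\<lambda>y. y i"]) auto
 qed
 show ?thesis using Stone_Weierstrass_basic[OF assms] by auto
qed

text \<open>On the image of \<open>coordinates\<close>, a bounded continuous function is the increasing limit of the
 Lipschitz functions \<open>y \<mapsto> inf\<^sub>\<xi> (\<Phi>(\<xi>) + k d(y, coordinates(\<xi>)))\<close>, which are defined on the whole cube.\<close>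

lemma weakly_convergesI:
 fixes P :: "nat => (real \<times> real \<times> 'm::polish_space) measure measure"
 assumes P: "\<forall>\<^sub>F n in sequentially. prob_space (P n)" "\<And>n. sets (P n) = sets borel_points"
  and Q: "prob_space Q" "sets Q = sets borel_points"
  and lap: "\<And>h. h \<in> nonneg_test_functions ==>
   (\<lambda>n. \<integral>\<xi>. exp (- (\<integral>z. h z \<partial>\<xi>)) \<partial>P n) \<longlonglongrightarrow> (\<integral>\<xi>. exp (- (\<integral>z. h z \<partial>\<xi>)) \<partial>Q)"
 shows "weakly_converges point_topology P Q"
proof -
 let ?N = "locally_finite_point_measures :: (real \<times> real \<times> 'm) measure set"
 obtain gs :: "nat => real \<times> real \<times> 'm => real" where gs: "range gs \<subseteq> nonneg_test_functions"
  "\<And>U. openin point_topology U ==> \<exists>W. open W \<and> U = {\<xi> \<in> ?N. coordinates gs \<xi> \<in> W}"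
  by (rule point_topology_initialE) (rule that; assumption)
 define Y where "Y = coordinates gs"
 have Ym: "Y \<in> measurable M borel" if "sets M = sets borel_points" for M
  using coordinates_measurable[OF gs(1)] measurable_cong_sets[OF that refl] unfolding Y_def by blast
 have Y01: "\<forall>i. Y \<xi> i \<in> {0..1}" if "\<xi> \<in> ?N" for \<xi>
  using coordinates_in_01[OF gs(1) that] by (simp add: Y_def)
 have sp: "space M = ?N" if "sets M = sets borel_points" for M
  using sets_eq_imp_space_eq[OF that] by simp
 have intF: "integrable M (\<lambda>\<xi>. F (Y \<xi>))" if M: "finite_measure M" "sets M = sets borel_points" and F: "continuous_on UNIV F" for M and F :: "(nat => real) => real"
 proof -
  have "bounded (F ` {y :: nat => real. \<forall>i. y i \<in> {0..1}})"
   using F by (intro compact_imp_bounded compact_continuous_image compact_cube) (auto intro: continuous_on_subset)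
  then obtain K where K: "\<And>y. (\<forall>i. y i \<in> {0..1}) ==> \<bar>F y\<bar> \<le> K"
   unfolding bounded_iff by auto
  show ?thesis
  proof (rule finite_measure.integrable_const_bound[OF M(1)])
   show "AE \<xi> in M. norm (F (Y \<xi>)) \<le> K" using K Y01 sp[OF M(2)] by (intro AE_I2) auto
   show "(\<lambda>\<xi>. F (Y \<xi>)) \<in> borel_measurable M"
    using Ym[OF M(2)] borel_measurable_continuous_onI[OF F] by (rule measurable_compose)
  qed
 qed
 have poly: "(\<lambda>n. \<integral>\<xi>. F (Y \<xi>) \<partial>P n) \<longlonglongrightarrow> (\<integral>\<xi>. F (Y \<xi>) \<partial>Q)" if "F \<in> poly_functions" for F
  using that
 proof induction
  case (monomial c xs)
  \<comment> \<open>The sum over the list is a test function, so the hypothesis \<open>lap\<close>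
    covers every monomial; the empty list gives the constants.\<close>
  define h where "h z = (\<Sum>g\<leftarrow>map gs xs. g z)" for z
  have gl: "set (map gs xs) \<subseteq> nonneg_test_functions" using gs(1) by auto
  have h: "h \<in> nonneg_test_functions" unfolding h_def using nonneg_test_function_sum_list[OF gl] .
  have eq: "(\<Prod>i\<leftarrow>xs. Y \<xi> i) = exp (- (\<integral>z. h z \<partial>\<xi>))" if \<xi>: "\<xi> \<in> ?N" for \<xi>
  proof -
   have "integrable \<xi> (\<lambda>z. \<Sum>g\<leftarrow>map gs ys. g z) \<and> (\<Prod>i\<leftarrow>ys. Y \<xi> i) = exp (- (\<integral>z. (\<Sum>g\<leftarrow>map gs ys. g z) \<partial>\<xi>))" for ys
   proof (induction ys)
    case (Cons i ys)
    have "integrable \<xi> (gs i)" using gs(1) test_function_integrable[OF \<xi>] nonneg_test_functionsD by auto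
    then show ?case using Cons by (simp add: Y_def coordinates_def exp_add[symmetric])
   qed simp
   then show ?thesis unfolding h_def by blast
  qed
  have E: "(\<integral>\<xi>. c * (\<Prod>i\<leftarrow>xs. Y \<xi> i) \<partial>M) = c * (\<integral>\<xi>. exp (- (\<integral>z. h z \<partial>\<xi>)) \<partial>M)" if "sets M = sets borel_points" for M
   using eq sp[OF that] by (subst integral_mult_right_zero[symmetric], intro Bochner_Integration.integral_cong) auto
  show ?case unfolding E[OF P(2)] E[OF Q(2)] by (intro tendsto_intros lap[OF h])
 next
  case (add f g)
  have c: "continuous_on UNIV f" "continuous_on UNIV g" using add continuous_poly_functions by auto
  have e: "(\<integral>\<xi>. f (Y \<xi>) + g (Y \<xi>) \<partial>M) = (\<integral>\<xi>. f (Y \<xi>) \<partial>M) + (\<integral>\<xi>. g (Y \<xi>) \<partial>M)" if "finite_measure M" "sets M = sets borel_points" for M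
   using intF[OF that c(1)] intF[OF that c(2)] by (rule Bochner_Integration.integral_add)
  have "\<forall>\<^sub>F n in sequentially. (\<integral>\<xi>. f (Y \<xi>) \<partial>P n) + (\<integral>\<xi>. g (Y \<xi>) \<partial>P n) = (\<integral>\<xi>. f (Y \<xi>) + g (Y \<xi>) \<partial>P n)"
   using P(1) by eventually_elim (use e P(2) in \<open>auto simp: prob_space_def\<close>)
  moreover have "(\<lambda>n. (\<integral>\<xi>. f (Y \<xi>) \<partial>P n) + (\<integral>\<xi>. g (Y \<xi>) \<partial>P n)) \<longlonglongrightarrow> (\<integral>\<xi>. f (Y \<xi>) + g (Y \<xi>) \<partial>Q)"
   using add Q by (subst e) (auto simp: prob_space_def intro!: tendsto_add)
  ultimately show ?case by (rule Lim_transform_eventually[rotated])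
 qed
 have cont: "(\<lambda>n. \<integral>\<xi>. F (Y \<xi>) \<partial>P n) \<longlonglongrightarrow> (\<integral>\<xi>. F (Y \<xi>) \<partial>Q)" if F: "continuous_on UNIV F" for F :: "(nat => real) => real"
 proof (rule tendstoI)
  fix r :: real assume r: "0 < r"
  have "\<exists>H\<in>poly_functions. \<forall>y. (\<forall>i. y i \<in> {0..1}) \<longrightarrow> \<bar>F y - H y\<bar> < r / 3"
   using r by (intro cube_Stone_Weierstrass continuous_on_subset[OF F]) auto
  then obtain H where H: "H \<in> poly_functions" "\<And>y. (\<forall>i. y i \<in> {0..1}) ==> \<bar>F y - H y\<bar> < r / 3" by blast
  have Hc: "continuous_on UNIV H" using continuous_poly_functions[OF H(1)] .
  have bd: "\<bar>(\<integral>\<xi>. F (Y \<xi>) \<partial>M) - (\<integral>\<xi>. H (Y \<xi>) \<partial>M)\<bar> \<le> r / 3" if M: "prob_space M" "sets M = sets borel_points" for M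
  proof -
   interpret prob_space M by (rule M(1))
   have i: "integrable M (\<lambda>\<xi>. F (Y \<xi>))" "integrable M (\<lambda>\<xi>. H (Y \<xi>))"
    using intF[OF _ M(2)] F Hc finite_measure_axioms by auto
   have "(\<integral>\<xi>. F (Y \<xi>) \<partial>M) - (\<integral>\<xi>. H (Y \<xi>) \<partial>M) = (\<integral>\<xi>. F (Y \<xi>) - H (Y \<xi>) \<partial>M)" using i by simp
   also have "\<bar>\<dots>\<bar> \<le> (\<integral>\<xi>. \<bar>F (Y \<xi>) - H (Y \<xi>)\<bar> \<partial>M)" by (rule integral_abs_bound)
   also have "\<dots> \<le> (\<integral>\<xi>. r / 3 \<partial>M)"
    using i H(2) Y01 sp[OF M(2)] by (intro integral_mono_AE AE_I2) (auto intro: less_imp_le)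
   finally show ?thesis by (simp add: prob_space)
  qed
  have "\<forall>\<^sub>F n in sequentially. dist (\<integral>\<xi>. H (Y \<xi>) \<partial>P n) (\<integral>\<xi>. H (Y \<xi>) \<partial>Q) < r / 3"
   using tendstoD[OF poly[OF H(1)], of "r / 3"] r by simp
  with P(1) show "\<forall>\<^sub>F n in sequentially. dist (\<integral>\<xi>. F (Y \<xi>) \<partial>P n) (\<integral>\<xi>. F (Y \<xi>) \<partial>Q) < r"
  proof eventually_elim
   case (elim n)
   show ?case using bd[OF elim(1) P(2)] bd[OF Q] elim(2) unfolding dist_real_def by linarith
  qed
 qed
 \<comment> \<open>This half of the convergence also applies to \<open>- \<Phi>\<close>. The
   Lipschitz minorants \<open>F k\<close> stay below \<open>\<Phi>\<close>, converge to it
   pointwise, and are continuous functions on the whole cube of coordinates, to which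
   \<open>cont\<close> applies; this takes the place of tightness.\<close>
 have lower: "\<forall>\<^sub>F n in sequentially. (\<integral>\<xi>. \<Phi> \<xi> \<partial>Q) - r < (\<integral>\<xi>. \<Phi> \<xi> \<partial>P n)"
  if \<Phi>: "continuous_map point_topology euclideanreal \<Phi>" "\<And>\<xi>. \<xi> \<in> ?N ==> \<bar>\<Phi> \<xi>\<bar> \<le> B" and r: "0 < r" for \<Phi> B r
 proof -
  have \<Phi>m: "\<Phi> \<in> borel_measurable M" if "sets M = sets borel_points" for M
  proof (rule borel_measurableI)
   fix U :: "real set" assume "open U"
   then have "openin point_topology {\<xi> \<in> ?N. \<Phi> \<xi> \<in> U}"
    using openin_continuous_map_preimage[OF \<Phi>(1)] by simp
   then have "{\<xi> \<in> ?N. \<Phi> \<xi> \<in> U} \<in> sets M" using open_in_borel_points that by auto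
   moreover have "\<Phi> -` U \<inter> space M = {\<xi> \<in> ?N. \<Phi> \<xi> \<in> U}" using sp[OF that] by auto
   ultimately show "\<Phi> -` U \<inter> space M \<in> sets M" by simp
  qed
  have ne: "?N \<noteq> {}" using prob_space.not_empty[OF Q(1)] sp[OF Q(2)] by simp
  define F where "F k y = (INF \<xi>\<in>?N. \<Phi> \<xi> + real k * dist y (Y \<xi>))" for k :: nat and y :: "nat => real"
  have bb: "bdd_below ((\<lambda>\<xi>. \<Phi> \<xi> + real k * dist y (Y \<xi>)) ` ?N)" for k y
  proof (rule bdd_belowI2)
   fix \<xi> :: "(real \<times> real \<times> 'm) measure" assume "\<xi> \<in> ?N"
   then have "- B \<le> \<Phi> \<xi>" using \<Phi>(2)[of \<xi>] by (simp add: abs_le_iff)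
   moreover have "0 \<le> real k * dist y (Y \<xi>)" by simp
   ultimately show "- B \<le> \<Phi> \<xi> + real k * dist y (Y \<xi>)" by linarith
  qed
  have Flip: "F k y - F k y' \<le> real k * dist y y'" for k y y'
  proof -
   have "F k y - real k * dist y y' \<le> F k y'"
    unfolding F_def[of k y']
   proof (rule cINF_greatest[OF ne])
    fix \<xi> assume "\<xi> \<in> ?N"
    then have "F k y \<le> \<Phi> \<xi> + real k * dist y (Y \<xi>)" unfolding F_def by (rule cINF_lower[OF bb])
    moreover have "real k * dist y (Y \<xi>) \<le> real k * (dist y y' + dist y' (Y \<xi>))"
     by (intro mult_left_mono dist_triangle) auto
    ultimately show "F k y - real k * dist y y' \<le> \<Phi> \<xi> + real k * dist y' (Y \<xi>)" by (simp add: distrib_left)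
   qed
   then show ?thesis by simp
  qed
  have Fc: "continuous_on UNIV (F k)" for k
  proof (rule lipschitz_on_continuous_on[of "real k"], rule lipschitz_onI)
   fix y y'
   show "dist (F k y) (F k y') \<le> real k * dist y y'"
    using Flip[of k y y'] Flip[of k y' y] by (simp add: dist_real_def abs_le_iff dist_commute)
  qed simp
  have Fle: "F k (Y \<xi>) \<le> \<Phi> \<xi>" if "\<xi> \<in> ?N" for k \<xi>
   unfolding F_def using cINF_lower[OF bb that, of k "Y \<xi>"] by simp
  have Fge: "- B \<le> F k y" for k y
   unfolding F_def
  proof (rule cINF_greatest[OF ne])
   fix \<xi> :: "(real \<times> real \<times> 'm) measure" assume "\<xi> \<in> ?N"
   then have "- B \<le> \<Phi> \<xi>" using \<Phi>(2)[of \<xi>] by (simp add: abs_le_iff)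
   moreover have "0 \<le> real k * dist y (Y \<xi>)" by simp
   ultimately show "- B \<le> \<Phi> \<xi> + real k * dist y (Y \<xi>)" by linarith
  qed
  have Flim: "(\<lambda>k. F k (Y \<xi>)) \<longlonglongrightarrow> \<Phi> \<xi>" if \<xi>: "\<xi> \<in> ?N" for \<xi>
  proof (rule LIMSEQ_I)
   fix e :: real assume e: "0 < e"
   have "openin point_topology {\<xi>' \<in> ?N. \<Phi> \<xi>' \<in> {\<Phi> \<xi> - e / 2<..}}"
    using openin_continuous_map_preimage[OF \<Phi>(1), of "{\<Phi> \<xi> - e / 2<..}"] by simp
   from gs(2)[OF this] obtain W where W: "open W" "{\<xi>' \<in> ?N. \<Phi> \<xi>' \<in> {\<Phi> \<xi> - e / 2<..}} = {\<xi>' \<in> ?N. Y \<xi>' \<in> W}"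
    unfolding Y_def by auto
   have "\<xi> \<in> {\<xi>' \<in> ?N. \<Phi> \<xi>' \<in> {\<Phi> \<xi> - e / 2<..}}" using \<xi> e by simp
   then have "Y \<xi> \<in> W" unfolding W(2) by simp
   then obtain \<rho> where \<rho>: "0 < \<rho>" "\<And>y. dist y (Y \<xi>) < \<rho> ==> y \<in> W" using W(1) unfolding open_dist by blast
   \<comment> \<open>Outside the ball of radius \<open>\<rho>\<close> around \<open>Y \<xi>\<close>
     the penalty is at least \<open>2 * B\<close>, which outweighs the oscillation of
     \<open>\<Phi>\<close>; inside, \<open>\<Phi>\<close> exceeds
     \<open>\<Phi> \<xi> - e / 2\<close>.\<close>
   obtain k0 :: nat where k0: "2 * B / \<rho> \<le> real k0" using real_arch_simple by blast
   have "norm (F k (Y \<xi>) - \<Phi> \<xi>) < e" if "k0 \<le> k" for k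
   proof -
    have "\<Phi> \<xi> - e / 2 \<le> F k (Y \<xi>)"
     unfolding F_def
    proof (rule cINF_greatest[OF ne])
     fix \<xi>' assume \<xi>': "\<xi>' \<in> ?N"
     show "\<Phi> \<xi> - e / 2 \<le> \<Phi> \<xi>' + real k * dist (Y \<xi>) (Y \<xi>')"
     proof (cases "dist (Y \<xi>') (Y \<xi>) < \<rho>")
      case True
      then have "\<xi>' \<in> {\<xi>' \<in> ?N. \<Phi> \<xi>' \<in> {\<Phi> \<xi> - e / 2<..}}" using \<rho>(2) \<xi>' unfolding W(2) by simp
      then have "\<Phi> \<xi> - e / 2 < \<Phi> \<xi>'" by simp
      moreover have "0 \<le> real k * dist (Y \<xi>) (Y \<xi>')" by simp
      ultimately show ?thesis by linarith
     next
      case False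
      have "2 * B \<le> real k0 * \<rho>" using k0 \<rho>(1) by (simp add: pos_divide_le_eq)
      also have "\<dots> \<le> real k * dist (Y \<xi>) (Y \<xi>')"
       using that False \<rho>(1) by (intro mult_mono) (auto simp: dist_commute)
      finally show ?thesis using \<Phi>(2)[OF \<xi>] \<Phi>(2)[OF \<xi>'] e unfolding abs_le_iff by linarith
     qed
    qed
    then show ?thesis using Fle[OF \<xi>, of k] e unfolding real_norm_def by linarith
   qed
   then show "\<exists>k0. \<forall>k\<ge>k0. norm (F k (Y \<xi>) - \<Phi> \<xi>) < e" by blast
  qed
  have intPhi: "integrable M \<Phi>" if M: "prob_space M" "sets M = sets borel_points" for M
   using \<Phi>(2) sp[OF M(2)] M(1)
   by (intro finite_measure.integrable_const_bound[where B = B] \<Phi>m[OF M(2)] AE_I2) (auto simp: prob_space_def)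
  have "(\<lambda>k. \<integral>\<xi>. F k (Y \<xi>) \<partial>Q) \<longlonglongrightarrow> (\<integral>\<xi>. \<Phi> \<xi> \<partial>Q)"
  proof (rule integral_dominated_convergence[where w = "\<lambda>_. B"])
   interpret prob_space Q by (rule Q(1))
   show "integrable Q (\<lambda>_. B)" by simp
   show "\<Phi> \<in> borel_measurable Q" by (rule \<Phi>m[OF Q(2)])
   show "(\<lambda>\<xi>. F k (Y \<xi>)) \<in> borel_measurable Q" for k
    using Ym[OF Q(2)] borel_measurable_continuous_onI[OF Fc] by (rule measurable_compose)
   show "AE \<xi> in Q. (\<lambda>k. F k (Y \<xi>)) \<longlonglongrightarrow> \<Phi> \<xi>" using Flim sp[OF Q(2)] by (intro AE_I2) auto
   show "AE \<xi> in Q. norm (F k (Y \<xi>)) \<le> B" for k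
   proof (intro AE_I2)
    fix \<xi> assume "\<xi> \<in> space Q"
    then have n: "\<xi> \<in> ?N" using sp[OF Q(2)] by simp
    show "norm (F k (Y \<xi>)) \<le> B" using Fge[of k "Y \<xi>"] Fle[OF n, of k] \<Phi>(2)[OF n] unfolding real_norm_def by linarith
   qed
  qed
  then have "\<forall>\<^sub>F k in sequentially. (\<integral>\<xi>. \<Phi> \<xi> \<partial>Q) - r / 2 < (\<integral>\<xi>. F k (Y \<xi>) \<partial>Q)"
   using r by (intro order_tendstoD) auto
  then obtain k where k: "(\<integral>\<xi>. \<Phi> \<xi> \<partial>Q) - r / 2 < (\<integral>\<xi>. F k (Y \<xi>) \<partial>Q)"
   using eventually_happens'[OF sequentially_bot] by blast
  have "\<forall>\<^sub>F n in sequentially. (\<integral>\<xi>. F k (Y \<xi>) \<partial>Q) - r / 2 < (\<integral>\<xi>. F k (Y \<xi>) \<partial>P n)"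
   using r by (intro order_tendstoD(1)[OF cont[OF Fc]]) auto
  with P(1) show ?thesis
  proof eventually_elim
   case (elim n)
   have "(\<integral>\<xi>. F k (Y \<xi>) \<partial>P n) \<le> (\<integral>\<xi>. \<Phi> \<xi> \<partial>P n)"
    using intF[OF _ P(2) Fc] elim(1) intPhi[OF elim(1) P(2)] Fle sp[OF P(2)]
    by (intro integral_mono_AE AE_I2) (auto simp: prob_space_def)
   then show ?case using elim(2) k by linarith
  qed
 qed
 show ?thesis
  unfolding weakly_converges_def
 proof (intro allI impI)
  fix \<Phi> :: "(real \<times> real \<times> 'm) measure => real"
  assume *: "continuous_map point_topology euclideanreal \<Phi> \<and> bounded (\<Phi> ` topspace point_topology)"
  then obtain B where B: "\<And>\<xi>. \<xi> \<in> ?N ==> \<bar>\<Phi> \<xi>\<bar> \<le> B" unfolding bounded_iff by auto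
  have c1: "continuous_map point_topology euclideanreal \<Phi>" using * by blast
  then have c2: "continuous_map point_topology euclideanreal (\<lambda>\<xi>. - \<Phi> \<xi>)" by (rule continuous_map_minus)
  show "(\<lambda>n. \<integral>\<xi>. \<Phi> \<xi> \<partial>P n) \<longlonglongrightarrow> (\<integral>\<xi>. \<Phi> \<xi> \<partial>Q)"
  proof (rule tendstoI)
   fix r :: real assume r: "0 < r"
   have "\<forall>\<^sub>F n in sequentially. (\<integral>\<xi>. \<Phi> \<xi> \<partial>Q) - r < (\<integral>\<xi>. \<Phi> \<xi> \<partial>P n)"
    by (rule lower[OF c1 B r])
   moreover have "\<forall>\<^sub>F n in sequentially. (\<integral>\<xi>. - \<Phi> \<xi> \<partial>Q) - r < (\<integral>\<xi>. - \<Phi> \<xi> \<partial>P n)"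
    using B by (intro lower[OF c2 _ r, of B]) auto
   ultimately show "\<forall>\<^sub>F n in sequentially. dist (\<integral>\<xi>. \<Phi> \<xi> \<partial>P n) (\<integral>\<xi>. \<Phi> \<xi> \<partial>Q) < r"
    by eventually_elim (auto simp: dist_real_def abs_less_iff)
  qed
 qed
qed

section \<open>The intensity measure\<close>

locale weak_kernel =
 fixes \<eta> :: "real => 'm::polish_space measure"
 assumes finite_kernel: "\<And>x. 0 < x ==> finite_borel (\<eta> x)"
  and weakly_continuous: "\<And>f :: 'm => real. continuous_on UNIV f ==> bounded (range f) ==>
   continuous_on {0<..} (\<lambda>x. \<integral>m. f m \<partial>\<eta> x)"
begin

lemma kernel_props:
 assumes "0 < x"
 shows "sets (\<eta> x) = sets borel" "space (\<eta> x) = UNIV" "finite_measure (\<eta> x)"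
 using finite_kernel[OF assms] sets_eq_imp_space_eq[of "\<eta> x" borel] by (auto simp: finite_borel_def)

lemma kernel_integrable:
 fixes f :: "'m => real"
 assumes "0 < x" "f \<in> borel_measurable borel" "\<And>m. \<bar>f m\<bar> \<le> B"
 shows "integrable (\<eta> x) f"
 using kernel_props[OF assms(1)] assms(2,3) measurable_cong_sets[OF kernel_props(1)[OF assms(1)] refl]
 by (intro finite_measure.integrable_const_bound[where B = B]) auto

lemma mass_continuous: "continuous_on {0<..} (\<lambda>x. mass (\<eta> x))"
 using weakly_continuous[of "\<lambda>_. 1"] by (auto simp: bounded_iff)

text \<open>The indicator of a closed set is the limit of bounded continuous functions of the
  distance to it, whose integrals are continuous in \<open>x\<close>.\<close>

lemma measure_closed_measurable:
 assumes C: "closed C"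
 shows "(\<lambda>x. indicator {0<..} x * measure (\<eta> x) C) \<in> borel_measurable borel"
\<comment> \<open>The empty set is treated apart: \<open>infdist\<close> to it is 0, so the
  approximants would be constantly 1.\<close>
proof (cases "C = {}")
 case False
 define f where "f k m = max 0 (1 - real k * infdist m C)" for k :: nat and m
 have fc: "continuous_on UNIV (f k)" for k unfolding f_def by (intro continuous_intros)
 have fb: "\<bar>f k m\<bar> \<le> 1" for k m unfolding f_def by (auto simp: infdist_nonneg)
 have fl: "(\<lambda>k. f k m) \<longlonglongrightarrow> indicator C m" for m
 proof (cases "m \<in> C")
  case True then show ?thesis by (simp add: f_def)
 next
  case m: False
  then have d: "0 < infdist m C" using C False by (simp add: infdist_pos_not_in_closed)
  obtain k0 :: nat where k0: "1 / infdist m C \<le> real k0" using real_arch_simple by blast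
  have "f k m = 0" if "k0 \<le> k" for k
  proof -
   have "1 \<le> real k0 * infdist m C" using k0 d by (simp add: pos_divide_le_eq)
   also have "\<dots> \<le> real k * infdist m C" using that d by (intro mult_right_mono) auto
   finally show ?thesis by (simp add: f_def)
  qed
  then have "\<forall>\<^sub>F k in sequentially. f k m = 0" by (auto simp: eventually_sequentially)
  then have "(\<lambda>k. f k m) \<longlonglongrightarrow> 0" by (rule tendsto_eventually)
  then show ?thesis using m by simp
 qed
 show ?thesis
 proof (rule borel_measurable_LIMSEQ_real)
  show "(\<lambda>x. indicator {0<..} x * (\<integral>m. f k m \<partial>\<eta> x)) \<in> borel_measurable borel" for k
  proof -
   have "continuous_on {0<..} (\<lambda>x. \<integral>m. f k m \<partial>\<eta> x)"
    using fb by (intro weakly_continuous fc) (auto simp: bounded_iff)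
   then have "(\<lambda>x. indicator {0<..} x *\<^sub>R (\<integral>m. f k m \<partial>\<eta> x)) \<in> borel_measurable borel"
    by (rule borel_measurable_continuous_on_indicator[rotated]) auto
   then show ?thesis by simp
  qed
  fix x :: real
  show "(\<lambda>k. indicator {0<..} x * (\<integral>m. f k m \<partial>\<eta> x)) \<longlonglongrightarrow> indicator {0<..} x * measure (\<eta> x) C"
  proof (cases "0 < x")
   case True
   note K = kernel_props[OF True]
   interpret finite_measure "\<eta> x" by (rule K(3))
   have Cm: "C \<in> sets (\<eta> x)" using C K(1) by auto
   have "(\<lambda>k. \<integral>m. f k m \<partial>\<eta> x) \<longlonglongrightarrow> (\<integral>m. indicator C m \<partial>\<eta> x)"
   proof (rule integral_dominated_convergence[where w = "\<lambda>_. 1"])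
    show "f k \<in> borel_measurable (\<eta> x)" for k
     using borel_measurable_continuous_onI[OF fc] measurable_cong_sets[OF K(1) refl] by auto
   qed (use fl fb Cm in auto)
   then show ?thesis using True K(2) by simp
  qed simp
 qed
qed simp

text \<open>Division by \<open>1 + mass\<close> makes every \<open>\<eta> x\<close> a subprobability
  measure, the zero measure included, so that the measurability theory of subprobability kernels
  applies. The factor is restored in \<open>nn_integral_kernel\<close>.\<close>

definition prob_kernel :: "real => 'm measure" where
 "prob_kernel x = (if 0 < x then scale_measure (ennreal (1 / (1 + mass (\<eta> x)))) (\<eta> x) else null_measure borel)"

lemma mass_nonneg: "0 \<le> mass (\<eta> x)" by simp

text \<open>Closed sets form an intersection-stable generator of the Borel sets, so
  \<open>measure_closed_measurable\<close> suffices.\<close>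

lemma prob_kernel_measurable: "prob_kernel \<in> measurable borel (subprob_algebra borel)"
proof (rule measurable_subprob_algebra_generated[where \<Omega> = UNIV and G = "{C. closed C}"])
 show "sets borel = sigma_sets UNIV {C :: 'm set. closed C}"
  by (simp add: borel_eq_closed)
 show "Int_stable {C :: 'm set. closed C}" by (auto simp: Int_stable_def)
 show "{C :: 'm set. closed C} \<subseteq> Pow UNIV" by auto
 show sets: "sets (prob_kernel x) = sets borel" for x
  using kernel_props(1)[of x] by (simp add: prob_kernel_def)
 show "subprob_space (prob_kernel x)" for x
 proof (rule subprob_spaceI)
  show "space (prob_kernel x) \<noteq> {}" using sets_eq_imp_space_eq[OF sets] by simp
  show "emeasure (prob_kernel x) (space (prob_kernel x)) \<le> 1"
  proof (cases "0 < x")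
   case True
   interpret finite_measure "\<eta> x" by (rule kernel_props(3)[OF True])
   have "emeasure (prob_kernel x) (space (prob_kernel x)) = ennreal (1 / (1 + mass (\<eta> x))) * ennreal (mass (\<eta> x))"
    using True by (simp add: prob_kernel_def space_scale_measure emeasure_eq_measure)
   also have "\<dots> = ennreal (mass (\<eta> x) / (1 + mass (\<eta> x)))" by (simp add: ennreal_mult[symmetric])
   also have "\<dots> \<le> 1"
   proof -
    have "0 < 1 + mass (\<eta> x)" using mass_nonneg[of x] by linarith
    then show ?thesis by (simp add: ennreal_le_1 divide_le_eq_1_pos)
   qed
   finally show ?thesis .
  qed (simp add: prob_kernel_def)
 qed
 have em: "(\<lambda>x. emeasure (prob_kernel x) C) \<in> borel_measurable borel" if "closed C" for C
 proof -
  have "(\<lambda>x. indicator {0<..} x * measure (\<eta> x) UNIV) \<in> borel_measurable borel"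
   by (rule measure_closed_measurable) simp
  then have "(\<lambda>x. ennreal (1 / (1 + indicator {0<..} x * measure (\<eta> x) UNIV)) * ennreal (indicator {0<..} x * measure (\<eta> x) C)) \<in> borel_measurable borel"
   using measure_closed_measurable[OF that] by measurable
  also have "(\<lambda>x. ennreal (1 / (1 + indicator {0<..} x * measure (\<eta> x) UNIV)) * ennreal (indicator {0<..} x * measure (\<eta> x) C)) = (\<lambda>x. emeasure (prob_kernel x) C)"
  proof
   fix x :: real
   show "ennreal (1 / (1 + indicator {0<..} x * measure (\<eta> x) UNIV)) * ennreal (indicator {0<..} x * measure (\<eta> x) C) = emeasure (prob_kernel x) C"
    using kernel_props[of x] by (cases "0 < x") (auto simp: prob_kernel_def finite_measure.emeasure_eq_measure)
  qed
  finally show ?thesis .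
 qed
 show "(\<lambda>a. emeasure (prob_kernel a) A) \<in> borel_measurable borel" if "A \<in> {C. closed C}" for A using em that by simp
 show "(\<lambda>a. emeasure (prob_kernel a) UNIV) \<in> borel_measurable borel" using em by simp
qed

lemma nn_integral_kernel:
 assumes "F \<in> borel_measurable borel" "0 < x"
 shows "(\<integral>\<^sup>+m. F m \<partial>\<eta> x) = ennreal (1 + mass (\<eta> x)) * (\<integral>\<^sup>+m. F m \<partial>prob_kernel x)"
proof -
 have F: "F \<in> borel_measurable (\<eta> x)" using assms measurable_cong_sets[OF kernel_props(1)[OF assms(2)] refl] by auto
 have "ennreal (1 + mass (\<eta> x)) * (\<integral>\<^sup>+m. F m \<partial>prob_kernel x) =
   (ennreal (1 + mass (\<eta> x)) * ennreal (1 / (1 + mass (\<eta> x)))) * (\<integral>\<^sup>+m. F m \<partial>\<eta> x)"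
  using assms(2) F by (simp add: prob_kernel_def nn_integral_scale_measure mult.assoc)
 also have "ennreal (1 + mass (\<eta> x)) * ennreal (1 / (1 + mass (\<eta> x))) = 1"
 proof -
  have p: "0 < 1 + mass (\<eta> x)" using mass_nonneg[of x] by linarith
  have "ennreal (1 + mass (\<eta> x)) * ennreal (1 / (1 + mass (\<eta> x))) = ennreal ((1 + mass (\<eta> x)) * (1 / (1 + mass (\<eta> x))))"
   using p by (intro ennreal_mult[symmetric]) auto
  also have "(1 + mass (\<eta> x)) * (1 / (1 + mass (\<eta> x))) = 1" using p by simp
  finally show ?thesis by simp
 qed
 finally show ?thesis by simp
qed

text \<open>Joint measurability of parameter-dependent integrals is known for the kernel
  \<open>prob_kernel\<close>; multiplication by the measurable factor \<open>1 + mass\<close>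
  transfers it to \<open>\<eta>\<close>.\<close>

lemma nn_integral_kernel_measurable:
 fixes F :: "real \<times> real \<times> 'm => ennreal"
 assumes F[measurable]: "F \<in> borel_measurable borel"
 shows "(\<lambda>(u, x). indicator {0<..} x * (\<integral>\<^sup>+m. F (u, x, m) \<partial>\<eta> x)) \<in> borel_measurable (borel \<Otimes>\<^sub>M borel)"
proof -
 have m1: "(\<lambda>x. ennreal (1 + indicator {0<..} x * measure (\<eta> x) UNIV)) \<in> borel_measurable borel"
  using measure_closed_measurable[OF closed_UNIV] by measurable
 have FF: "(\<lambda>((u, x), m). F (u, x, m)) \<in> borel_measurable ((borel \<Otimes>\<^sub>M borel) \<Otimes>\<^sub>M borel)"
 proof -
  have "(\<lambda>z. (fst (fst z), snd (fst z), snd z)) \<in> measurable ((borel \<Otimes>\<^sub>M borel) \<Otimes>\<^sub>M borel) (borel \<Otimes>\<^sub>M (borel \<Otimes>\<^sub>M borel) :: (real \<times> real \<times> 'm) measure)"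
   by measurable
  moreover have bp: "(borel \<Otimes>\<^sub>M (borel \<Otimes>\<^sub>M borel) :: (real \<times> real \<times> 'm) measure) = borel" by (simp add: borel_prod)
  ultimately have "(\<lambda>z. (fst (fst z), snd (fst z), snd z)) \<in> measurable ((borel \<Otimes>\<^sub>M borel) \<Otimes>\<^sub>M borel) (borel :: (real \<times> real \<times> 'm) measure)"
   by (simp only:)
  from measurable_compose[OF this F] show ?thesis by (simp add: split_beta')
 qed
 have Lm: "(\<lambda>z. prob_kernel (snd z)) \<in> measurable (borel \<Otimes>\<^sub>M borel :: (real \<times> real) measure) (subprob_algebra borel)"
  by (rule measurable_compose[OF measurable_snd prob_kernel_measurable])
 have "(\<lambda>z. \<integral>\<^sup>+m. F (fst z, snd z, m) \<partial>prob_kernel (snd z)) \<in> borel_measurable (borel \<Otimes>\<^sub>M borel)"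
  using nn_integral_measurable_subprob_algebra2[OF _ Lm, of "\<lambda>z m. F (fst z, snd z, m)"] FF by (simp add: split_beta')
 then have "(\<lambda>z. indicator {0<..} (snd z) * (ennreal (1 + indicator {0<..} (snd z) * measure (\<eta> (snd z)) UNIV) *
   (\<integral>\<^sup>+m. F (fst z, snd z, m) \<partial>prob_kernel (snd z)))) \<in> borel_measurable (borel \<Otimes>\<^sub>M borel)"
  using measurable_compose[OF measurable_snd m1] by measurable
 also have "(\<lambda>z. indicator {0<..} (snd z) * (ennreal (1 + indicator {0<..} (snd z) * measure (\<eta> (snd z)) UNIV) *
   (\<integral>\<^sup>+m. F (fst z, snd z, m) \<partial>prob_kernel (snd z)))) = (\<lambda>(u, x). indicator {0<..} x * (\<integral>\<^sup>+m. F (u, x, m) \<partial>\<eta> x))"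
 proof
  fix z :: "real \<times> real"
  obtain u x where z: "z = (u, x)" by (cases z)
  have "(\<lambda>m. F (u, x, m)) \<in> borel_measurable borel"
  proof -
   have "(\<lambda>m. (u, x, m)) \<in> measurable borel (borel :: (real \<times> real \<times> 'm) measure)"
    by (intro borel_measurable_continuous_onI continuous_intros)
   from measurable_compose[OF this F] show ?thesis .
  qed
  from nn_integral_kernel[OF this, of x]
  have "indicator {0<..} x * (ennreal (1 + indicator {0<..} x * measure (\<eta> x) UNIV) * (\<integral>\<^sup>+m. F (u, x, m) \<partial>prob_kernel x)) =
   indicator {0<..} x * (\<integral>\<^sup>+m. F (u, x, m) \<partial>\<eta> x)"
   using kernel_props(2)[of x] by (auto simp: indicator_def)
  then show "indicator {0<..} (snd z) * (ennreal (1 + indicator {0<..} (snd z) * measure (\<eta> (snd z)) UNIV) *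
   (\<integral>\<^sup>+m. F (fst z, snd z, m) \<partial>prob_kernel (snd z))) = (case z of (u, x) => indicator {0<..} x * (\<integral>\<^sup>+m. F (u, x, m) \<partial>\<eta> x))"
   unfolding z fst_conv snd_conv prod.case .
 qed
 finally show ?thesis .
qed

lemma section_measurable:
 fixes F :: "real \<times> real \<times> 'm => 'b::topological_space"
 assumes "F \<in> borel_measurable borel"
 shows "(\<lambda>m. F (u, x, m)) \<in> borel_measurable borel"
proof -
 have "(\<lambda>m. (u, x, m)) \<in> measurable borel (borel :: (real \<times> real \<times> 'm) measure)"
  by (intro borel_measurable_continuous_onI continuous_intros)
 from measurable_compose[OF this assms] show ?thesis .
qed

text \<open>The integral against \<open>intensity \<eta> \<kappa>\<close> in the order of
  integration used there. Its countable additivity is what makes \<open>intensity\<close> a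
  measure.\<close>

definition intensity_integral :: "real => (real \<times> real \<times> 'm => ennreal) => ennreal" where
 "intensity_integral \<kappa> F = (\<integral>\<^sup>+u\<in>{0..1}. (\<integral>\<^sup>+x\<in>{0<..}.
   ennreal (exp (- \<kappa> * x) / x) * (\<integral>\<^sup>+m. F (u, x, m) \<partial>\<eta> x) \<partial>lborel) \<partial>lborel)"

lemma intensity_measurable1:
 fixes F :: "real \<times> real \<times> 'm => ennreal"
 assumes F: "F \<in> borel_measurable borel"
 shows "(\<lambda>(u, x). ennreal (exp (- \<kappa> * x) / x) * (\<integral>\<^sup>+m. F (u, x, m) \<partial>\<eta> x) * indicator {0<..} x) \<in> borel_measurable (borel \<Otimes>\<^sub>M borel)"
proof -
 have "(\<lambda>z. ennreal (exp (- \<kappa> * snd z) / snd z) * (case z of (u, x) => indicator {0<..} x * (\<integral>\<^sup>+m. F (u, x, m) \<partial>\<eta> x)))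
   \<in> borel_measurable (borel \<Otimes>\<^sub>M borel)"
  using nn_integral_kernel_measurable[OF F] by measurable
 then show ?thesis by (simp add: split_beta' mult_ac)
qed

lemma intensity_measurable2:
 fixes F :: "real \<times> real \<times> 'm => ennreal"
 assumes F: "F \<in> borel_measurable borel"
 shows "(\<lambda>x. ennreal (exp (- \<kappa> * x) / x) * (\<integral>\<^sup>+m. F (u, x, m) \<partial>\<eta> x) * indicator {0<..} x) \<in> borel_measurable lborel"
  "(\<lambda>u. (\<integral>\<^sup>+x\<in>{0<..}. ennreal (exp (- \<kappa> * x) / x) * (\<integral>\<^sup>+m. F (u, x, m) \<partial>\<eta> x) \<partial>lborel) * indicator {0..1} u) \<in> borel_measurable lborel"
proof -
 note m = intensity_measurable1[OF F, of \<kappa>]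
 have "(\<lambda>x. (u, x)) \<in> measurable lborel (borel \<Otimes>\<^sub>M borel :: (real \<times> real) measure)" by measurable
 from measurable_compose[OF this m]
 show "(\<lambda>x. ennreal (exp (- \<kappa> * x) / x) * (\<integral>\<^sup>+m. F (u, x, m) \<partial>\<eta> x) * indicator {0<..} x) \<in> borel_measurable lborel" by simp
 have "(\<lambda>(u, x). ennreal (exp (- \<kappa> * x) / x) * (\<integral>\<^sup>+m. F (u, x, m) \<partial>\<eta> x) * indicator {0<..} x) \<in> borel_measurable (lborel \<Otimes>\<^sub>M lborel)"
  using m by (simp cong: measurable_cong_sets add: sets_pair_measure_cong[OF sets_lborel sets_lborel])
 from lborel.borel_measurable_nn_integral_fst[OF this]
 have "(\<lambda>u. \<integral>\<^sup>+x\<in>{0<..}. ennreal (exp (- \<kappa> * x) / x) * (\<integral>\<^sup>+m. F (u, x, m) \<partial>\<eta> x) \<partial>lborel) \<in> borel_measurable lborel"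
  by simp
 then show "(\<lambda>u. (\<integral>\<^sup>+x\<in>{0<..}. ennreal (exp (- \<kappa> * x) / x) * (\<integral>\<^sup>+m. F (u, x, m) \<partial>\<eta> x) \<partial>lborel) * indicator {0..1} u) \<in> borel_measurable lborel"
  by measurable
qed

lemma kernel_section_measurable:
 fixes F :: "real \<times> real \<times> 'm => ennreal"
 assumes "F \<in> borel_measurable borel" "0 < x"
 shows "(\<lambda>m. F (u, x, m)) \<in> borel_measurable (\<eta> x)"
 using section_measurable[OF assms(1)] measurable_cong_sets[OF kernel_props(1)[OF assms(2)] refl] by blast

lemma intensity_integral_suminf:
 assumes F: "\<And>i. F i \<in> borel_measurable borel"
 shows "intensity_integral \<kappa> (\<lambda>z. \<Sum>i. F i z) = (\<Sum>i. intensity_integral \<kappa> (F i))"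
proof -
 have "intensity_integral \<kappa> (\<lambda>z. \<Sum>i. F i z) = (\<integral>\<^sup>+u\<in>{0..1}. (\<integral>\<^sup>+x\<in>{0<..}.
   (\<Sum>i. ennreal (exp (- \<kappa> * x) / x) * (\<integral>\<^sup>+m. F i (u, x, m) \<partial>\<eta> x)) \<partial>lborel) \<partial>lborel)"
  unfolding intensity_integral_def
  by (intro nn_integral_cong) (auto simp: indicator_def nn_integral_suminf kernel_section_measurable[OF F] intro!: nn_integral_cong)
 also have "\<dots> = (\<integral>\<^sup>+u\<in>{0..1}. (\<Sum>i. \<integral>\<^sup>+x\<in>{0<..}.
   ennreal (exp (- \<kappa> * x) / x) * (\<integral>\<^sup>+m. F i (u, x, m) \<partial>\<eta> x) \<partial>lborel) \<partial>lborel)"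
  using intensity_measurable2(1)[OF F] by (simp add: nn_integral_suminf[symmetric])
 also have "\<dots> = (\<Sum>i. intensity_integral \<kappa> (F i))"
  unfolding intensity_integral_def using intensity_measurable2(2)[OF F] by (simp add: nn_integral_suminf[symmetric])
 finally show ?thesis .
qed

lemma intensity_integral_cmult:
 assumes F: "F \<in> borel_measurable borel"
 shows "intensity_integral \<kappa> (\<lambda>z. c * F z) = c * intensity_integral \<kappa> F"
proof -
 have "intensity_integral \<kappa> (\<lambda>z. c * F z) = (\<integral>\<^sup>+u\<in>{0..1}. (\<integral>\<^sup>+x.
   c * (ennreal (exp (- \<kappa> * x) / x) * (\<integral>\<^sup>+m. F (u, x, m) \<partial>\<eta> x) * indicator {0<..} x) \<partial>lborel) \<partial>lborel)"
  unfolding intensity_integral_def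
  by (intro nn_integral_cong) (auto simp: indicator_def nn_integral_cmult kernel_section_measurable[OF F] mult_ac intro!: nn_integral_cong)
 also have "\<dots> = (\<integral>\<^sup>+u. c * ((\<integral>\<^sup>+x\<in>{0<..}.
   ennreal (exp (- \<kappa> * x) / x) * (\<integral>\<^sup>+m. F (u, x, m) \<partial>\<eta> x) \<partial>lborel) * indicator {0..1} u) \<partial>lborel)"
  using intensity_measurable2(1)[OF F] by (simp add: nn_integral_cmult mult.assoc)
 also have "\<dots> = c * intensity_integral \<kappa> F"
  unfolding intensity_integral_def using intensity_measurable2(2)[OF F] by (simp add: nn_integral_cmult)
 finally show ?thesis .
qed

lemma intensity_integral_cong:
 assumes "\<And>z. z \<in> E ==> F z = G z"
 shows "intensity_integral \<kappa> F = intensity_integral \<kappa> G"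
proof -
 have "(\<integral>\<^sup>+m. F (u, x, m) \<partial>\<eta> x) = (\<integral>\<^sup>+m. G (u, x, m) \<partial>\<eta> x)" if "u \<in> {0..1}" "0 < x" for u x
  using assms that by (intro nn_integral_cong) (auto simp: E_def)
 then show ?thesis unfolding intensity_integral_def
  by (intro nn_integral_cong) (auto simp: indicator_def intro!: nn_integral_cong)
qed

lemma sets_intensity [simp]: "sets (intensity \<eta> \<kappa>) = sets borel_E" "space (intensity \<eta> \<kappa>) = E"
 unfolding intensity_def by (rule sets.sets_measure_of_eq, subst sets.space_measure_of_eq, simp)

lemma borel_E_in_borel: "A \<in> sets borel_E ==> A \<in> sets (borel :: (real \<times> real \<times> 'm) measure)"
 using E_in_borel by (auto simp: borel_E_def sets_restrict_space)

end

context weak_kernel begin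
lemma emeasure_kernel_section:
 assumes A: "A \<in> sets borel_E" and x: "0 < x"
 shows "emeasure (\<eta> x) {m. (u, x, m) \<in> A} = (\<integral>\<^sup>+m. indicator A (u, x, m) \<partial>\<eta> x)"
proof -
 have 0: "(indicator A :: _ => ennreal) \<in> borel_measurable (borel :: (real \<times> real \<times> 'm) measure)"
  using borel_E_in_borel[OF A] by (rule borel_measurable_indicator)
 have 1: "(\<lambda>m. indicator A (u, x, m) :: ennreal) = indicator {m. (u, x, m) \<in> A}"
  by (rule ext) (simp split: split_indicator)
 have "(indicator {m. (u, x, m) \<in> A} :: _ => ennreal) \<in> borel_measurable (\<eta> x)"
  using kernel_section_measurable[OF 0 x, of u] unfolding 1 .
 then have "{m. (u, x, m) \<in> A} \<inter> space (\<eta> x) \<in> sets (\<eta> x)"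
  by (subst (asm) borel_measurable_indicator_iff)
 then have "{m. (u, x, m) \<in> A} \<in> sets (\<eta> x)" unfolding kernel_props(2)[OF x] Int_UNIV_right .
 then show ?thesis unfolding 1 by (rule nn_integral_indicator[symmetric])
qed

text \<open>\<open>measure_of\<close> is guaranteed to return the given set function only if that is
  countably additive; this is monotone convergence, carried through three nested integrals in
  \<open>intensity_integral_suminf\<close>.\<close>

lemma emeasure_intensity:
 assumes A: "A \<in> sets borel_E"
 shows "emeasure (intensity \<eta> \<kappa>) A = intensity_integral \<kappa> (indicator A)"
proof -
 define \<mu> :: "(real \<times> real \<times> 'm) set => ennreal" where "\<mu> A = (\<integral>\<^sup>+u\<in>{0..1}. (\<integral>\<^sup>+x\<in>{0<..}.
    ennreal (exp (- \<kappa> * x) / x) * emeasure (\<eta> x) {m. (u, x, m) \<in> A} \<partial>lborel) \<partial>lborel)" for A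
 have eq: "\<mu> A = intensity_integral \<kappa> (indicator A)" if A: "A \<in> sets borel_E" for A
 proof -
  have "(\<integral>\<^sup>+x\<in>{0<..}. ennreal (exp (- \<kappa> * x) / x) * emeasure (\<eta> x) {m. (u, x, m) \<in> A} \<partial>lborel) =
    (\<integral>\<^sup>+x\<in>{0<..}. ennreal (exp (- \<kappa> * x) / x) * (\<integral>\<^sup>+m. indicator A (u, x, m) \<partial>\<eta> x) \<partial>lborel)" for u
  proof (rule nn_integral_cong)
   fix x :: real
   show "ennreal (exp (- \<kappa> * x) / x) * emeasure (\<eta> x) {m. (u, x, m) \<in> A} * indicator {0<..} x =
     ennreal (exp (- \<kappa> * x) / x) * (\<integral>\<^sup>+m. indicator A (u, x, m) \<partial>\<eta> x) * indicator {0<..} x"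
   proof (cases "0 < x")
    case True
    show ?thesis unfolding emeasure_kernel_section[OF A True] ..
   next
    case False
    then have "indicator {0<..} x = (0 :: ennreal)" by simp
    then show ?thesis by (simp only: mult_zero_right)
   qed
  qed
  then show ?thesis unfolding \<mu>_def intensity_integral_def by (simp only:)
 qed
 show ?thesis
  unfolding eq[OF A, symmetric] intensity_def \<mu>_def[symmetric]
 proof (rule emeasure_measure_of_sigma)
  show "sigma_algebra (space borel_E) (sets (borel_E :: (real \<times> real \<times> 'm) measure))" by (rule sets.sigma_algebra_axioms)
  show "positive (sets borel_E) \<mu>" by (simp add: positive_def \<mu>_def)
  show "countably_additive (sets borel_E) \<mu>"
  proof (rule countably_additiveI)
   fix B :: "nat => (real \<times> real \<times> 'm) set" assume B: "range B \<subseteq> sets borel_E" "disjoint_family B" "(\<Union>i. B i) \<in> sets borel_E"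
   have "(\<Sum>i. \<mu> (B i)) = (\<Sum>i. intensity_integral \<kappa> (indicator (B i)))"
    by (intro suminf_cong eq) (use B(1) in blast)
   also have "\<dots> = intensity_integral \<kappa> (\<lambda>z. \<Sum>i. indicator (B i) z)"
   proof (rule intensity_integral_suminf[symmetric])
    fix i
    have "B i \<in> sets borel" using B(1) by (intro borel_E_in_borel) blast
    then show "indicator (B i) \<in> borel_measurable borel" by (rule borel_measurable_indicator)
   qed
   also have "\<dots> = intensity_integral \<kappa> (indicator (\<Union>i. B i))"
    unfolding suminf_indicator[OF B(2)] ..
   also have "\<dots> = \<mu> (\<Union>i. B i)" by (rule eq[OF B(3), symmetric])
   finally show "(\<Sum>i. \<mu> (B i)) = \<mu> (\<Union>i. B i)" .
  qed
 qed (rule A)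
qed

lemma intensity_integral_add:
 assumes F: "F \<in> borel_measurable borel" "G \<in> borel_measurable borel"
 shows "intensity_integral \<kappa> (\<lambda>z. F z + G z) = intensity_integral \<kappa> F + intensity_integral \<kappa> G"
proof -
 \<comment> \<open>A sum of two terms as a series padded with zeros, so that
   \<open>intensity_integral_suminf\<close> applies.\<close>
 define H where "H i = (if i = 0 then F else if i = 1 then G else (\<lambda>_. 0))" for i :: nat
 have H: "H i \<in> borel_measurable borel" for i using F by (simp add: H_def)
 have "(\<Sum>i. H i z) = (\<Sum>i\<in>{0, 1}. H i z)" for z by (rule suminf_finite) (auto simp: H_def)
 then have 1: "(\<lambda>z. \<Sum>i. H i z) = (\<lambda>z. F z + G z)" by (simp add: H_def fun_eq_iff)
 have "intensity_integral \<kappa> (\<lambda>_. 0) = 0" by (simp add: intensity_integral_def)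
 then have "(\<Sum>i. intensity_integral \<kappa> (H i)) = (\<Sum>i\<in>{0, 1}. intensity_integral \<kappa> (H i))"
  by (intro suminf_finite) (auto simp: H_def)
 then show ?thesis using intensity_integral_suminf[of H \<kappa>] H unfolding 1 by (simp add: H_def)
qed

lemma intensity_integral_SUP:
 assumes F: "\<And>i. F i \<in> borel_measurable borel" and inc: "incseq F"
 shows "intensity_integral \<kappa> (\<lambda>z. SUP i. F i z) = (SUP i. intensity_integral \<kappa> (F i))"
proof -
 have le: "F i z \<le> F j z" if "i \<le> j" for i j z using inc that unfolding incseq_def le_fun_def by blast
 define A where "A i u x = ennreal (exp (- \<kappa> * x) / x) * (\<integral>\<^sup>+m. F i (u, x, m) \<partial>\<eta> x) * indicator {0<..} x" for i u x
 have Aincr: "A i u x \<le> A j u x" if "i \<le> j" for i j u x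
  unfolding A_def by (intro mult_right_mono mult_left_mono nn_integral_mono le that) auto
 have Am: "A i u \<in> borel_measurable lborel" for i u unfolding A_def[abs_def] by (rule intensity_measurable2(1)[OF F])
 define B where "B i u = (\<integral>\<^sup>+x. A i u x \<partial>lborel) * indicator {0..1} u" for i u
 have Bincr: "B i u \<le> B j u" if "i \<le> j" for i j u
  unfolding B_def by (intro mult_right_mono nn_integral_mono Aincr that) auto
 have Bm: "B i \<in> borel_measurable lborel" for i
  unfolding B_def A_def by (rule intensity_measurable2(2)[OF F])
 have "intensity_integral \<kappa> (\<lambda>z. SUP i. F i z) = (\<integral>\<^sup>+u\<in>{0..1}. (\<integral>\<^sup>+x. (SUP i. A i u x) \<partial>lborel) \<partial>lborel)"
  unfolding intensity_integral_def
 proof (intro nn_integral_cong arg_cong2[where f = "(*)"] refl)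
  fix u x :: real
  show "ennreal (exp (- \<kappa> * x) / x) * (\<integral>\<^sup>+m. (SUP i. F i (u, x, m)) \<partial>\<eta> x) * indicator {0<..} x = (SUP i. A i u x)"
  proof (cases "0 < x")
   case True
   have "(\<integral>\<^sup>+m. (SUP i. F i (u, x, m)) \<partial>\<eta> x) = (SUP i. \<integral>\<^sup>+m. F i (u, x, m) \<partial>\<eta> x)"
    by (rule nn_integral_monotone_convergence_SUP)
     (auto simp: incseq_def le_fun_def le intro: kernel_section_measurable[OF F True])
   then show ?thesis using True by (simp add: A_def SUP_mult_left_ennreal)
  qed (simp add: A_def)
 qed
 also have "\<dots> = (\<integral>\<^sup>+u. (SUP i. B i u) \<partial>lborel)"
 proof (intro nn_integral_cong)
  fix u :: real
  have "(\<integral>\<^sup>+x. (SUP i. A i u x) \<partial>lborel) = (SUP i. \<integral>\<^sup>+x. A i u x \<partial>lborel)"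
   by (rule nn_integral_monotone_convergence_SUP[OF _ Am]) (auto simp: incseq_def le_fun_def Aincr)
  then show "(\<integral>\<^sup>+x. (SUP i. A i u x) \<partial>lborel) * indicator {0..1} u = (SUP i. B i u)"
   by (simp add: B_def indicator_def)
 qed
 also have "\<dots> = (SUP i. \<integral>\<^sup>+u. B i u \<partial>lborel)"
  by (rule nn_integral_monotone_convergence_SUP[OF _ Bm]) (auto simp: incseq_def le_fun_def Bincr)
 also have "\<dots> = (SUP i. intensity_integral \<kappa> (F i))"
  by (simp add: B_def A_def intensity_integral_def)
 finally show ?thesis .
qed

lemma measurable_intensity:
 assumes "F \<in> borel_measurable borel" shows "F \<in> borel_measurable (intensity \<eta> \<kappa>)"
proof -
 have "F \<in> borel_measurable borel_E" unfolding borel_E_def by (rule measurable_restrict_space1[OF assms])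
 then show ?thesis unfolding measurable_cong_sets[OF sets_intensity(1) refl] .
qed

text \<open>Both sides agree on indicators and respect multiples, sums and increasing
  limits.\<close>

lemma nn_integral_intensity:
 assumes F: "F \<in> borel_measurable borel"
 shows "(\<integral>\<^sup>+z. F z \<partial>intensity \<eta> \<kappa>) = intensity_integral \<kappa> F"
 using F
proof (induction rule: borel_measurable_induct)
 case (cong f g)
 then have "f = g" by auto
 then show ?case using cong by simp
next
 case (set A)
 have AE': "A \<inter> E \<in> sets borel_E" using set by (auto simp: borel_E_def sets_restrict_space Int_commute)
 have "(\<integral>\<^sup>+z. indicator A z \<partial>intensity \<eta> \<kappa>) = (\<integral>\<^sup>+z. indicator (A \<inter> E) z \<partial>intensity \<eta> \<kappa>)"
  by (intro nn_integral_cong) (auto simp: indicator_def)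
 also have "\<dots> = emeasure (intensity \<eta> \<kappa>) (A \<inter> E)" using AE' by (intro nn_integral_indicator) simp
 also have "\<dots> = intensity_integral \<kappa> (indicator (A \<inter> E))" by (rule emeasure_intensity[OF AE'])
 also have "\<dots> = intensity_integral \<kappa> (indicator A)" by (rule intensity_integral_cong) (auto simp: indicator_def)
 finally show ?case .
next
 case (mult u c)
 have "(\<integral>\<^sup>+z. c * u z \<partial>intensity \<eta> \<kappa>) = c * (\<integral>\<^sup>+z. u z \<partial>intensity \<eta> \<kappa>)"
  by (rule nn_integral_cmult[OF measurable_intensity[OF mult(2)]])
 then show ?case unfolding mult(4) intensity_integral_cmult[OF mult(2)] .
next
 case (add u v)
 have "(\<integral>\<^sup>+z. v z + u z \<partial>intensity \<eta> \<kappa>) = (\<integral>\<^sup>+z. v z \<partial>intensity \<eta> \<kappa>) + (\<integral>\<^sup>+z. u z \<partial>intensity \<eta> \<kappa>)"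
  by (rule nn_integral_add[OF measurable_intensity[OF add(3)] measurable_intensity[OF add(1)]])
 then show ?case unfolding add(6) add(7) intensity_integral_add[OF add(3) add(1)] .
next
 case (seq U)
 have "(\<integral>\<^sup>+z. (SUP i. U i z) \<partial>intensity \<eta> \<kappa>) = (SUP i. \<integral>\<^sup>+z. U i z \<partial>intensity \<eta> \<kappa>)"
  by (rule nn_integral_monotone_convergence_SUP[OF seq(3) measurable_intensity[OF seq(1)]])
 also have "\<dots> = (SUP i. intensity_integral \<kappa> (U i))" unfolding seq(5) ..
 also have "\<dots> = intensity_integral \<kappa> (\<lambda>z. SUP i. U i z)"
  by (rule intensity_integral_SUP[OF seq(1) seq(3), symmetric])
 finally show ?case unfolding SUP_apply .
qed

end

section \<open>The Laplace functional of a Poisson process\<close>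

lemma nn_integral_points_measurable:
 fixes F :: "real \<times> real \<times> 'm::polish_space => ennreal"
 assumes F: "F \<in> borel_measurable borel_E" and sets: "\<And>\<xi>. \<xi> \<in> space P ==> sets \<xi> = sets borel_E"
  and cnt: "\<And>A. A \<in> sets borel_E ==> (\<lambda>\<xi>. emeasure \<xi> A) \<in> borel_measurable P"
 shows "(\<lambda>\<xi>. \<integral>\<^sup>+z. F z \<partial>\<xi>) \<in> borel_measurable P"
 using F
proof (induction rule: borel_measurable_induct)
 case (cong f g)
 have "(\<integral>\<^sup>+z. f z \<partial>\<xi>) = (\<integral>\<^sup>+z. g z \<partial>\<xi>)" if "\<xi> \<in> space P" for \<xi>
  using cong(3) sets_eq_imp_space_eq[OF sets[OF that]] by (intro nn_integral_cong) simp
 then show ?case using cong(4) by (simp cong: measurable_cong)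
next
 case (set A)
 have "(\<integral>\<^sup>+z. indicator A z \<partial>\<xi>) = emeasure \<xi> A" if "\<xi> \<in> space P" for \<xi>
  using set sets[OF that] by (intro nn_integral_indicator) simp
 then show ?case using cnt[OF set] by (simp cong: measurable_cong)
next
 case (mult u c)
 have "(\<integral>\<^sup>+z. c * u z \<partial>\<xi>) = c * (\<integral>\<^sup>+z. u z \<partial>\<xi>)" if "\<xi> \<in> space P" for \<xi>
  by (rule nn_integral_cmult) (use mult(2) measurable_cong_sets[OF sets[OF that] refl] in blast)
 moreover have "(\<lambda>\<xi>. c * (\<integral>\<^sup>+z. u z \<partial>\<xi>)) \<in> borel_measurable P" using mult(4) by measurable
 ultimately show ?case by (simp cong: measurable_cong)
next
 case (add u v)
 have "(\<integral>\<^sup>+z. v z + u z \<partial>\<xi>) = (\<integral>\<^sup>+z. v z \<partial>\<xi>) + (\<integral>\<^sup>+z. u z \<partial>\<xi>)" if "\<xi> \<in> space P" for \<xi>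
  by (rule nn_integral_add) (use add(1,3) measurable_cong_sets[OF sets[OF that] refl] in blast)+
 moreover have "(\<lambda>\<xi>. (\<integral>\<^sup>+z. v z \<partial>\<xi>) + (\<integral>\<^sup>+z. u z \<partial>\<xi>)) \<in> borel_measurable P" using add(6,7) by measurable
 ultimately show ?case by (simp cong: measurable_cong)
next
 case (seq U)
 have "(\<integral>\<^sup>+z. (SUP i. U i z) \<partial>\<xi>) = (SUP i. \<integral>\<^sup>+z. U i z \<partial>\<xi>)" if "\<xi> \<in> space P" for \<xi>
  by (rule nn_integral_monotone_convergence_SUP[OF seq(3)])
   (use seq(1) measurable_cong_sets[OF sets[OF that] refl] in blast)
 moreover have "(\<lambda>\<xi>. SUP i. \<integral>\<^sup>+z. U i z \<partial>\<xi>) \<in> borel_measurable P" using seq(5) by measurable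
 ultimately show ?case unfolding SUP_apply by (simp cong: measurable_cong)
qed

text \<open>The Laplace transform at \<open>v\<close> of the Poisson law with mean \<open>l\<close>;
  the case \<open>v = 0\<close> is its normalization.\<close>

lemma exp_poisson_sums:
 fixes l v :: real
 shows "(\<lambda>k. exp (- v * real k) * (l ^ k / fact k * exp (- l))) sums exp (- (1 - exp (- v)) * l)"
proof -
 have "(\<lambda>k. exp (- l) * ((exp (- v) * l) ^ k / fact k)) sums (exp (- l) * exp (exp (- v) * l))"
  using exp_converges[of "exp (- v) * l"] by (intro sums_mult) (simp add: divide_inverse mult.commute)
 moreover have "exp (- l) * ((exp (- v) * l) ^ k / fact k) = exp (- v * real k) * (l ^ k / fact k * exp (- l))" for k
  by (simp add: power_mult_distrib exp_of_nat_mult[symmetric] mult_ac)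
 moreover have "exp (- l) * exp (exp (- v) * l) = exp (- (1 - exp (- v)) * l)"
  by (simp add: exp_add[symmetric] algebra_simps)
 ultimately show ?thesis by (simp only:)
qed

context
 fixes \<nu> :: "(real \<times> real \<times> 'm::polish_space) measure" and P
 assumes law: "poisson_process_law \<nu> P" and sets_nu: "sets \<nu> = sets borel_E"
begin

interpretation prob_space P using law by (simp add: poisson_process_law_def)

lemma poisson_space: "\<xi> \<in> space P ==> \<xi> \<in> locally_finite_point_measures"
proof -
 have "sets P = sets borel_points" using law by (simp add: poisson_process_law_def)
 from sets_eq_imp_space_eq[OF this] show "\<xi> \<in> space P ==> ?thesis" by simp
qed

text \<open>Measurability of the counts is contained in the independence clause of
  \<open>poisson_process_law\<close>; a family with a single index extracts it.\<close>

lemma poisson_count_measurable: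
 assumes A: "A \<in> sets borel_E"
 shows "(\<lambda>\<xi>. emeasure \<xi> A) \<in> borel_measurable P"
proof -
 have "indep_vars (\<lambda>_. borel) (\<lambda>i \<xi>. emeasure \<xi> ((\<lambda>_ :: nat. A) i)) {0}"
  using law A unfolding poisson_process_law_def by (elim conjE allE[of _ "{0}"] allE[of _ "\<lambda>_. A"]) (simp add: disjoint_family_on_def)
 then show ?thesis unfolding indep_vars_def by simp
qed

lemma poisson_count_laplace:
 assumes A: "A \<in> sets borel_E" and fin: "emeasure \<nu> A < \<infinity>"
 shows "(\<integral>\<^sup>+\<xi>. ennreal (exp (- v * measure \<xi> A)) \<partial>P) = ennreal (exp (- (1 - exp (- v)) * measure \<nu> A))"
proof -
 define S where "S k = {\<xi> \<in> space P. emeasure \<xi> A = of_nat k}" for k :: nat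
 let ?l = "measure \<nu> A"
 have pS: "prob (S k) = ?l ^ k / fact k * exp (- ?l)" for k
  using law A fin unfolding poisson_process_law_def S_def by blast
 have Sm: "S k \<in> events" for k
  unfolding S_def using poisson_count_measurable[OF A] by measurable
 have disj: "disjoint_family S" by (auto simp: S_def disjoint_family_on_def)
 have "(\<lambda>k. ?l ^ k / fact k * exp (- ?l)) sums prob (\<Union>k. S k)"
  using finite_measure_UNION[OF _ disj] Sm unfolding pS by auto
 moreover have "(\<lambda>k. ?l ^ k / fact k * exp (- ?l)) sums 1" using exp_poisson_sums[of 0 ?l] by simp
 \<comment> \<open>The Poisson weights sum to 1, so the count is almost surely finite and the
   expectation splits over its values.\<close>
 ultimately have "prob (\<Union>k. S k) = 1" by (rule sums_unique2)
 then have AE: "AE \<xi> in P. \<xi> \<in> (\<Union>k. S k)" by (rule AE_prob_1)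
 have "(\<integral>\<^sup>+\<xi>. ennreal (exp (- v * measure \<xi> A)) \<partial>P) = (\<integral>\<^sup>+\<xi>. (\<Sum>k. ennreal (exp (- v * real k)) * indicator (S k) \<xi>) \<partial>P)"
 proof (rule nn_integral_cong_AE)
  show "AE \<xi> in P. ennreal (exp (- v * measure \<xi> A)) = (\<Sum>k. ennreal (exp (- v * real k)) * indicator (S k) \<xi>)"
   using AE
  proof eventually_elim
   case (elim \<xi>)
   then obtain k where k: "\<xi> \<in> S k" by auto
   have "(\<Sum>i. ennreal (exp (- v * real i)) * indicator (S i) \<xi>) = (\<Sum>i\<in>{k}. ennreal (exp (- v * real i)) * indicator (S i) \<xi>)"
    using k disj by (intro suminf_finite) (auto simp: disjoint_family_on_def indicator_def)
   also have "\<dots> = ennreal (exp (- v * real k))" using k by simp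
   also have "real k = measure \<xi> A" using k by (simp add: S_def measure_def)
   finally show ?case by simp
  qed
 qed
 also have "\<dots> = (\<Sum>k. ennreal (exp (- v * real k)) * emeasure P (S k))"
  using Sm by (subst nn_integral_suminf) (auto simp: nn_integral_cmult)
 also have "\<dots> = (\<Sum>k. ennreal (exp (- v * real k) * (?l ^ k / fact k * exp (- ?l))))"
 proof (intro suminf_cong)
  fix k
  show "ennreal (exp (- v * real k)) * emeasure P (S k) = ennreal (exp (- v * real k) * (?l ^ k / fact k * exp (- ?l)))"
   unfolding emeasure_eq_measure pS by (intro ennreal_mult[symmetric]) auto
 qed
 also have "\<dots> = ennreal (exp (- (1 - exp (- v)) * ?l))"
  by (rule suminf_ennreal_eq[OF _ exp_poisson_sums]) simp
 finally show ?thesis .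
qed

text \<open>The level sets of \<open>f\<close> in steps of \<open>1 / n\<close> are disjoint, so for
  the rounded function \<open>g n\<close> the expectation is a product over independent Poisson
  counts; both sides then pass to the limit by dominated convergence. Integrability of
  \<open>f\<close> against almost every \<open>\<xi>\<close> is assumed because a Bochner integral
  would otherwise be 0 instead of infinite.\<close>

lemma poisson_laplace:
 fixes f :: "real \<times> real \<times> 'm => real"
 assumes fm: "f \<in> borel_measurable borel_E" and f0: "\<And>z. z \<in> E ==> 0 \<le> f z"
  and lev: "\<And>c. 0 < c ==> emeasure \<nu> {z \<in> E. c \<le> f z} < \<infinity>"
  and fin: "AE \<xi> in P. integrable \<xi> f"
  and ifin: "integrable \<nu> (\<lambda>z. 1 - exp (- f z))"
 shows "(\<integral>\<xi>. exp (- (\<integral>z. f z \<partial>\<xi>)) \<partial>P) = exp (- (\<integral>z. 1 - exp (- f z) \<partial>\<nu>))"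
proof -
 \<comment> \<open>\<open>g n\<close> rounds \<open>f\<close> down to multiples of
   \<open>1 / n\<close> and is 0 where the rounded level exceeds \<open>n * n\<close>, so finitely
   many level sets remain. Level 0, whose intensity may be infinite, does not enter.\<close>
 define A where "A n i = {z \<in> E. nat \<lfloor>real n * f z\<rfloor> = i}" for n i :: nat
 define g where "g n z = (\<Sum>i=1..n*n. (real i / real n) * indicator (A n i) z)" for n z
 have sp: "space \<nu> = E" using sets_eq_imp_space_eq[OF sets_nu] by simp
 have sx: "sets \<xi> = sets borel_E" "space \<xi> = E" if "\<xi> \<in> space P" for \<xi>
  using point_measureD[OF poisson_space[OF that]] by auto
 have Am: "A n i \<in> sets borel_E" for n i
 proof -
  have "{z \<in> space borel_E. nat \<lfloor>real n * f z\<rfloor> = i} \<in> sets borel_E" using fm by measurable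
  then show ?thesis by (simp add: A_def)
 qed
 have gz: "g n z = (let i = nat \<lfloor>real n * f z\<rfloor> in if 1 \<le> i \<and> i \<le> n * n then real i / real n else 0)" if z: "z \<in> E" for n z
 proof -
  have "g n z = (\<Sum>i=1..n*n. if nat \<lfloor>real n * f z\<rfloor> = i then real i / real n else 0)"
   unfolding g_def using z by (intro sum.cong) (auto simp: A_def indicator_def)
  then show ?thesis by (auto simp: Let_def)
 qed
 have gle: "0 \<le> g n z" "g n z \<le> f z" if z: "z \<in> E" for n z
 proof -
  show "0 \<le> g n z" unfolding gz[OF z] by (auto simp: Let_def)
  show "g n z \<le> f z"
  proof (cases "n = 0")
   case False
   have "real (nat \<lfloor>real n * f z\<rfloor>) \<le> real n * f z" using f0[OF z] by (simp add: of_nat_nat)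
   then show ?thesis unfolding gz[OF z] using False f0[OF z] by (auto simp: Let_def field_simps)
  qed (use f0[OF z] gz[OF z] in \<open>auto simp: Let_def\<close>)
 qed
 have glim: "(\<lambda>n. g n z) \<longlonglongrightarrow> f z" if z: "z \<in> E" for z
 proof (rule tendsto_sandwich[of "\<lambda>n. f z - 1 / real n" _ _ "\<lambda>_. f z"])
  obtain n0 :: nat where n0: "f z \<le> real n0" using real_arch_simple by blast
  show "\<forall>\<^sub>F n in sequentially. f z - 1 / real n \<le> g n z"
   using eventually_ge_at_top[of "Suc n0"]
  proof eventually_elim
   case (elim n)
   then have n: "0 < real n" "f z \<le> real n" using n0 by auto
   define i where "i = nat \<lfloor>real n * f z\<rfloor>"
   have r: "real i = of_int \<lfloor>real n * f z\<rfloor>" using f0[OF z] n by (simp add: i_def)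
   have "real n * f z - 1 < real i" unfolding r by linarith
   then have 1: "f z - 1 / real n < real i / real n"
    using divide_strict_right_mono[of "real n * f z - 1" "real i" "real n"] n by (simp add: diff_divide_distrib)
   have "real i \<le> real n * f z" unfolding r by linarith
   also have "\<dots> \<le> real n * real n" using n by (intro mult_left_mono) auto
   finally have "real i \<le> real (n * n)" by simp
   then have 2: "i \<le> n * n" by (simp only: of_nat_le_iff)
   show ?case
   proof (cases "1 \<le> i")
    case True
    then show ?thesis using 1 2 unfolding gz[OF z] i_def[symmetric] by (simp add: Let_def)
   next
    case False
    then have "i = 0" by simp
    then show ?thesis using 1 unfolding gz[OF z] i_def[symmetric] by (simp add: Let_def)
   qed
  qed
  show "\<forall>\<^sub>F n in sequentially. g n z \<le> f z" using gle(2)[OF z] by simp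
  have "(\<lambda>n. f z - 1 / real n) \<longlonglongrightarrow> f z - 0" by (intro tendsto_intros lim_1_over_n)
  then show "(\<lambda>n. f z - 1 / real n) \<longlonglongrightarrow> f z" by simp
 qed simp
 have gm: "g n \<in> borel_measurable borel_E" for n
  unfolding g_def using Am by measurable
 have Ale: "indicator (A n i) z \<le> real n * f z" if "z \<in> E" "1 \<le> i" for n i z
 proof (cases "z \<in> A n i")
  case True
  then have "1 \<le> nat \<lfloor>real n * f z\<rfloor>" using that by (simp add: A_def)
  then have "1 \<le> \<lfloor>real n * f z\<rfloor>" by linarith
  then have "1 \<le> real n * f z" by (simp add: le_floor_iff)
  then show ?thesis using True by simp
 qed (use f0[OF that(1)] in simp)
 have nuA: "emeasure \<nu> (A n i) < \<infinity>" if i: "1 \<le> i" for n i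
 proof (cases "n = 0")
  case True
  then have "A n i = {}" using i by (auto simp: A_def)
  then show ?thesis by simp
 next
  case False
  have "A n i \<subseteq> {z \<in> E. 1 / real n \<le> f z}"
  proof
   fix z assume z: "z \<in> A n i"
   then have "z \<in> E" by (simp add: A_def)
   moreover from this have "1 \<le> real n * f z" using Ale[OF _ i, of z n] z by simp
   ultimately show "z \<in> {z \<in> E. 1 / real n \<le> f z}" using False by (simp add: divide_le_eq mult.commute)
  qed
  moreover have "{z \<in> E. 1 / real n \<le> f z} \<in> sets \<nu>"
  proof -
   have "{z \<in> space borel_E. 1 / real n \<le> f z} \<in> sets borel_E" using fm by measurable
   then show ?thesis by (simp add: sets_nu)
  qed
  ultimately have "emeasure \<nu> (A n i) \<le> emeasure \<nu> {z \<in> E. 1 / real n \<le> f z}" by (rule emeasure_mono)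
  also have "\<dots> < \<infinity>" using False by (intro lev) simp
  finally show ?thesis .
 qed
 have xiA: "emeasure \<xi> (A n i) < \<infinity>" if \<xi>: "\<xi> \<in> space P" "integrable \<xi> f" and i: "1 \<le> i" for \<xi> n i
 proof -
  have "integrable \<xi> (indicator (A n i) :: _ => real)"
  proof (rule Bochner_Integration.integrable_bound[OF integrable_mult_right[OF \<xi>(2), of "real n"]])
   show "(indicator (A n i) :: _ => real) \<in> borel_measurable \<xi>" using Am sx(1)[OF \<xi>(1)] by simp
   show "AE z in \<xi>. norm (indicator (A n i) z :: real) \<le> norm (real n * f z)"
    using Ale[OF _ i] f0 sx(2)[OF \<xi>(1)] by (intro AE_I2) auto
  qed
  then have "emeasure \<xi> (A n i \<inter> space \<xi>) < \<infinity>" by (simp add: integrable_indicator_iff)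
  moreover have "A n i \<inter> space \<xi> = A n i" using sx(2)[OF \<xi>(1)] by (auto simp: A_def)
  ultimately show ?thesis by simp
 qed
 have gxi: "(\<integral>z. g n z \<partial>\<xi>) = (\<Sum>i=1..n*n. (real i / real n) * measure \<xi> (A n i))" if \<xi>: "\<xi> \<in> space P" "integrable \<xi> f" for n \<xi>
 proof -
  have "(\<integral>z. g n z \<partial>\<xi>) = (\<Sum>i=1..n*n. \<integral>z. (real i / real n) * indicator (A n i) z \<partial>\<xi>)"
   unfolding g_def
  proof (rule Bochner_Integration.integral_sum)
   fix i assume "i \<in> {1..n*n}"
   then show "integrable \<xi> (\<lambda>z. (real i / real n) * indicator (A n i) z)"
    using xiA[OF \<xi>, of i n] Am sx(1)[OF \<xi>(1)] by (intro integrable_mult_right integrable_real_indicator) auto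
  qed
  also have "\<dots> = (\<Sum>i=1..n*n. (real i / real n) * measure \<xi> (A n i))"
   using sx[OF \<xi>(1)] by (intro sum.cong refl) (auto simp: A_def intro!: arg_cong[of _ _ "measure \<xi>"] disjI2)
  finally show ?thesis .
 qed
 have lhs: "(\<integral>\<xi>. exp (- (\<Sum>i=1..n*n. (real i / real n) * measure \<xi> (A n i))) \<partial>P) = exp (- (\<integral>z. 1 - exp (- g n z) \<partial>\<nu>))" for n
 proof -
  have ind: "indep_vars (\<lambda>_. borel) (\<lambda>i \<xi>. ennreal (exp (- (real i / real n) * enn2real (emeasure \<xi> (A n i))))) {1..n*n}"
  proof -
   have "A n ` {1..n*n} \<subseteq> sets borel_E" using Am by auto
   moreover have "disjoint_family_on (A n) {1..n*n}" by (auto simp: disjoint_family_on_def A_def)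
   ultimately have "indep_vars (\<lambda>_. borel) (\<lambda>i \<xi>. emeasure \<xi> (A n i)) {1..n*n}"
    using law unfolding poisson_process_law_def by blast
   from indep_vars_compose2[OF this, where Y = "\<lambda>i y. ennreal (exp (- (real i / real n) * enn2real y))" and N = "\<lambda>_. borel"]
   show ?thesis by measurable
  qed
  have "ennreal (exp (- (\<Sum>i=1..n*n. (real i / real n) * measure \<xi> (A n i)))) =
   (\<Prod>i=1..n*n. ennreal (exp (- (real i / real n) * measure \<xi> (A n i))))" for \<xi>
   by (subst prod_ennreal) (simp_all add: exp_sum[symmetric] sum_negf[symmetric])
  then have "(\<integral>\<^sup>+\<xi>. ennreal (exp (- (\<Sum>i=1..n*n. (real i / real n) * measure \<xi> (A n i)))) \<partial>P) =
   (\<integral>\<^sup>+\<xi>. (\<Prod>i=1..n*n. ennreal (exp (- (real i / real n) * measure \<xi> (A n i)))) \<partial>P)" by simp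
  also have "\<dots> = (\<Prod>i=1..n*n. \<integral>\<^sup>+\<xi>. ennreal (exp (- (real i / real n) * measure \<xi> (A n i))) \<partial>P)"
   using indep_vars_nn_integral[OF _ ind] unfolding measure_def by simp
  also have "\<dots> = (\<Prod>i=1..n*n. ennreal (exp (- (1 - exp (- (real i / real n))) * measure \<nu> (A n i))))"
   using nuA Am by (intro prod.cong refl poisson_count_laplace) auto
  also have "\<dots> = ennreal (exp (- (\<Sum>i=1..n*n. (1 - exp (- (real i / real n))) * measure \<nu> (A n i))))"
   by (subst prod_ennreal) (simp_all add: exp_sum[symmetric] sum_negf[symmetric] left_diff_distrib)
  also have "(\<Sum>i=1..n*n. (1 - exp (- (real i / real n))) * measure \<nu> (A n i)) = (\<integral>z. 1 - exp (- g n z) \<partial>\<nu>)"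
  proof -
   have "(\<integral>z. 1 - exp (- g n z) \<partial>\<nu>) = (\<integral>z. (\<Sum>i=1..n*n. (1 - exp (- (real i / real n))) * indicator (A n i) z) \<partial>\<nu>)"
   proof (rule Bochner_Integration.integral_cong[OF refl])
    fix z assume "z \<in> space \<nu>"
    then have z: "z \<in> E" using sp by simp
    have "(\<Sum>i=1..n*n. (1 - exp (- (real i / real n))) * indicator (A n i) z) =
      (\<Sum>i=1..n*n. if nat \<lfloor>real n * f z\<rfloor> = i then 1 - exp (- (real i / real n)) else 0)"
     using z by (intro sum.cong) (auto simp: A_def indicator_def)
    then show "1 - exp (- g n z) = (\<Sum>i=1..n*n. (1 - exp (- (real i / real n))) * indicator (A n i) z)"
     unfolding gz[OF z] by (auto simp: Let_def)
   qed
   also have "\<dots> = (\<Sum>i=1..n*n. \<integral>z. (1 - exp (- (real i / real n))) * indicator (A n i) z \<partial>\<nu>)"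
   proof (rule Bochner_Integration.integral_sum)
    fix i assume "i \<in> {1..n*n}"
    then show "integrable \<nu> (\<lambda>z. (1 - exp (- (real i / real n))) * indicator (A n i) z)"
     using nuA[of i n] Am sets_nu by (intro integrable_mult_right integrable_real_indicator) auto
   qed
   also have "\<dots> = (\<Sum>i=1..n*n. (1 - exp (- (real i / real n))) * measure \<nu> (A n i))"
    using sp by (intro sum.cong refl) (auto simp: A_def intro!: arg_cong[of _ _ "measure \<nu>"] disjI2)
   finally show ?thesis ..
  qed
  finally have nn: "(\<integral>\<^sup>+\<xi>. ennreal (exp (- (\<Sum>i=1..n*n. (real i / real n) * measure \<xi> (A n i)))) \<partial>P) =
    ennreal (exp (- (\<integral>z. 1 - exp (- g n z) \<partial>\<nu>)))" .
  show ?thesis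
   using poisson_count_measurable[OF Am] unfolding measure_def
   by (intro integral_eq_nn_integral[THEN trans]) (use nn in \<open>auto simp: measure_def\<close>)
 qed
 have fint: "(\<lambda>\<xi>. exp (- (\<integral>z. f z \<partial>\<xi>))) \<in> borel_measurable P"
 proof -
  have "(\<lambda>\<xi>. \<integral>\<^sup>+z. ennreal (f z) \<partial>\<xi>) \<in> borel_measurable P"
   using fm sx poisson_count_measurable by (intro nn_integral_points_measurable) auto
  then have "(\<lambda>\<xi>. exp (- enn2real (\<integral>\<^sup>+z. ennreal (f z) \<partial>\<xi>))) \<in> borel_measurable P" by measurable
  moreover have "(\<integral>z. f z \<partial>\<xi>) = enn2real (\<integral>\<^sup>+z. ennreal (f z) \<partial>\<xi>)" if "\<xi> \<in> space P" for \<xi>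
  proof (rule integral_eq_nn_integral)
   show "f \<in> borel_measurable \<xi>" using fm unfolding measurable_cong_sets[OF sx(1)[OF that] refl] .
   show "AE z in \<xi>. 0 \<le> f z" using f0 sx(2)[OF that] by (intro AE_I2) auto
  qed
  ultimately show ?thesis by (simp cong: measurable_cong)
 qed
 have l1: "(\<lambda>n. \<integral>\<xi>. exp (- (\<Sum>i=1..n*n. (real i / real n) * measure \<xi> (A n i))) \<partial>P) \<longlonglongrightarrow> (\<integral>\<xi>. exp (- (\<integral>z. f z \<partial>\<xi>)) \<partial>P)"
 proof (rule integral_dominated_convergence[where w = "\<lambda>_. 1"])
  show "(\<lambda>\<xi>. exp (- (\<Sum>i=1..n*n. (real i / real n) * measure \<xi> (A n i)))) \<in> borel_measurable P" for n
   using poisson_count_measurable[OF Am] unfolding measure_def by measurable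
  show "AE \<xi> in P. norm (exp (- (\<Sum>i=1..n*n. (real i / real n) * measure \<xi> (A n i)))) \<le> 1" for n
   by (intro AE_I2) (auto intro!: sum_nonneg)
  show "AE \<xi> in P. (\<lambda>n. exp (- (\<Sum>i=1..n*n. (real i / real n) * measure \<xi> (A n i)))) \<longlonglongrightarrow> exp (- (\<integral>z. f z \<partial>\<xi>))"
   using fin AE_space
  proof eventually_elim
   case (elim \<xi>)
   have "(\<lambda>n. \<integral>z. g n z \<partial>\<xi>) \<longlonglongrightarrow> (\<integral>z. f z \<partial>\<xi>)"
   proof (rule integral_dominated_convergence[where w = f])
    show "f \<in> borel_measurable \<xi>" using fm unfolding measurable_cong_sets[OF sx(1)[OF elim(2)] refl] .
    show "g n \<in> borel_measurable \<xi>" for n using gm unfolding measurable_cong_sets[OF sx(1)[OF elim(2)] refl] .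
    show "AE z in \<xi>. (\<lambda>n. g n z) \<longlonglongrightarrow> f z" using glim sx(2)[OF elim(2)] by (intro AE_I2) auto
    show "AE z in \<xi>. norm (g n z) \<le> f z" for n using gle sx(2)[OF elim(2)] by (intro AE_I2) auto
   qed (rule elim(1))
   then show ?case unfolding gxi[OF elim(2,1)] by (intro tendsto_intros)
  qed
 qed (use fint in auto)
 \<comment> \<open>The dominating function is \<open>1 - exp (- f)\<close>, integrable by
   \<open>ifin\<close>; \<open>f\<close> itself is not assumed integrable against
   \<open>\<nu>\<close>.\<close>
 have l2: "(\<lambda>n. exp (- (\<integral>z. 1 - exp (- g n z) \<partial>\<nu>))) \<longlonglongrightarrow> exp (- (\<integral>z. 1 - exp (- f z) \<partial>\<nu>))"
 proof (intro tendsto_intros integral_dominated_convergence[where w = "\<lambda>z. 1 - exp (- f z)"])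
  have m: "borel_measurable \<nu> = (borel_measurable borel_E :: (_ => real) set)" by (rule measurable_cong_sets[OF sets_nu refl])
  show "(\<lambda>z. 1 - exp (- f z)) \<in> borel_measurable \<nu>" "\<And>n. (\<lambda>z. 1 - exp (- g n z)) \<in> borel_measurable \<nu>"
   unfolding m using fm gm by measurable
  show "AE z in \<nu>. (\<lambda>n. 1 - exp (- g n z)) \<longlonglongrightarrow> 1 - exp (- f z)"
   using glim sp by (intro AE_I2 tendsto_intros) auto
  show "AE z in \<nu>. norm (1 - exp (- g n z)) \<le> 1 - exp (- f z)" for n
   using gle sp by (intro AE_I2) auto
 qed (rule ifin)
 show ?thesis using LIMSEQ_unique[OF l1] l2 unfolding lhs by blast
qed

end

section \<open>The canonical model\<close>

abbreviation cycle_space :: "((label \<times> 'm::polish_space) \<times> real) measure" where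
 "cycle_space \<equiv> (count_space UNIV \<Otimes>\<^sub>M borel) \<Otimes>\<^sub>M restrict_space borel {0..1}"

lemma finite_borelD:
 fixes M :: "'m::topological_space measure"
 assumes "finite_borel M"
 shows "sets M = sets borel" "space M = UNIV" "finite_measure M" "emeasure M (space M) = ennreal (mass M)"
 using assms sets_eq_imp_space_eq[of M borel] by (auto simp: finite_borel_def finite_measure.emeasure_eq_measure)

lemma normalized_subprob:
 assumes M: "finite_borel (M :: 'm::polish_space measure)"
 shows "normalized M \<in> space (subprob_algebra borel)"
proof -
 note D = finite_borelD[OF M]
 have "emeasure (normalized M) (space M) \<le> 1"
  by (cases "mass M = 0")
   (simp_all add: normalized_def D(4) inverse_ennreal ennreal_mult[symmetric] zero_less_measure_iff)
 then show ?thesis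
  using D by (auto simp: space_subprob_algebra normalized_def space_scale_measure intro!: subprob_spaceI)
qed

definition label_part :: "'m measure => 'm measure => label => 'm measure" where
 "label_part \<mu>eff \<mu>bg s = (case s of Eff => \<mu>eff | Bg => \<mu>bg)"

lemma mass_split:
 assumes "finite_borel \<mu>" "finite_borel \<mu>1" "finite_borel \<mu>2"
  and "\<And>A. A \<in> sets borel ==> emeasure \<mu> A = emeasure \<mu>1 A + emeasure \<mu>2 A"
 shows "mass \<mu> = mass \<mu>1 + mass \<mu>2"
proof -
 have "space M = UNIV" if "finite_borel M" for M :: "'a measure"
  using that sets_eq_imp_space_eq[of M borel] by (auto simp: finite_borel_def)
 moreover have "emeasure M A = ennreal (measure M A)" if "finite_borel M" for M :: "'a measure" and A
  using that finite_measure.emeasure_eq_measure unfolding finite_borel_def by blast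
 ultimately have "ennreal (mass \<mu>) = ennreal (mass \<mu>1 + mass \<mu>2)"
  using assms(4)[of UNIV] assms(1-3) by simp
 then show ?thesis by (subst (asm) ennreal_inj) auto
qed

context
 fixes \<mu> \<mu>eff \<mu>bg :: "'m::polish_space measure"
 assumes fb: "finite_borel \<mu>" "finite_borel \<mu>eff" "finite_borel \<mu>bg"
  and split: "\<And>A. A \<in> sets borel ==> emeasure \<mu> A = emeasure \<mu>eff A + emeasure \<mu>bg A"
  and pos: "0 < mass \<mu>"
begin

lemma label_part_fb: "finite_borel (label_part \<mu>eff \<mu>bg s)" using fb by (cases s) (auto simp: label_part_def)

lemma label_pmf: "pmf (label_law \<mu> \<mu>eff) s = mass (label_part \<mu>eff \<mu>bg s) / mass \<mu>"
proof -
 let ?p = "mass \<mu>eff / mass \<mu>"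
 have p: "0 \<le> ?p" "?p \<le> 1" using pos mass_split[OF fb split] by (auto simp: divide_le_eq_1)
 have inj: "inj (\<lambda>b. if b then Eff else Bg)" by (auto simp: inj_def)
 have "pmf (label_law \<mu> \<mu>eff) ((\<lambda>b. if b then Eff else Bg) b) = pmf (bernoulli_pmf ?p) b" for b
  unfolding label_law_def by (rule pmf_map_inj'[OF inj])
 from this[of True] this[of False] have "pmf (label_law \<mu> \<mu>eff) Eff = ?p" "pmf (label_law \<mu> \<mu>eff) Bg = 1 - ?p"
  using p by simp_all
 moreover have "1 - ?p = mass \<mu>bg / mass \<mu>" using pos mass_split[OF fb split] by (simp add: field_simps)
 ultimately show ?thesis by (cases s) (auto simp: label_part_def)
qed

definition "label_mark = measure_pmf (label_law \<mu> \<mu>eff) \<bind>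
    (\<lambda>s. distr (normalized (label_part \<mu>eff \<mu>bg s)) (count_space UNIV \<Otimes>\<^sub>M borel) (\<lambda>m. (s, m)))"

lemma cycle_law_eq: "cycle_law \<mu> \<mu>eff \<mu>bg = label_mark \<Otimes>\<^sub>M restrict_space lborel {0..1}"
 by (simp add: cycle_law_def label_mark_def label_part_def)

lemma Pair_label_measurable: "(\<lambda>m. (s, m)) \<in> measurable (normalized (label_part \<mu>eff \<mu>bg s)) (count_space UNIV \<Otimes>\<^sub>M borel)"
proof -
 have "sets (normalized (label_part \<mu>eff \<mu>bg s)) = sets borel" using finite_borelD(1)[OF label_part_fb] by (simp add: normalized_def)
 note m = measurable_cong_sets[OF this refl]
 show ?thesis unfolding m by measurable
qed

lemma label_mark_kernel: "(\<lambda>s. distr (normalized (label_part \<mu>eff \<mu>bg s)) (count_space UNIV \<Otimes>\<^sub>M borel) (\<lambda>m. (s, m)))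
 \<in> measurable (measure_pmf (label_law \<mu> \<mu>eff)) (subprob_algebra (count_space UNIV \<Otimes>\<^sub>M borel))"
proof -
 have "distr (normalized (label_part \<mu>eff \<mu>bg s)) (count_space UNIV \<Otimes>\<^sub>M borel) (\<lambda>m. (s, m)) \<in> space (subprob_algebra (count_space UNIV \<Otimes>\<^sub>M borel))" for s
 proof -
  have "subprob_space (normalized (label_part \<mu>eff \<mu>bg s))" using normalized_subprob[OF label_part_fb] by (simp add: space_subprob_algebra)
  then have "subprob_space (distr (normalized (label_part \<mu>eff \<mu>bg s)) (count_space UNIV \<Otimes>\<^sub>M borel) (\<lambda>m. (s, m)))"
   by (rule subprob_space.subprob_space_distr[OF _ Pair_label_measurable]) (simp add: space_pair_measure)
  then show ?thesis by (simp add: space_subprob_algebra)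
 qed
 then show ?thesis by simp
qed

lemma sets_label_mark: "sets label_mark = sets (count_space UNIV \<Otimes>\<^sub>M borel)"
 unfolding label_mark_def by (rule sets_bind) auto

lemma sets_cycle_law: "sets (cycle_law \<mu> \<mu>eff \<mu>bg) = sets cycle_space"
 unfolding cycle_law_eq
 by (rule sets_pair_measure_cong[OF sets_label_mark]) (simp cong: sets_restrict_space_cong)

text \<open>The probability of a label has the mass of its measure in the numerator, and the mark
  law has it in the denominator; they cancel and leave a factor \<open>1 / mass \<mu>\<close>. A
  label of mass 0 contributes 0 to both sides.\<close>

lemma nn_integral_label_mark:
 assumes H: "H \<in> borel_measurable (count_space UNIV \<Otimes>\<^sub>M borel)"
 shows "(\<integral>\<^sup>+a. H a \<partial>label_mark) = ennreal (1 / mass \<mu>) * ((\<integral>\<^sup>+m. H (Eff, m) \<partial>\<mu>eff) + (\<integral>\<^sup>+m. H (Bg, m) \<partial>\<mu>bg))"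
proof -
 have one: "ennreal (pmf (label_law \<mu> \<mu>eff) s) * (\<integral>\<^sup>+a. H a \<partial>distr (normalized (label_part \<mu>eff \<mu>bg s)) (count_space UNIV \<Otimes>\<^sub>M borel) (\<lambda>m. (s, m))) =
   ennreal (1 / mass \<mu>) * (\<integral>\<^sup>+m. H (s, m) \<partial>label_part \<mu>eff \<mu>bg s)" for s
 proof -
  have Hm: "(\<lambda>m. H (s, m)) \<in> borel_measurable (label_part \<mu>eff \<mu>bg s)"
  proof -
   have "(\<lambda>m. H (s, m)) \<in> borel_measurable borel" using H by measurable
   then show ?thesis unfolding measurable_cong_sets[OF finite_borelD(1)[OF label_part_fb] refl] .
  qed
  have "(\<integral>\<^sup>+a. H a \<partial>distr (normalized (label_part \<mu>eff \<mu>bg s)) (count_space UNIV \<Otimes>\<^sub>M borel) (\<lambda>m. (s, m))) = (\<integral>\<^sup>+m. H (s, m) \<partial>normalized (label_part \<mu>eff \<mu>bg s))"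
   by (rule nn_integral_distr[OF Pair_label_measurable]) (use H in simp)
  also have "\<dots> = inverse (emeasure (label_part \<mu>eff \<mu>bg s) (space (label_part \<mu>eff \<mu>bg s))) * (\<integral>\<^sup>+m. H (s, m) \<partial>label_part \<mu>eff \<mu>bg s)"
   unfolding normalized_def using Hm by (rule nn_integral_scale_measure)
  finally have *: "(\<integral>\<^sup>+a. H a \<partial>distr (normalized (label_part \<mu>eff \<mu>bg s)) (count_space UNIV \<Otimes>\<^sub>M borel) (\<lambda>m. (s, m))) = \<dots>" .
  show ?thesis
  proof (cases "mass (label_part \<mu>eff \<mu>bg s) = 0")
   case True
   then have "emeasure (label_part \<mu>eff \<mu>bg s) (space (label_part \<mu>eff \<mu>bg s)) = 0" using finite_borelD(4)[OF label_part_fb[of s]] by simp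
   then have "(\<integral>\<^sup>+m. H (s, m) \<partial>label_part \<mu>eff \<mu>bg s) = 0"
    using nn_integral_null_measure Hm by (subst nn_integral_0_iff_AE) (auto intro: AE_I')
   then show ?thesis using True by (simp add: label_pmf)
  next
   case False
   then have p: "0 < mass (label_part \<mu>eff \<mu>bg s)" by (simp add: zero_less_measure_iff)
   have "ennreal (pmf (label_law \<mu> \<mu>eff) s) * inverse (emeasure (label_part \<mu>eff \<mu>bg s) (space (label_part \<mu>eff \<mu>bg s))) = ennreal (mass (label_part \<mu>eff \<mu>bg s) / mass \<mu> * inverse (mass (label_part \<mu>eff \<mu>bg s)))"
    using p pos unfolding label_pmf finite_borelD(4)[OF label_part_fb[of s]] by (simp add: inverse_ennreal ennreal_mult[symmetric])
   also have "mass (label_part \<mu>eff \<mu>bg s) / mass \<mu> * inverse (mass (label_part \<mu>eff \<mu>bg s)) = 1 / mass \<mu>" using p by (simp add: field_simps)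
   finally show ?thesis unfolding * by (simp add: mult.assoc[symmetric])
  qed
 qed
 have "(\<integral>\<^sup>+a. H a \<partial>label_mark) = (\<integral>\<^sup>+s. (\<integral>\<^sup>+a. H a \<partial>distr (normalized (label_part \<mu>eff \<mu>bg s)) (count_space UNIV \<Otimes>\<^sub>M borel) (\<lambda>m. (s, m))) \<partial>measure_pmf (label_law \<mu> \<mu>eff))"
  unfolding label_mark_def by (rule nn_integral_bind[OF H label_mark_kernel])
 also have "\<dots> = (\<Sum>s\<in>{Eff, Bg}. (\<integral>\<^sup>+a. H a \<partial>distr (normalized (label_part \<mu>eff \<mu>bg s)) (count_space UNIV \<Otimes>\<^sub>M borel) (\<lambda>m. (s, m))) * ennreal (pmf (label_law \<mu> \<mu>eff) s))"
 proof (rule nn_integral_measure_pmf_support)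
  fix s assume "s \<notin> {Eff, Bg}"
  then show "(\<integral>\<^sup>+a. H a \<partial>distr (normalized (label_part \<mu>eff \<mu>bg s)) (count_space UNIV \<Otimes>\<^sub>M borel) (\<lambda>m. (s, m))) = 0"
   by (cases s) auto
 qed simp_all
 also have "\<dots> = ennreal (1 / mass \<mu>) * ((\<integral>\<^sup>+m. H (Eff, m) \<partial>\<mu>eff) + (\<integral>\<^sup>+m. H (Bg, m) \<partial>\<mu>bg))"
  using one[of Eff] one[of Bg] by (simp add: label_part_def mult.commute distrib_left)
 finally show ?thesis .
qed

lemma prob_space_label_mark: "prob_space label_mark"
proof (rule prob_spaceI)
 have "emeasure label_mark (space label_mark) = (\<integral>\<^sup>+a. 1 \<partial>label_mark)" by simp
 also have "\<dots> = ennreal (1 / mass \<mu>) * (ennreal (mass \<mu>eff) + ennreal (mass \<mu>bg))"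
  by (subst nn_integral_label_mark) (use finite_borelD(4)[OF fb(2)] finite_borelD(4)[OF fb(3)] in auto)
 also have "\<dots> = ennreal (1 / mass \<mu> * mass \<mu>)"
  unfolding mass_split[OF fb split, symmetric] using pos mass_split[OF fb split] by (simp add: ennreal_mult[symmetric] ennreal_plus[symmetric] del: ennreal_plus)
 also have "\<dots> = 1" using pos by simp
 finally show "emeasure label_mark (space label_mark) = 1" .
qed

lemma prob_space_unit_interval: "prob_space (restrict_space lborel {0..1::real})"
 by (rule prob_spaceI) (simp add: space_restrict_space emeasure_restrict_space)

lemma prob_space_cycle_law: "prob_space (cycle_law \<mu> \<mu>eff \<mu>bg)"
proof -
 interpret A: prob_space label_mark by (rule prob_space_label_mark)
 interpret B: prob_space "restrict_space lborel {0..1::real}" by (rule prob_space_unit_interval)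
 interpret pair_prob_space label_mark "restrict_space lborel {0..1::real}" ..
 show ?thesis unfolding cycle_law_eq by (rule prob_space_axioms)
qed

text \<open>The expectation of a factor attached to one cycle is a modified weight divided by
  \<open>mass \<mu>\<close>. In canonical expectations this quotient converts the original weights
  into the modified ones; the other two claims place the modified weight of each label between 0 and
  the original one.\<close>

lemma cycle_law_expectation:
 assumes G: "G \<in> borel_measurable cycle_space" and G01: "\<And>a. 0 \<le> G a" "\<And>a. G a \<le> 1"
 shows "(\<integral>\<^sup>+a. ennreal (G a) \<partial>cycle_law \<mu> \<mu>eff \<mu>bg) = ennreal
  (((LINT u:{0..1}|lborel. \<integral>m. G ((Eff, m), u) \<partial>\<mu>eff) + (LINT u:{0..1}|lborel. \<integral>m. G ((Bg, m), u) \<partial>\<mu>bg)) / mass \<mu>)"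
  and "(LINT u:{0..1}|lborel. \<integral>m. G ((s, m), u) \<partial>label_part \<mu>eff \<mu>bg s) \<le> mass (label_part \<mu>eff \<mu>bg s)"
  and "0 \<le> (LINT u:{0..1}|lborel. \<integral>m. G ((s, m), u) \<partial>label_part \<mu>eff \<mu>bg s)"
proof -
 interpret A: prob_space label_mark by (rule prob_space_label_mark)
 interpret B: prob_space "restrict_space lborel {0..1::real}" by (rule prob_space_unit_interval)
 interpret pair_prob_space label_mark "restrict_space lborel {0..1::real}" ..
 let ?U = "restrict_space lborel {0..1::real}"
 have Gm: "G \<in> borel_measurable (label_mark \<Otimes>\<^sub>M ?U)"
  using G unfolding measurable_cong_sets[OF sets_cycle_law[unfolded cycle_law_eq] refl] .
 have Gs: "(\<lambda>(u, m). G ((s, m), u)) \<in> borel_measurable (?U \<Otimes>\<^sub>M label_part \<mu>eff \<mu>bg s)" for s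
 proof -
  have "(\<lambda>z. ((s, snd z), fst z)) \<in> measurable (restrict_space borel {0..1} \<Otimes>\<^sub>M borel) cycle_space" by measurable
  from measurable_compose[OF this G] have *: "(\<lambda>z. G ((s, snd z), fst z)) \<in> borel_measurable (restrict_space borel {0..1} \<Otimes>\<^sub>M borel)" .
  have "sets (?U \<Otimes>\<^sub>M label_part \<mu>eff \<mu>bg s) = sets (restrict_space borel {0..1} \<Otimes>\<^sub>M borel)"
   by (rule sets_pair_measure_cong) (simp_all add: finite_borelD(1)[OF label_part_fb] cong: sets_restrict_space_cong)
  from * show ?thesis unfolding measurable_cong_sets[OF \<open>sets (?U \<Otimes>\<^sub>M label_part \<mu>eff \<mu>bg s) = _\<close> refl] split_beta' .
 qed
 have fm: "finite_measure (label_part \<mu>eff \<mu>bg s)" for s by (rule finite_borelD(3)[OF label_part_fb])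
 have Gsec: "(\<lambda>m. G ((s, m), u)) \<in> borel_measurable (label_part \<mu>eff \<mu>bg s)" if "u \<in> {0..1}" for s u
  using measurable_Pair2[OF Gs[of s], of u] that by (simp add: space_restrict_space)
 have Gint: "integrable (label_part \<mu>eff \<mu>bg s) (\<lambda>m. G ((s, m), u))" if "u \<in> {0..1}" for s u
  using G01 by (intro finite_measure.integrable_const_bound[OF fm, where B = 1] AE_I2 Gsec that) auto
 have in_le: "(\<integral>m. G ((s, m), u) \<partial>label_part \<mu>eff \<mu>bg s) \<le> mass (label_part \<mu>eff \<mu>bg s)" if "u \<in> {0..1}" for s u
 proof -
  interpret finite_measure "label_part \<mu>eff \<mu>bg s" by (rule fm)
  have "(\<integral>m. G ((s, m), u) \<partial>label_part \<mu>eff \<mu>bg s) \<le> (\<integral>m. 1 \<partial>label_part \<mu>eff \<mu>bg s)"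
   using Gint[OF that] G01 by (intro integral_mono) auto
  then show ?thesis by simp
 qed
 have in_ge: "0 \<le> (\<integral>m. G ((s, m), u) \<partial>label_part \<mu>eff \<mu>bg s)" for s u
  using G01 by (intro Bochner_Integration.integral_nonneg) auto
 have om: "(\<lambda>u. \<integral>m. G ((s, m), u) \<partial>label_part \<mu>eff \<mu>bg s) \<in> borel_measurable ?U" for s
 proof -
  interpret finite_measure "label_part \<mu>eff \<mu>bg s" by (rule fm)
  show ?thesis using borel_measurable_lebesgue_integral[OF Gs[of s]] by simp
 qed
 have oi: "integrable ?U (\<lambda>u. \<integral>m. G ((s, m), u) \<partial>label_part \<mu>eff \<mu>bg s)" for s
  using in_le in_ge by (intro B.integrable_const_bound[where B = "mass (label_part \<mu>eff \<mu>bg s)"] AE_I2 om) (auto simp: space_restrict_space)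
 have LI: "(\<integral>u. f u \<partial>?U) = (LINT u:{0..1}|lborel. f u)" for f :: "real => real"
  by (subst integral_restrict_space) (auto simp: set_lebesgue_integral_def)
 show le: "(LINT u:{0..1}|lborel. \<integral>m. G ((s, m), u) \<partial>label_part \<mu>eff \<mu>bg s) \<le> mass (label_part \<mu>eff \<mu>bg s)" for s
 proof -
  have "(\<integral>u. (\<integral>m. G ((s, m), u) \<partial>label_part \<mu>eff \<mu>bg s) \<partial>?U) \<le> (\<integral>u. mass (label_part \<mu>eff \<mu>bg s) \<partial>?U)"
   using in_le oi by (intro integral_mono) (auto simp: space_restrict_space)
  moreover have "measure ?U {0..1} = 1" using B.prob_space by (simp add: space_restrict_space)
  ultimately show ?thesis unfolding LI[symmetric] by (simp add: space_restrict_space)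
 qed
 show ge: "0 \<le> (LINT u:{0..1}|lborel. \<integral>m. G ((s, m), u) \<partial>label_part \<mu>eff \<mu>bg s)" for s
  unfolding LI[symmetric] by (rule Bochner_Integration.integral_nonneg) (rule in_ge)
 have inn: "(\<integral>\<^sup>+u. (\<integral>\<^sup>+m. ennreal (G ((s, m), u)) \<partial>label_part \<mu>eff \<mu>bg s) \<partial>?U) = ennreal (LINT u:{0..1}|lborel. \<integral>m. G ((s, m), u) \<partial>label_part \<mu>eff \<mu>bg s)" for s
 proof -
  have "(\<integral>\<^sup>+u. (\<integral>\<^sup>+m. ennreal (G ((s, m), u)) \<partial>label_part \<mu>eff \<mu>bg s) \<partial>?U) = (\<integral>\<^sup>+u. ennreal (\<integral>m. G ((s, m), u) \<partial>label_part \<mu>eff \<mu>bg s) \<partial>?U)"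
   using G01 Gint by (intro nn_integral_cong nn_integral_eq_integral) (auto simp: space_restrict_space)
  also have "\<dots> = ennreal (\<integral>u. (\<integral>m. G ((s, m), u) \<partial>label_part \<mu>eff \<mu>bg s) \<partial>?U)"
   using in_ge by (intro nn_integral_eq_integral oi) auto
  finally show ?thesis unfolding LI .
 qed
 have secm: "(\<lambda>a. G (a, u)) \<in> borel_measurable (count_space UNIV \<Otimes>\<^sub>M borel)" if "u \<in> {0..1}" for u
  using measurable_Pair1[OF G, of u] that by (simp add: space_restrict_space)
 have "(\<integral>\<^sup>+a. ennreal (G a) \<partial>cycle_law \<mu> \<mu>eff \<mu>bg) = (\<integral>\<^sup>+u. (\<integral>\<^sup>+a. ennreal (G (a, u)) \<partial>label_mark) \<partial>?U)"
  unfolding cycle_law_eq using Gm by (subst nn_integral_snd[symmetric]) auto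
 also have "\<dots> = (\<integral>\<^sup>+u. ennreal (1 / mass \<mu>) * ((\<integral>\<^sup>+m. ennreal (G ((Eff, m), u)) \<partial>label_part \<mu>eff \<mu>bg Eff) + (\<integral>\<^sup>+m. ennreal (G ((Bg, m), u)) \<partial>label_part \<mu>eff \<mu>bg Bg)) \<partial>?U)"
 proof (rule nn_integral_cong)
  fix u assume "u \<in> space ?U"
  then have "u \<in> {0..1}" by (simp add: space_restrict_space)
  from secm[OF this] show "(\<integral>\<^sup>+a. ennreal (G (a, u)) \<partial>label_mark) = ennreal (1 / mass \<mu>) * ((\<integral>\<^sup>+m. ennreal (G ((Eff, m), u)) \<partial>label_part \<mu>eff \<mu>bg Eff) + (\<integral>\<^sup>+m. ennreal (G ((Bg, m), u)) \<partial>label_part \<mu>eff \<mu>bg Bg))"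
   by (subst nn_integral_label_mark) (auto simp: label_part_def)
 qed
 also have "\<dots> = ennreal (1 / mass \<mu>) * ((\<integral>\<^sup>+u. (\<integral>\<^sup>+m. ennreal (G ((Eff, m), u)) \<partial>label_part \<mu>eff \<mu>bg Eff) \<partial>?U) + (\<integral>\<^sup>+u. (\<integral>\<^sup>+m. ennreal (G ((Bg, m), u)) \<partial>label_part \<mu>eff \<mu>bg Bg) \<partial>?U))"
 proof -
  have m: "(\<lambda>u. \<integral>\<^sup>+m. ennreal (G ((s, m), u)) \<partial>label_part \<mu>eff \<mu>bg s) \<in> borel_measurable ?U" for s
  proof -
   interpret finite_measure "label_part \<mu>eff \<mu>bg s" by (rule fm)
   have "(\<lambda>(u, m). ennreal (G ((s, m), u))) \<in> borel_measurable (?U \<Otimes>\<^sub>M label_part \<mu>eff \<mu>bg s)"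
    using measurable_compose[OF Gs[of s] measurable_ennreal] by (simp add: split_beta')
   from borel_measurable_nn_integral_fst[OF this] show ?thesis by simp
  qed
  show ?thesis using m[of Eff] m[of Bg] by (simp add: nn_integral_cmult nn_integral_add)
 qed
 also have "\<dots> = ennreal (((LINT u:{0..1}|lborel. \<integral>m. G ((Eff, m), u) \<partial>label_part \<mu>eff \<mu>bg Eff) + (LINT u:{0..1}|lborel. \<integral>m. G ((Bg, m), u) \<partial>label_part \<mu>eff \<mu>bg Bg)) / mass \<mu>)"
  unfolding inn using ge[of Eff] ge[of Bg] pos
  by (simp add: ennreal_mult[symmetric] ennreal_plus[symmetric] del: ennreal_plus)
 finally show "(\<integral>\<^sup>+a. ennreal (G a) \<partial>cycle_law \<mu> \<mu>eff \<mu>bg) = ennreal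
  (((LINT u:{0..1}|lborel. \<integral>m. G ((Eff, m), u) \<partial>\<mu>eff) + (LINT u:{0..1}|lborel. \<integral>m. G ((Bg, m), u) \<partial>\<mu>bg)) / mass \<mu>)"
  by (simp add: label_part_def)
qed

end

lemma partition_function_pos: "(\<And>j. 1 \<le> j ==> 0 < q j) ==> 0 < partition_function q m"
proof (induction m rule: less_induct)
 case (less m)
 show ?case
 proof (cases "m = 0")
  case False
  have "0 < (\<Sum>j=1..m. q j * partition_function q (m - j))"
   using False less by (intro sum_pos mult_pos_pos) auto
  then show ?thesis unfolding partition_function_rec[symmetric] using False by (simp add: zero_less_mult_iff)
 qed simp
qed

lemma count_weight_mult:
 assumes "\<And>j. j \<in> {1..N} ==> r j = q j * e j"
 shows "count_weight q N c * (\<Prod>j=1..N. e j ^ c j) = count_weight r N c"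
 unfolding count_weight_def prod.distrib[symmetric]
 using assms by (intro prod.cong refl) (simp add: power_mult_distrib power_divide)

locale canonical_model =
 fixes \<mu> \<mu>eff \<mu>bg :: "nat => 'm::polish_space measure" and N :: nat
 assumes fb: "\<And>j. 1 \<le> j ==> finite_borel (\<mu> j)" "\<And>j. 1 \<le> j ==> finite_borel (\<mu>eff j)" "\<And>j. 1 \<le> j ==> finite_borel (\<mu>bg j)"
  and split: "\<And>j A. 1 \<le> j ==> A \<in> sets borel ==> emeasure (\<mu> j) A = emeasure (\<mu>eff j) A + emeasure (\<mu>bg j) A"
  and pos: "\<And>j. 1 \<le> j ==> 0 < mass (\<mu> j)"
begin

definition cycle_index :: "(nat \<times> nat) set" where "cycle_index = {1..N} \<times> {..<N}"

text \<open>\<open>max 1 j\<close> supplies a probability measure also for \<open>j = 0\<close>,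
  where the model assumes nothing; the product is formed over \<open>cycle_index\<close>, where
  \<open>j \<ge> 1\<close> and it makes no difference.\<close>

definition attribute_law :: "nat \<times> nat => ((label \<times> 'm) \<times> real) measure" where
 "attribute_law = (\<lambda>(j, i). cycle_law (\<mu> (max 1 j)) (\<mu>eff (max 1 j)) (\<mu>bg (max 1 j)))"

lemma canonical_space_eq:
 "canonical_space \<mu> \<mu>eff \<mu>bg N = count_law (\<lambda>j. mass (\<mu> j)) N \<Otimes>\<^sub>M PiM cycle_index attribute_law"
proof -
 have "PiM ({1..N} \<times> {..<N}) (\<lambda>(j, i). cycle_law (\<mu> j) (\<mu>eff j) (\<mu>bg j)) = PiM cycle_index attribute_law"
  unfolding cycle_index_def by (intro PiM_cong refl) (auto simp: attribute_law_def max_def)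
 then show ?thesis by (simp add: canonical_space_def)
qed

lemma prob_space_attribute_law: "prob_space (attribute_law x)"
proof -
 obtain j i where x: "x = (j, i)" by (cases x)
 have j: "1 \<le> max 1 j" by simp
 have "prob_space (cycle_law (\<mu> (max 1 j)) (\<mu>eff (max 1 j)) (\<mu>bg (max 1 j)))"
  using fb[OF j] split[OF j] pos[OF j] by (rule prob_space_cycle_law)
 then show ?thesis by (simp add: attribute_law_def x)
qed

lemma sets_attribute_law: "sets (attribute_law x) = sets cycle_space"
proof -
 obtain j i where x: "x = (j, i)" by (cases x)
 have j: "1 \<le> max 1 j" by simp
 have "sets (cycle_law (\<mu> (max 1 j)) (\<mu>eff (max 1 j)) (\<mu>bg (max 1 j))) = sets cycle_space"
  using fb[OF j] split[OF j] pos[OF j] by (rule sets_cycle_law)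
 then show ?thesis by (simp add: attribute_law_def x)
qed

lemma sets_canonical_space:
 "sets (canonical_space \<mu> \<mu>eff \<mu>bg N) = sets (count_space (cycle_counts N) \<Otimes>\<^sub>M PiM cycle_index (\<lambda>_. cycle_space))"
 unfolding canonical_space_eq
 by (intro sets_pair_measure_cong sets_PiM_cong refl)
  (simp_all add: count_law_def sets_point_measure sets_attribute_law)

lemma space_canonical_space:
 "space (canonical_space \<mu> \<mu>eff \<mu>bg N) = cycle_counts N \<times> (PiE cycle_index (\<lambda>_. UNIV \<times> {0..1}))"
 using sets_eq_imp_space_eq[OF sets_canonical_space] by (simp add: space_pair_measure space_PiM space_restrict_space)

text \<open>One factor for each actual cycle, while conceivable cycles that do not occur contribute
  1. Laplace functionals of the process, Laplace transforms of particle numbers and the absence of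
  background cycles in a strip all have this form.\<close>

definition cycle_product :: "(nat => (label \<times> 'm) \<times> real => real) => (nat => nat) \<times> (nat \<times> nat => (label \<times> 'm) \<times> real) => real" where
 "cycle_product G \<omega> = (\<Prod>x\<in>cycle_index. if snd x < fst \<omega> (fst x) then G (fst x) (snd \<omega> x) else 1)"

lemma cycle_product_01:
 assumes "\<And>j a. 0 \<le> G j a" "\<And>j a. G j a \<le> 1"
 shows "0 \<le> cycle_product G \<omega>" "cycle_product G \<omega> \<le> 1"
 unfolding cycle_product_def by (intro prod_nonneg; simp add: assms) (intro prod_le_1; simp add: assms)

lemma cycle_factor_measurable:
 assumes G: "\<And>j. 1 \<le> j ==> G j \<in> borel_measurable cycle_space" and x: "x \<in> cycle_index"
 shows "(\<lambda>\<omega>. if snd x < fst \<omega> (fst x) then G (fst x) (snd \<omega> x) else (b :: real)) \<in> borel_measurable (canonical_space \<mu> \<mu>eff \<mu>bg N)"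
proof -
 let ?C = "count_space (cycle_counts N)" and ?A = "PiM cycle_index (\<lambda>_. cycle_space :: ((label \<times> 'm) \<times> real) measure)"
 have "1 \<le> fst x" using x by (auto simp: cycle_index_def)
 from G[OF this] have Gx: "G (fst x) \<in> borel_measurable cycle_space" .
 have "(\<lambda>a. a x) \<in> measurable ?A cycle_space" using x by (rule measurable_component_singleton)
 then have "(\<lambda>a. G (fst x) (a x)) \<in> borel_measurable ?A" using Gx by (rule measurable_compose)
 then have m1: "(\<lambda>\<omega>. G (fst x) (snd \<omega> x)) \<in> borel_measurable (?C \<Otimes>\<^sub>M ?A)"
  by (rule measurable_compose[OF measurable_snd])
 have "Measurable.pred ?C (\<lambda>c. snd x < c (fst x))" by simp
 then have m2: "Measurable.pred (?C \<Otimes>\<^sub>M ?A) (\<lambda>\<omega>. snd x < fst \<omega> (fst x))"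
  by (rule measurable_compose[OF measurable_fst])
 have "(\<lambda>\<omega>. if snd x < fst \<omega> (fst x) then G (fst x) (snd \<omega> x) else b) \<in> borel_measurable (?C \<Otimes>\<^sub>M ?A)"
  using m1 m2 by measurable
 then show ?thesis unfolding measurable_cong_sets[OF sets_canonical_space refl] .
qed

lemma cycle_product_measurable:
 assumes G: "\<And>j. 1 \<le> j ==> G j \<in> borel_measurable cycle_space"
 shows "cycle_product G \<in> borel_measurable (canonical_space \<mu> \<mu>eff \<mu>bg N)"
 unfolding cycle_product_def using cycle_factor_measurable[OF G] by (intro borel_measurable_prod) auto

text \<open>Given the counts \<open>c\<close>, independence of the attributes gives
  \<open>(\<Prod>j. e j ^ c j)\<close> with \<open>e j = r j / q j\<close>, which turns the weight
  of \<open>c\<close> for \<open>q\<close> into its weight for \<open>r\<close>; summation over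
  \<open>c\<close> yields the modified partition function.\<close>

lemma canonical_nn_expectation:
 assumes G: "\<And>j. 1 \<le> j ==> G j \<in> borel_measurable cycle_space" and G01: "\<And>j a. 0 \<le> G j a" "\<And>j a. G j a \<le> 1"
  and r: "\<And>j. 1 \<le> j ==> r j = (LINT u:{0..1}|lborel. \<integral>m. G j ((Eff, m), u) \<partial>\<mu>eff j) + (LINT u:{0..1}|lborel. \<integral>m. G j ((Bg, m), u) \<partial>\<mu>bg j)"
 shows "(\<integral>\<^sup>+\<omega>. ennreal (cycle_product G \<omega>) \<partial>canonical_space \<mu> \<mu>eff \<mu>bg N) =
  ennreal (partition_function r N / partition_function (\<lambda>j. mass (\<mu> j)) N)"
proof -
 let ?q = "\<lambda>j. mass (\<mu> j)" and ?Z = "partition_function (\<lambda>j. mass (\<mu> j)) N"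
 have Z: "0 < ?Z" using pos by (intro partition_function_pos) auto
 define e where "e j = r j / ?q j" for j
 have r0: "0 \<le> r j" if j: "1 \<le> j" for j
  using cycle_law_expectation(3)[OF fb[OF j] split[OF j] pos[OF j] G[OF j] G01, of Eff]
   cycle_law_expectation(3)[OF fb[OF j] split[OF j] pos[OF j] G[OF j] G01, of Bg]
  unfolding r[OF j] by (simp add: label_part_def)
 have ee: "(\<integral>\<^sup>+a. ennreal (G j a) \<partial>cycle_law (\<mu> j) (\<mu>eff j) (\<mu>bg j)) = ennreal (e j)" if j: "1 \<le> j" for j
  unfolding e_def r[OF j] using fb[OF j] split[OF j] pos[OF j] G[OF j] G01 by (rule cycle_law_expectation(1))
 have e0: "0 \<le> e j" if j: "1 \<le> j" for j using r0[OF j] by (simp add: e_def)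
 interpret A: product_prob_space attribute_law cycle_index
  using prob_space_attribute_law by (intro product_prob_spaceI)
 have sf: "sigma_finite_measure (PiM cycle_index attribute_law)"
  by (rule prob_space_imp_sigma_finite) (intro prob_space_PiM prob_space_attribute_law)
 have finI: "finite cycle_index" by (simp add: cycle_index_def)
 have inner: "(\<integral>\<^sup>+a. ennreal (cycle_product G (c, a)) \<partial>PiM cycle_index attribute_law) = ennreal (\<Prod>j=1..N. e j ^ c j)" if c: "c \<in> cycle_counts N" for c
 proof -
  have "(\<integral>\<^sup>+a. ennreal (cycle_product G (c, a)) \<partial>PiM cycle_index attribute_law) =
   (\<integral>\<^sup>+a. (\<Prod>x\<in>cycle_index. (\<lambda>x y. ennreal (if snd x < c (fst x) then G (fst x) y else 1)) x (a x)) \<partial>PiM cycle_index attribute_law)"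
   unfolding cycle_product_def fst_conv snd_conv using G01 by (intro nn_integral_cong) (subst prod_ennreal, auto)
  also have "\<dots> = (\<Prod>x\<in>cycle_index. \<integral>\<^sup>+y. ennreal (if snd x < c (fst x) then G (fst x) y else 1) \<partial>attribute_law x)"
  proof (rule A.product_nn_integral_prod[OF finI])
   fix x assume "x \<in> cycle_index"
   then have "1 \<le> fst x" by (auto simp: cycle_index_def)
   then show "(\<lambda>y. ennreal (if snd x < c (fst x) then G (fst x) y else 1)) \<in> borel_measurable (attribute_law x)"
    unfolding measurable_cong_sets[OF sets_attribute_law refl] using G[of "fst x"] by measurable
  qed
  also have "\<dots> = (\<Prod>x\<in>cycle_index. ennreal (if snd x < c (fst x) then e (fst x) else 1))"
  proof (rule prod.cong[OF refl])
   fix x assume "x \<in> cycle_index"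
   then obtain j i where x: "x = (j, i)" "1 \<le> j" by (auto simp: cycle_index_def)
   show "(\<integral>\<^sup>+y. ennreal (if snd x < c (fst x) then G (fst x) y else 1) \<partial>attribute_law x) = ennreal (if snd x < c (fst x) then e (fst x) else 1)"
    using ee[OF x(2)] x prob_space.emeasure_space_1[OF prob_space_attribute_law[of x]] by (auto simp: attribute_law_def max_def)
  qed
  also have "\<dots> = ennreal (\<Prod>x\<in>cycle_index. if snd x < c (fst x) then e (fst x) else 1)"
   using e0 by (subst prod_ennreal) (auto simp: cycle_index_def)
  also have "(\<Prod>x\<in>cycle_index. if snd x < c (fst x) then e (fst x) else 1) = (\<Prod>j=1..N. \<Prod>i<N. if i < c j then e j else 1)"
   unfolding cycle_index_def by (subst prod.cartesian_product) (simp add: split_beta')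
  also have "\<dots> = (\<Prod>j=1..N. e j ^ c j)"
  proof (rule prod.cong[OF refl])
   fix j
   have "(\<Prod>i<N. if i < c j then e j else 1) = (\<Prod>i\<in>{..<N} \<inter> {i. i < c j}. e j)"
    by (simp add: prod.If_cases)
   \<comment> \<open>No actual cycle is lost by the restriction to \<open>i < N\<close>, since
     \<open>c j \<le> N\<close>.\<close>
   also have "{..<N} \<inter> {i. i < c j} = {..<c j}" using cycle_counts_le[OF c, of j] by auto
   finally show "(\<Prod>i<N. if i < c j then e j else 1) = e j ^ c j" by simp
  qed
  finally show ?thesis .
 qed
 have "cycle_product G \<in> borel_measurable (count_law ?q N \<Otimes>\<^sub>M PiM cycle_index attribute_law)"
  using cycle_product_measurable[OF G] unfolding canonical_space_eq .
 then have "(\<integral>\<^sup>+\<omega>. ennreal (cycle_product G \<omega>) \<partial>canonical_space \<mu> \<mu>eff \<mu>bg N) =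
   (\<integral>\<^sup>+c. (\<integral>\<^sup>+a. ennreal (cycle_product G (c, a)) \<partial>PiM cycle_index attribute_law) \<partial>count_law ?q N)"
  unfolding canonical_space_eq by (subst sigma_finite_measure.nn_integral_fst[OF sf, symmetric]) auto
 also have "\<dots> = (\<Sum>c\<in>cycle_counts N. ennreal (count_weight ?q N c / ?Z) * ennreal (\<Prod>j=1..N. e j ^ c j))"
  unfolding count_law_def by (subst nn_integral_point_measure_finite) (auto simp: inner)
 also have "\<dots> = (\<Sum>c\<in>cycle_counts N. ennreal (count_weight r N c / ?Z))"
 proof (rule sum.cong[OF refl])
  fix c
  have w0: "0 \<le> count_weight ?q N c" unfolding count_weight_def by (intro prod_nonneg) auto
  have "count_weight ?q N c * (\<Prod>j=1..N. e j ^ c j) = count_weight r N c"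
   using pos by (intro count_weight_mult) (simp add: e_def less_imp_neq[symmetric])
  then have "count_weight ?q N c / ?Z * (\<Prod>j=1..N. e j ^ c j) = count_weight r N c / ?Z" by (simp add: field_simps)
  moreover have "0 \<le> (\<Prod>j=1..N. e j ^ c j)" using e0 by (intro prod_nonneg zero_le_power) auto
  ultimately show "ennreal (count_weight ?q N c / ?Z) * ennreal (\<Prod>j=1..N. e j ^ c j) = ennreal (count_weight r N c / ?Z)"
   using w0 Z by (simp add: ennreal_mult[symmetric])
 qed
 also have "\<dots> = ennreal (\<Sum>c\<in>cycle_counts N. count_weight r N c / ?Z)"
 proof (rule sum_ennreal)
  fix c
  have "0 \<le> count_weight r N c" unfolding count_weight_def using r0 by (intro prod_nonneg) auto
  then show "0 \<le> count_weight r N c / ?Z" using Z by simp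
 qed
 also have "(\<Sum>c\<in>cycle_counts N. count_weight r N c / ?Z) = partition_function r N / ?Z"
  unfolding partition_function_def[of r] by (simp add: sum_divide_distrib)
 finally show ?thesis .
qed

text \<open>The case of constant factors 1, in which the modified weights are the original
  ones.\<close>

lemma prob_space_canonical: "prob_space (canonical_space \<mu> \<mu>eff \<mu>bg N)"
proof (rule prob_spaceI)
 have Z: "0 < partition_function (\<lambda>j. mass (\<mu> j)) N" using pos by (intro partition_function_pos) auto
 have c1: "cycle_product (\<lambda>_ _. 1) \<omega> = 1" for \<omega> by (simp add: cycle_product_def)
 have "emeasure (canonical_space \<mu> \<mu>eff \<mu>bg N) (space (canonical_space \<mu> \<mu>eff \<mu>bg N)) =
  (\<integral>\<^sup>+\<omega>. ennreal (cycle_product (\<lambda>_ _. 1) \<omega>) \<partial>canonical_space \<mu> \<mu>eff \<mu>bg N)" by (simp add: c1)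
 also have "\<dots> = ennreal (partition_function (\<lambda>j. mass (\<mu> j)) N / partition_function (\<lambda>j. mass (\<mu> j)) N)"
 proof (rule canonical_nn_expectation)
  fix j :: nat assume j: "1 \<le> j"
  have "(LINT u:{0..1::real}|lborel. c) = c" for c :: real by (simp add: set_lebesgue_integral_def)
  then show "mass (\<mu> j) = (LINT u:{0..1::real}|lborel. \<integral>m. 1 \<partial>\<mu>eff j) + (LINT u:{0..1::real}|lborel. \<integral>m. 1 \<partial>\<mu>bg j)"
   using mass_split[OF fb[OF j] split[OF j]] by simp
 qed auto
 also have "\<dots> = 1" using Z by simp
 finally show "emeasure (canonical_space \<mu> \<mu>eff \<mu>bg N) (space (canonical_space \<mu> \<mu>eff \<mu>bg N)) = 1" .
qed

lemma canonical_expectation: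
 assumes G: "\<And>j. 1 \<le> j ==> G j \<in> borel_measurable cycle_space" and G01: "\<And>j a. 0 \<le> G j a" "\<And>j a. G j a \<le> 1"
  and r: "\<And>j. 1 \<le> j ==> r j = (LINT u:{0..1}|lborel. \<integral>m. G j ((Eff, m), u) \<partial>\<mu>eff j) + (LINT u:{0..1}|lborel. \<integral>m. G j ((Bg, m), u) \<partial>\<mu>bg j)"
 shows "(\<integral>\<omega>. cycle_product G \<omega> \<partial>canonical_space \<mu> \<mu>eff \<mu>bg N) = partition_function r N / partition_function (\<lambda>j. mass (\<mu> j)) N"
proof -
 have r0: "0 \<le> r j" if j: "1 \<le> j" for j
  using cycle_law_expectation(3)[OF fb[OF j] split[OF j] pos[OF j] G[OF j] G01, of Eff]
   cycle_law_expectation(3)[OF fb[OF j] split[OF j] pos[OF j] G[OF j] G01, of Bg]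
  unfolding r[OF j] by (simp add: label_part_def)
 have "0 \<le> partition_function r N / partition_function (\<lambda>j. mass (\<mu> j)) N"
  using r0 by (intro divide_nonneg_nonneg partition_function_nonneg) auto
 then show ?thesis
  using canonical_nn_expectation[OF G G01 r] cycle_product_01[OF G01] cycle_product_measurable[OF G]
  by (subst integral_eq_nn_integral) auto
qed

end

section \<open>The cycle process as a random point measure\<close>

context canonical_model
begin

context
 fixes V :: real
 assumes V: "0 < V"
begin

definition cycle_point :: "nat => (label \<times> 'm) \<times> real => real \<times> real \<times> 'm" where
 "cycle_point j a = (snd a, real j / V, snd (fst a))"

definition cycles :: "label set => (nat => nat) \<times> (nat \<times> nat => (label \<times> 'm) \<times> real) => (nat \<times> nat) set" where
 "cycles S \<omega> = {x \<in> cycle_index. snd x < fst \<omega> (fst x) \<and> fst (fst (snd \<omega> x)) \<in> S}"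

abbreviation "canonical \<equiv> canonical_space \<mu> \<mu>eff \<mu>bg N"

lemma finite_cycles: "finite (cycles S \<omega>)"
 by (simp add: cycles_def cycle_index_def)

lemma cycle_process_eq:
 assumes \<omega>: "\<omega> \<in> space canonical"
 shows "cycle_process V S \<omega> = distr (count_space (cycles S \<omega>)) borel_E (\<lambda>x. cycle_point (fst x) (snd \<omega> x))"
proof -
 obtain c a where ca: "\<omega> = (c, a)" by (cases \<omega>)
 have c: "c \<in> cycle_counts N" using \<omega> by (simp add: space_canonical_space ca)
 have "{(j, i). 1 \<le> j \<and> i < c j \<and> fst (fst (a (j, i))) \<in> S} = cycles S \<omega>"
 proof -
  have "j \<le> N \<and> i < N" if "i < c j" for j i
   using that c cycle_counts_le[OF c, of j] by (cases "j \<in> {1..N}") (auto simp: cycle_counts_def)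
  then show ?thesis by (auto simp: cycles_def cycle_index_def ca)
 qed
 then show ?thesis unfolding cycle_process_def ca cycle_point_def by (simp add: split_beta')
qed

lemma cycle_point_in_E:
 assumes \<omega>: "\<omega> \<in> space canonical" and x: "x \<in> cycle_index"
 shows "cycle_point (fst x) (snd \<omega> x) \<in> E"
proof -
 have "snd \<omega> \<in> PiE cycle_index (\<lambda>_. UNIV \<times> {0..1})"
  using \<omega> unfolding space_canonical_space mem_Times_iff by (rule conjunct2)
 from PiE_mem[OF this x] have "snd \<omega> x \<in> UNIV \<times> {0..1}" .
 then show ?thesis using x V by (auto simp: cycle_point_def E_def cycle_index_def)
qed

lemma cycle_point_map:
 assumes \<omega>: "\<omega> \<in> space canonical"
 shows "(\<lambda>x. cycle_point (fst x) (snd \<omega> x)) \<in> measurable (count_space (cycles S \<omega>)) borel_E"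
 using cycle_point_in_E[OF \<omega>] by (auto simp: cycles_def)

lemma emeasure_cycle_process:
 assumes \<omega>: "\<omega> \<in> space canonical" and A: "A \<in> sets borel_E"
 shows "emeasure (cycle_process V S \<omega>) A = of_nat (card {x \<in> cycles S \<omega>. cycle_point (fst x) (snd \<omega> x) \<in> A})"
 unfolding cycle_process_eq[OF \<omega>] using finite_cycles
 by (subst emeasure_distr[OF cycle_point_map[OF \<omega>] A])
  (auto simp: emeasure_count_space_finite vimage_def Int_def conj_commute intro!: arg_cong[where f = card])

lemma integral_cycle_process:
 fixes f :: "real \<times> real \<times> 'm => real"
 assumes \<omega>: "\<omega> \<in> space canonical" and f: "f \<in> borel_measurable borel_E"
 shows "(\<integral>z. f z \<partial>cycle_process V S \<omega>) = (\<Sum>x\<in>cycles S \<omega>. f (cycle_point (fst x) (snd \<omega> x)))"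
 unfolding cycle_process_eq[OF \<omega>]
 by (subst integral_distr[OF cycle_point_map[OF \<omega>] f]) (rule lebesgue_integral_count_space_finite[OF finite_cycles])

lemma cycle_process_point_measure:
 assumes \<omega>: "\<omega> \<in> space canonical"
 shows "cycle_process V S \<omega> \<in> locally_finite_point_measures"
proof -
 let ?D = "cycles S \<omega>" and ?p = "\<lambda>x. cycle_point (fst x) (snd \<omega> x)"
 \<comment> \<open>Point measures are defined through index sets of natural numbers, so the pairs
   \<open>(j, i)\<close> are encoded by \<open>to_nat\<close>.\<close>
 let ?I = "to_nat ` ?D"
 have bij: "bij_betw to_nat ?D ?I" by (auto intro: inj_on_imp_bij_betw inj_on_subset[OF inj_to_nat])
 have pE: "?p ` ?D \<subseteq> E" using cycle_point_in_E[OF \<omega>] by (auto simp: cycles_def)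
 have "distr (count_space ?I) borel_E (\<lambda>n. ?p (from_nat n)) = distr (distr (count_space ?D) (count_space ?I) to_nat) borel_E (\<lambda>n. ?p (from_nat n))"
  unfolding distr_bij_count_space[OF bij] ..
 also have "\<dots> = distr (count_space ?D) borel_E (\<lambda>x. ?p (from_nat (to_nat x)))"
  using pE by (subst distr_distr) (auto simp: comp_def)
 finally have "cycle_process V S \<omega> = distr (count_space ?I) borel_E (\<lambda>n. ?p (from_nat n))"
  unfolding cycle_process_eq[OF \<omega>] by simp
 moreover have "(\<lambda>n. ?p (from_nat n)) ` ?I \<subseteq> E" using pE by auto
 ultimately have "is_point_measure (cycle_process V S \<omega>)" unfolding is_point_measure_def by blast
 moreover have "emeasure (cycle_process V S \<omega>) (strip \<delta> R) < \<infinity>" if "0 < \<delta>" for \<delta> R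
  unfolding emeasure_cycle_process[OF \<omega> strip_in_borel_E[OF that]] by (simp add: of_nat_less_top)
 ultimately show ?thesis by (simp add: locally_finite_point_measures_def)
qed

lemma sum_cycles:
 "(\<Sum>x\<in>cycles S \<omega>. f x) = (\<Sum>x\<in>cycle_index. if snd x < fst \<omega> (fst x) then (if fst (fst (snd \<omega> x)) \<in> S then f x else 0) else (0 :: real))"
proof -
 have "finite cycle_index" by (simp add: cycle_index_def)
 then show ?thesis unfolding cycles_def
  by (simp add: sum.inter_filter[symmetric] if_conn cong: if_cong)
qed

lemma exp_sum_cycles:
 "exp (- (\<Sum>x\<in>cycles S \<omega>. g (fst x) (snd \<omega> x))) = cycle_product (\<lambda>j a. if fst (fst a) \<in> S then exp (- g j a) else 1) \<omega>"
proof -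
 have "finite cycle_index" by (simp add: cycle_index_def)
 then show ?thesis unfolding sum_cycles cycle_product_def
  by (simp only: sum_negf[symmetric] exp_sum) (intro prod.cong refl, simp)
qed

lemma cycle_point_measurable: "cycle_point j \<in> measurable cycle_space borel"
proof -
 have "(\<lambda>a. (snd a, real j / V, snd (fst a))) \<in> measurable cycle_space (borel \<Otimes>\<^sub>M (borel \<Otimes>\<^sub>M borel) :: (real \<times> real \<times> 'm) measure)"
 proof (intro measurable_Pair)
  show "(\<lambda>a. snd a) \<in> measurable (cycle_space :: ((label \<times> 'm) \<times> real) measure) borel"
   by (rule measurable_compose[OF measurable_snd]) (rule measurable_restrict_space1, simp)
 qed simp_all
 moreover have "(borel \<Otimes>\<^sub>M (borel \<Otimes>\<^sub>M borel) :: (real \<times> real \<times> 'm) measure) = borel" by (simp add: borel_prod)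
 ultimately show ?thesis unfolding cycle_point_def[abs_def] by (simp only:)
qed

lemma label_pred: "Measurable.pred (cycle_space :: ((label \<times> 'm) \<times> real) measure) (\<lambda>a. fst (fst a) \<in> S)"
proof -
 have "(\<lambda>a. fst (fst a)) \<in> measurable (cycle_space :: ((label \<times> 'm) \<times> real) measure) (count_space UNIV)"
  by (rule measurable_compose[OF measurable_fst measurable_fst])
 then show ?thesis by (rule measurable_compose) simp
qed

lemma integral_cycle_process_measurable:
 fixes h :: "real \<times> real \<times> 'm => real"
 assumes h: "h \<in> borel_measurable borel_E"
 shows "(\<lambda>\<omega>. \<integral>z. h z \<partial>cycle_process V S \<omega>) \<in> borel_measurable canonical"
proof -
 define h' where "h' = (\<lambda>z. if z \<in> E then h z else 0)"
 define G where "G j a = (if fst (fst a) \<in> S then h' (cycle_point j a) else 0)" for j a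
 have Gm: "G j \<in> borel_measurable cycle_space" for j
  unfolding G_def h'_def using label_pred measurable_compose[OF cycle_point_measurable borel_E_extend_measurable[OF h]] by measurable
 have "(\<integral>z. h z \<partial>cycle_process V S \<omega>) = (\<Sum>x\<in>cycle_index. if snd x < fst \<omega> (fst x) then G (fst x) (snd \<omega> x) else 0)" if \<omega>: "\<omega> \<in> space canonical" for \<omega>
  unfolding integral_cycle_process[OF \<omega> h] sum_cycles
  using cycle_point_in_E[OF \<omega>] by (intro sum.cong refl) (simp add: G_def h'_def)
 moreover have "(\<lambda>\<omega>. \<Sum>x\<in>cycle_index. if snd x < fst \<omega> (fst x) then G (fst x) (snd \<omega> x) else 0) \<in> borel_measurable canonical"
  using cycle_factor_measurable[OF Gm] by (intro borel_measurable_sum) auto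
 ultimately show ?thesis by (simp cong: measurable_cong)
qed

lemma cycle_process_measurable: "cycle_process V S \<in> measurable canonical borel_points"
 by (rule measurable_borel_pointsI)
  (auto intro: cycle_process_point_measure integral_cycle_process_measurable test_function_measurable nonneg_test_functionsD)

lemma canonical_laplace:
 assumes h: "h \<in> nonneg_test_functions"
  and r: "\<And>j. 1 \<le> j ==> r j = (LINT u:{0..1}|lborel. \<integral>m. exp (- h (u, real j / V, m)) \<partial>\<mu>eff j) + (LINT u:{0..1}|lborel. \<integral>m. exp (- h (u, real j / V, m)) \<partial>\<mu>bg j)"
 shows "(\<integral>\<xi>. exp (- (\<integral>z. h z \<partial>\<xi>)) \<partial>distr canonical borel_points (cycle_process V UNIV)) =
  partition_function r N / partition_function (\<lambda>j. mass (\<mu> j)) N"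
proof -
 have hm: "h \<in> borel_measurable borel_E" using h test_function_measurable nonneg_test_functionsD by blast
 have h0: "\<And>z. z \<in> E ==> 0 \<le> h z" using h by (simp add: nonneg_test_functions_def)
 \<comment> \<open>The factors must lie in \<open>{0..1}\<close> for all arguments, also off
   \<open>E\<close>, where nothing is known about \<open>h\<close>.\<close>
 define h' where "h' = (\<lambda>z. if z \<in> E then h z else 0)"
 define G where "G j a = exp (- h' (cycle_point j a))" for j a
 have Gm: "G j \<in> borel_measurable cycle_space" for j
  unfolding G_def h'_def using measurable_compose[OF cycle_point_measurable borel_E_extend_measurable[OF hm]] by measurable
 have "(\<integral>\<xi>. exp (- (\<integral>z. h z \<partial>\<xi>)) \<partial>distr canonical borel_points (cycle_process V UNIV)) =
   (\<integral>\<omega>. exp (- (\<integral>z. h z \<partial>cycle_process V UNIV \<omega>)) \<partial>canonical)"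
 proof (rule integral_distr[OF cycle_process_measurable])
  have "(\<lambda>y :: real. exp (- y)) \<in> borel_measurable borel" by measurable
  from measurable_compose[OF integral_test_function_measurable[OF nonneg_test_functionsD[OF h]] this]
  show "(\<lambda>\<xi>. exp (- (\<integral>z. h z \<partial>\<xi>))) \<in> borel_measurable borel_points" .
 qed
 also have "\<dots> = (\<integral>\<omega>. cycle_product G \<omega> \<partial>canonical)"
 proof (rule Bochner_Integration.integral_cong[OF refl])
  fix \<omega> assume \<omega>: "\<omega> \<in> space canonical"
  have "(\<integral>z. h z \<partial>cycle_process V UNIV \<omega>) = (\<Sum>x\<in>cycles UNIV \<omega>. h' (cycle_point (fst x) (snd \<omega> x)))"
   unfolding integral_cycle_process[OF \<omega> hm] using cycle_point_in_E[OF \<omega>] by (intro sum.cong refl) (simp add: h'_def cycles_def)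
  then show "exp (- (\<integral>z. h z \<partial>cycle_process V UNIV \<omega>)) = cycle_product G \<omega>"
   using exp_sum_cycles[where S = UNIV and \<omega> = \<omega> and g = "\<lambda>j a. h' (cycle_point j a)"] by (simp add: G_def[abs_def])
 qed
 also have "\<dots> = partition_function r N / partition_function (\<lambda>j. mass (\<mu> j)) N"
 proof (rule canonical_expectation)
  fix j :: nat assume j: "1 \<le> j"
  have "(LINT u:{0..1}|lborel. \<integral>m. G j ((s, m), u) \<partial>M) = (LINT u:{0..1}|lborel. \<integral>m. exp (- h (u, real j / V, m)) \<partial>M)" for s and M :: "'m measure"
   using j V by (intro set_lebesgue_integral_cong) (auto simp: G_def h'_def cycle_point_def E_def)
  then show "r j = (LINT u:{0..1}|lborel. \<integral>m. G j ((Eff, m), u) \<partial>\<mu>eff j) + (LINT u:{0..1}|lborel. \<integral>m. G j ((Bg, m), u) \<partial>\<mu>bg j)"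
   unfolding r[OF j] by simp
 qed (use Gm h0 in \<open>auto simp: G_def h'_def\<close>)
 finally show ?thesis .
qed

lemma integral_const_unit: "(LINT u:{0..1::real}|lborel. (c :: real)) = c"
 by (simp add: set_lebesgue_integral_def)

text \<open>With the factor 0 for background cycles whose size lies in the strip and 1 for all
  others, the cycle product is the indicator that no such cycle occurs; its expectation deletes
  these lengths from the background weights.\<close>

lemma canonical_strip:
 assumes \<delta>: "0 < \<delta>"
 shows "measure canonical {\<omega> \<in> space canonical. 0 < emeasure (cycle_process V {Bg} \<omega>) (strip \<delta> R)} =
  1 - partition_function (\<lambda>j. mass (\<mu>eff j) + (if \<delta> \<le> real j / V \<and> real j / V \<le> R then 0 else mass (\<mu>bg j))) N /
   partition_function (\<lambda>j. mass (\<mu> j)) N"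
proof -
 interpret prob_space canonical by (rule prob_space_canonical)
 define b where "b j \<longleftrightarrow> \<delta> \<le> real j / V \<and> real j / V \<le> R" for j :: nat
 define G where "G j a = (if fst (fst a) \<in> {Bg} \<and> b j then 0 else 1 :: real)" for j and a :: "(label \<times> 'm) \<times> real"
 have Gm: "G j \<in> borel_measurable cycle_space" for j
  unfolding G_def by (cases "b j") (use label_pred[of "{Bg}"] in \<open>simp_all\<close>)
 let ?A = "{\<omega> \<in> space canonical. 0 < emeasure (cycle_process V {Bg} \<omega>) (strip \<delta> R)}"
 have ev: "indicator ?A \<omega> = 1 - cycle_product G \<omega>" if \<omega>: "\<omega> \<in> space canonical" for \<omega>
 proof -
  let ?D = "{x \<in> cycles {Bg} \<omega>. cycle_point (fst x) (snd \<omega> x) \<in> strip \<delta> R}"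
  have D: "?D = {x \<in> cycles {Bg} \<omega>. b (fst x)}"
   using \<omega> by (auto simp: cycle_point_def strip_def b_def cycles_def space_canonical_space PiE_iff)
    (metis (no_types, lifting) atLeastAtMost_iff mem_Sigma_iff surjective_pairing)+
  have finD: "finite ?D" using finite_cycles[of "{Bg}" \<omega>] by auto
  have e: "emeasure (cycle_process V {Bg} \<omega>) (strip \<delta> R) = of_nat (card ?D)"
   by (rule emeasure_cycle_process[OF \<omega> strip_in_borel_E[OF \<delta>]])
  have finI: "finite cycle_index" by (simp add: cycle_index_def)
  show ?thesis
  proof (cases "?D = {}")
   case True
   then have "emeasure (cycle_process V {Bg} \<omega>) (strip \<delta> R) = 0" unfolding e by (simp only: card.empty of_nat_0)
   then have "\<omega> \<notin> ?A" by simp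
   moreover have "cycle_product G \<omega> = 1"
    unfolding cycle_product_def using True unfolding D by (intro prod.neutral) (auto simp: G_def cycles_def)
   ultimately show ?thesis by simp
  next
   case False
   then have "0 < card ?D" using finD by (simp add: card_gt_0_iff)
   then have "\<omega> \<in> ?A" unfolding e using \<omega> by (simp add: e)
   moreover have "cycle_product G \<omega> = 0"
   proof -
    obtain x where "x \<in> cycles {Bg} \<omega>" "b (fst x)" using False unfolding D by auto
    then have "x \<in> cycle_index" "(if snd x < fst \<omega> (fst x) then G (fst x) (snd \<omega> x) else 1) = 0"
     by (auto simp: cycles_def G_def)
    then show ?thesis unfolding cycle_product_def by (intro prod_zero[OF finI] bexI[of _ x])
   qed
   ultimately show ?thesis by simp
  qed
 qed
 have pm: "cycle_product G \<in> borel_measurable canonical" by (rule cycle_product_measurable[OF Gm])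
 have G01: "0 \<le> G j a" "G j a \<le> 1" for j a by (auto simp: G_def)
 have pi: "integrable canonical (cycle_product G)"
  using cycle_product_01[of G, OF G01] by (intro integrable_const_bound[where B = 1] pm) auto
 have Am: "?A \<in> sets canonical"
 proof -
  have "?A = {\<omega> \<in> space canonical. cycle_product G \<omega> \<noteq> 1}"
  proof (intro set_eqI)
   fix \<omega>
   show "\<omega> \<in> ?A \<longleftrightarrow> \<omega> \<in> {\<omega> \<in> space canonical. cycle_product G \<omega> \<noteq> 1}"
   proof (cases "\<omega> \<in> space canonical")
    case True
    show ?thesis
    proof (cases "\<omega> \<in> ?A")
     case A: True
     have "1 = 1 - cycle_product G \<omega>" using ev[OF True] unfolding indicator_simps(1)[OF A] .
     then show ?thesis using A True by simp
    next
     case A: False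
     have "0 = 1 - cycle_product G \<omega>" using ev[OF True] unfolding indicator_simps(2)[OF A] .
     then show ?thesis using A True by simp
    qed
   qed simp
  qed
  also have "\<dots> \<in> sets canonical" using pm by measurable
  finally show ?thesis .
 qed
 have "measure canonical ?A = (\<integral>\<omega>. indicator ?A \<omega> \<partial>canonical)" using Am by simp
 also have "\<dots> = (\<integral>\<omega>. 1 - cycle_product G \<omega> \<partial>canonical)" by (rule Bochner_Integration.integral_cong[OF refl ev])
 also have "\<dots> = 1 - (\<integral>\<omega>. cycle_product G \<omega> \<partial>canonical)" using pi by (simp add: prob_space)
 also have "(\<integral>\<omega>. cycle_product G \<omega> \<partial>canonical) = partition_function (\<lambda>j. mass (\<mu>eff j) + (if b j then 0 else mass (\<mu>bg j))) N /
   partition_function (\<lambda>j. mass (\<mu> j)) N"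
  using Gm G01 by (intro canonical_expectation) (auto simp: G_def integral_const_unit)
 finally show ?thesis unfolding b_def .
qed

lemma particle_number_eq:
 assumes \<omega>: "\<omega> \<in> space canonical"
 shows "particle_number V S \<omega> = (\<Sum>x\<in>cycles S \<omega>. real (fst x))"
proof -
 have "(\<lambda>z :: real \<times> real \<times> 'm. fst (snd z)) \<in> borel_measurable borel_E"
  unfolding borel_E_def by (intro measurable_restrict_space1 borel_measurable_continuous_onI continuous_intros)
 from integral_cycle_process[OF \<omega> this] show ?thesis
  using V by (simp add: particle_number_def total_size_def cycle_point_def sum_distrib_left)
qed

lemma particle_number_sum:
 assumes \<omega>: "\<omega> \<in> space canonical"
 shows "particle_number V {Eff} \<omega> + particle_number V {Bg} \<omega> = real N"
proof -
 obtain c a where ca: "\<omega> = (c, a)" by (cases \<omega>)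
 have c: "c \<in> cycle_counts N" using \<omega> by (simp add: space_canonical_space ca)
 have "particle_number V {Eff} \<omega> + particle_number V {Bg} \<omega> = (\<Sum>x\<in>cycle_index. if snd x < c (fst x) then real (fst x) else 0)"
  unfolding particle_number_eq[OF \<omega>] sum_cycles sum.distrib[symmetric]
 proof (rule sum.cong[OF refl])
  fix x
  show "(if snd x < fst \<omega> (fst x) then if fst (fst (snd \<omega> x)) \<in> {Eff} then real (fst x) else 0 else 0) +
   (if snd x < fst \<omega> (fst x) then if fst (fst (snd \<omega> x)) \<in> {Bg} then real (fst x) else 0 else 0) =
   (if snd x < c (fst x) then real (fst x) else 0)"
   by (cases "fst (fst (snd \<omega> x))") (auto simp: ca)
 qed
 also have "\<dots> = (\<Sum>j=1..N. \<Sum>i<N. if i < c j then real j else 0)"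
  unfolding cycle_index_def by (subst sum.cartesian_product) (simp add: split_beta')
 also have "\<dots> = (\<Sum>j=1..N. real (j * c j))"
 proof (rule sum.cong[OF refl])
  fix j
  have "(\<Sum>i<N. if i < c j then real j else 0) = (\<Sum>i\<in>{..<N} \<inter> {i. i < c j}. real j)"
   by (simp add: sum.If_cases)
  also have "{..<N} \<inter> {i. i < c j} = {..<c j}" using cycle_counts_le[OF c, of j] by auto
  finally show "(\<Sum>i<N. if i < c j then real j else 0) = real (j * c j)" by simp
 qed
 also have "\<dots> = real N" using c by (simp only: cycle_counts_def mem_Collect_eq of_nat_sum[symmetric])
 finally show ?thesis .
qed

text \<open>The particle number is additive over cycles, whence a factor
  \<open>exp (- s * j / V)\<close> for each background cycle of length \<open>j\<close>.\<close>

lemma particle_number_laplace: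
 assumes s: "0 \<le> s"
 shows "(\<integral>\<omega>. exp (- s * (particle_number V {Bg} \<omega> / V)) \<partial>canonical) =
  partition_function (\<lambda>j. mass (\<mu>eff j) + exp (- s * (real j / V)) * mass (\<mu>bg j)) N / partition_function (\<lambda>j. mass (\<mu> j)) N"
proof -
 define G where "G j a = (if fst (fst a) \<in> {Bg} then exp (- (s * (real j / V))) else 1)" for j :: nat and a :: "(label \<times> 'm) \<times> real"
 have Gm: "G j \<in> borel_measurable cycle_space" for j
  unfolding G_def using label_pred[of "{Bg}"] by simp
 have "(\<integral>\<omega>. exp (- s * (particle_number V {Bg} \<omega> / V)) \<partial>canonical) = (\<integral>\<omega>. cycle_product G \<omega> \<partial>canonical)"
 proof (rule Bochner_Integration.integral_cong[OF refl])
  fix \<omega> assume \<omega>: "\<omega> \<in> space canonical"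
  have "s * (particle_number V {Bg} \<omega> / V) = (\<Sum>x\<in>cycles {Bg} \<omega>. s * (real (fst x) / V))"
   unfolding particle_number_eq[OF \<omega>] by (simp add: sum_distrib_left sum_divide_distrib)
  then show "exp (- s * (particle_number V {Bg} \<omega> / V)) = cycle_product G \<omega>"
   using exp_sum_cycles[where S = "{Bg}" and \<omega> = \<omega> and g = "\<lambda>j a. s * (real j / V)"] by (simp add: G_def[abs_def])
 qed
 also have "\<dots> = partition_function (\<lambda>j. mass (\<mu>eff j) + exp (- s * (real j / V)) * mass (\<mu>bg j)) N / partition_function (\<lambda>j. mass (\<mu> j)) N"
 proof (rule canonical_expectation)
  show "G j a \<le> 1" for j a using s V by (simp add: G_def)
  fix j :: nat assume j: "1 \<le> j"
  show "mass (\<mu>eff j) + exp (- s * (real j / V)) * mass (\<mu>bg j) = (LINT u:{0..1}|lborel. \<integral>m. G j ((Eff, m), u) \<partial>\<mu>eff j) + (LINT u:{0..1}|lborel. \<integral>m. G j ((Bg, m), u) \<partial>\<mu>bg j)"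
   by (simp add: G_def integral_const_unit mult.commute)
 qed (use Gm in \<open>auto simp: G_def\<close>)
 finally show ?thesis .
qed

lemma particle_number_measurable: "particle_number V S \<in> borel_measurable canonical"
proof -
 have "(\<lambda>z :: real \<times> real \<times> 'm. fst (snd z)) \<in> borel_measurable borel_E"
  unfolding borel_E_def by (intro measurable_restrict_space1 borel_measurable_continuous_onI continuous_intros)
 from integral_cycle_process_measurable[OF this, of S] show ?thesis
  unfolding particle_number_def[abs_def] total_size_def by measurable
qed

lemma particle_number_nonneg: "\<omega> \<in> space canonical ==> 0 \<le> particle_number V S \<omega>"
 unfolding particle_number_eq by (intro sum_nonneg) auto

end

end

section \<open>Tilted cycle weights\<close>

text \<open>The exponents of normalization and generating function are merged into one series.
  Separately each can grow like \<open>ln V\<close> with the volume, whereas the terms of the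
  difference are nonnegative and, where \<open>q'\<close> and \<open>q\<close> agree, proportional
  to \<open>1 - y ^ j\<close>.\<close>

lemma partition_function_weighted_sums:
 fixes q q' :: "nat => real"
 assumes q: "\<And>j. 1 \<le> j ==> 0 \<le> q' j" "\<And>j. 1 \<le> j ==> q' j \<le> q j" and r: "0 \<le> r" and y: "0 \<le> y" "y \<le> 1"
  and s: "summable (\<lambda>j. q (Suc j) * r ^ Suc j / real (Suc j))"
 shows "(\<lambda>m. exp (- (\<Sum>j. q (Suc j) * r ^ Suc j / real (Suc j))) * partition_function (\<lambda>j. q' j * r ^ j) m * y ^ m) sums
  exp (- (\<Sum>j. (q (Suc j) - q' (Suc j) * y ^ Suc j) * r ^ Suc j / real (Suc j)))"
proof -
 let ?b = "\<lambda>j. q (Suc j) * r ^ Suc j / real (Suc j)"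
 let ?a = "\<lambda>j. (q' (Suc j) * r ^ Suc j * y ^ Suc j) / real (Suc j)"
 have ale: "\<bar>?a j\<bar> \<le> ?b j" for j
 proof -
  have "q' (Suc j) * r ^ Suc j * y ^ Suc j \<le> q (Suc j) * r ^ Suc j * 1"
   using q(1)[of "Suc j"] q(2)[of "Suc j"] r y by (intro mult_mono power_le_one mult_nonneg_nonneg zero_le_power) auto
  moreover have "0 \<le> q' (Suc j) * r ^ Suc j * y ^ Suc j"
   using q(1)[of "Suc j"] r y by (intro mult_nonneg_nonneg zero_le_power) auto
  ultimately show ?thesis by (simp add: divide_right_mono abs_mult abs_divide)
 qed
 have sa: "summable ?a" by (rule summable_comparison_test'[OF s, of 0]) (use ale in auto)
 have "(\<lambda>m. partition_function (\<lambda>j. q' j * r ^ j * y ^ j) m) sums exp (suminf ?a)"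
 proof (rule partition_function_sums)
  fix j :: nat assume "1 \<le> j" then show "0 \<le> q' j * r ^ j * y ^ j" using q(1) r y by simp
 qed (rule summable_sums[OF sa])
 then have "(\<lambda>m. exp (- suminf ?b) * (partition_function (\<lambda>j. q' j * r ^ j) m * y ^ m)) sums (exp (- suminf ?b) * exp (suminf ?a))"
  unfolding partition_function_tilt[of "\<lambda>j. q' j * r ^ j" y] by (intro sums_mult) (simp add: mult.commute)
 moreover have "exp (- suminf ?b) * exp (suminf ?a) = exp (- (\<Sum>j. ?b j - ?a j))"
  using suminf_diff[OF s sa] by (simp add: exp_add[symmetric])
 moreover have "?b j - ?a j = (q (Suc j) - q' (Suc j) * y ^ Suc j) * r ^ Suc j / real (Suc j)" for j
  unfolding diff_divide_distrib[symmetric] by (simp add: algebra_simps del: of_nat_Suc power_Suc)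
 ultimately show ?thesis by (simp add: mult.assoc)
qed

lemma exp_power_mult: "exp (- c / v) ^ m = exp (- c * (real m / v))" for c v :: real
 by (simp add: exp_of_nat_mult[symmetric] mult.commute)

lemma summable_tilted:
 fixes q :: "nat => real"
 assumes q: "\<And>j. 1 \<le> j ==> 0 \<le> q j" "\<And>j. 1 \<le> j ==> q j \<le> C" and r: "0 \<le> r" "r < 1"
 shows "summable (\<lambda>j. q (Suc j) * r ^ Suc j / real (Suc j))"
proof (rule summable_comparison_test'[where N = 0])
 show "summable (\<lambda>j. \<bar>C\<bar> * r ^ Suc j)" using r by (intro summable_mult summable_Suc_iff[THEN iffD2] summable_geometric) auto
 fix j :: nat
 have "q (Suc j) * r ^ Suc j / real (Suc j) \<le> q (Suc j) * r ^ Suc j / 1"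
  using q(1)[of "Suc j"] r by (intro divide_left_mono mult_nonneg_nonneg zero_le_power) auto
 also have "\<dots> \<le> \<bar>C\<bar> * r ^ Suc j" using q(2)[of "Suc j"] r by (simp add: mult_right_mono)
 finally show "norm (q (Suc j) * r ^ Suc j / real (Suc j)) \<le> \<bar>C\<bar> * r ^ Suc j"
  using q(1)[of "Suc j"] r by (simp add: abs_mult)
qed

text \<open>For independent Poisson counts with means
  \<open>q j * exp (- \<kappa> / v) ^ j / j\<close>, this is the probability of total length
  \<open>m\<close>, each cycle of length \<open>j\<close> being weighted by
  \<open>q' j / q j\<close>. The family \<open>q\<close> enters only through the normalization;
  \<open>q' = q\<close> gives the probability itself.\<close>

definition cycle_weight :: "real => real => (nat => real) => (nat => real) => nat => real" where
 "cycle_weight v \<kappa> q q' m = exp (- (\<Sum>j. q (Suc j) * exp (- \<kappa> / v) ^ Suc j / real (Suc j))) *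
  partition_function (\<lambda>j. q' j * exp (- \<kappa> / v) ^ j) m"

lemma cycle_weight_nonneg: "(\<And>j. 1 \<le> j ==> 0 \<le> q' j) ==> 0 \<le> cycle_weight v \<kappa> q q' m"
 unfolding cycle_weight_def by (intro mult_nonneg_nonneg partition_function_nonneg) auto

lemma cycle_weight_mono:
 assumes "\<And>j. 1 \<le> j ==> 0 \<le> q' j" "\<And>j. 1 \<le> j ==> q' j \<le> q'' j"
 shows "cycle_weight v \<kappa> q q' m \<le> cycle_weight v \<kappa> q q'' m"
 unfolding cycle_weight_def using assms by (intro mult_left_mono partition_function_mono mult_right_mono) auto

lemma cycle_weight_rec:
 "real m * cycle_weight v \<kappa> q q' m = (\<Sum>j=1..m. (q' j * exp (- \<kappa> / v) ^ j) * cycle_weight v \<kappa> q q' (m - j))"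
proof -
 let ?c = "exp (- (\<Sum>j. q (Suc j) * exp (- \<kappa> / v) ^ Suc j / real (Suc j)))" and ?q = "\<lambda>j. q' j * exp (- \<kappa> / v) ^ j"
 have "real m * cycle_weight v \<kappa> q q' m = ?c * (real m * partition_function ?q m)" by (simp add: cycle_weight_def)
 also have "\<dots> = (\<Sum>j=1..m. ?c * (?q j * partition_function ?q (m - j)))"
  unfolding partition_function_rec sum_distrib_left ..
 finally show ?thesis by (simp add: cycle_weight_def mult.left_commute)
qed

lemma cycle_weight_sums:
 assumes "\<And>j. 1 \<le> j ==> 0 \<le> q' j" "\<And>j. 1 \<le> j ==> q' j \<le> q j" "0 \<le> y" "y \<le> 1"
  and "summable (\<lambda>j. q (Suc j) * exp (- \<kappa> / v) ^ Suc j / real (Suc j))"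
 shows "(\<lambda>m. cycle_weight v \<kappa> q q' m * y ^ m) sums
  exp (- (\<Sum>j. (q (Suc j) - q' (Suc j) * y ^ Suc j) * exp (- \<kappa> / v) ^ Suc j / real (Suc j)))"
 unfolding cycle_weight_def using assms by (intro partition_function_weighted_sums) auto

lemma cycle_weight_sum_le_1:
 assumes q: "\<And>j. 1 \<le> j ==> 0 \<le> q' j" "\<And>j. 1 \<le> j ==> q' j \<le> q j"
  and s: "summable (\<lambda>j. q (Suc j) * exp (- \<kappa> / v) ^ Suc j / real (Suc j))"
 shows "summable (cycle_weight v \<kappa> q q')" "suminf (cycle_weight v \<kappa> q q') \<le> 1"
proof -
 have S: "(\<lambda>m. cycle_weight v \<kappa> q q' m * 1 ^ m) sums
  exp (- (\<Sum>j. (q (Suc j) - q' (Suc j) * 1 ^ Suc j) * exp (- \<kappa> / v) ^ Suc j / real (Suc j)))"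
  by (rule cycle_weight_sums[OF q _ _ s]) auto
 then show "summable (cycle_weight v \<kappa> q q')" by (simp add: sums_iff)
 have t: "0 \<le> (q (Suc j) - q' (Suc j) * 1 ^ Suc j) * exp (- \<kappa> / v) ^ Suc j / real (Suc j)" (is "0 \<le> ?t j") for j
  using q(2)[of "Suc j"] by simp
 have le: "?t j \<le> q (Suc j) * exp (- \<kappa> / v) ^ Suc j / real (Suc j)" for j
  using q(1)[of "Suc j"] by (intro divide_right_mono mult_right_mono) auto
 have "norm (?t j) \<le> q (Suc j) * exp (- \<kappa> / v) ^ Suc j / real (Suc j)" for j
  unfolding real_norm_def abs_of_nonneg[OF t] by (rule le)
 then have "summable ?t" by (intro summable_comparison_test'[OF s, of 0])
 from suminf_nonneg[OF this t] show "suminf (cycle_weight v \<kappa> q q') \<le> 1" using S by (simp add: sums_iff)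
qed

text \<open>The prefactors do not involve the weights \<open>a\<close> and \<open>b\<close>;
  modified and original partition functions share them, so they cancel in quotients.\<close>

lemma partition_function_split_weights:
 "partition_function (\<lambda>j. a j + b j) N = exp (\<kappa> / v) ^ N *
  exp (\<Sum>j. q (Suc j) * exp (- \<kappa> / v) ^ Suc j / real (Suc j)) * exp (\<Sum>j. q' (Suc j) * exp (- \<kappa> / v) ^ Suc j / real (Suc j)) *
  (\<Sum>k\<le>N. cycle_weight v \<kappa> q' b k * cycle_weight v \<kappa> q a (N - k))"
proof -
 let ?r = "exp (- \<kappa> / v)"
 let ?A = "\<Sum>j. q (Suc j) * ?r ^ Suc j / real (Suc j)" and ?B = "\<Sum>j. q' (Suc j) * ?r ^ Suc j / real (Suc j)"
 have e: "exp (\<kappa> / v) ^ N * ?r ^ N = 1" by (simp add: power_mult_distrib[symmetric] exp_add[symmetric])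
 have "partition_function (\<lambda>j. a j + b j) N = exp (\<kappa> / v) ^ N * partition_function (\<lambda>j. (a j + b j) * ?r ^ j) N"
  unfolding partition_function_tilt mult.assoc[symmetric] e by simp
 also have "(\<lambda>j. (a j + b j) * ?r ^ j) = (\<lambda>j. b j * ?r ^ j + a j * ?r ^ j)" by (simp add: distrib_right add.commute)
 also have "partition_function \<dots> N = (\<Sum>k\<le>N. partition_function (\<lambda>j. b j * ?r ^ j) k * partition_function (\<lambda>j. a j * ?r ^ j) (N - k))"
  by (rule partition_function_add)
 also have "\<dots> = (\<Sum>k\<le>N. exp ?A * exp ?B * (cycle_weight v \<kappa> q' b k * cycle_weight v \<kappa> q a (N - k)))"
 proof (rule sum.cong[OF refl])
  fix k
  have 1: "exp ?A * exp (- ?A) = 1" "exp ?B * exp (- ?B) = 1" by (simp_all add: exp_add[symmetric])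
  have "exp ?A * exp ?B * (exp (- ?B) * x * (exp (- ?A) * y)) = (exp ?A * exp (- ?A)) * (exp ?B * exp (- ?B)) * (x * y)" for x y :: real
   by (simp only: ac_simps)
  then have "exp ?A * exp ?B * (exp (- ?B) * x * (exp (- ?A) * y)) = x * y" for x y :: real
   unfolding 1 by simp
  then show "partition_function (\<lambda>j. b j * ?r ^ j) k * partition_function (\<lambda>j. a j * ?r ^ j) (N - k) =
    exp ?A * exp ?B * (cycle_weight v \<kappa> q' b k * cycle_weight v \<kappa> q a (N - k))"
   unfolding cycle_weight_def by simp
 qed
 also have "\<dots> = exp ?A * exp ?B * (\<Sum>k\<le>N. cycle_weight v \<kappa> q' b k * cycle_weight v \<kappa> q a (N - k))"
  by (simp add: sum_distrib_left)
 finally show ?thesis by (simp add: mult.assoc)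
qed

text \<open>A Riemann sum over the lattice \<open>j / V\<close> whose integrand has to be dominated
  at both ends. Near 0 the weights agree, so that \<open>1 - exp (- t * x)\<close> compensates the
  singularity \<open>1 / x\<close>; at infinity the tilt \<open>exp (- \<kappa> * x)\<close>
  decides.\<close>

lemma laplace_exponent_tendsto:
 fixes V :: "nat => real" and q q' :: "nat => nat => real" and \<phi> \<psi> :: "real => real"
 assumes V: "\<And>n. 0 < V n" "filterlim V at_top sequentially" and \<kappa>: "0 < \<kappa>" and t: "0 \<le> t"
  and q0: "\<And>n j. 1 \<le> j ==> 0 \<le> q' n j" "\<And>n j. 1 \<le> j ==> q' n j \<le> q n j" "\<And>n j. 1 \<le> j ==> q n j \<le> C"
  and \<delta>: "0 < \<delta>" "\<And>n j. 1 \<le> j ==> real j / V n < \<delta> ==> q' n j = q n j"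
  and c: "continuous_on {0<..} \<phi>" "continuous_on {0<..} \<psi>"
  and lq: "\<And>\<delta> R \<epsilon>. 0 < \<delta> ==> \<delta> < R ==> 0 < \<epsilon> ==>
   \<forall>\<^sub>F n in sequentially. \<forall>j. \<delta> \<le> real j / V n \<and> real j / V n \<le> R \<longrightarrow> \<bar>q n j - \<phi> (real j / V n)\<bar> < \<epsilon>"
  and lq': "\<And>\<delta> R \<epsilon>. 0 < \<delta> ==> \<delta> < R ==> 0 < \<epsilon> ==>
   \<forall>\<^sub>F n in sequentially. \<forall>j. \<delta> \<le> real j / V n \<and> real j / V n \<le> R \<longrightarrow> \<bar>q' n j - \<psi> (real j / V n)\<bar> < \<epsilon>"
 shows "(\<lambda>n. \<Sum>j. (q n (Suc j) - q' n (Suc j) * exp (- t / V n) ^ Suc j) * exp (- \<kappa> / V n) ^ Suc j / real (Suc j))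
  \<longlonglongrightarrow> (LINT x:{0<..}|lborel. (\<phi> x - \<psi> x * exp (- t * x)) * exp (- \<kappa> * x) / x)"
proof -
 define G where "G n j = (q n j - q' n j * exp (- t * (real j / V n))) * exp (- \<kappa> * (real j / V n)) / (real j / V n)" for n j
 define g where "g x = indicator {0<..} x *\<^sub>R ((\<phi> x - \<psi> x * exp (- t * x)) * exp (- \<kappa> * x) / x)" for x
 have C: "0 \<le> C" using q0[of 1 0] by linarith
 have pt: "(\<lambda>n. q n (nat \<lfloor>x * V n\<rfloor>)) \<longlonglongrightarrow> \<phi> x"
  if x: "0 < x" and c: "continuous_on {0<..} \<phi>" and lq: "\<And>\<delta> R \<epsilon>. 0 < \<delta> ==> \<delta> < R ==> 0 < \<epsilon> ==>
   \<forall>\<^sub>F n in sequentially. \<forall>j. \<delta> \<le> real j / V n \<and> real j / V n \<le> R \<longrightarrow> \<bar>q n j - \<phi> (real j / V n)\<bar> < \<epsilon>"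
  for q :: "nat => nat => real" and \<phi> x
 proof -
  note y = floor_quotient_tendsto[OF V x]
  have "isCont \<phi> x" using c x by (simp add: continuous_on_eq_continuous_at)
  from isCont_tendsto_compose[OF this y(1)] have 1: "(\<lambda>n. \<phi> (real (nat \<lfloor>x * V n\<rfloor>) / V n)) \<longlonglongrightarrow> \<phi> x" .
  have "(\<lambda>n. q n (nat \<lfloor>x * V n\<rfloor>) - \<phi> (real (nat \<lfloor>x * V n\<rfloor>) / V n)) \<longlonglongrightarrow> 0"
  proof (rule tendstoI)
   fix e :: real assume e: "0 < e"
   have "x / 2 < 2 * x" using x by simp
   from lq[OF _ this e] x have "\<forall>\<^sub>F n in sequentially. \<forall>j. x / 2 \<le> real j / V n \<and> real j / V n \<le> 2 * x \<longrightarrow> \<bar>q n j - \<phi> (real j / V n)\<bar> < e" by simp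
   then show "\<forall>\<^sub>F n in sequentially. dist (q n (nat \<lfloor>x * V n\<rfloor>) - \<phi> (real (nat \<lfloor>x * V n\<rfloor>) / V n)) 0 < e"
    using y(2)
   proof eventually_elim
    case (elim n)
    show ?case using elim(1) floor_quotient_bounds[OF V(1) elim(2)] x by (auto simp: dist_real_def)
   qed
  qed
  from tendsto_add[OF this 1] show ?thesis by simp
 qed
 have "(\<lambda>n. \<Sum>j. G n (Suc j) / V n) \<longlonglongrightarrow> (LINT x:{0<..}|lborel. g x)"
 \<comment> \<open>The integrand without the tilt is at most \<open>C * t\<close> below
   \<open>\<delta>\<close> and at most \<open>C / \<delta>\<close> above. The rate drops to
   \<open>\<kappa> / 2\<close> because the lattice point may be as small as
   \<open>x / 2\<close>.\<close>
 proof (rule riemann_sum_tendsto[OF V(1), where B = "\<lambda>x. 2 * C * (t + 1 / \<delta>) * exp (- (\<kappa> / 2) * x)"])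
  fix x :: real assume x: "0 < x"
  note y = floor_quotient_tendsto[OF V x]
  have "(\<lambda>n. G n (nat \<lfloor>x * V n\<rfloor>)) \<longlonglongrightarrow> (\<phi> x - \<psi> x * exp (- t * x)) * exp (- \<kappa> * x) / x"
   unfolding G_def by (intro tendsto_intros pt[OF x c(1) lq] pt[OF x c(2) lq'] y(1)) (use x in auto)
  then have "(\<lambda>n. G n (nat \<lfloor>x * V n\<rfloor>)) \<longlonglongrightarrow> g x" using x by (simp add: g_def)
  then show "(\<lambda>n. indicator {1 / V n..} x * G n (nat \<lfloor>x * V n\<rfloor>)) \<longlonglongrightarrow> g x"
   by (rule Lim_transform_eventually) (use y(2) in \<open>eventually_elim, simp\<close>)
 next
  show "\<forall>\<^sub>F n in sequentially. \<forall>x\<ge>1 / V n. \<bar>G n (nat \<lfloor>x * V n\<rfloor>)\<bar> \<le> 2 * C * (t + 1 / \<delta>) * exp (- (\<kappa> / 2) * x)"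
  proof (intro always_eventually allI impI)
   fix n x assume x: "1 / V n \<le> x"
   define j where "j = nat \<lfloor>x * V n\<rfloor>"
   define y where "y = real j / V n"
   note b = floor_quotient_bounds[OF V(1) x, folded j_def, folded y_def]
   have x0: "0 < x" using x V(1)[of n] by (meson divide_pos_pos less_le_trans zero_less_one)
   have y0: "0 < y" using b(1) x0 by linarith
   note j1 = b(4)
   have q1: "0 \<le> q' n j" "q' n j \<le> q n j" "q n j \<le> C" using q0 j1 by auto
   have ey: "1 - exp (- (t * y)) \<le> t * y" "0 \<le> 1 - exp (- (t * y))"
    using exp_ge_add_one_self[of "- (t * y)"] t y0 by auto
   have "\<bar>q n j - q' n j * exp (- t * y)\<bar> \<le> C * (t + 1 / \<delta>) * y"
   proof (cases "y < \<delta>")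
    case True
    then have "q' n j = q n j" using \<delta>(2)[OF j1] by (simp add: y_def)
    then have "q n j - q' n j * exp (- t * y) = q n j * (1 - exp (- (t * y)))" by (simp add: algebra_simps)
    moreover have "0 \<le> q n j * (1 - exp (- (t * y)))" using q1 ey by (intro mult_nonneg_nonneg) auto
    ultimately have "\<bar>q n j - q' n j * exp (- t * y)\<bar> = q n j * (1 - exp (- (t * y)))" by simp
    also have "\<dots> \<le> C * (t * y)" using q1 ey by (intro mult_mono) auto
    also have "\<dots> \<le> C * (t + 1 / \<delta>) * y" using C y0 \<delta>(1) by (simp add: algebra_simps)
    finally show ?thesis .
   next
    case False
    have "q' n j * exp (- t * y) \<le> q n j * 1" using q1 t y0 by (intro mult_mono) auto
    moreover have "0 \<le> q' n j * exp (- t * y)" using q1 by simp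
    ultimately have "\<bar>q n j - q' n j * exp (- t * y)\<bar> \<le> C" using q1 by linarith
    also have "\<dots> = C * 1" by simp
    also have "\<dots> \<le> C * (y / \<delta>)" using False \<delta>(1) C by (intro mult_left_mono) auto
    also have "\<dots> \<le> C * (t + 1 / \<delta>) * y" using C y0 t by (simp add: algebra_simps)
    finally show ?thesis .
   qed
   then have "\<bar>q n j - q' n j * exp (- t * y)\<bar> / y \<le> C * (t + 1 / \<delta>)" using y0 by (simp add: pos_divide_le_eq)
   moreover have "exp (- \<kappa> * y) \<le> exp (- (\<kappa> / 2) * x)"
   proof -
    have "\<kappa> * (x / 2) \<le> \<kappa> * y" using b(1) \<kappa> by (intro mult_left_mono) auto
    then show ?thesis by simp
   qed
   ultimately have "\<bar>q n j - q' n j * exp (- t * y)\<bar> / y * exp (- \<kappa> * y) \<le> C * (t + 1 / \<delta>) * exp (- (\<kappa> / 2) * x)"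
    using C t \<delta>(1) y0 by (intro mult_mono) auto
   also have "\<dots> \<le> 2 * C * (t + 1 / \<delta>) * exp (- (\<kappa> / 2) * x)" using C t \<delta>(1) by (intro mult_right_mono) auto
   finally show "\<bar>G n (nat \<lfloor>x * V n\<rfloor>)\<bar> \<le> 2 * C * (t + 1 / \<delta>) * exp (- (\<kappa> / 2) * x)"
    unfolding G_def j_def[symmetric] y_def[symmetric] using y0 by (simp add: abs_mult abs_divide)
  qed
  have "set_integrable lborel {0<..} (\<lambda>x. exp (- (x * (\<kappa> / 2))))"
   using \<kappa> by (intro integrable_I0i_exp_mscale) simp
  then have "set_integrable lborel {0<..} (\<lambda>x. (2 * C * (t + 1 / \<delta>)) * exp (- (x * (\<kappa> / 2))))"
   by (rule set_integrable_mult_right)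
  then show "set_integrable lborel {0<..} (\<lambda>x. 2 * C * (t + 1 / \<delta>) * exp (- (\<kappa> / 2) * x))"
   by (simp add: mult.commute)
  have "continuous_on {0<..} (\<lambda>x. (\<phi> x - \<psi> x * exp (- t * x)) * exp (- \<kappa> * x) / x)"
   by (intro continuous_intros c) auto
  then show "g \<in> borel_measurable borel"
   unfolding g_def by (rule borel_measurable_continuous_on_indicator[rotated]) auto
 qed
 moreover have "G n (Suc j) / V n = (q n (Suc j) - q' n (Suc j) * exp (- t / V n) ^ Suc j) * exp (- \<kappa> / V n) ^ Suc j / real (Suc j)" for n j
  unfolding G_def exp_power_mult using V(1)[of n] by simp
 moreover have "(LINT x:{0<..}|lborel. g x) = (LINT x:{0<..}|lborel. (\<phi> x - \<psi> x * exp (- t * x)) * exp (- \<kappa> * x) / x)"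
  by (intro set_lebesgue_integral_cong) (auto simp: g_def)
 ultimately show ?thesis by simp
qed

text \<open>The cycle weights satisfy the recursion with the tilted \<open>q'\<close>, have total
  mass at most 1, and their Laplace transforms at integers are the exponentials treated in
  \<open>laplace_exponent_tendsto\<close>. The limit \<open>g\<close> is tied to the model only by
  its Laplace transform, through \<open>lap\<close>.\<close>

lemma effective_local_limit:
 fixes V :: "nat => real" and q q' :: "nat => nat => real" and \<phi> \<psi> g :: "real => real"
 assumes V: "\<And>n. 0 < V n" "filterlim V at_top sequentially" and \<kappa>: "0 < \<kappa>"
  and q0: "\<And>n j. 1 \<le> j ==> 0 \<le> q' n j" "\<And>n j. 1 \<le> j ==> q' n j \<le> q n j" "\<And>n j. 1 \<le> j ==> q n j \<le> C"
  and \<delta>: "0 < \<delta>" "\<And>n j. 1 \<le> j ==> real j / V n < \<delta> ==> q' n j = q n j"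
  and c: "continuous_on {0<..} \<phi>" "continuous_on {0<..} \<psi>"
  and lq: "\<And>\<delta> R \<epsilon>. 0 < \<delta> ==> \<delta> < R ==> 0 < \<epsilon> ==>
   \<forall>\<^sub>F n in sequentially. \<forall>j. \<delta> \<le> real j / V n \<and> real j / V n \<le> R \<longrightarrow> \<bar>q n j - \<phi> (real j / V n)\<bar> < \<epsilon>"
  and lq': "\<And>\<delta> R \<epsilon>. 0 < \<delta> ==> \<delta> < R ==> 0 < \<epsilon> ==>
   \<forall>\<^sub>F n in sequentially. \<forall>j. \<delta> \<le> real j / V n \<and> real j / V n \<le> R \<longrightarrow> \<bar>q' n j - \<psi> (real j / V n)\<bar> < \<epsilon>"
  and g: "set_integrable lborel {0<..} g" "isCont g a"
  and lap: "\<And>k::nat. (LINT x:{0<..}|lborel. g x * exp (- x) ^ k) =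
   exp (- (LINT x:{0<..}|lborel. (\<phi> x - \<psi> x * exp (- real k * x)) * exp (- \<kappa> * x) / x))"
  and a: "0 < a" and \<epsilon>: "0 < \<epsilon>"
 shows "\<exists>\<eta>>0. \<forall>\<^sub>F n in sequentially. \<forall>m. \<bar>real m / V n - a\<bar> < \<eta> \<longrightarrow>
  \<bar>V n * cycle_weight (V n) \<kappa> (q n) (q' n) m - g a\<bar> < \<epsilon>"
proof (rule local_limit[OF V])
 have r: "0 \<le> exp (- \<kappa> / V n)" "exp (- \<kappa> / V n) < 1" for n using \<kappa> V(1)[of n] by auto
 have qnn: "0 \<le> q n j" if "1 \<le> j" for n j using q0(1,2)[OF that, of n] by linarith
 have sm: "summable (\<lambda>j. q n (Suc j) * exp (- \<kappa> / V n) ^ Suc j / real (Suc j))" for n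
  by (rule summable_tilted[OF qnn q0(3) r])
 show "0 \<le> q' n j * exp (- \<kappa> / V n) ^ j" if "1 \<le> j" for n j using q0(1)[OF that] r by simp
 show "q' n j * exp (- \<kappa> / V n) ^ j \<le> C" if "1 \<le> j" for n j
 proof -
  have "q' n j * exp (- \<kappa> / V n) ^ j \<le> q' n j * 1"
   using q0(1)[OF that] r[of n] by (intro mult_left_mono power_le_one) auto
  then show ?thesis using q0(2,3)[OF that, of n] by linarith
 qed
 show "0 \<le> cycle_weight (V n) \<kappa> (q n) (q' n) m" for n m using q0(1) by (rule cycle_weight_nonneg)
 show "summable (cycle_weight (V n) \<kappa> (q n) (q' n))" "suminf (cycle_weight (V n) \<kappa> (q n) (q' n)) \<le> 1" for n
  using cycle_weight_sum_le_1[OF q0(1,2) sm] by auto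
 show "real m * cycle_weight (V n) \<kappa> (q n) (q' n) m =
   (\<Sum>j=1..m. (q' n j * exp (- \<kappa> / V n) ^ j) * cycle_weight (V n) \<kappa> (q n) (q' n) (m - j))" for n m
  by (rule cycle_weight_rec)
 show "continuous_on {0<..} (\<lambda>x. \<psi> x * exp (- \<kappa> * x))" by (intro continuous_intros c)
 show "\<forall>\<^sub>F n in sequentially. \<forall>j. \<delta> \<le> real j / V n \<and> real j / V n \<le> R \<longrightarrow>
   \<bar>q' n j * exp (- \<kappa> / V n) ^ j - \<psi> (real j / V n) * exp (- \<kappa> * (real j / V n))\<bar> < \<epsilon>"
  if "0 < \<delta>" "\<delta> < R" "0 < \<epsilon>" for \<delta> R \<epsilon>
  using lq'[OF that]
 proof eventually_elim
  case (elim n)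
  show ?case
  proof (intro allI impI)
   fix j assume j: "\<delta> \<le> real j / V n \<and> real j / V n \<le> R"
   have "\<bar>q' n j * exp (- \<kappa> / V n) ^ j - \<psi> (real j / V n) * exp (- \<kappa> * (real j / V n))\<bar> =
     \<bar>q' n j - \<psi> (real j / V n)\<bar> * exp (- \<kappa> * (real j / V n))"
    unfolding exp_power_mult left_diff_distrib[symmetric] by (simp add: abs_mult)
   also have "\<dots> \<le> \<bar>q' n j - \<psi> (real j / V n)\<bar> * 1"
    using \<kappa> V(1)[of n] by (intro mult_left_mono) auto
   also have "\<dots> < \<epsilon>" using elim j by simp
   finally show "\<bar>q' n j * exp (- \<kappa> / V n) ^ j - \<psi> (real j / V n) * exp (- \<kappa> * (real j / V n))\<bar> < \<epsilon>" .
  qed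
 qed
 show "(\<lambda>n. \<Sum>m. cycle_weight (V n) \<kappa> (q n) (q' n) m * exp (- (real m / V n)) ^ k) \<longlonglongrightarrow>
   (LINT x:{0<..}|lborel. g x * exp (- x) ^ k)" for k :: nat
 proof -
  have y: "exp (- (real m / V n)) ^ k = exp (- real k / V n) ^ m" for m n
   by (simp add: exp_of_nat_mult[symmetric] mult.commute)
  have "(\<Sum>m. cycle_weight (V n) \<kappa> (q n) (q' n) m * exp (- (real m / V n)) ^ k) =
    exp (- (\<Sum>j. (q n (Suc j) - q' n (Suc j) * exp (- real k / V n) ^ Suc j) * exp (- \<kappa> / V n) ^ Suc j / real (Suc j)))" for n
   unfolding y using V(1)[of n] by (intro sums_unique[symmetric] cycle_weight_sums q0 sm) auto
  moreover have "(\<lambda>n. exp (- (\<Sum>j. (q n (Suc j) - q' n (Suc j) * exp (- real k / V n) ^ Suc j) * exp (- \<kappa> / V n) ^ Suc j / real (Suc j))))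
    \<longlonglongrightarrow> (LINT x:{0<..}|lborel. g x * exp (- x) ^ k)"
   unfolding lap by (intro tendsto_intros laplace_exponent_tendsto[OF V \<kappa> _ q0 \<delta> c lq lq']) auto
  ultimately show ?thesis by (simp only:)
 qed
qed (use g a \<epsilon> in auto)

text \<open>If \<open>A n\<close> concentrates at \<open>\<rho>b V n\<close> and \<open>V n B n\<close> is bounded and has the limit \<open>\<gamma>\<close> at \<open>a\<close>, then their
 convolution at \<open>(\<rho>b + a) V n\<close> is asymptotically \<open>\<tau> \<gamma> / V n\<close>, where \<open>\<tau>\<close> is the limiting mass of \<open>A n\<close>.\<close>

lemma convolution_tendsto:
 fixes V :: "nat => real" and N :: "nat => nat" and A P B :: "nat => nat => real"
 assumes V: "\<And>n. 0 < V n" and N: "(\<lambda>n. real (N n) / V n) \<longlonglongrightarrow> \<rho>b + a" and a: "0 < a"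
  and A: "\<forall>\<^sub>F n in sequentially. \<forall>k. 0 \<le> A n k \<and> A n k \<le> P n k"
  and P: "\<forall>\<^sub>F n in sequentially. summable (P n) \<and> suminf (P n) \<le> 1"
  and conc: "\<And>\<eta>. 0 < \<eta> ==> (\<lambda>n. \<Sum>k. if \<eta> \<le> \<bar>real k / V n - \<rho>b\<bar> then P n k else 0) \<longlonglongrightarrow> 0"
  and mass: "(\<lambda>n. suminf (A n)) \<longlonglongrightarrow> \<tau>"
  and B0: "\<And>n m. 0 \<le> B n m" and BK: "\<forall>\<^sub>F n in sequentially. \<forall>m\<le>N n. V n * B n m \<le> K"
  and B: "\<And>\<epsilon>. 0 < \<epsilon> ==> \<exists>\<eta>>0. \<forall>\<^sub>F n in sequentially. \<forall>m. \<bar>real m / V n - a\<bar> < \<eta> \<longrightarrow> \<bar>V n * B n m - \<gamma>\<bar> < \<epsilon>"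
 shows "(\<lambda>n. V n * (\<Sum>k\<le>N n. A n k * B n (N n - k))) \<longlonglongrightarrow> \<tau> * \<gamma>"
proof -
 have "(\<lambda>n. V n * (\<Sum>k\<le>N n. A n k * B n (N n - k)) - \<gamma> * suminf (A n)) \<longlonglongrightarrow> 0"
 proof (rule tendstoI)
  fix r :: real assume r: "0 < r"
  define K' where "K' = \<bar>K\<bar> + \<bar>\<gamma>\<bar> + 1"
  have K': "0 < K'" by (simp add: K'_def)
  obtain \<eta> where \<eta>: "0 < \<eta>" and ev: "\<forall>\<^sub>F n in sequentially. \<forall>m. \<bar>real m / V n - a\<bar> < \<eta> \<longrightarrow> \<bar>V n * B n m - \<gamma>\<bar> < r / 2"
   using B[of "r / 2"] r by auto
  \<comment> \<open>The deviations of \<open>k / V\<close> from \<open>\<rho>b\<close> and of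
    \<open>N / V\<close> from its limit add up to less than \<open>2 * \<eta>'\<close>. At most
    \<open>\<eta>\<close> keeps \<open>(N - k) / V\<close> in the range of \<open>ev\<close>, at
    most \<open>a\<close> ensures \<open>k \<le> N\<close>.\<close>
  define \<eta>' where "\<eta>' = min \<eta> a / 2"
  have \<eta>': "0 < \<eta>'" "2 * \<eta>' \<le> \<eta>" "2 * \<eta>' \<le> a" using \<eta> a by (auto simp: \<eta>'_def)
  define bad where "bad n k \<longleftrightarrow> \<eta>' \<le> \<bar>real k / V n - \<rho>b\<bar>" for n k
  have ev1: "\<forall>\<^sub>F n in sequentially. \<bar>real (N n) / V n - (\<rho>b + a)\<bar> < \<eta>'"
   using tendstoD[OF N \<eta>'(1)] by (simp add: dist_real_def)
  have "0 < r / (2 * K')" using r K' by simp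
  from tendstoD[OF conc[OF \<eta>'(1)] this]
  have ev2: "\<forall>\<^sub>F n in sequentially. (\<Sum>k. if bad n k then P n k else 0) < r / (2 * K')"
   unfolding bad_def by eventually_elim (simp add: dist_real_def)
  show "\<forall>\<^sub>F n in sequentially. dist (V n * (\<Sum>k\<le>N n. A n k * B n (N n - k)) - \<gamma> * suminf (A n)) 0 < r"
   using ev ev1 ev2 A P BK
  proof eventually_elim
   case (elim n)
   note Vn = V[of n]
   have A0: "0 \<le> A n k" "A n k \<le> P n k" for k using elim(4) by auto
   have sP: "summable (P n)" "suminf (P n) \<le> 1" using elim(5) by auto
   have sA: "summable (A n)" by (rule summable_comparison_test'[OF sP(1), of 0]) (use A0 in auto)
   \<comment> \<open>The error, term by term. On good indices it is at most \<open>r / 2\<close>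
     times \<open>A n k\<close>; on bad ones only the a priori bound \<open>K'\<close> is available,
     but there the mass of \<open>P n\<close> tends to 0.\<close>
   define D where "D k = V n * (if k \<le> N n then A n k * B n (N n - k) else 0) - \<gamma> * A n k" for k
   define b where "b k = (if bad n k then P n k else 0)" for k
   have sb: "summable b" by (rule summable_comparison_test'[OF sP(1), of 0]) (use A0 in \<open>auto simp: b_def intro: order_trans\<close>)
   have bound: "\<bar>D k\<bar> \<le> r / 2 * A n k + K' * b k" for k
   proof (cases "bad n k")
    case True
    have "\<bar>D k\<bar> \<le> \<bar>K\<bar> * A n k + \<bar>\<gamma>\<bar> * A n k"
    proof -
     have "\<bar>V n * (if k \<le> N n then A n k * B n (N n - k) else 0)\<bar> \<le> \<bar>K\<bar> * A n k"
     proof (cases "k \<le> N n")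
      case kN: True
      have "V n * B n (N n - k) \<le> \<bar>K\<bar>" using elim(6) by (meson abs_ge_self diff_le_self order_trans)
      then have "(V n * B n (N n - k)) * A n k \<le> \<bar>K\<bar> * A n k" using A0 by (intro mult_right_mono) auto
      moreover have "V n * (A n k * B n (N n - k)) = (V n * B n (N n - k)) * A n k" by simp
      moreover have "0 \<le> V n * (A n k * B n (N n - k))" using Vn A0 B0 by (intro mult_nonneg_nonneg) auto
      ultimately show ?thesis unfolding if_P[OF kN] by linarith
     qed (use A0 in simp)
     moreover have "\<bar>\<gamma> * A n k\<bar> = \<bar>\<gamma>\<bar> * A n k" using A0 by (simp add: abs_mult)
     ultimately show ?thesis unfolding D_def by (intro order_trans[OF abs_triangle_ineq4] add_mono) auto
    qed
    also have "\<dots> \<le> K' * A n k" using A0[of k] by (simp add: K'_def distrib_right)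
    also have "\<dots> \<le> K' * P n k" using A0 K' by (intro mult_left_mono) auto
    also have "\<dots> \<le> r / 2 * A n k + K' * b k" using True r A0 by (simp add: b_def)
    finally show ?thesis .
   next
    case False
    then have kb: "\<bar>real k / V n - \<rho>b\<bar> < \<eta>'" by (simp add: bad_def)
    have "real k / V n < real (N n) / V n" using kb elim(2) \<eta>' by (auto simp: abs_less_iff)
    then have kN: "k \<le> N n" using Vn by (simp add: divide_less_cancel)
    then have eq: "real (N n - k) / V n - a = (real (N n) / V n - (\<rho>b + a)) - (real k / V n - \<rho>b)"
     by (simp add: of_nat_diff diff_divide_distrib)
    have "\<bar>real (N n - k) / V n - a\<bar> < \<eta>" unfolding eq using kb elim(2) \<eta>' by linarith
    then have "\<bar>V n * B n (N n - k) - \<gamma>\<bar> < r / 2" using elim(1) by blast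
    then have "\<bar>V n * B n (N n - k) - \<gamma>\<bar> * A n k \<le> r / 2 * A n k" using A0 by (intro mult_right_mono) auto
    moreover have "D k = (V n * B n (N n - k) - \<gamma>) * A n k" using kN by (simp add: D_def algebra_simps)
    ultimately show ?thesis using False A0[of k] by (simp add: b_def abs_mult)
   qed
   have sfin: "summable (\<lambda>k. if k \<le> N n then A n k * B n (N n - k) else 0)"
    by (rule summable_finite[of "{..N n}"]) auto
   have "(\<Sum>k\<le>N n. A n k * B n (N n - k)) = (\<Sum>k. if k \<le> N n then A n k * B n (N n - k) else 0)"
    by (subst suminf_finite[of "{..N n}"]) auto
   then have "V n * (\<Sum>k\<le>N n. A n k * B n (N n - k)) - \<gamma> * suminf (A n) = suminf D"
    unfolding D_def using sfin sA
    by (simp add: suminf_diff[symmetric] suminf_mult[symmetric] summable_mult)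
   moreover have sD: "summable (\<lambda>k. \<bar>D k\<bar>)"
    by (rule summable_comparison_test'[where N = 0 and g = "\<lambda>k. r / 2 * A n k + K' * b k"])
     (use bound sA sb in \<open>auto intro!: summable_add summable_mult\<close>)
   moreover have "\<bar>suminf D\<bar> \<le> (\<Sum>k. r / 2 * A n k + K' * b k)"
    by (rule order_trans[OF summable_rabs[OF sD] suminf_le[OF bound sD]])
     (intro summable_add summable_mult sA sb)
   moreover have "(\<Sum>k. r / 2 * A n k + K' * b k) = r / 2 * suminf (A n) + K' * suminf b"
    by (simp only: suminf_add[OF summable_mult[OF sA] summable_mult[OF sb], symmetric] suminf_mult[OF sA] suminf_mult[OF sb])
   moreover have "suminf (A n) \<le> 1" using suminf_le[OF A0(2) sA sP(1)] sP(2) by simp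
   then have "r / 2 * suminf (A n) \<le> r / 2 * 1" using r by (intro mult_left_mono) auto
   moreover have "K' * suminf b < r / 2"
    using elim(3) K' unfolding b_def[abs_def] by (simp add: field_simps)
   ultimately show ?case by (simp add: dist_real_def)
  qed
 qed
 from tendsto_add[OF this tendsto_mult_left[OF mass, of \<gamma>]] show ?thesis by (simp add: mult.commute)
qed

lemma one_minus_exp_bounds:
 fixes y :: real
 assumes "0 \<le> y"
 shows "1 - exp (- y) \<le> y" "y - y\<^sup>2 \<le> 1 - exp (- y)" "y \<le> 1 ==> y / 2 \<le> 1 - exp (- y)"
proof -
 show "1 - exp (- y) \<le> y" using exp_ge_add_one_self[of "- y"] by simp
 have "exp (- y) = 1 / exp y" by (simp add: exp_minus field_simps)
 also have "\<dots> \<le> 1 / (1 + y)" using exp_ge_add_one_self[of y] assms by (intro divide_left_mono) auto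
 finally have *: "exp (- y) \<le> 1 / (1 + y)" .
 have "(1 - y + y\<^sup>2) * (1 + y) = 1 + y ^ 3" by (simp add: algebra_simps power2_eq_square power3_eq_cube)
 then have "1 \<le> (1 - y + y\<^sup>2) * (1 + y)" using assms by simp
 then have "1 / (1 + y) \<le> 1 - y + y\<^sup>2" using assms by (simp add: pos_divide_le_eq)
 then show "y - y\<^sup>2 \<le> 1 - exp (- y)" using * by linarith
 assume y1: "y \<le> 1"
 have "1 / (1 + y) \<le> 1 - y / 2"
 proof -
  have "y * y \<le> y" using assms y1 by (simp add: mult_left_le)
  then have "1 \<le> (1 - y / 2) * (1 + y)" by (simp add: algebra_simps)
  then show ?thesis using assms by (simp add: pos_divide_le_eq)
 qed
 then show "y / 2 \<le> 1 - exp (- y)" using * by linarith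
qed

text \<open>A finite limit forces the extended sums to be finite eventually, and from then on they
  are the real sums. For the remaining \<open>n\<close> the series may diverge, so summability is
  only an eventual statement.\<close>

lemma scaled_ennreal_suminf_tendsto:
 fixes c :: "nat => real" and f :: "nat => nat => real"
 assumes c: "\<And>n. 0 < c n" and f: "\<And>n j. 0 \<le> f n j" and l: "0 \<le> l"
  and lim: "(\<lambda>n. ennreal (c n) * (\<Sum>j. ennreal (f n j))) \<longlonglongrightarrow> ennreal l"
 shows "\<forall>\<^sub>F n in sequentially. summable (f n)" "(\<lambda>n. c n * suminf (f n)) \<longlonglongrightarrow> l"
proof -
 have "\<forall>\<^sub>F n in sequentially. ennreal (c n) * (\<Sum>j. ennreal (f n j)) < top"
  by (rule order_tendstoD(2)[OF lim]) simp
 then show s: "\<forall>\<^sub>F n in sequentially. summable (f n)"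
 proof eventually_elim
  case (elim n)
  then have "(\<Sum>j. ennreal (f n j)) \<noteq> top" using c[of n] by (auto simp: ennreal_mult_eq_top_iff less_top[symmetric])
  then show ?case using f by (intro summable_suminf_not_top) auto
 qed
 have "\<forall>\<^sub>F n in sequentially. ennreal (c n) * (\<Sum>j. ennreal (f n j)) = ennreal (c n * suminf (f n))"
  using s
 proof eventually_elim
  case (elim n)
  show ?case using elim f c[of n] by (simp add: suminf_ennreal2 ennreal_mult suminf_nonneg)
 qed
 from Lim_transform_eventually[OF lim this]
 show "(\<lambda>n. c n * suminf (f n)) \<longlonglongrightarrow> l"
 proof (rule tendsto_ennrealD)
  show "\<forall>\<^sub>F n in sequentially. 0 \<le> c n * suminf (f n)"
   using s
  proof eventually_elim
   case (elim n)
   show ?case using c[of n] suminf_nonneg[OF elim f] by simp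
  qed
 qed (rule l)
qed

section \<open>The law of large numbers for the background factor\<close>

locale background =
 fixes V :: "nat => real" and \<kappa> \<rho>b :: real and q :: "nat => nat => real"
 assumes V: "\<And>n. 0 < V n" and q0: "\<And>n j. 1 \<le> j ==> 0 \<le> q n j" and \<rho>b: "0 \<le> \<rho>b"
  and b0: "(\<lambda>n. ennreal (1 / V n) * (\<Sum>j. ennreal (exp (- \<kappa> * real (Suc j) / V n) * q n (Suc j)))) \<longlonglongrightarrow> ennreal \<rho>b"
  and b1: "(\<lambda>n. ennreal (1 / (V n)\<^sup>2) * (\<Sum>j. ennreal (real (Suc j) * exp (- \<kappa> * real (Suc j) / V n) * q n (Suc j)))) \<longlonglongrightarrow> 0"
begin

definition W :: "nat => nat => real" where "W n j = q n (Suc j) * exp (- \<kappa> / V n) ^ Suc j"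

lemma W_nonneg: "0 \<le> W n j" unfolding W_def using q0 by simp

lemma W_eq: "exp (- \<kappa> * real (Suc j) / V n) * q n (Suc j) = W n j"
 unfolding W_def exp_power_mult by simp

lemma first_moment: "\<forall>\<^sub>F n in sequentially. summable (W n)" "(\<lambda>n. 1 / V n * suminf (W n)) \<longlonglongrightarrow> \<rho>b"
 using scaled_ennreal_suminf_tendsto[OF _ _ \<rho>b b0[unfolded W_eq]] V W_nonneg by auto

lemma second_moment: "\<forall>\<^sub>F n in sequentially. summable (\<lambda>j. real (Suc j) * W n j)"
  "(\<lambda>n. 1 / (V n)\<^sup>2 * (\<Sum>j. real (Suc j) * W n j)) \<longlonglongrightarrow> 0"
proof -
 have eq: "real (Suc j) * exp (- \<kappa> * real (Suc j) / V n) * q n (Suc j) = real (Suc j) * W n j" for n j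
  using W_eq[of j n] by (simp only: mult.assoc)
 have l: "(\<lambda>n. ennreal (1 / (V n)\<^sup>2) * (\<Sum>j. ennreal (real (Suc j) * W n j))) \<longlonglongrightarrow> ennreal 0"
  using b1[unfolded eq] by simp
 have p: "0 < 1 / (V n)\<^sup>2" for n using V[of n] by simp
 have nn: "0 \<le> real (Suc j) * W n j" for n j using W_nonneg by (intro mult_nonneg_nonneg) auto
 show "\<forall>\<^sub>F n in sequentially. summable (\<lambda>j. real (Suc j) * W n j)"
  "(\<lambda>n. 1 / (V n)\<^sup>2 * (\<Sum>j. real (Suc j) * W n j)) \<longlonglongrightarrow> 0"
  using scaled_ennreal_suminf_tendsto[OF p nn order_refl l] by auto
qed

lemma summable_W_div: "summable (W n) ==> summable (\<lambda>j. q n (Suc j) * exp (- \<kappa> / V n) ^ Suc j / real (Suc j))"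
proof -
 assume s: "summable (W n)"
 have "norm (q n (Suc j) * exp (- \<kappa> / V n) ^ Suc j / real (Suc j)) \<le> W n j" for j
 proof -
  have "W n j / real (Suc j) \<le> W n j / 1" using W_nonneg[of n j] by (intro divide_left_mono) auto
  moreover have "0 \<le> W n j / real (Suc j)" using W_nonneg[of n j] by simp
  ultimately show ?thesis unfolding W_def[symmetric] by simp
 qed
 then show ?thesis by (intro summable_comparison_test'[OF s, of 0])
qed

text \<open>Here \<open>1 - exp (- y)\<close> is \<open>y\<close> up to \<open>y\<^sup>2\<close>, at
  \<open>y = s * j / V\<close>. After division by \<open>j\<close> the linear term is
  \<open>s / V\<close> times the sum of \<open>W\<close>, which converges by the first background
  condition, and the quadratic error is \<open>(s / V)\<^sup>2\<close> times the sum of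
  \<open>j * W\<close>, which vanishes by the second.\<close>

lemma exponent_tendsto:
 assumes s: "0 \<le> s"
 shows "(\<lambda>n. \<Sum>j. W n j * (1 - exp (- s * (real (Suc j) / V n))) / real (Suc j)) \<longlonglongrightarrow> s * \<rho>b"
proof -
 have "(\<lambda>n. (\<Sum>j. W n j * (1 - exp (- s * (real (Suc j) / V n))) / real (Suc j)) - s * (1 / V n * suminf (W n))) \<longlonglongrightarrow> 0"
 proof (rule Lim_null_comparison)
  show "(\<lambda>n. s\<^sup>2 * (1 / (V n)\<^sup>2 * (\<Sum>j. real (Suc j) * W n j))) \<longlonglongrightarrow> 0"
   using tendsto_mult_left[OF second_moment(2), of "s\<^sup>2"] by simp
  show "\<forall>\<^sub>F n in sequentially. norm ((\<Sum>j. W n j * (1 - exp (- s * (real (Suc j) / V n))) / real (Suc j)) - s * (1 / V n * suminf (W n)))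
    \<le> s\<^sup>2 * (1 / (V n)\<^sup>2 * (\<Sum>j. real (Suc j) * W n j))"
   using first_moment(1) second_moment(1)
  proof eventually_elim
   case (elim n)
   define J where "J j = real (Suc j)" for j
   have J: "0 < J j" for j by (simp add: J_def)
   let ?t = "\<lambda>j. W n j * (1 - exp (- s * (J j / V n))) / J j" and ?u = "\<lambda>j. s / V n * W n j"
   let ?v = "\<lambda>j. s\<^sup>2 / (V n)\<^sup>2 * (J j * W n j)"
   have y: "0 \<le> s * (J j / V n)" for j using s J[of j] V[of n] by simp
   have u: "?u j = W n j * (s * (J j / V n)) / J j" for j using J[of j] by simp
   have v: "?v j = W n j * (s * (J j / V n))\<^sup>2 / J j" for j using J[of j] by (simp add: power2_eq_square)
   have tu: "?t j - ?u j = W n j * ((1 - exp (- (s * (J j / V n)))) - s * (J j / V n)) / J j" for j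
    unfolding u by (simp add: diff_divide_distrib right_diff_distrib)
   have le: "norm (?t j - ?u j) \<le> ?v j" for j
   proof -
    have "\<bar>(1 - exp (- (s * (J j / V n)))) - s * (J j / V n)\<bar> \<le> (s * (J j / V n))\<^sup>2"
     using one_minus_exp_bounds(1,2)[OF y[of j]] zero_le_power2[of "s * (J j / V n)"] by linarith
    then have "W n j * \<bar>(1 - exp (- (s * (J j / V n)))) - s * (J j / V n)\<bar> / J j \<le> W n j * (s * (J j / V n))\<^sup>2 / J j"
     using W_nonneg[of n j] J[of j] by (intro divide_right_mono mult_left_mono) auto
    then show ?thesis unfolding tu v using W_nonneg[of n j] J[of j] by (simp add: abs_mult)
   qed
   have su: "summable ?u" using elim(1) by (rule summable_mult)
   have sv: "summable ?v" using elim(2) unfolding J_def by (rule summable_mult)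
   have stu: "summable (\<lambda>j. ?t j - ?u j)" by (rule summable_comparison_test'[OF sv, of 0]) (rule le)
   have st: "summable ?t" using summable_add[OF stu su] by simp
   have stun: "summable (\<lambda>j. norm (?t j - ?u j))" by (rule summable_comparison_test'[OF sv, of 0]) (use le in auto)
   have "norm (suminf ?t - suminf ?u) = norm (\<Sum>j. ?t j - ?u j)" using suminf_diff[OF st su] by simp
   also have "\<dots> \<le> (\<Sum>j. norm (?t j - ?u j))" by (rule summable_norm[OF stun])
   also have "\<dots> \<le> suminf ?v" by (rule suminf_le[OF le stun sv])
   also have "suminf ?v = s\<^sup>2 / (V n)\<^sup>2 * (\<Sum>j. J j * W n j)" using elim(2) unfolding J_def by (rule suminf_mult)
   finally show ?case using suminf_mult[OF elim(1), of "s / V n"] unfolding J_def by simp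
  qed
 qed
 from tendsto_add[OF this tendsto_mult_left[OF first_moment(2), of s]] show ?thesis by simp
qed

abbreviation "weight n \<equiv> cycle_weight (V n) \<kappa> (q n)"

lemma weight_sum_le: "\<forall>\<^sub>F n in sequentially. summable (weight n (q n)) \<and> suminf (weight n (q n)) \<le> 1"
 using first_moment(1)
proof eventually_elim
 case (elim n)
 from cycle_weight_sum_le_1[OF q0 _ summable_W_div[OF elim]] show ?case by auto
qed

text \<open>Evaluating the generating function at \<open>exp (- s / V)\<close> and inserting
  \<open>exp (- s * j / V)\<close> into each cycle lead to the same exponent. The first form serves
  the concentration, the second the Laplace transform of the background particle number.\<close>

lemma weight_laplace:
 assumes s: "0 \<le> s"
 shows "(\<lambda>n. \<Sum>k. weight n (q n) k * exp (- s / V n) ^ k) \<longlonglongrightarrow> exp (- s * \<rho>b)"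
  and "(\<lambda>n. suminf (weight n (\<lambda>j. exp (- s * (real j / V n)) * q n j))) \<longlonglongrightarrow> exp (- s * \<rho>b)"
proof -
 have lim: "(\<lambda>n. exp (- (\<Sum>j. W n j * (1 - exp (- s * (real (Suc j) / V n))) / real (Suc j)))) \<longlonglongrightarrow> exp (- s * \<rho>b)"
  using tendsto_exp[OF tendsto_minus[OF exponent_tendsto[OF s]]] by simp
 have es: "0 \<le> exp (- s / V n)" "exp (- s / V n) \<le> 1" for n using s V[of n] by auto
 have t1: "(q n (Suc j) - q n (Suc j) * exp (- s / V n) ^ Suc j) * exp (- \<kappa> / V n) ^ Suc j / real (Suc j) =
   W n j * (1 - exp (- s * (real (Suc j) / V n))) / real (Suc j)" for n j
  unfolding W_def exp_power_mult[of s] by (simp add: algebra_simps del: of_nat_Suc power_Suc)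
 have "\<forall>\<^sub>F n in sequentially. exp (- (\<Sum>j. W n j * (1 - exp (- s * (real (Suc j) / V n))) / real (Suc j))) = (\<Sum>k. weight n (q n) k * exp (- s / V n) ^ k)"
  using first_moment(1)
 proof eventually_elim
  case (elim n)
  from cycle_weight_sums[OF q0 order_refl es(1)[of n] es(2)[of n] summable_W_div[OF elim]]
  show ?case unfolding t1 by (rule sums_unique)
 qed
 from Lim_transform_eventually[OF lim this]
 show "(\<lambda>n. \<Sum>k. weight n (q n) k * exp (- s / V n) ^ k) \<longlonglongrightarrow> exp (- s * \<rho>b)" .
 have t2: "(q n (Suc j) - (exp (- s * (real (Suc j) / V n)) * q n (Suc j)) * 1 ^ Suc j) * exp (- \<kappa> / V n) ^ Suc j / real (Suc j) =
   W n j * (1 - exp (- s * (real (Suc j) / V n))) / real (Suc j)" for n j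
  unfolding W_def by (simp add: algebra_simps del: of_nat_Suc power_Suc)
 have "\<forall>\<^sub>F n in sequentially. exp (- (\<Sum>j. W n j * (1 - exp (- s * (real (Suc j) / V n))) / real (Suc j))) = suminf (weight n (\<lambda>j. exp (- s * (real j / V n)) * q n j))"
  using first_moment(1)
 proof eventually_elim
  case (elim n)
  have le: "exp (- s * (real j / V n)) * q n j \<le> q n j" if "1 \<le> j" for j
   using q0[OF that, of n] s V[of n] by (simp add: mult_left_le_one_le)
  have "(\<lambda>m. weight n (\<lambda>j. exp (- s * (real j / V n)) * q n j) m * 1 ^ m) sums
    exp (- (\<Sum>j. (q n (Suc j) - (exp (- s * (real (Suc j) / V n)) * q n (Suc j)) * 1 ^ Suc j) * exp (- \<kappa> / V n) ^ Suc j / real (Suc j)))"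
   by (rule cycle_weight_sums[OF _ le _ _ summable_W_div[OF elim]]) (use q0 in auto)
  then show ?case unfolding t2 unfolding power_one mult_1_right by (rule sums_unique)
 qed
 from Lim_transform_eventually[OF lim this]
 show "(\<lambda>n. suminf (weight n (\<lambda>j. exp (- s * (real j / V n)) * q n j))) \<longlonglongrightarrow> exp (- s * \<rho>b)" .
qed

text \<open>A change at lengths \<open>j \<ge> \<delta> * V\<close> alters the exponent by at most
  the sum of the tilted weights over \<open>j\<close>, and there
  \<open>1 / j \<le> j / (\<delta> * V)\<^sup>2\<close>; so the second background condition makes it
  negligible. This covers test functions as well as the removal of the cycles in a strip.\<close>

lemma weight_truncated:
 assumes \<delta>: "0 < \<delta>" and q': "\<And>n j. 1 \<le> j ==> 0 \<le> q' n j" "\<And>n j. 1 \<le> j ==> q' n j \<le> q n j"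
  and eq: "\<And>n j. 1 \<le> j ==> real j / V n < \<delta> ==> q' n j = q n j"
 shows "(\<lambda>n. suminf (weight n (q' n))) \<longlonglongrightarrow> 1"
proof -
 let ?t = "\<lambda>n j. (q n (Suc j) - q' n (Suc j) * 1 ^ Suc j) * exp (- \<kappa> / V n) ^ Suc j / real (Suc j)"
 have "(\<lambda>n. \<Sum>j. ?t n j) \<longlonglongrightarrow> 0"
 proof (rule Lim_null_comparison)
  show "(\<lambda>n. 1 / \<delta>\<^sup>2 * (1 / (V n)\<^sup>2 * (\<Sum>j. real (Suc j) * W n j))) \<longlonglongrightarrow> 0"
   using tendsto_mult_left[OF second_moment(2), of "1 / \<delta>\<^sup>2"] by simp
  show "\<forall>\<^sub>F n in sequentially. norm (\<Sum>j. ?t n j) \<le> 1 / \<delta>\<^sup>2 * (1 / (V n)\<^sup>2 * (\<Sum>j. real (Suc j) * W n j))"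
   using second_moment(1)
  proof eventually_elim
   case (elim n)
   have t0: "0 \<le> ?t n j" for j using q'(2)[of "Suc j" n] by simp
   have le: "?t n j \<le> (1 / \<delta>\<^sup>2 * (1 / (V n)\<^sup>2)) * (real (Suc j) * W n j)" for j
   proof (cases "real (Suc j) / V n < \<delta>")
    case True
    then have "?t n j = 0" using eq[of "Suc j" n] by simp
    then show ?thesis using W_nonneg[of n j] by simp
   next
    case False
    have "?t n j \<le> W n j / real (Suc j)"
     unfolding W_def using q'(1)[of "Suc j" n] by (intro divide_right_mono mult_right_mono) auto
    also have "\<dots> \<le> (real (Suc j) / (\<delta> * V n))\<^sup>2 * (W n j / real (Suc j))"
    proof -
     have "1 \<le> real (Suc j) / (\<delta> * V n)" using False \<delta> V[of n] by (simp add: field_simps)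
     then have "1 \<le> (real (Suc j) / (\<delta> * V n))\<^sup>2" by (simp add: one_le_power)
     then have "1 * (W n j / real (Suc j)) \<le> (real (Suc j) / (\<delta> * V n))\<^sup>2 * (W n j / real (Suc j))"
      using W_nonneg[of n j] by (intro mult_right_mono) auto
     then show ?thesis by simp
    qed
    also have "\<dots> = (1 / \<delta>\<^sup>2 * (1 / (V n)\<^sup>2)) * (real (Suc j) * W n j)"
     by (simp add: power2_eq_square del: of_nat_Suc)
    finally show ?thesis .
   qed
   have s: "summable (\<lambda>j. (1 / \<delta>\<^sup>2 * (1 / (V n)\<^sup>2)) * (real (Suc j) * W n j))" using elim by (rule summable_mult)
   have nt: "norm (?t n j) \<le> (1 / \<delta>\<^sup>2 * (1 / (V n)\<^sup>2)) * (real (Suc j) * W n j)" for j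
    unfolding real_norm_def abs_of_nonneg[OF t0] by (rule le)
   have st: "summable (?t n)" by (rule summable_comparison_test'[OF s, of 0]) (rule nt)
   have "norm (\<Sum>j. ?t n j) = (\<Sum>j. ?t n j)" using suminf_nonneg[OF st t0] by simp
   also have "\<dots> \<le> (\<Sum>j. (1 / \<delta>\<^sup>2 * (1 / (V n)\<^sup>2)) * (real (Suc j) * W n j))" by (rule suminf_le[OF le st s])
   also have "\<dots> = (1 / \<delta>\<^sup>2 * (1 / (V n)\<^sup>2)) * (\<Sum>j. real (Suc j) * W n j)" by (rule suminf_mult[OF elim])
   finally show ?case by (simp add: mult.assoc)
  qed
 qed
 then have lim: "(\<lambda>n. exp (- (\<Sum>j. ?t n j))) \<longlonglongrightarrow> 1" using tendsto_exp[OF tendsto_minus] by fastforce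
 have "\<forall>\<^sub>F n in sequentially. exp (- (\<Sum>j. ?t n j)) = suminf (weight n (q' n))"
  using first_moment(1)
 proof eventually_elim
  case (elim n)
  have "(\<lambda>m. weight n (q' n) m * 1 ^ m) sums exp (- (\<Sum>j. ?t n j))"
   by (rule cycle_weight_sums[OF q' _ _ summable_W_div[OF elim]]) auto
  from sums_unique[OF this] show ?case by (simp only: power_one mult_1_right)
 qed
 from Lim_transform_eventually[OF lim this] show ?thesis .
qed

text \<open>Chebyshev's inequality for \<open>exp (- k / V)\<close> around
  \<open>exp (- \<rho>b)\<close>: the second moment involves only the Laplace transforms at 0, 1 and
  2, and their limits are those of a point mass at \<open>\<rho>b\<close>.\<close>

lemma weight_concentration:
 assumes \<eta>: "0 < \<eta>"
 shows "(\<lambda>n. \<Sum>k. if \<eta> \<le> \<bar>real k / V n - \<rho>b\<bar> then weight n (q n) k else 0) \<longlonglongrightarrow> 0"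
proof -
 define e where "e = exp (- \<rho>b)"
 \<comment> \<open>If \<open>k / V\<close> is at least \<open>\<eta>\<close> away from
   \<open>\<rho>b\<close>, then \<open>exp (- k / V)\<close> is at least
   \<open>e * (1 - exp (- \<eta>))\<close> away from \<open>e\<close>; that is the case
   \<open>k / V > \<rho>b\<close>, the other side gives the larger distance
   \<open>e * (exp \<eta> - 1)\<close>.\<close>
 define c where "c = (e * (1 - exp (- \<eta>)))\<^sup>2"
 have c0: "0 < c" using \<eta> by (simp add: c_def e_def)
 define L where "L s n = (\<Sum>k. weight n (q n) k * exp (- s / V n) ^ k)" for s n
 have L: "L s \<longlonglongrightarrow> exp (- s * \<rho>b)" if "0 \<le> s" for s unfolding L_def using weight_laplace(1)[OF that] .
 have "(\<lambda>n. L 2 n - 2 * e * L 1 n + e\<^sup>2 * L 0 n) \<longlonglongrightarrow> exp (- 2 * \<rho>b) - 2 * e * exp (- 1 * \<rho>b) + e\<^sup>2 * exp (- 0 * \<rho>b)"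
  by (intro tendsto_intros L) auto
 also have "exp (- 2 * \<rho>b) - 2 * e * exp (- 1 * \<rho>b) + e\<^sup>2 * exp (- 0 * \<rho>b) = 0"
 proof -
  have "exp (- 2 * \<rho>b) = e * e" by (simp add: e_def exp_add[symmetric])
  then show ?thesis by (simp add: e_def[symmetric] power2_eq_square)
 qed
 finally have lim: "(\<lambda>n. 1 / c * (L 2 n - 2 * e * L 1 n + e\<^sup>2 * L 0 n)) \<longlonglongrightarrow> 0"
  using tendsto_mult_left[of _ 0 sequentially "1 / c"] by simp
 show ?thesis
 proof (rule Lim_null_comparison[OF _ lim])
  show "\<forall>\<^sub>F n in sequentially. norm (\<Sum>k. if \<eta> \<le> \<bar>real k / V n - \<rho>b\<bar> then weight n (q n) k else 0) \<le> 1 / c * (L 2 n - 2 * e * L 1 n + e\<^sup>2 * L 0 n)"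
   using weight_sum_le
  proof eventually_elim
   case (elim n)
   let ?w = "weight n (q n)"
   have w0: "0 \<le> ?w k" for k using q0 by (rule cycle_weight_nonneg)
   have sw: "summable ?w" using elim by simp
   let ?b = "\<lambda>k. if \<eta> \<le> \<bar>real k / V n - \<rho>b\<bar> then ?w k else 0"
   have sb: "summable ?b" by (rule summable_comparison_test'[OF sw, of 0]) (use w0 in auto)
   have pw: "exp (- s / V n) ^ k = exp (- s * (real k / V n))" for s k by (rule exp_power_mult)
   have sL: "summable (\<lambda>k. ?w k * exp (- s / V n) ^ k)" if "0 \<le> s" for s
   proof (rule summable_comparison_test'[OF sw, of 0])
    fix k
    have "exp (- s / V n) ^ k \<le> 1" using that V[of n] by (intro power_le_one) auto
    then show "norm (?w k * exp (- s / V n) ^ k) \<le> ?w k" using w0[of k] by (simp add: abs_mult mult_left_le)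
   qed
   have quad: "?w k * exp (- 2 / V n) ^ k - 2 * e * (?w k * exp (- 1 / V n) ^ k) + e\<^sup>2 * (?w k * exp (- 0 / V n) ^ k) =
     ?w k * (exp (- (real k / V n)) - e)\<^sup>2" for k
   proof -
    have "exp (- 2 * (real k / V n)) = exp (- (real k / V n)) * exp (- (real k / V n))" by (simp add: exp_add[symmetric])
    then show ?thesis unfolding pw by (simp add: power2_eq_square algebra_simps)
   qed
   have key: "c * ?b k \<le> ?w k * (exp (- (real k / V n)) - e)\<^sup>2" for k
   proof (cases "\<eta> \<le> \<bar>real k / V n - \<rho>b\<bar>")
    case True
    define x where "x = real k / V n"
    have "e * (1 - exp (- \<eta>)) \<le> \<bar>exp (- x) - e\<bar>"
    proof (cases "\<rho>b \<le> x")
     case ge: True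
     then have "exp (- x) \<le> exp (- \<rho>b + - \<eta>)" using True by (simp add: x_def)
     then have "exp (- x) \<le> e * exp (- \<eta>)" unfolding exp_add e_def .
     then show ?thesis by (simp add: right_diff_distrib)
    next
     case False
     then have "exp (- \<rho>b + \<eta>) \<le> exp (- x)" using True by (simp add: x_def)
     then have 1: "e * exp \<eta> \<le> exp (- x)" unfolding exp_add e_def .
     have "1 - exp (- \<eta>) \<le> \<eta>" by (rule one_minus_exp_bounds(1)) (use \<eta> in simp)
     then have "1 - exp (- \<eta>) \<le> exp \<eta> - 1" using exp_ge_add_one_self[of \<eta>] by linarith
     then have "e * (1 - exp (- \<eta>)) \<le> e * (exp \<eta> - 1)" by (intro mult_left_mono) (auto simp: e_def)
     then show ?thesis using 1 by (simp add: right_diff_distrib)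
    qed
    then have "c \<le> \<bar>exp (- x) - e\<bar>\<^sup>2" unfolding c_def using \<eta> by (intro power_mono mult_nonneg_nonneg) (auto simp: e_def)
    then have "c * ?w k \<le> (exp (- x) - e)\<^sup>2 * ?w k" using w0[of k] by (intro mult_right_mono) auto
    then show ?thesis using True by (simp add: x_def mult.commute)
   qed (use w0[of k] in simp)
   have "(\<lambda>k. ?w k * (exp (- (real k / V n)) - e)\<^sup>2) sums (L 2 n - 2 * e * L 1 n + e\<^sup>2 * L 0 n)"
    unfolding quad[symmetric] L_def
    by (intro sums_add sums_diff sums_mult summable_sums sL) auto
   from sums_le[OF key sums_mult[OF summable_sums[OF sb], of c] this]
   have "c * suminf ?b \<le> L 2 n - 2 * e * L 1 n + e\<^sup>2 * L 0 n" .
   moreover have "0 \<le> suminf ?b" using w0 by (intro suminf_nonneg sb) auto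
   ultimately show ?case using c0 by (simp add: field_simps)
  qed
 qed
qed

end

section \<open>A bound on the effective weights that is uniform down to index 0\<close>

lemma neg_ln_sums:
 fixes y :: real
 assumes "0 \<le> y" "y < 1"
 shows "(\<lambda>j. y ^ Suc j / real (Suc j)) sums (- ln (1 - y))"
proof -
 have "(\<lambda>n. - ((y) ^ n) / of_nat n) sums ln (1 - y)"
  using ln_series'[of "- y"] assms by simp
 from sums_minus[OF this] have "(\<lambda>n. y ^ n / real n) sums (- ln (1 - y))" by simp
 then show ?thesis using sums_Suc_iff[of "\<lambda>n. y ^ n / real n" "- ln (1 - y)"] by simp
qed

lemma neg_ln_exp_lower:
 fixes c v :: real
 assumes "0 < c" "0 < v"
 shows "ln v - ln c \<le> - ln (1 - exp (- c / v))"
proof -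
 have "1 - exp (- c / v) \<le> c / v" using one_minus_exp_bounds(1)[of "c / v"] assms by simp
 moreover have "0 < 1 - exp (- c / v)" using assms by simp
 ultimately have "ln (1 - exp (- c / v)) \<le> ln (c / v)" by (intro ln_mono) auto
 also have "\<dots> = ln c - ln v" using assms by (simp add: ln_div)
 finally show ?thesis by simp
qed

text \<open>For constant weights the generating function is
  \<open>(1 - z) powr (- \<Theta>)\<close>. The recursion reduces the coefficient at
  \<open>m\<close> to a partial sum, which is estimated by the value at
  \<open>t = exp (- 1 / m)\<close>: up to index \<open>m\<close> the factor \<open>t ^ i\<close>
  costs at most \<open>exp 1\<close>, and \<open>1 - t \<ge> 1 / (2 * m)\<close>.\<close>

lemma partition_function_const_bound:
 assumes \<Theta>: "0 \<le> \<Theta>" and m: "1 \<le> m"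
 shows "real m * partition_function (\<lambda>_. \<Theta>) m \<le> \<Theta> * (exp 1 * (2 * real m) powr \<Theta>)"
proof -
 define t where "t = exp (- 1 / real m)"
 have t: "0 < t" "t < 1" using m by (auto simp: t_def)
 have tm: "1 \<le> exp 1 * t ^ i" if "i \<le> m" for i
 proof -
  have "exp 1 * t ^ i = exp (1 - real i / real m)" unfolding t_def exp_power_mult by (simp add: exp_add[symmetric])
  moreover have "0 \<le> 1 - real i / real m" using that m by simp
  ultimately show ?thesis by simp
 qed
 have p0: "0 \<le> partition_function (\<lambda>_. \<Theta>) i" for i using \<Theta> by (intro partition_function_nonneg)
 have S: "(\<lambda>i. partition_function (\<lambda>j. \<Theta> * t ^ j) i) sums exp (\<Theta> * - ln (1 - t))"
 proof (rule partition_function_sums)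
  show "(\<lambda>j. \<Theta> * t ^ Suc j / real (Suc j)) sums (\<Theta> * - ln (1 - t))"
   using sums_mult[OF neg_ln_sums[of t], of \<Theta>] t by simp
 qed (use \<Theta> t in auto)
 have "real m * partition_function (\<lambda>_. \<Theta>) m = \<Theta> * (\<Sum>j=1..m. partition_function (\<lambda>_. \<Theta>) (m - j))"
  unfolding partition_function_rec by (simp add: sum_distrib_left)
 also have "(\<Sum>j=1..m. partition_function (\<lambda>_. \<Theta>) (m - j)) = (\<Sum>i<m. partition_function (\<lambda>_. \<Theta>) i)"
  by (rule sum.reindex_bij_witness[of _ "\<lambda>i. m - i" "\<lambda>j. m - j"]) auto
 also have "\<dots> \<le> (\<Sum>i<m. exp 1 * partition_function (\<lambda>j. \<Theta> * t ^ j) i)"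
 proof (rule sum_mono)
  fix i assume "i \<in> {..<m}"
  then have "1 * partition_function (\<lambda>_. \<Theta>) i \<le> (exp 1 * t ^ i) * partition_function (\<lambda>_. \<Theta>) i"
   using p0 tm by (intro mult_right_mono) auto
  then show "partition_function (\<lambda>_. \<Theta>) i \<le> exp 1 * partition_function (\<lambda>j. \<Theta> * t ^ j) i"
   unfolding partition_function_tilt[of "\<lambda>_. \<Theta>" t] by simp
 qed
 also have "\<dots> = exp 1 * (\<Sum>i<m. partition_function (\<lambda>j. \<Theta> * t ^ j) i)" by (simp add: sum_distrib_left)
 also have "(\<Sum>i<m. partition_function (\<lambda>j. \<Theta> * t ^ j) i) \<le> exp (\<Theta> * - ln (1 - t))"
  using S \<Theta> t by (intro sum_le_suminf[THEN order_trans]) (auto simp: sums_iff intro!: partition_function_nonneg)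
 also have "exp (\<Theta> * - ln (1 - t)) \<le> (2 * real m) powr \<Theta>"
 proof -
  have "1 / real m / 2 \<le> 1 - t" unfolding t_def using one_minus_exp_bounds(3)[of "1 / real m"] m by simp
  then have "ln (1 / (2 * real m)) \<le> ln (1 - t)" using m t by (subst ln_le_cancel_iff) auto
  then have "- ln (1 - t) \<le> ln (2 * real m)" using m by (simp add: ln_div)
  then have "\<Theta> * - ln (1 - t) \<le> \<Theta> * ln (2 * real m)" using \<Theta> by (intro mult_left_mono)
  then show ?thesis using m by (simp add: powr_def)
 qed
 finally show ?thesis using \<Theta> by (simp add: mult_left_mono)
qed

text \<open>The number \<open>\<Theta>\<close> bounds the growth of the partition function, \<open>m\<^sup>\<Theta>\<^sup>-\<^sup>1\<close>, and also gives the decay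
 \<open>v\<^sup>-\<^sup>\<Theta>\<close> of the normalization; the two compensate each other.\<close>

lemma cycle_weight_small_bound:
 assumes v: "1 \<le> v" and q: "\<And>j. 1 \<le> j ==> 0 \<le> q j" "\<And>j. 1 \<le> j ==> q j \<le> \<Theta>" and \<Theta>: "1 \<le> \<Theta>" "\<Theta> \<le> K" and \<kappa>: "0 < \<kappa>"
  and S: "\<Theta> * ln v \<le> K + (\<Sum>j. q (Suc j) * exp (- \<kappa> / v) ^ Suc j / real (Suc j))"
  and M: "1 \<le> M" and m: "real m \<le> M * v"
 shows "v * cycle_weight v \<kappa> q q m \<le> exp K * (K * exp 1 * 2 powr K * M powr K)"
proof -
 let ?S = "\<Sum>j. q (Suc j) * exp (- \<kappa> / v) ^ Suc j / real (Suc j)"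
 let ?p = "partition_function (\<lambda>j. q j * exp (- \<kappa> / v) ^ j) m"
 have "exp (- ?S) \<le> exp (K - \<Theta> * ln v)" using S by simp
 also have "\<dots> = exp K * v powr - \<Theta>" using v by (simp add: exp_diff powr_def exp_minus divide_inverse)
 finally have eS: "exp (- ?S) \<le> exp K * v powr - \<Theta>" .
 have pp: "?p \<le> partition_function (\<lambda>_. \<Theta>) m"
 proof (rule partition_function_mono)
  fix j :: nat assume j: "1 \<le> j"
  have "exp (- \<kappa> / v) ^ j \<le> 1" using \<kappa> v by (intro power_le_one) auto
  then have "q j * exp (- \<kappa> / v) ^ j \<le> \<Theta> * 1" using q[OF j] \<Theta> by (intro mult_mono) auto
  then show "q j * exp (- \<kappa> / v) ^ j \<le> \<Theta>" by simp
 qed (use q in auto)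
 have p0: "0 \<le> ?p" using q by (intro partition_function_nonneg) auto
 have "v * (v powr - \<Theta> * ?p) \<le> K * exp 1 * 2 powr K * M powr K"
 \<comment> \<open>At \<open>m = 0\<close> the partition function is 1, and the remaining
   \<open>v powr (1 - \<Theta>)\<close> is at most 1 because
   \<open>\<Theta> \<ge> 1\<close>.\<close>
 proof (cases "m = 0")
  case True
  have "v * v powr - \<Theta> = v powr (1 - \<Theta>)" using v by (simp add: powr_diff powr_minus divide_inverse)
  also have "\<dots> \<le> v powr 0" using v \<Theta> by (intro powr_mono) auto
  finally have "v * (v powr - \<Theta> * ?p) \<le> 1" using True v by simp
  moreover have "1 * 1 * 1 * 1 \<le> K * exp 1 * 2 powr K * M powr K"
   using \<Theta> M by (intro mult_mono ge_one_powr_ge_zero mult_nonneg_nonneg) auto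
  ultimately show ?thesis by simp
 next
  case False
  then have m1: "1 \<le> m" by simp
  have m0: "0 < real m" using m1 by simp
  have "real m * ?p \<le> \<Theta> * (exp 1 * (2 * real m) powr \<Theta>)"
   using partition_function_const_bound[OF _ m1, of \<Theta>] pp \<Theta> m0 by (meson mult_left_mono order_trans of_nat_0_le_iff zero_le_one)
  also have "(2 * real m) powr \<Theta> = real m * (2 powr \<Theta> * real m powr (\<Theta> - 1))"
   using m0 by (simp add: powr_mult powr_diff)
  finally have "real m * ?p \<le> real m * (\<Theta> * exp 1 * 2 powr \<Theta> * real m powr (\<Theta> - 1))" by (simp add: mult_ac)
  then have "?p \<le> \<Theta> * exp 1 * 2 powr \<Theta> * real m powr (\<Theta> - 1)" using m0 by (simp only: mult_le_cancel_left_pos)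
  also have "\<dots> \<le> \<Theta> * exp 1 * 2 powr \<Theta> * (M * v) powr (\<Theta> - 1)"
   using m m0 \<Theta> by (intro mult_left_mono powr_mono2) auto
  finally have "v * (v powr - \<Theta> * ?p) \<le> v * (v powr - \<Theta> * (\<Theta> * exp 1 * 2 powr \<Theta> * (M * v) powr (\<Theta> - 1)))"
   using v by (intro mult_left_mono) auto
  \<comment> \<open>The exponents of \<open>v\<close> add up to
    \<open>1 - \<Theta> + (\<Theta> - 1) = 0\<close>.\<close>
  also have "\<dots> = \<Theta> * exp 1 * 2 powr \<Theta> * M powr (\<Theta> - 1)"
  proof -
   have "v * v powr - \<Theta> * v powr (\<Theta> - 1) = 1" using v by (simp add: powr_diff powr_minus field_simps)
   then have "v * (v powr - \<Theta> * (X * (M powr (\<Theta> - 1) * v powr (\<Theta> - 1)))) = X * M powr (\<Theta> - 1)" for X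
    by (metis (no_types, opaque_lifting) mult.assoc mult.commute mult.right_neutral)
   then show ?thesis using v M by (simp add: powr_mult)
  qed
  also have "\<dots> \<le> K * exp 1 * 2 powr K * M powr K"
   using \<Theta> M by (intro mult_mono powr_mono mult_nonneg_nonneg) auto
  finally show ?thesis .
 qed
 then have "exp K * (v * (v powr - \<Theta> * ?p)) \<le> exp K * (K * exp 1 * 2 powr K * M powr K)" by simp
 moreover have "v * cycle_weight v \<kappa> q q m \<le> exp K * (v * (v powr - \<Theta> * ?p))"
 proof -
  have "exp (- ?S) * ?p \<le> exp K * v powr - \<Theta> * ?p" using eS p0 by (rule mult_right_mono)
  then have "v * (exp (- ?S) * ?p) \<le> v * (exp K * v powr - \<Theta> * ?p)" using v by (intro mult_left_mono) auto
  then show ?thesis unfolding cycle_weight_def by (simp add: mult_ac)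
 qed
 ultimately show ?thesis by linarith
qed

section \<open>The Laplace functional of the bridge\<close>

lemma continuous_section:
 assumes "continuous_on E F" "u \<in> {0..1}" "0 < x"
 shows "continuous_on UNIV (\<lambda>m. F (u, x, m))"
 by (rule continuous_on_compose2[OF assms(1)]) (use assms(2,3) in \<open>auto simp: E_def intro!: continuous_intros\<close>)

context weak_kernel
begin

lemma section_integrable:
 fixes F :: "real \<times> real \<times> 'm => real"
 assumes F: "continuous_on E F" "\<And>z. z \<in> E ==> \<bar>F z\<bar> \<le> B" and u: "u \<in> {0..1}" "0 < x"
 shows "integrable (\<eta> x) (\<lambda>m. F (u, x, m))"
proof (rule kernel_integrable[OF u(2)])
 show "(\<lambda>m. F (u, x, m)) \<in> borel_measurable borel"
  by (rule borel_measurable_continuous_onI[OF continuous_section[OF F(1) u]])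
 show "\<bar>F (u, x, m)\<bar> \<le> B" for m using u by (intro F(2)) (auto simp: E_def)
qed

text \<open>Weak continuity of \<open>\<eta>\<close> only concerns integrands that do not depend on \<open>x\<close>; a jointly continuous
 integrand is approximated from below by Lipschitz functions.\<close>

lemma kernel_lower_semicontinuous:
 fixes G :: "real \<times> real \<times> 'm => real"
 assumes G: "continuous_on E G" "\<And>z. z \<in> E ==> 0 \<le> G z" "\<And>z. z \<in> E ==> G z \<le> B"
  and u: "u \<in> {0..1}" and x: "0 < x" and \<epsilon>: "0 < \<epsilon>"
 shows "\<forall>\<^sub>F y in at x within {0<..}. (\<integral>m. G (u, x, m) \<partial>\<eta> x) - \<epsilon> < (\<integral>m. G (u, y, m) \<partial>\<eta> y)"
proof -
 from countable_lipschitz_approximation[where 'a="real \<times> real \<times> 'm"]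
 obtain \<G> :: "(real \<times> real \<times> 'm => real) set" where GG: "countable \<G> \<and>
  (\<forall>g\<in>\<G>. (\<forall>w. 0 \<le> g w) \<and> (\<exists>K. \<forall>w. g w \<le> K) \<and> (\<exists>L\<ge>0. \<forall>w v. \<bar>g w - g v\<bar> \<le> L * dist w v)) \<and>
  (\<forall>S f. continuous_on S f \<longrightarrow> (\<forall>w\<in>S. 0 \<le> f w) \<longrightarrow>
   (\<exists>h. range h \<subseteq> \<G> \<and> (\<forall>n. \<forall>w\<in>S. h n w \<le> f w) \<and> (\<forall>w. incseq (\<lambda>n. h n w)) \<and> (\<forall>w\<in>S. (\<lambda>n. h n w) \<longlonglongrightarrow> f w)))"
  by (rule exE)
 note G2 = GG[THEN conjunct2, THEN conjunct1, THEN bspec]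
 note G3 = GG[THEN conjunct2, THEN conjunct2, THEN spec, THEN spec, THEN mp, THEN mp]
 have "\<forall>w\<in>E. 0 \<le> G w" using G(2) by blast
 from G3[OF G(1) this] obtain h where hh: "range h \<subseteq> \<G> \<and> (\<forall>n. \<forall>w\<in>E. h n w \<le> G w) \<and>
   (\<forall>w. incseq (\<lambda>n. h n w)) \<and> (\<forall>w\<in>E. (\<lambda>n. h n w) \<longlonglongrightarrow> G w)" by (rule exE)
 then have h: "range h \<subseteq> \<G>" "\<And>n w. w \<in> E ==> h n w \<le> G w" "\<And>w. w \<in> E ==> (\<lambda>n. h n w) \<longlonglongrightarrow> G w"
  by simp_all
 have hG: "h n \<in> \<G>" for n using h(1) by auto
 note h0 = G2[OF hG, THEN conjunct1, THEN spec]
 have B0: "0 \<le> B" using G(2,3)[of "(u, x, undefined)"] u x by (force simp: E_def)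
 have zE: "(u, y, m) \<in> E" if "0 < y" for y m using that u by (auto simp: E_def)
 have hc: "continuous_on S (h n)" for n S
 proof -
  obtain L where L: "L \<ge> 0" "\<And>w v. \<bar>h n w - h n v\<bar> \<le> L * dist w v" using G2[OF hG[of n]] by auto
  have "L-lipschitz_on S (h n)" using L by (intro lipschitz_onI) (auto simp: dist_real_def)
  then show ?thesis by (rule lipschitz_on_continuous_on)
 qed
 have hb: "\<bar>h n z\<bar> \<le> B" if "z \<in> E" for n z using h(2)[OF that, of n] h0[of n z] G(3)[OF that] by simp
 have Gb: "\<bar>G z\<bar> \<le> B" if "z \<in> E" for z using G(2,3)[OF that] by simp
 have "(\<lambda>n. \<integral>m. h n (u, x, m) \<partial>\<eta> x) \<longlonglongrightarrow> (\<integral>m. G (u, x, m) \<partial>\<eta> x)"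
 proof (rule integral_dominated_convergence[where w = "\<lambda>m. G (u, x, m)"])
  show "integrable (\<eta> x) (\<lambda>m. G (u, x, m))" by (rule section_integrable[OF G(1) Gb u x])
  then show "(\<lambda>m. G (u, x, m)) \<in> borel_measurable (\<eta> x)" by (rule borel_measurable_integrable)
  show "(\<lambda>m. h n (u, x, m)) \<in> borel_measurable (\<eta> x)" for n
   by (rule borel_measurable_integrable[OF section_integrable[OF hc hb u x]])
  show "AE m in \<eta> x. (\<lambda>n. h n (u, x, m)) \<longlonglongrightarrow> G (u, x, m)" using h(3)[OF zE[OF x]] by simp
  show "AE m in \<eta> x. norm (h n (u, x, m)) \<le> G (u, x, m)" for n using h(2)[OF zE[OF x]] h0 by simp
 qed
 then have "\<forall>\<^sub>F n in sequentially. (\<integral>m. G (u, x, m) \<partial>\<eta> x) - \<epsilon> < (\<integral>m. h n (u, x, m) \<partial>\<eta> x)"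
  using \<epsilon> by (intro order_tendstoD) auto
 then obtain n where n: "(\<integral>m. G (u, x, m) \<partial>\<eta> x) - \<epsilon> < (\<integral>m. h n (u, x, m) \<partial>\<eta> x)"
  using eventually_happens'[OF sequentially_bot] by blast
 obtain L where L: "L \<ge> 0" "\<And>w v. \<bar>h n w - h n v\<bar> \<le> L * dist w v" using G2[OF hG[of n]] by auto
 have c1: "((\<lambda>y. \<integral>m. h n (u, x, m) \<partial>\<eta> y) \<longlongrightarrow> (\<integral>m. h n (u, x, m) \<partial>\<eta> x)) (at x within {0<..})"
 proof -
  have "continuous_on {0<..} (\<lambda>y. \<integral>m. h n (u, x, m) \<partial>\<eta> y)"
  proof (rule weakly_continuous)
   show "continuous_on UNIV (\<lambda>m. h n (u, x, m))" by (rule continuous_section[OF hc u x])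
   have "\<bar>h n (u, x, m)\<bar> \<le> B" for m by (rule hb[OF zE[OF x]])
   then show "bounded (range (\<lambda>m. h n (u, x, m)))" unfolding bounded_iff by auto
  qed
  then show ?thesis using x by (auto simp: continuous_on_def)
 qed
 have c2: "((\<lambda>y. mass (\<eta> y)) \<longlongrightarrow> mass (\<eta> x)) (at x within {0<..})"
  using mass_continuous x by (auto simp: continuous_on_def)
 \<comment> \<open>A minorant of the integral at \<open>y\<close>: exchanging \<open>x\<close> for
   \<open>y\<close> in the argument of the Lipschitz function \<open>h n\<close> costs at most
   \<open>L * \<bar>x - y\<bar>\<close> times the mass, and the integrand with \<open>x\<close>
   frozen is covered by weak continuity.\<close>
 have "((\<lambda>y. (\<integral>m. h n (u, x, m) \<partial>\<eta> y) - L * \<bar>x - y\<bar> * mass (\<eta> y)) \<longlongrightarrow> (\<integral>m. h n (u, x, m) \<partial>\<eta> x) - L * \<bar>x - x\<bar> * mass (\<eta> x)) (at x within {0<..})"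
  by (intro tendsto_intros c1 c2)
 then have "((\<lambda>y. (\<integral>m. h n (u, x, m) \<partial>\<eta> y) - L * \<bar>x - y\<bar> * mass (\<eta> y)) \<longlongrightarrow> (\<integral>m. h n (u, x, m) \<partial>\<eta> x)) (at x within {0<..})" by simp
 from order_tendstoD(1)[OF this n]
 have ev: "\<forall>\<^sub>F y in at x within {0<..}. (\<integral>m. G (u, x, m) \<partial>\<eta> x) - \<epsilon> < (\<integral>m. h n (u, x, m) \<partial>\<eta> y) - L * \<bar>x - y\<bar> * mass (\<eta> y)" .
 moreover have "\<forall>\<^sub>F y in at x within {0<..}. 0 < y" by (simp add: eventually_at_filter)
 ultimately show ?thesis
 proof eventually_elim
  case (elim y)
  interpret finite_measure "\<eta> y" by (rule kernel_props(3)[OF elim(2)])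
  have i1: "integrable (\<eta> y) (\<lambda>m. h n (u, x, m))"
  proof (rule kernel_integrable[OF elim(2)])
   show "(\<lambda>m. h n (u, x, m)) \<in> borel_measurable borel"
    by (rule borel_measurable_continuous_onI[OF continuous_section[OF hc u x]])
  qed (rule hb[OF zE[OF x]])
  have i2: "integrable (\<eta> y) (\<lambda>m. h n (u, y, m))" by (rule section_integrable[OF hc hb u elim(2)])
  have i3: "integrable (\<eta> y) (\<lambda>m. G (u, y, m))" by (rule section_integrable[OF G(1) Gb u elim(2)])
  have "(\<integral>m. h n (u, x, m) \<partial>\<eta> y) - L * \<bar>x - y\<bar> * mass (\<eta> y) = (\<integral>m. h n (u, x, m) - L * \<bar>x - y\<bar> \<partial>\<eta> y)"
   using i1 by simp
  also have "\<dots> \<le> (\<integral>m. h n (u, y, m) \<partial>\<eta> y)"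
  proof (rule integral_mono)
   fix m :: 'm
   have "dist (u, x, m) (u, y, m) = \<bar>x - y\<bar>" by (simp add: dist_Pair_Pair dist_real_def)
   then show "h n (u, x, m) - L * \<bar>x - y\<bar> \<le> h n (u, y, m)" using L(2)[of "(u, x, m)" "(u, y, m)"] by (simp add: abs_le_iff)
  qed (use i1 i2 in auto)
  also have "\<dots> \<le> (\<integral>m. G (u, y, m) \<partial>\<eta> y)"
   by (rule integral_mono[OF i2 i3]) (rule h(2)[OF zE[OF elim(2)]])
  finally show ?case using elim(1) by linarith
 qed
qed

text \<open>Lower semicontinuity for the nonnegative functions \<open>F + B\<close> and
  \<open>B - F\<close>, together with continuity of \<open>mass (\<eta> x)\<close>, gives both
  inequalities.\<close>

lemma kernel_continuous:
 fixes F :: "real \<times> real \<times> 'm => real"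
 assumes F: "continuous_on E F" "\<And>z. z \<in> E ==> \<bar>F z\<bar> \<le> B" and u: "u \<in> {0..1}"
 shows "continuous_on {0<..} (\<lambda>x. \<integral>m. F (u, x, m) \<partial>\<eta> x)"
 unfolding continuous_on_def
proof (intro ballI tendstoI)
 fix x e :: real assume "x \<in> {0<..}" and e: "0 < e"
 then have x: "0 < x" by simp
 have i: "integrable (\<eta> y) (\<lambda>m. F (u, y, m))" if "0 < y" for y by (rule section_integrable[OF F u that])
 have Fb: "- B \<le> F z" "F z \<le> B" if "z \<in> E" for z using F(2)[OF that] by (auto simp: abs_le_iff)
 have c: "continuous_on E (\<lambda>z. F z + B)" "continuous_on E (\<lambda>z. B - F z)" by (intro continuous_intros F)+
 have l1: "\<forall>\<^sub>F y in at x within {0<..}. (\<integral>m. F (u, x, m) + B \<partial>\<eta> x) - e / 2 < (\<integral>m. F (u, y, m) + B \<partial>\<eta> y)"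
  using kernel_lower_semicontinuous[OF c(1) _ _ u x, of "2 * B" "e / 2"] Fb e by force
 have l2: "\<forall>\<^sub>F y in at x within {0<..}. (\<integral>m. B - F (u, x, m) \<partial>\<eta> x) - e / 2 < (\<integral>m. B - F (u, y, m) \<partial>\<eta> y)"
  using kernel_lower_semicontinuous[OF c(2) _ _ u x, of "2 * B" "e / 2"] Fb e by force
 have c2: "((\<lambda>y. B * mass (\<eta> y)) \<longlongrightarrow> B * mass (\<eta> x)) (at x within {0<..})"
  using mass_continuous x by (intro tendsto_intros) (auto simp: continuous_on_def)
 have "0 < e / 2" using e by simp
 note l3 = tendstoD[OF c2 this]
 have "\<forall>\<^sub>F y in at x within {0<..}. 0 < y" by (simp add: eventually_at_filter)
 with l1 l2 l3 show "\<forall>\<^sub>F y in at x within {0<..}. dist (\<integral>m. F (u, y, m) \<partial>\<eta> y) (\<integral>m. F (u, x, m) \<partial>\<eta> x) < e"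
 proof eventually_elim
  case (elim y)
  have eq: "(\<integral>m. F (u, z, m) + B \<partial>\<eta> z) = (\<integral>m. F (u, z, m) \<partial>\<eta> z) + B * mass (\<eta> z)"
   "(\<integral>m. B - F (u, z, m) \<partial>\<eta> z) = B * mass (\<eta> z) - (\<integral>m. F (u, z, m) \<partial>\<eta> z)" if "0 < z" for z
  proof -
   interpret finite_measure "\<eta> z" by (rule kernel_props(3)[OF that])
   show "(\<integral>m. F (u, z, m) + B \<partial>\<eta> z) = (\<integral>m. F (u, z, m) \<partial>\<eta> z) + B * mass (\<eta> z)"
    "(\<integral>m. B - F (u, z, m) \<partial>\<eta> z) = B * mass (\<eta> z) - (\<integral>m. F (u, z, m) \<partial>\<eta> z)"
    using i[OF that] by simp_all
  qed
  show ?case using elim unfolding eq[OF x] eq[OF elim(4)] dist_real_def by linarith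
 qed
qed

lemma section_measurable_u:
 fixes F :: "real \<times> real \<times> 'm => real"
 assumes F: "continuous_on E F" "\<And>z. z \<in> E ==> \<bar>F z\<bar> \<le> B" and x: "0 < x"
 shows "(\<lambda>u. indicator {0..1} u * (\<integral>m. F (u, x, m) \<partial>\<eta> x)) \<in> borel_measurable lborel"
proof -
 interpret finite_measure "\<eta> x" by (rule kernel_props(3)[OF x])
 define F' where "F' z = (if z \<in> E then F z else 0)" for z
 have "F \<in> borel_measurable borel_E" unfolding borel_E_def by (rule borel_measurable_continuous_on_restrict[OF F(1)])
 from borel_E_extend_measurable[OF this] have F': "F' \<in> borel_measurable borel" unfolding F'_def .
 have "(\<lambda>z. (fst z, x, snd z)) \<in> measurable (borel \<Otimes>\<^sub>M borel) (borel \<Otimes>\<^sub>M (borel \<Otimes>\<^sub>M borel) :: (real \<times> real \<times> 'm) measure)" by measurable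
 moreover have "(borel \<Otimes>\<^sub>M (borel \<Otimes>\<^sub>M borel) :: (real \<times> real \<times> 'm) measure) = borel" by (simp add: borel_prod)
 ultimately have "(\<lambda>z. (fst z, x, snd z)) \<in> measurable (borel \<Otimes>\<^sub>M borel) (borel :: (real \<times> real \<times> 'm) measure)" by (simp only:)
 from measurable_compose[OF this F'] have m: "(\<lambda>z. F' (fst z, x, snd z)) \<in> borel_measurable (borel \<Otimes>\<^sub>M borel)" .
 have s: "sets (lborel \<Otimes>\<^sub>M \<eta> x) = sets (borel \<Otimes>\<^sub>M borel)"
  by (rule sets_pair_measure_cong) (simp_all add: kernel_props(1)[OF x])
 have "(\<lambda>(u, m). F' (u, x, m)) \<in> borel_measurable (lborel \<Otimes>\<^sub>M \<eta> x)"
  unfolding measurable_cong_sets[OF s refl] split_beta' by (rule m)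
 from borel_measurable_lebesgue_integral[OF this]
 have "(\<lambda>u. \<integral>m. F' (u, x, m) \<partial>\<eta> x) \<in> borel_measurable lborel" .
 then have "(\<lambda>u. indicator {0..1} u * (\<integral>m. F' (u, x, m) \<partial>\<eta> x)) \<in> borel_measurable lborel" by measurable
 also have "(\<lambda>u. indicator {0..1} u * (\<integral>m. F' (u, x, m) \<partial>\<eta> x)) = (\<lambda>u. indicator {0..1} u * (\<integral>m. F (u, x, m) \<partial>\<eta> x))"
 proof
  fix u :: real
  show "indicator {0..1} u * (\<integral>m. F' (u, x, m) \<partial>\<eta> x) = indicator {0..1} u * (\<integral>m. F (u, x, m) \<partial>\<eta> x)"
  proof (cases "u \<in> {0..1}")
   case True
   then have "F' (u, x, m) = F (u, x, m)" for m using x by (simp add: F'_def E_def)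
   then show ?thesis by simp
  qed simp
 qed
 finally show ?thesis .
qed

lemma section_integral_bound:
 fixes F :: "real \<times> real \<times> 'm => real"
 assumes F: "continuous_on E F" "\<And>z. z \<in> E ==> \<bar>F z\<bar> \<le> B" and u: "u \<in> {0..1}" and x: "0 < x"
 shows "\<bar>\<integral>m. F (u, x, m) \<partial>\<eta> x\<bar> \<le> B * mass (\<eta> x)"
proof -
 interpret finite_measure "\<eta> x" by (rule kernel_props(3)[OF x])
 note i = section_integrable[OF F u x]
 have "\<bar>\<integral>m. F (u, x, m) \<partial>\<eta> x\<bar> \<le> (\<integral>m. \<bar>F (u, x, m)\<bar> \<partial>\<eta> x)" by (rule integral_abs_bound)
 also have "\<dots> \<le> (\<integral>m. B \<partial>\<eta> x)"
  using i u x by (intro integral_mono) (auto intro!: F(2) simp: E_def)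
 finally show ?thesis by (simp add: mult.commute)
qed

lemma averaged_integrable:
 fixes F :: "real \<times> real \<times> 'm => real"
 assumes F: "continuous_on E F" "\<And>z. z \<in> E ==> \<bar>F z\<bar> \<le> B" and x: "0 < x"
 shows "set_integrable lborel {0..1} (\<lambda>u. \<integral>m. F (u, x, m) \<partial>\<eta> x)"
 unfolding set_integrable_def
proof (rule Bochner_Integration.integrable_bound)
 show "integrable lborel (\<lambda>u::real. indicator {0..1} u * (B * mass (\<eta> x)))"
  by (intro integrable_mult_left integrable_real_indicator) auto
 show "(\<lambda>u. indicator {0..1} u *\<^sub>R (\<integral>m. F (u, x, m) \<partial>\<eta> x)) \<in> borel_measurable lborel"
  using section_measurable_u[OF F x] by simp
 show "AE u in lborel. norm (indicator {0..1} u *\<^sub>R (\<integral>m. F (u, x, m) \<partial>\<eta> x)) \<le> norm (indicator {0..1} u * (B * mass (\<eta> x)))"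
 proof (intro AE_I2)
  fix u :: real
  show "norm (indicator {0..1} u *\<^sub>R (\<integral>m. F (u, x, m) \<partial>\<eta> x)) \<le> norm (indicator {0..1} u * (B * mass (\<eta> x)))"
   using section_integral_bound[OF F _ x, of u] by (cases "u \<in> {0..1}") auto
 qed
qed

text \<open>Dominated convergence in \<open>u\<close>; along a convergent sequence of points the
  masses of \<open>\<eta>\<close> converge and are therefore bounded.\<close>

lemma averaged_continuous:
 fixes F :: "real \<times> real \<times> 'm => real"
 assumes F: "continuous_on E F" "\<And>z. z \<in> E ==> \<bar>F z\<bar> \<le> B"
 shows "continuous_on {0<..} (\<lambda>x. LINT u:{0..1}|lborel. \<integral>m. F (u, x, m) \<partial>\<eta> x)"
 unfolding continuous_on_sequentially
proof (intro allI ballI impI)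
 fix xs :: "nat => real" and x assume x: "x \<in> {0<..}" and "(\<forall>n. xs n \<in> {0<..}) \<and> xs \<longlonglongrightarrow> x"
 then have xs: "\<And>n. 0 < xs n" "xs \<longlonglongrightarrow> x" and x0: "0 < x" by auto
 have ml: "(\<lambda>n. mass (\<eta> (xs n))) \<longlonglongrightarrow> mass (\<eta> x)"
  using continuous_on_tendsto_compose[OF mass_continuous xs(2)] x xs(1) by auto
 then have "Bseq (\<lambda>n. mass (\<eta> (xs n)))" by (intro convergent_imp_Bseq) (auto simp: convergent_def)
 then obtain K where K: "\<And>n. \<bar>mass (\<eta> (xs n))\<bar> \<le> K" by (auto simp: Bseq_def)
 have "(\<lambda>n. \<integral>u. indicator {0..1} u *\<^sub>R (\<integral>m. F (u, xs n, m) \<partial>\<eta> (xs n)) \<partial>lborel) \<longlonglongrightarrow> (\<integral>u. indicator {0..1} u *\<^sub>R (\<integral>m. F (u, x, m) \<partial>\<eta> x) \<partial>lborel)"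
 proof (rule integral_dominated_convergence[where w = "\<lambda>u. indicator {0..1} u * (\<bar>B\<bar> * K)"])
  show "(\<lambda>u. indicator {0..1} u *\<^sub>R (\<integral>m. F (u, x, m) \<partial>\<eta> x)) \<in> borel_measurable lborel"
   using section_measurable_u[OF F x0] by simp
  show "(\<lambda>u. indicator {0..1} u *\<^sub>R (\<integral>m. F (u, xs n, m) \<partial>\<eta> (xs n))) \<in> borel_measurable lborel" for n
   using section_measurable_u[OF F xs(1)] by simp
  show "integrable lborel (\<lambda>u::real. indicator {0..1} u * (\<bar>B\<bar> * K))"
   by (intro integrable_mult_left integrable_real_indicator) auto
  show "AE u in lborel. (\<lambda>n. indicator {0..1} u *\<^sub>R (\<integral>m. F (u, xs n, m) \<partial>\<eta> (xs n))) \<longlonglongrightarrow> indicator {0..1} u *\<^sub>R (\<integral>m. F (u, x, m) \<partial>\<eta> x)"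
  proof (intro AE_I2)
   fix u :: real
   show "(\<lambda>n. indicator {0..1} u *\<^sub>R (\<integral>m. F (u, xs n, m) \<partial>\<eta> (xs n))) \<longlonglongrightarrow> indicator {0..1} u *\<^sub>R (\<integral>m. F (u, x, m) \<partial>\<eta> x)"
   proof (cases "u \<in> {0..1}")
    case True
    from continuous_on_tendsto_compose[OF kernel_continuous[OF F True] xs(2)] x xs(1)
    show ?thesis using True by auto
   qed simp
  qed
  show "AE u in lborel. norm (indicator {0..1} u *\<^sub>R (\<integral>m. F (u, xs n, m) \<partial>\<eta> (xs n))) \<le> indicator {0..1} u * (\<bar>B\<bar> * K)" for n
  proof (intro AE_I2)
   fix u :: real
   have "B * mass (\<eta> (xs n)) \<le> \<bar>B\<bar> * K" using K[of n] by (intro mult_mono) auto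
   then show "norm (indicator {0..1} u *\<^sub>R (\<integral>m. F (u, xs n, m) \<partial>\<eta> (xs n))) \<le> indicator {0..1} u * (\<bar>B\<bar> * K)"
    using section_integral_bound[OF F _ xs(1), of u n] by (cases "u \<in> {0..1}") auto
  qed
 qed
 then show "((\<lambda>x. LINT u:{0..1}|lborel. \<integral>m. F (u, x, m) \<partial>\<eta> x) \<circ> xs) \<longlonglongrightarrow> (LINT u:{0..1}|lborel. \<integral>m. F (u, x, m) \<partial>\<eta> x)"
  by (simp add: comp_def set_lebesgue_integral_def)
qed

end

section \<open>The exponent of the Poisson Laplace functional\<close>

context weak_kernel
begin

context
 fixes \<kappa> t :: real and h :: "real \<times> real \<times> 'm => real" and P :: "(real \<times> real \<times> 'm) measure measure"
 assumes h: "h \<in> nonneg_test_functions" and t: "0 \<le> t"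
  and phi: "set_integrable lborel {0<..} (\<lambda>x. min 1 x * exp (- \<kappa> * x) * (mass (\<eta> x) / x))"
begin

text \<open>The integrand of the Poisson exponent for \<open>h\<close> plus \<open>t\<close> times
  the size. Testing the total size along with \<open>h\<close> is what later determines the law
  conditioned on the total size.\<close>

definition defect :: "real \<times> real \<times> 'm => real" where
 "defect z = 1 - exp (- (h z + t * fst (snd z)))"

definition averaged_defect :: "real => real" where
 "averaged_defect x = (LINT u:{0..1}|lborel. \<integral>m. defect (u, x, m) \<partial>\<eta> x)"

lemma h_facts: "continuous_on E h" "\<And>z. z \<in> E ==> 0 \<le> h z"
 using h by (auto simp: nonneg_test_functions_def test_functions_def)

lemma defect_continuous: "continuous_on E defect"
 unfolding defect_def by (intro continuous_intros h_facts)

lemma defect_bounds: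
 assumes "z \<in> E" shows "0 \<le> defect z" "\<bar>defect z\<bar> \<le> 1"
proof -
 have "0 \<le> h z + t * fst (snd z)" using h_facts(2)[OF assms] assms t by (auto simp: E_def)
 then show "0 \<le> defect z" "\<bar>defect z\<bar> \<le> 1" by (auto simp: defect_def)
qed

lemma averaged_defect_nonneg: "0 < x ==> 0 \<le> averaged_defect x"
 unfolding averaged_defect_def set_lebesgue_integral_def
 by (intro integral_nonneg_AE AE_I2) (auto simp: indicator_def E_def intro!: integral_nonneg_AE AE_I2 defect_bounds)

text \<open>The defect is at most 1 and at most \<open>h + t * x\<close>. As \<open>h\<close> is
  bounded by \<open>M\<close> and vanishes for \<open>x < \<delta>\<close>, it is at most
  \<open>M * x / \<delta>\<close>, so the defect is at most linear near 0; this matches the factor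
  \<open>min 1 x\<close> in \<open>phi\<close>.\<close>

lemma averaged_defect_bound:
 "\<exists>C. \<forall>x>0. averaged_defect x \<le> C * min 1 x * mass (\<eta> x)"
proof -
 obtain \<delta> R where d: "0 < \<delta>" and z: "\<And>z. z \<in> E ==> z \<notin> strip \<delta> R ==> h z = 0"
  using h by (auto simp: nonneg_test_functions_def test_functions_def)
 have "bounded (h ` E)" using h by (simp add: nonneg_test_functions_def test_functions_def)
 then obtain M where "\<forall>y\<in>h ` E. norm y \<le> M" unfolding bounded_iff ..
 then have M: "\<bar>h z\<bar> \<le> M" if "z \<in> E" for z using that by simp
 define C where "C = 1 + \<bar>M\<bar> / \<delta> + t"
 have C0: "0 \<le> \<bar>M\<bar> / \<delta>" using d by simp
 have b: "\<bar>defect (u, x, m)\<bar> \<le> C * min 1 x" if u: "u \<in> {0..1}" and x: "0 < x" for u x m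
 proof -
  have e: "(u, x, m) \<in> E" using u x by (auto simp: E_def)
  show ?thesis
  proof (cases "1 \<le> x")
   case True
   then show ?thesis using defect_bounds(2)[OF e] C0 t by (simp add: C_def)
  next
   case False
   have "h (u, x, m) \<le> \<bar>M\<bar> / \<delta> * x"
   proof (cases "\<delta> \<le> x")
    case True
    have "h (u, x, m) \<le> \<bar>M\<bar>" using M[OF e] by linarith
    also have "\<bar>M\<bar> = \<bar>M\<bar> / \<delta> * \<delta>" using d by simp
    also have "\<dots> \<le> \<bar>M\<bar> / \<delta> * x" using True C0 by (rule mult_left_mono)
    finally show ?thesis .
   next
    case False
    then have "(u, x, m) \<notin> strip \<delta> R" by (simp add: strip_def)
    from z[OF e this] show ?thesis using mult_nonneg_nonneg[OF C0 less_imp_le[OF x]] by simp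
   qed
   moreover have "defect (u, x, m) \<le> h (u, x, m) + t * x"
    unfolding defect_def fst_conv snd_conv using exp_ge_add_one_self[of "- (h (u, x, m) + t * x)"] by linarith
   moreover have "C * x = x + \<bar>M\<bar> / \<delta> * x + t * x" by (simp add: C_def algebra_simps)
   ultimately show ?thesis using defect_bounds(1)[OF e] x False by (simp add: min_def)
  qed
 qed
 have "averaged_defect x \<le> C * min 1 x * mass (\<eta> x)" if x: "0 < x" for x
 proof -
  have C1: "0 \<le> C * min 1 x" using C0 t x by (simp add: C_def)
  interpret finite_measure "\<eta> x" by (rule kernel_props(3)[OF x])
  have "(\<integral>m. defect (u, x, m) \<partial>\<eta> x) \<le> C * min 1 x * mass (\<eta> x)" if u: "u \<in> {0..1}" for u
  proof -
   have "(\<integral>m. defect (u, x, m) \<partial>\<eta> x) \<le> (\<integral>m. C * min 1 x \<partial>\<eta> x)"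
    using b[OF u x] by (intro integral_mono section_integrable[OF defect_continuous defect_bounds(2) u x]) (auto simp: abs_le_iff)
   then show ?thesis by (simp add: mult_ac)
  qed
  then have "averaged_defect x \<le> (LINT u:{0..1::real}|lborel. C * min 1 x * mass (\<eta> x))"
   unfolding averaged_defect_def
   by (intro set_integral_mono averaged_integrable[OF defect_continuous defect_bounds(2) x])
    (auto simp: set_integrable_def intro!: integrable_mult_left integrable_real_indicator)
  also have "\<dots> = C * min 1 x * mass (\<eta> x)" by (simp add: set_lebesgue_integral_def)
  finally show ?thesis .
 qed
 then show ?thesis by blast
qed

lemma averaged_defect_integrable:
 "set_integrable lborel {0<..} (\<lambda>x. exp (- \<kappa> * x) / x * averaged_defect x)"
proof -
 obtain C where C: "\<And>x. 0 < x ==> averaged_defect x \<le> C * min 1 x * mass (\<eta> x)" using averaged_defect_bound by blast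
 have c: "continuous_on {0<..} averaged_defect"
  unfolding averaged_defect_def[abs_def] by (rule averaged_continuous[OF defect_continuous defect_bounds(2)])
 have "(\<lambda>x. indicator {0<..} x *\<^sub>R (exp (- \<kappa> * x) / x * averaged_defect x)) \<in> borel_measurable borel"
  by (intro borel_measurable_continuous_on_indicator continuous_intros c) auto
 then have m: "(\<lambda>x. indicator {0<..} x *\<^sub>R (exp (- \<kappa> * x) / x * averaged_defect x)) \<in> borel_measurable lborel" by simp
 show ?thesis unfolding set_integrable_def
 proof (rule Bochner_Integration.integrable_bound[OF _ m])
  show "integrable lborel (\<lambda>x. C * (indicator {0<..} x *\<^sub>R (min 1 x * exp (- \<kappa> * x) * (mass (\<eta> x) / x))))"
   using phi unfolding set_integrable_def by (rule integrable_mult_right)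
  show "AE x in lborel. norm (indicator {0<..} x *\<^sub>R (exp (- \<kappa> * x) / x * averaged_defect x)) \<le>
    norm (C * (indicator {0<..} x *\<^sub>R (min 1 x * exp (- \<kappa> * x) * (mass (\<eta> x) / x))))"
  proof (intro AE_I2)
   fix x :: real
   show "norm (indicator {0<..} x *\<^sub>R (exp (- \<kappa> * x) / x * averaged_defect x)) \<le>
    norm (C * (indicator {0<..} x *\<^sub>R (min 1 x * exp (- \<kappa> * x) * (mass (\<eta> x) / x))))"
   proof (cases "0 < x")
    case True
    have p: "0 \<le> exp (- \<kappa> * x) / x" using True by simp
    have "norm (indicator {0<..} x *\<^sub>R (exp (- \<kappa> * x) / x * averaged_defect x)) = exp (- \<kappa> * x) / x * averaged_defect x"
     using True averaged_defect_nonneg[OF True] by simp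
    also have "\<dots> \<le> exp (- \<kappa> * x) / x * (C * min 1 x * mass (\<eta> x))" by (rule mult_left_mono[OF C[OF True] p])
    also have "\<dots> = C * (indicator {0<..} x *\<^sub>R (min 1 x * exp (- \<kappa> * x) * (mass (\<eta> x) / x)))"
     using True by simp
    finally show ?thesis by (simp only: real_norm_def abs_of_nonneg)
   qed simp
  qed
 qed
qed

lemma averaged_defect_eq:
 assumes x: "0 < x"
 shows "averaged_defect x = mass (\<eta> x) - (LINT u:{0..1}|lborel. \<integral>m. exp (- h (u, x, m)) \<partial>\<eta> x) * exp (- t * x)"
proof -
 interpret finite_measure "\<eta> x" by (rule kernel_props(3)[OF x])
 have c: "continuous_on E (\<lambda>z. exp (- h z))" by (intro continuous_intros h_facts)
 have b: "\<bar>exp (- h z)\<bar> \<le> 1" if "z \<in> E" for z using h_facts(2)[OF that] by simp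
 have "(\<integral>m. defect (u, x, m) \<partial>\<eta> x) = mass (\<eta> x) - (\<integral>m. exp (- h (u, x, m)) \<partial>\<eta> x) * exp (- t * x)" if u: "u \<in> {0..1}" for u
 proof -
  have i: "integrable (\<eta> x) (\<lambda>m. exp (- h (u, x, m)))" by (rule section_integrable[OF c b u x])
  have "(\<integral>m. defect (u, x, m) \<partial>\<eta> x) = (\<integral>m. 1 - exp (- h (u, x, m)) * exp (- t * x) \<partial>\<eta> x)"
   by (simp add: defect_def mult_exp_exp)
  also have "\<dots> = (\<integral>m. 1 \<partial>\<eta> x) - (\<integral>m. exp (- h (u, x, m)) * exp (- t * x) \<partial>\<eta> x)"
   using i by (intro Bochner_Integration.integral_diff integrable_mult_left) auto
  finally show ?thesis using i by simp
 qed
 then have "averaged_defect x = (LINT u:{0..1}|lborel. mass (\<eta> x) - (\<integral>m. exp (- h (u, x, m)) \<partial>\<eta> x) * exp (- t * x))"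
  unfolding averaged_defect_def by (intro set_lebesgue_integral_cong) auto
 also have "\<dots> = (LINT u:{0..1::real}|lborel. mass (\<eta> x)) - (LINT u:{0..1}|lborel. (\<integral>m. exp (- h (u, x, m)) \<partial>\<eta> x) * exp (- t * x))"
  by (intro set_integral_diff set_integrable_mult_left averaged_integrable[OF c b x])
   (auto simp: set_integrable_def intro!: integrable_mult_left integrable_real_indicator)
 finally show ?thesis by (simp add: set_lebesgue_integral_def)
qed

text \<open>Fubini: the intensity integrates over \<open>x\<close> inside and over \<open>u\<close>
  outside, the averaged form the other way round.\<close>

lemma defect_intensity:
 "(\<integral>\<^sup>+z. ennreal (defect z) \<partial>intensity \<eta> \<kappa>) = ennreal (LINT x:{0<..}|lborel. exp (- \<kappa> * x) / x * averaged_defect x)"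
proof -
 define F where "F z = ennreal (if z \<in> E then defect z else 0)" for z
 have "defect \<in> borel_measurable borel_E"
  unfolding borel_E_def by (rule borel_measurable_continuous_on_restrict[OF defect_continuous])
 from borel_E_extend_measurable[OF this] have F: "F \<in> borel_measurable borel" unfolding F_def[abs_def] by measurable
 define A where "A u x = ennreal (exp (- \<kappa> * x) / x) * (\<integral>\<^sup>+m. F (u, x, m) \<partial>\<eta> x) * indicator {0<..} x" for u x
 have m: "(\<lambda>(u, x). A u x * indicator {0..1} u) \<in> borel_measurable (lborel \<Otimes>\<^sub>M lborel)"
 proof -
  have "(\<lambda>(u, x). A u x) \<in> borel_measurable (borel \<Otimes>\<^sub>M borel)" unfolding A_def by (rule intensity_measurable1[OF F])
  then have "(\<lambda>z. (case z of (u, x) => A u x) * indicator {0..1} (fst z)) \<in> borel_measurable (borel \<Otimes>\<^sub>M borel)" by measurable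
  then have "(\<lambda>(u, x). A u x * indicator {0..1} u) \<in> borel_measurable (borel \<Otimes>\<^sub>M borel)" by (simp add: split_beta')
  then show ?thesis unfolding measurable_cong_sets[OF sets_pair_measure_cong[OF sets_lborel sets_lborel] refl] .
 qed
 have "(\<integral>\<^sup>+z. ennreal (defect z) \<partial>intensity \<eta> \<kappa>) = (\<integral>\<^sup>+z. F z \<partial>intensity \<eta> \<kappa>)"
  by (rule nn_integral_cong) (simp add: sets_intensity F_def)
 also have "\<dots> = intensity_integral \<kappa> F" by (rule nn_integral_intensity[OF F])
 also have "\<dots> = (\<integral>\<^sup>+u. (\<integral>\<^sup>+x. A u x \<partial>lborel) * indicator {0..1} u \<partial>lborel)" by (simp add: intensity_integral_def A_def)
 also have "\<dots> = (\<integral>\<^sup>+u. \<integral>\<^sup>+x. A u x * indicator {0..1} u \<partial>lborel \<partial>lborel)"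
  by (intro nn_integral_cong) (simp split: split_indicator)
 also have "\<dots> = (\<integral>\<^sup>+x. \<integral>\<^sup>+u. A u x * indicator {0..1} u \<partial>lborel \<partial>lborel)"
  by (rule lborel_pair.Fubini'[OF m, symmetric])
 also have "\<dots> = (\<integral>\<^sup>+x. ennreal (indicator {0<..} x *\<^sub>R (exp (- \<kappa> * x) / x * averaged_defect x)) \<partial>lborel)"
 proof (intro nn_integral_cong)
  fix x :: real
  show "(\<integral>\<^sup>+u. A u x * indicator {0..1} u \<partial>lborel) = ennreal (indicator {0<..} x *\<^sub>R (exp (- \<kappa> * x) / x * averaged_defect x))"
  proof (cases "0 < x")
   case True
   have s: "A u x * indicator {0..1} u = ennreal (exp (- \<kappa> * x) / x * (indicator {0..1} u *\<^sub>R (\<integral>m. defect (u, x, m) \<partial>\<eta> x)))" for u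
   proof (cases "u \<in> {0..1}")
    case u: True
    then have e: "(u, x, m) \<in> E" for m :: 'm using True by (auto simp: E_def)
    have "(\<integral>\<^sup>+m. F (u, x, m) \<partial>\<eta> x) = (\<integral>\<^sup>+m. ennreal (defect (u, x, m)) \<partial>\<eta> x)" using e by (simp add: F_def)
    also have "\<dots> = ennreal (\<integral>m. defect (u, x, m) \<partial>\<eta> x)"
     by (intro nn_integral_eq_integral section_integrable[OF defect_continuous defect_bounds(2) u True] AE_I2 defect_bounds(1) e)
    finally show ?thesis using u True
     by (simp add: A_def ennreal_mult[symmetric] integral_nonneg_AE defect_bounds(1)[OF e])
   qed simp
   have "(\<integral>\<^sup>+u. A u x * indicator {0..1} u \<partial>lborel) =
     ennreal (\<integral>u. exp (- \<kappa> * x) / x * (indicator {0..1} u *\<^sub>R (\<integral>m. defect (u, x, m) \<partial>\<eta> x)) \<partial>lborel)"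
    unfolding s
   proof (rule nn_integral_eq_integral)
    show "integrable lborel (\<lambda>u. exp (- \<kappa> * x) / x * (indicator {0..1} u *\<^sub>R (\<integral>m. defect (u, x, m) \<partial>\<eta> x)))"
     using averaged_integrable[OF defect_continuous defect_bounds(2) True] unfolding set_integrable_def by (rule integrable_mult_right)
    show "AE u in lborel. 0 \<le> exp (- \<kappa> * x) / x * (indicator {0..1} u *\<^sub>R (\<integral>m. defect (u, x, m) \<partial>\<eta> x))"
     using True by (intro AE_I2) (auto simp: indicator_def E_def intro!: integral_nonneg_AE mult_nonneg_nonneg divide_nonneg_nonneg defect_bounds)
   qed
   then show ?thesis using True by (simp add: averaged_defect_def set_lebesgue_integral_def)
  qed (simp add: A_def)
 qed
 also have "\<dots> = ennreal (LINT x:{0<..}|lborel. exp (- \<kappa> * x) / x * averaged_defect x)"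
  unfolding set_lebesgue_integral_def
  by (rule nn_integral_eq_integral[OF averaged_defect_integrable[unfolded set_integrable_def]])
   (auto simp: indicator_def averaged_defect_nonneg)
 finally show ?thesis .
qed

text \<open>The Poisson formula for \<open>f = h + t * x\<close>. Unlike a test function,
  \<open>f\<close> need not vanish near \<open>x = 0\<close> and for large \<open>x\<close>, so
  finiteness of the level sets and of the exponent has to come from the integrable defect.\<close>

lemma poisson_laplace_intensity:
 assumes law: "poisson_process_law (intensity \<eta> \<kappa>) P"
  and size: "AE \<xi> in P. integrable \<xi> (\<lambda>z. fst (snd z))" and sm: "total_size \<in> borel_measurable P"
 shows "(\<integral>\<xi>. exp (- (\<integral>z. h z \<partial>\<xi>)) * exp (- t * total_size \<xi>) \<partial>P) =
  exp (- (LINT x:{0<..}|lborel. (mass (\<eta> x) - (LINT u:{0..1}|lborel. \<integral>m. exp (- h (u, x, m)) \<partial>\<eta> x) * exp (- t * x)) * exp (- \<kappa> * x) / x))"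
proof -
 define f where "f z = h z + t * fst (snd z)" for z
 have sn: "sets (intensity \<eta> \<kappa>) = sets borel_E" "space (intensity \<eta> \<kappa>) = E" by (simp_all add: sets_intensity)
 have setsP: "sets P = sets borel_points" using law by (simp add: poisson_process_law_def)
 note pts = poisson_space[OF law sn(1)]
 have fc: "continuous_on E f" unfolding f_def by (intro continuous_intros h_facts)
 have fm: "f \<in> borel_measurable borel_E" unfolding borel_E_def by (rule borel_measurable_continuous_on_restrict[OF fc])
 have f0: "0 \<le> f z" if "z \<in> E" for z using h_facts(2)[OF that] that t by (auto simp: f_def E_def)
 have df: "1 - exp (- f z) = defect z" for z by (simp add: defect_def f_def)
 have dm: "defect \<in> borel_measurable (intensity \<eta> \<kappa>)"
  unfolding measurable_cong_sets[OF sn(1) refl] borel_E_def by (rule borel_measurable_continuous_on_restrict[OF defect_continuous])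
 have d0: "AE z in intensity \<eta> \<kappa>. 0 \<le> defect z" by (rule AE_I2) (simp add: sn defect_bounds)
 have di: "integrable (intensity \<eta> \<kappa>) (\<lambda>z. 1 - exp (- f z))" unfolding df
  by (rule integrableI_nn_integral_finite[OF dm d0 defect_intensity])
 have I0: "0 \<le> (LINT x:{0<..}|lborel. exp (- \<kappa> * x) / x * averaged_defect x)"
  unfolding set_lebesgue_integral_def
  by (intro integral_nonneg_AE AE_I2) (auto simp: indicator_def averaged_defect_nonneg)
 have dv: "(\<integral>z. 1 - exp (- f z) \<partial>intensity \<eta> \<kappa>) = (LINT x:{0<..}|lborel. exp (- \<kappa> * x) / x * averaged_defect x)"
  unfolding df integral_eq_nn_integral[OF dm d0] defect_intensity using I0 by simp
 \<comment> \<open>Markov's inequality for the defect, which is at least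
   \<open>1 - exp (- c)\<close> where \<open>f \<ge> c\<close>.\<close>
 have lev: "emeasure (intensity \<eta> \<kappa>) {z \<in> E. c \<le> f z} < \<infinity>" if c: "0 < c" for c
 proof -
  have "{z \<in> space borel_E. c \<le> f z} \<in> sets borel_E" using fm by measurable
  then have As: "{z \<in> E. c \<le> f z} \<in> sets (intensity \<eta> \<kappa>)" unfolding sn(1) by simp
  have "ennreal (1 - exp (- c)) * emeasure (intensity \<eta> \<kappa>) {z \<in> E. c \<le> f z} =
    (\<integral>\<^sup>+z. ennreal (1 - exp (- c)) * indicator {z \<in> E. c \<le> f z} z \<partial>intensity \<eta> \<kappa>)"
   using As by (rule nn_integral_cmult_indicator[symmetric])
  also have "\<dots> \<le> (\<integral>\<^sup>+z. ennreal (defect z) \<partial>intensity \<eta> \<kappa>)"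
   unfolding df[symmetric] by (intro nn_integral_mono) (auto simp: indicator_def intro!: ennreal_leI)
  also have "\<dots> < \<infinity>" unfolding defect_intensity by simp
  finally have "ennreal (1 - exp (- c)) * emeasure (intensity \<eta> \<kappa>) {z \<in> E. c \<le> f z} < \<infinity>" .
  moreover have "ennreal (1 - exp (- c)) \<noteq> 0" using c by simp
  ultimately show ?thesis by (auto simp: ennreal_mult_less_top)
 qed
 have fin: "AE \<xi> in P. integrable \<xi> f"
  using size AE_space
 proof eventually_elim
  case (elim \<xi>)
  then show ?case unfolding f_def
   using test_function_integrable[OF pts[OF elim(2)] nonneg_test_functionsD[OF h]] by simp
 qed
 have cnt: "(\<lambda>\<xi>. emeasure \<xi> A) \<in> borel_measurable P" if "A \<in> sets borel_E" for A
  by (rule poisson_count_measurable[OF law sn(1) that])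
 have xs: "sets \<xi> = sets borel_E" "space \<xi> = E" if "\<xi> \<in> space P" for \<xi>
  using point_measureD[OF pts[OF that]] by auto
 have mf: "(\<lambda>\<xi>. \<integral>z. f z \<partial>\<xi>) \<in> borel_measurable P"
 proof -
  have "(\<lambda>z. ennreal (f z)) \<in> borel_measurable borel_E" using fm by measurable
  from nn_integral_points_measurable[OF this xs(1) cnt]
  have "(\<lambda>\<xi>. \<integral>\<^sup>+z. ennreal (f z) \<partial>\<xi>) \<in> borel_measurable P" .
  then have "(\<lambda>\<xi>. enn2real (\<integral>\<^sup>+z. ennreal (f z) \<partial>\<xi>)) \<in> borel_measurable P" by measurable
  moreover have "(\<integral>z. f z \<partial>\<xi>) = enn2real (\<integral>\<^sup>+z. ennreal (f z) \<partial>\<xi>)" if "\<xi> \<in> space P" for \<xi>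
  proof (rule integral_eq_nn_integral)
   show "f \<in> borel_measurable \<xi>" unfolding measurable_cong_sets[OF xs(1)[OF that] refl] by (rule fm)
   show "AE z in \<xi>. 0 \<le> f z" by (rule AE_I2) (simp add: xs(2)[OF that] f0)
  qed
  ultimately show ?thesis by (simp cong: measurable_cong)
 qed
 have mh: "(\<lambda>\<xi>. \<integral>z. h z \<partial>\<xi>) \<in> borel_measurable P"
  using integral_test_function_measurable[OF nonneg_test_functionsD[OF h]] unfolding measurable_cong_sets[OF setsP refl] .
 have ae: "AE \<xi> in P. exp (- (\<integral>z. h z \<partial>\<xi>)) * exp (- t * total_size \<xi>) = exp (- (\<integral>z. f z \<partial>\<xi>))"
  using size AE_space
 proof eventually_elim
  case (elim \<xi>)
  have "(\<integral>z. f z \<partial>\<xi>) = (\<integral>z. h z \<partial>\<xi>) + t * total_size \<xi>"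
   unfolding f_def total_size_def
   using elim(1) test_function_integrable[OF pts[OF elim(2)] nonneg_test_functionsD[OF h]] by simp
  then show ?case by (simp add: mult_exp_exp)
 qed
 note mh[measurable] sm[measurable] mf[measurable]
 have "(\<lambda>\<xi>. exp (- (\<integral>z. h z \<partial>\<xi>)) * exp (- t * total_size \<xi>)) \<in> borel_measurable P"
  "(\<lambda>\<xi>. exp (- (\<integral>z. f z \<partial>\<xi>))) \<in> borel_measurable P" by measurable
 from integral_cong_AE[OF this ae] have "(\<integral>\<xi>. exp (- (\<integral>z. h z \<partial>\<xi>)) * exp (- t * total_size \<xi>) \<partial>P) = (\<integral>\<xi>. exp (- (\<integral>z. f z \<partial>\<xi>)) \<partial>P)"
  .
 also have "\<dots> = exp (- (LINT x:{0<..}|lborel. exp (- \<kappa> * x) / x * averaged_defect x))"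
  unfolding dv[symmetric] by (rule poisson_laplace[OF law sn(1) fm f0 lev fin di])
 also have "(LINT x:{0<..}|lborel. exp (- \<kappa> * x) / x * averaged_defect x) =
   (LINT x:{0<..}|lborel. (mass (\<eta> x) - (LINT u:{0..1}|lborel. \<integral>m. exp (- h (u, x, m)) \<partial>\<eta> x) * exp (- t * x)) * exp (- \<kappa> * x) / x)"
  by (intro set_lebesgue_integral_cong) (auto simp: averaged_defect_eq)
 finally show ?thesis .
qed

end

end

section \<open>The bridge as a disintegration of the Poisson law\<close>

context weak_kernel
begin

context
 fixes P :: "(real \<times> real \<times> 'm) measure measure" and f :: "real => real" and \<kappa> :: real
 assumes law: "poisson_process_law (intensity \<eta> \<kappa>) P"
  and phi: "set_integrable lborel {0<..} (\<lambda>x. min 1 x * exp (- \<kappa> * x) * (mass (\<eta> x) / x))"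
  and f0: "\<And>a. 0 < a ==> 0 \<le> f a" and fc: "continuous_on {0<..} f"
  and dens: "distributed P lborel total_size (\<lambda>a. ennreal (f a) * indicator {0<..} a)"
begin

lemma density_set_integrable: "set_integrable lborel {0<..} f"
proof -
 interpret prob_space P using law by (simp add: poisson_process_law_def)
 have "(\<lambda>a. indicator {0<..} a *\<^sub>R f a) \<in> borel_measurable borel"
  by (rule borel_measurable_continuous_on_indicator[OF _ fc]) auto
 then have m: "(\<lambda>a. indicator {0<..} a *\<^sub>R f a) \<in> borel_measurable lborel" by simp
 have "(\<integral>\<^sup>+a. ennreal (indicator {0<..} a *\<^sub>R f a) \<partial>lborel) = (\<integral>\<^sup>+a. ennreal (f a) * indicator {0<..} a \<partial>lborel)"
  by (intro nn_integral_cong) (simp add: indicator_def)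
 also have "\<dots> = (\<integral>\<^sup>+a. (ennreal (f a) * indicator {0<..} a) * indicator (space lborel) a \<partial>lborel)" by simp
 also have "\<dots> = emeasure P (total_size -` space lborel \<inter> space P)"
  by (rule distributed_emeasure[OF dens, symmetric]) simp
 also have "\<dots> = ennreal 1" using emeasure_space_1 by simp
 finally show ?thesis unfolding set_integrable_def
  by (intro integrableI_nn_integral_finite[OF m AE_I2]) (auto simp: indicator_def f0)
qed

text \<open>A non-integrable size would give \<open>total_size \<xi> = 0\<close> by the convention
  for Bochner integrals, but the density lives on \<open>{0<..}\<close>, so the total size is almost
  surely positive.\<close>

lemma size_integrable_AE: "AE \<xi> in P. integrable \<xi> (\<lambda>z. fst (snd z))"
proof -
 have X: "total_size \<in> measurable P lborel" by (rule distributed_measurable[OF dens])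
 have "AE a in density lborel (\<lambda>a. ennreal (f a) * indicator {0<..} a). 0 < a"
  by (subst AE_density[OF distributed_borel_measurable[OF dens]], intro AE_I2) (auto simp: indicator_def)
 then have "AE a in distr P lborel total_size. 0 < a" unfolding distributed_distr_eq_density[OF dens] .
 then have "AE \<xi> in P. 0 < total_size \<xi>" by (rule AE_distrD[OF X])
 then show ?thesis
 proof eventually_elim
  case (elim \<xi>)
  then show ?case using not_integrable_integral_eq unfolding total_size_def by fastforce
 qed
qed

lemma total_size_measurable: "total_size \<in> borel_measurable P"
 using distributed_measurable[OF dens] by simp

text \<open>\<open>G\<close> is the Laplace functional of the bridge times the density. Where
  \<open>f\<close> vanishes \<open>Br\<close> is arbitrary, so \<open>G\<close> is put to 0 there,
  in accordance with the factor \<open>f a\<close> of the disintegration.\<close>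

context
 fixes Br h and G :: "real => real"
 assumes bridge: "bridge_law P f Br" and h: "h \<in> nonneg_test_functions"
 defines "G \<equiv> \<lambda>a. if 0 < a \<and> 0 < f a then (\<integral>\<xi>. exp (- (\<integral>z. h z \<partial>\<xi>)) \<partial>Br a) * f a else 0"
begin

lemma positive_density_open: "open {a. 0 < a \<and> 0 < f a}"
proof -
 have "open ({0<..} \<inter> f -` {0<..})" by (rule continuous_open_preimage[OF fc]) auto
 also have "{0<..} \<inter> f -` {0<..} = {a. 0 < a \<and> 0 < f a}" by auto
 finally show ?thesis .
qed

lemma bridge_weight_continuous: "continuous_on {a. 0 < a \<and> 0 < f a} G"
proof -
 have "continuous_on {a. 0 < a \<and> 0 < f a} (\<lambda>a. \<integral>\<xi>. exp (- (\<integral>z. h z \<partial>\<xi>)) \<partial>Br a)"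
  by (rule bspec[OF bridge[unfolded bridge_law_def, THEN conjunct2, THEN conjunct2] h])
 then have "continuous_on {a. 0 < a \<and> 0 < f a} (\<lambda>a. (\<integral>\<xi>. exp (- (\<integral>z. h z \<partial>\<xi>)) \<partial>Br a) * f a)"
  by (rule continuous_on_mult) (rule continuous_on_subset[OF fc], auto)
 then show ?thesis by (rule continuous_on_eq) (simp add: G_def)
qed

lemma bridge_weight_isCont: "0 < a ==> 0 < f a ==> isCont G a"
 using bridge_weight_continuous continuous_on_eq_continuous_at[OF positive_density_open] by blast

lemma bridge_functional_measurable: "(\<lambda>\<xi>. exp (- (\<integral>z. h z \<partial>\<xi>))) \<in> borel_measurable borel_points"
 using integral_test_function_measurable[OF nonneg_test_functionsD[OF h]] by measurable

lemma bridge_functional_bounds: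
 assumes "\<xi> \<in> space borel_points"
 shows "0 \<le> exp (- (\<integral>z. h z \<partial>\<xi>))" "exp (- (\<integral>z. h z \<partial>\<xi>)) \<le> 1"
proof -
 have "\<xi> \<in> locally_finite_point_measures" using assms by simp
 from point_measureD(2)[OF this] have "0 \<le> (\<integral>z. h z \<partial>\<xi>)"
  using h by (intro integral_nonneg_AE AE_I2) (auto simp: nonneg_test_functions_def)
 then show "0 \<le> exp (- (\<integral>z. h z \<partial>\<xi>))" "exp (- (\<integral>z. h z \<partial>\<xi>)) \<le> 1" by auto
qed

lemma bridge_weight_bounds: "0 < a ==> 0 \<le> G a \<and> G a \<le> f a"
proof (cases "0 < f a")
 case True
 assume a: "0 < a"
 have "\<forall>a. 0 < a \<and> 0 < f a \<longrightarrow> prob_space (Br a) \<and> sets (Br a) = sets borel_points"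
  using bridge unfolding bridge_law_def by (rule conjunct1)
 with a True have p: "prob_space (Br a)" and s: "sets (Br a) = sets borel_points" by auto
 interpret prob_space "Br a" by (rule p)
 have sp: "space (Br a) = space borel_points" by (rule sets_eq_imp_space_eq[OF s])
 have m: "(\<lambda>\<xi>. exp (- (\<integral>z. h z \<partial>\<xi>))) \<in> borel_measurable (Br a)"
  unfolding measurable_cong_sets[OF s refl] by (rule bridge_functional_measurable)
 have i: "integrable (Br a) (\<lambda>\<xi>. exp (- (\<integral>z. h z \<partial>\<xi>)))"
  using bridge_functional_bounds by (intro integrable_const_bound[where B = 1, OF AE_I2 m]) (auto simp: sp)
 have "(\<integral>\<xi>. exp (- (\<integral>z. h z \<partial>\<xi>)) \<partial>Br a) \<le> (\<integral>\<xi>. 1 \<partial>Br a)"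
  by (intro integral_mono i bridge_functional_bounds) (auto simp: sp)
 also have "\<dots> = 1" by (simp add: prob_space)
 finally have L: "(\<integral>\<xi>. exp (- (\<integral>z. h z \<partial>\<xi>)) \<partial>Br a) \<le> 1" .
 have L0: "0 \<le> (\<integral>\<xi>. exp (- (\<integral>z. h z \<partial>\<xi>)) \<partial>Br a)" by (rule integral_nonneg_AE) simp
 show ?thesis using True a L L0 mult_right_mono[OF L, of "f a"] by (simp add: G_def)
qed (simp add: G_def f0)

lemma bridge_weight_integrable: "set_integrable lborel {0<..} G"
proof -
 have "(\<lambda>a. indicator {a. 0 < a \<and> 0 < f a} a *\<^sub>R G a) \<in> borel_measurable borel"
  by (rule borel_measurable_continuous_on_indicator[OF borel_open[OF positive_density_open] bridge_weight_continuous])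
 moreover have "(\<lambda>a. indicator {a. 0 < a \<and> 0 < f a} a *\<^sub>R G a) = (\<lambda>a. indicator {0<..} a *\<^sub>R G a)"
  by (auto simp: G_def indicator_def)
 ultimately have m: "(\<lambda>a. indicator {0<..} a *\<^sub>R G a) \<in> borel_measurable lborel" by simp
 show ?thesis unfolding set_integrable_def
 proof (rule Bochner_Integration.integrable_bound[OF density_set_integrable[unfolded set_integrable_def] m])
  show "AE a in lborel. norm (indicator {0<..} a *\<^sub>R G a) \<le> norm (indicator {0<..} a *\<^sub>R f a)"
   using bridge_weight_bounds f0 by (intro AE_I2) (auto simp: indicator_def)
 qed
qed

text \<open>The disintegration, tested with \<open>exp (- k * a)\<close>, reduces the transform of
  \<open>G\<close> to a Poisson expectation. This is the identity that
  \<open>effective_local_limit\<close> requires of its limit.\<close>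

lemma bridge_weight_laplace:
 "(LINT a:{0<..}|lborel. G a * exp (- a) ^ k) =
  exp (- (LINT x:{0<..}|lborel. (mass (\<eta> x) - (LINT u:{0..1}|lborel. \<integral>m. exp (- h (u, x, m)) \<partial>\<eta> x) * exp (- real k * x)) * exp (- \<kappa> * x) / x))"
proof -
 \<comment> \<open>Truncation at 0 makes the test function bounded on the whole line, as the
   disintegration demands; \<open>total_size\<close> is never negative.\<close>
 define g where "g a = exp (- real k * max 0 a)" for a :: real
 have gm: "g \<in> borel_measurable borel" unfolding g_def[abs_def] by measurable
 have gb: "bounded (range g)" unfolding bounded_iff by (intro exI[of _ 1]) (auto simp: g_def)
 have pb: "bounded ((\<lambda>\<xi>. exp (- (\<integral>z. h z \<partial>\<xi>))) ` space borel_points)"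
  unfolding bounded_iff using bridge_functional_bounds by (intro exI[of _ 1]) auto
 have setsP: "sets P = sets borel_points" using law by (simp add: poisson_process_law_def)
 have "(\<integral>\<xi>. exp (- (\<integral>z. h z \<partial>\<xi>)) * exp (- real k * total_size \<xi>) \<partial>P) = (\<integral>\<xi>. exp (- (\<integral>z. h z \<partial>\<xi>)) * g (total_size \<xi>) \<partial>P)"
 proof (rule Bochner_Integration.integral_cong[OF refl])
  fix \<xi> assume "\<xi> \<in> space P"
  then have "\<xi> \<in> locally_finite_point_measures" using sets_eq_imp_space_eq[OF setsP] by simp
  note sp = point_measureD(2)[OF this]
  have "0 \<le> fst (snd z)" if "z \<in> space \<xi>" for z using that unfolding sp by (auto simp: E_def)
  then have "0 \<le> total_size \<xi>" unfolding total_size_def by (intro integral_nonneg_AE AE_I2)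
  then show "exp (- (\<integral>z. h z \<partial>\<xi>)) * exp (- real k * total_size \<xi>) = exp (- (\<integral>z. h z \<partial>\<xi>)) * g (total_size \<xi>)"
   by (simp add: g_def)
 qed
 also have "\<dots> = (LINT a:{0<..}|lborel. g a * (\<integral>\<xi>. exp (- (\<integral>z. h z \<partial>\<xi>)) \<partial>Br a) * f a)"
  using bridge[unfolded bridge_law_def, THEN conjunct2, THEN conjunct1, THEN spec, THEN spec, THEN mp,
    OF conjI[OF bridge_functional_measurable conjI[OF pb conjI[OF gm gb]]]] .
 also have "\<dots> = (LINT a:{0<..}|lborel. G a * exp (- a) ^ k)"
 proof (rule set_lebesgue_integral_cong)
  show "\<forall>a. a \<in> {0<..} \<longrightarrow> g a * (\<integral>\<xi>. exp (- (\<integral>z. h z \<partial>\<xi>)) \<partial>Br a) * f a = G a * exp (- a) ^ k"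
  proof (intro allI impI)
   fix a :: real assume a: "a \<in> {0<..}"
   have "g a = exp (- a) ^ k" using a by (simp add: g_def exp_of_nat_mult[symmetric])
   moreover have "f a = 0" if "\<not> 0 < f a" using that f0[of a] a by simp
   ultimately show "g a * (\<integral>\<xi>. exp (- (\<integral>z. h z \<partial>\<xi>)) \<partial>Br a) * f a = G a * exp (- a) ^ k"
    using a by (auto simp: G_def)
  qed
 qed simp
 finally show ?thesis
  using poisson_laplace_intensity[OF h of_nat_0_le_iff phi law size_integrable_AE total_size_measurable, of k] by simp
qed

end

end

end

section \<open>The spectral criterion\<close>

text \<open>What both alternatives of the criterion provide: a bound \<open>\<Theta>\<close> on the
  weights, which governs the growth of the partition function, and a normalizing exponent of at
  least \<open>\<Theta> * ln V\<close> up to a constant. \<open>\<Theta>\<close> may depend on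
  \<open>n\<close>, \<open>K\<close> may not. Positivity of the weights makes the canonical law well
  defined.\<close>

definition logarithmic_trace_bound :: "(nat => real) => real => (nat => nat => real) => real => bool" where
 "logarithmic_trace_bound V \<kappa> q K \<longleftrightarrow> (\<forall>\<^sub>F n in sequentially. (\<forall>j\<ge>1. 0 < q n j) \<and>
  (\<exists>\<Theta>. 1 \<le> \<Theta> \<and> \<Theta> \<le> K \<and> (\<forall>j\<ge>1. q n j \<le> \<Theta>) \<and>
    \<Theta> * ln (V n) \<le> K + (\<Sum>j. q n (Suc j) * exp (- \<kappa> / V n) ^ Suc j / real (Suc j))))"

lemma exp_quotient_less_one:
 fixes c v :: real
 shows "0 < c ==> 0 < v ==> exp (- c / v) < 1"
 by simp

text \<open>For fixed \<open>l\<close> the tilted series sums to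
  \<open>- ln (1 - exp (- (\<kappa> + \<beta> * l) / v))\<close>, which is at least
  \<open>ln v - ln (\<kappa> + \<beta> * l)\<close>. Integration over \<open>S\<close> produces
  \<open>mass S * ln v\<close> and the logarithmic moment.\<close>

lemma halfline_trace_bound:
 fixes S :: "real measure" and v \<beta> \<kappa> L :: real
 assumes S: "finite_borel_halfline S" and m: "0 < mass S" and v: "0 < v" and \<beta>: "0 < \<beta>" and \<kappa>: "0 < \<kappa>"
  and q: "\<And>j. 1 \<le> j ==> q j = (\<integral>l. exp (- \<beta> * (real j / v) * l) \<partial>S)"
  and L: "(\<integral>\<^sup>+l. ennreal (ln (1 + \<kappa> + \<beta> * l)) \<partial>S) \<le> ennreal L" "0 \<le> L"
 shows "1 \<le> j ==> 0 < q j" "1 \<le> j ==> q j \<le> mass S"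
  "mass S * ln v \<le> L + (\<Sum>j. q (Suc j) * exp (- \<kappa> / v) ^ Suc j / real (Suc j))"
proof -
 interpret finite_measure S using S by (simp add: finite_borel_halfline_def)
 have sets: "sets S = sets (restrict_space borel {0..})" using S by (simp add: finite_borel_halfline_def)
 have sp: "space S = {0..}" using sets_eq_imp_space_eq[OF sets] by (simp add: space_restrict_space)
 have meas: "f \<in> borel_measurable S" if "f \<in> borel_measurable borel" for f :: "real => real"
  using measurable_restrict_space1[OF that] unfolding measurable_cong_sets[OF sets refl] .
 have em: "(\<lambda>l. exp (- \<beta> * x * l)) \<in> borel_measurable S" for x by (rule meas) measurable
 have lm: "(\<lambda>l. ln (1 + \<kappa> + \<beta> * l)) \<in> borel_measurable S" by (rule meas) measurable
 have i: "integrable S (\<lambda>l. exp (- \<beta> * (real j / v) * l))" for j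
 proof (rule integrable_const_bound[where B = 1])
  show "AE l in S. norm (exp (- \<beta> * (real j / v) * l)) \<le> 1"
   using \<beta> v by (intro AE_I2) (simp add: sp)
 qed (rule em)
 show q0: "0 < q j" if j: "1 \<le> j" for j
 proof -
  have "0 \<le> q j" unfolding q[OF j] by (rule integral_nonneg_AE) simp
  moreover have "q j \<noteq> 0"
  proof
   assume "q j = 0"
   then have "AE l in S. exp (- \<beta> * (real j / v) * l) = 0"
    unfolding q[OF j] by (subst (asm) integral_nonneg_eq_0_iff_AE[OF i]) auto
   then have "AE l in S. False" by simp
   then have "emeasure S (space S) = 0" by (simp add: AE_iff_measurable[OF _ refl])
   then show False using m by (simp add: measure_def)
  qed
  ultimately show ?thesis by simp
 qed
 show qm: "q j \<le> mass S" if j: "1 \<le> j" for j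
 proof -
  have "q j \<le> (\<integral>l. 1 \<partial>S)" unfolding q[OF j]
   using \<beta> v by (intro integral_mono i) (auto simp: sp)
  then show ?thesis by simp
 qed
 \<comment> \<open>Stated in the extended nonnegative reals, where integral and series may be
   interchanged freely; the summand 1 inside the logarithm keeps the compensating term
   nonnegative.\<close>
 have pw: "ennreal (ln v) \<le> (\<Sum>j. ennreal (exp (- \<beta> * (real (Suc j) / v) * l) * (exp (- \<kappa> / v) ^ Suc j / real (Suc j)))) + ennreal (ln (1 + \<kappa> + \<beta> * l))"
  if l: "l \<in> space S" for l
 proof -
  have bl: "0 \<le> \<beta> * l" using l \<beta> by (simp add: sp)
  let ?c = "\<kappa> + \<beta> * l"
  have c: "0 < ?c" using \<kappa> bl by simp
  have e1: "exp (- ?c / v) < 1" by (rule exp_quotient_less_one[OF c v])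
  have eq: "exp (- ?c / v) ^ Suc j / real (Suc j) = exp (- \<beta> * (real (Suc j) / v) * l) * (exp (- \<kappa> / v) ^ Suc j / real (Suc j))" for j
  proof -
   have "exp (- ?c / v) ^ Suc j = exp (- \<beta> * (real (Suc j) / v) * l) * exp (- \<kappa> / v) ^ Suc j"
    unfolding exp_power_mult mult_exp_exp by (intro arg_cong[where f = exp]) (simp add: algebra_simps add_divide_distrib)
   then show ?thesis by (simp only: times_divide_eq_right)
  qed
  have "(\<Sum>j. ennreal (exp (- \<beta> * (real (Suc j) / v) * l) * (exp (- \<kappa> / v) ^ Suc j / real (Suc j)))) = ennreal (- ln (1 - exp (- ?c / v)))"
   using neg_ln_sums[OF _ e1] unfolding eq by (intro suminf_ennreal_eq) auto
  moreover have "ln v \<le> - ln (1 - exp (- ?c / v)) + ln (1 + \<kappa> + \<beta> * l)"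
  proof -
   have "ln ?c \<le> ln (1 + \<kappa> + \<beta> * l)" using c by (intro ln_mono) auto
   then show ?thesis using neg_ln_exp_lower[OF c v] by simp
  qed
  moreover have "0 \<le> - ln (1 - exp (- ?c / v))" using e1 by simp
  moreover have "0 \<le> ln (1 + \<kappa> + \<beta> * l)" using c by simp
  ultimately show ?thesis by (simp add: ennreal_plus[symmetric] ennreal_leI del: ennreal_plus)
 qed
 have r: "0 \<le> exp (- \<kappa> / v)" "exp (- \<kappa> / v) < 1" using \<kappa> v by auto
 have sm: "summable (\<lambda>j. q (Suc j) * exp (- \<kappa> / v) ^ Suc j / real (Suc j))"
  by (rule summable_tilted[OF less_imp_le[OF q0] qm r])
 have nn: "0 \<le> q (Suc j) * exp (- \<kappa> / v) ^ Suc j / real (Suc j)" for j using q0[of "Suc j"] by simp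
 have am: "(\<lambda>l. ennreal (exp (- \<beta> * (real (Suc j) / v) * l) * (exp (- \<kappa> / v) ^ Suc j / real (Suc j)))) \<in> borel_measurable S" for j
  by (rule measurable_compose[OF borel_measurable_times[OF em borel_measurable_const] measurable_ennreal])
 have bm: "(\<lambda>l. ennreal (ln (1 + \<kappa> + \<beta> * l))) \<in> borel_measurable S"
  by (rule measurable_compose[OF lm measurable_ennreal])
 have "ennreal (ln v) * emeasure S (space S) = (\<integral>\<^sup>+l. ennreal (ln v) \<partial>S)" by simp
 also have "\<dots> \<le> (\<integral>\<^sup>+l. (\<Sum>j. ennreal (exp (- \<beta> * (real (Suc j) / v) * l) * (exp (- \<kappa> / v) ^ Suc j / real (Suc j)))) + ennreal (ln (1 + \<kappa> + \<beta> * l)) \<partial>S)"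
  by (rule nn_integral_mono) (rule pw)
 also have "\<dots> = (\<integral>\<^sup>+l. (\<Sum>j. ennreal (exp (- \<beta> * (real (Suc j) / v) * l) * (exp (- \<kappa> / v) ^ Suc j / real (Suc j)))) \<partial>S) + (\<integral>\<^sup>+l. ennreal (ln (1 + \<kappa> + \<beta> * l)) \<partial>S)"
  by (rule nn_integral_add[OF borel_measurable_suminf_order[OF am] bm])
 also have "(\<integral>\<^sup>+l. (\<Sum>j. ennreal (exp (- \<beta> * (real (Suc j) / v) * l) * (exp (- \<kappa> / v) ^ Suc j / real (Suc j)))) \<partial>S) =
   (\<Sum>j. \<integral>\<^sup>+l. ennreal (exp (- \<beta> * (real (Suc j) / v) * l) * (exp (- \<kappa> / v) ^ Suc j / real (Suc j))) \<partial>S)"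
  by (rule nn_integral_suminf) (rule am)
 also have "\<dots> = (\<Sum>j. ennreal (q (Suc j) * exp (- \<kappa> / v) ^ Suc j / real (Suc j)))"
 proof (rule suminf_cong)
  fix j
  have "(\<integral>\<^sup>+l. ennreal (exp (- \<beta> * (real (Suc j) / v) * l) * (exp (- \<kappa> / v) ^ Suc j / real (Suc j))) \<partial>S) =
    ennreal (\<integral>l. exp (- \<beta> * (real (Suc j) / v) * l) * (exp (- \<kappa> / v) ^ Suc j / real (Suc j)) \<partial>S)"
   by (rule nn_integral_eq_integral[OF integrable_mult_left[OF i]]) simp
  also have "(\<integral>l. exp (- \<beta> * (real (Suc j) / v) * l) * (exp (- \<kappa> / v) ^ Suc j / real (Suc j)) \<partial>S) = q (Suc j) * (exp (- \<kappa> / v) ^ Suc j / real (Suc j))"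
   using q[of "Suc j"] by (simp only: integral_mult_left_zero)
  finally show "(\<integral>\<^sup>+l. ennreal (exp (- \<beta> * (real (Suc j) / v) * l) * (exp (- \<kappa> / v) ^ Suc j / real (Suc j))) \<partial>S) = ennreal (q (Suc j) * exp (- \<kappa> / v) ^ Suc j / real (Suc j))"
   by (simp only: times_divide_eq_right)
 qed
 also have "\<dots> = ennreal (\<Sum>j. q (Suc j) * exp (- \<kappa> / v) ^ Suc j / real (Suc j))"
  by (rule suminf_ennreal_eq[OF nn summable_sums[OF sm]])
 finally have "ennreal (ln v) * emeasure S (space S) \<le> ennreal (\<Sum>j. q (Suc j) * exp (- \<kappa> / v) ^ Suc j / real (Suc j)) + ennreal L"
  using L(1) by (meson add_left_mono order_trans)
 moreover have s0: "0 \<le> (\<Sum>j. q (Suc j) * exp (- \<kappa> / v) ^ Suc j / real (Suc j))" by (rule suminf_nonneg[OF sm nn])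
 ultimately have "ennreal (ln v) * ennreal (mass S) \<le> ennreal ((\<Sum>j. q (Suc j) * exp (- \<kappa> / v) ^ Suc j / real (Suc j)) + L)"
  using L(2) by (simp add: emeasure_eq_measure)
 then have *: "ennreal (mass S * ln v) \<le> ennreal ((\<Sum>j. q (Suc j) * exp (- \<kappa> / v) ^ Suc j / real (Suc j)) + L)"
  by (simp add: ennreal_mult'' mult.commute)
 show "mass S * ln v \<le> L + (\<Sum>j. q (Suc j) * exp (- \<kappa> / v) ^ Suc j / real (Suc j))"
  using * unfolding ennreal_le_iff[OF add_nonneg_nonneg[OF s0 L(2)]] by linarith
qed

text \<open>Here \<open>\<Theta>\<close> is the total mass of the spectral measure for the given
  \<open>n\<close>, which is eventually above 1; the boundedness of the masses and of the
  logarithmic moments makes \<open>K\<close> uniform.\<close>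

lemma spectral_criterion_A_bound:
 fixes V :: "nat => real"
 assumes V: "\<And>n. 0 < V n" and \<beta>: "0 < \<beta>" and \<kappa>: "0 < \<kappa>" and crit: "spectral_criterion_A V \<beta> q \<Sigma>"
 shows "\<exists>K. logarithmic_trace_bound V \<kappa> q K"
proof -
 from crit obtain S :: "nat => real measure" where S: "\<And>n. finite_borel_halfline (S n)"
   "\<And>n j. 1 \<le> j ==> q n j = (\<integral>l. exp (- \<beta> * (real j / V n) * l) \<partial>S n)"
   "bdd_above (range (\<lambda>n. mass (S n)))" and ex: "\<exists>\<Theta>>1. \<forall>\<^sub>F n in sequentially. \<Theta> \<le> mass (S n)"
   and sup: "(SUP n. \<integral>\<^sup>+l. ennreal (ln (1 + \<kappa> + \<beta> * l)) \<partial>S n) < \<infinity>"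
  using \<kappa> unfolding spectral_criterion_A_def by (elim exE conjE) (rule that, auto)
 from ex obtain \<Theta> where \<Theta>: "1 < \<Theta>" "\<forall>\<^sub>F n in sequentially. \<Theta> \<le> mass (S n)" by blast
 obtain C where C: "\<And>n. mass (S n) \<le> C" using S(3) by (auto simp: bdd_above_def)
 define L where "L = enn2real (SUP n. \<integral>\<^sup>+l. ennreal (ln (1 + \<kappa> + \<beta> * l)) \<partial>S n)"
 have L: "(\<integral>\<^sup>+l. ennreal (ln (1 + \<kappa> + \<beta> * l)) \<partial>S n) \<le> ennreal L" for n
  using sup unfolding L_def by (auto intro: SUP_upper2)
 have "logarithmic_trace_bound V \<kappa> q (max C L)" unfolding logarithmic_trace_bound_def
  using \<Theta>(2)
 proof eventually_elim
  case (elim n)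
  then have m: "0 < mass (S n)" and m1: "1 \<le> mass (S n)" using \<Theta>(1) by auto
  note h = halfline_trace_bound[OF S(1) m V \<beta> \<kappa> S(2) L enn2real_nonneg[of "SUP n. \<integral>\<^sup>+l. ennreal (ln (1 + \<kappa> + \<beta> * l)) \<partial>S n", folded L_def]]
  show ?case
  proof (intro conjI exI[of _ "mass (S n)"] allI impI)
   show "mass (S n) * ln (V n) \<le> max C L + (\<Sum>j. q n (Suc j) * exp (- \<kappa> / V n) ^ Suc j / real (Suc j))"
    using h(3) by simp
  qed (use h(1,2) m1 C[of n] in auto)
 qed
 then show ?thesis ..
qed

text \<open>Here \<open>\<Theta> = 1\<close>, the sum of the \<open>\<theta> r\<close>. The
  convergent sequences \<open>lamL n r\<close> are bounded by some \<open>b r\<close>, which makes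
  \<open>K\<close> independent of \<open>n\<close>.\<close>

lemma spectral_criterion_B_bound:
 fixes V :: "nat => real"
 assumes V: "\<And>n. 0 < V n" and \<beta>: "0 < \<beta>" and \<kappa>: "0 < \<kappa>" and crit: "spectral_criterion_B V \<beta> q"
 shows "\<exists>K. logarithmic_trace_bound V \<kappa> q K"
proof -
 from crit obtain Q :: nat and \<theta> lamL lam where Q: "1 \<le> Q" "\<And>r. r \<in> {1..Q} ==> 0 < \<theta> r" "(\<Sum>r=1..Q. \<theta> r) = 1"
   and l: "\<And>r n. r \<in> {1..Q} ==> 0 \<le> lamL n r" "\<And>r. r \<in> {1..Q} ==> (\<lambda>n. lamL n r) \<longlonglongrightarrow> lam r"
   and q: "\<And>n j. 1 \<le> j ==> q n j = (\<Sum>r=1..Q. \<theta> r * exp (- \<beta> * lamL n r * real j / V n))"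
  unfolding spectral_criterion_B_def by (elim exE conjE) (rule that, auto)
 have "\<exists>b. \<forall>n. lamL n r \<le> b" if r: "r \<in> {1..Q}" for r
 proof -
  have "Bseq (\<lambda>n. lamL n r)" using l(2)[OF r] by (intro convergent_imp_Bseq) (auto simp: convergent_def)
  then obtain b where "\<And>n. \<bar>lamL n r\<bar> \<le> b" by (auto simp: Bseq_def)
  then show ?thesis by (intro exI[of _ b]) (auto simp: abs_le_iff)
 qed
 then obtain b where b: "\<And>r n. r \<in> {1..Q} ==> lamL n r \<le> b r" by metis
 define K where "K = max 1 (\<Sum>r=1..Q. \<theta> r * ln (\<kappa> + \<beta> * b r))"
 have "(\<forall>j\<ge>1. 0 < q n j) \<and> (\<exists>\<Theta>. 1 \<le> \<Theta> \<and> \<Theta> \<le> K \<and> (\<forall>j\<ge>1. q n j \<le> \<Theta>) \<and>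
    \<Theta> * ln (V n) \<le> K + (\<Sum>j. q n (Suc j) * exp (- \<kappa> / V n) ^ Suc j / real (Suc j)))" for n
 proof (intro conjI exI[of _ "1::real"] allI impI)
  fix j :: nat assume j: "1 \<le> j"
  show "0 < q n j" unfolding q[OF j] using Q by (intro sum_pos) auto
  have "q n j \<le> (\<Sum>r=1..Q. \<theta> r * 1)" unfolding q[OF j]
  proof (intro sum_mono mult_left_mono)
   fix r assume r: "r \<in> {1..Q}"
   have "0 \<le> \<beta> * lamL n r * real j / V n" using \<beta> l(1)[OF r] V[of n] by simp
   then show "exp (- \<beta> * lamL n r * real j / V n) \<le> 1" by simp
   show "0 \<le> \<theta> r" using Q(2)[OF r] by simp
  qed
  then show "q n j \<le> 1" using Q(3) by simp
 next
  let ?c = "\<lambda>r. \<kappa> + \<beta> * lamL n r"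
  have c: "0 < ?c r" if "r \<in> {1..Q}" for r using \<kappa> \<beta> l(1)[OF that] by (simp add: add_pos_nonneg)
  have "(\<lambda>j. \<Sum>r=1..Q. \<theta> r * (exp (- ?c r / V n) ^ Suc j / real (Suc j))) sums (\<Sum>r=1..Q. \<theta> r * (- ln (1 - exp (- ?c r / V n))))"
   by (intro sums_sum sums_mult neg_ln_sums exp_quotient_less_one c V) auto
  also have "(\<lambda>j. \<Sum>r=1..Q. \<theta> r * (exp (- ?c r / V n) ^ Suc j / real (Suc j))) = (\<lambda>j. q n (Suc j) * exp (- \<kappa> / V n) ^ Suc j / real (Suc j))"
  proof
   fix j
   have "exp (- ?c r / V n) ^ Suc j = exp (- \<beta> * lamL n r * real (Suc j) / V n) * exp (- \<kappa> / V n) ^ Suc j" for r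
    unfolding exp_power_mult mult_exp_exp by (intro arg_cong[where f = exp]) (simp add: algebra_simps add_divide_distrib diff_divide_distrib)
   moreover have le: "1 \<le> Suc j" by simp
   ultimately show "(\<Sum>r=1..Q. \<theta> r * (exp (- ?c r / V n) ^ Suc j / real (Suc j))) = q n (Suc j) * exp (- \<kappa> / V n) ^ Suc j / real (Suc j)"
    unfolding q[OF le] by (simp only: sum_distrib_right sum_divide_distrib mult.assoc times_divide_eq_right)
  qed
  finally have S: "(\<Sum>j. q n (Suc j) * exp (- \<kappa> / V n) ^ Suc j / real (Suc j)) = (\<Sum>r=1..Q. \<theta> r * (- ln (1 - exp (- ?c r / V n))))"
   by (rule sums_unique[symmetric])
  have "1 * ln (V n) = (\<Sum>r=1..Q. \<theta> r * ln (V n))" using Q(3) by (simp add: sum_distrib_right[symmetric])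
  also have "\<dots> \<le> (\<Sum>r=1..Q. \<theta> r * (- ln (1 - exp (- ?c r / V n))) + \<theta> r * ln (\<kappa> + \<beta> * b r))"
  proof (intro sum_mono)
   fix r assume r: "r \<in> {1..Q}"
   have "\<beta> * lamL n r \<le> \<beta> * b r" using \<beta> b[OF r] by simp
   then have "ln (?c r) \<le> ln (\<kappa> + \<beta> * b r)" using c[OF r] by (intro ln_mono) auto
   then have "ln (V n) \<le> - ln (1 - exp (- ?c r / V n)) + ln (\<kappa> + \<beta> * b r)" using neg_ln_exp_lower[OF c[OF r] V[of n]] by linarith
   then show "\<theta> r * ln (V n) \<le> \<theta> r * (- ln (1 - exp (- ?c r / V n))) + \<theta> r * ln (\<kappa> + \<beta> * b r)"
    unfolding distrib_left[symmetric] using Q(2)[OF r] by (intro mult_left_mono) auto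
  qed
  also have "\<dots> \<le> K + (\<Sum>j. q n (Suc j) * exp (- \<kappa> / V n) ^ Suc j / real (Suc j))"
   unfolding S sum.distrib K_def by simp
  finally show "1 * ln (V n) \<le> K + (\<Sum>j. q n (Suc j) * exp (- \<kappa> / V n) ^ Suc j / real (Suc j))" .
 qed (auto simp: K_def)
 then show ?thesis unfolding logarithmic_trace_bound_def by (intro exI[of _ K]) simp
qed

section \<open>Convergence\<close>

text \<open>At \<open>x = j / V\<close> the floor returns exactly \<open>j\<close>, so uniform
  convergence in \<open>x\<close> contains convergence along the lattice.\<close>

lemma uniform_limit_at_lattice:
 fixes V :: "nat => real" and G :: "nat => nat => real => real"
 assumes V: "\<And>n. 0 < V n" and u: "uniform_limit {\<delta>..R} (\<lambda>n x. G n (nat \<lfloor>x * V n\<rfloor>) x) g sequentially" and \<epsilon>: "0 < \<epsilon>"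
 shows "\<forall>\<^sub>F n in sequentially. \<forall>j. \<delta> \<le> real j / V n \<and> real j / V n \<le> R \<longrightarrow> \<bar>G n j (real j / V n) - g (real j / V n)\<bar> < \<epsilon>"
 using uniform_limitD[OF u \<epsilon>]
proof eventually_elim
 case (elim n)
 have eq: "nat \<lfloor>real j / V n * V n\<rfloor> = j" for j using V[of n] by simp
 show ?case
 proof (intro allI impI)
  fix j assume "\<delta> \<le> real j / V n \<and> real j / V n \<le> R"
  then have "real j / V n \<in> {\<delta>..R}" by simp
  from bspec[OF elim this] show "\<bar>G n j (real j / V n) - g (real j / V n)\<bar> < \<epsilon>" unfolding eq dist_real_def .
 qed
qed

lemma partition_ratio_tendsto:
 fixes V :: "nat => real"
 assumes V: "\<And>n. 0 < V n"
  and num: "(\<lambda>n. V n * (\<Sum>k\<le>N n. cycle_weight (V n) \<kappa> (q' n) (b n) k * cycle_weight (V n) \<kappa> (q n) (a n) (N n - k))) \<longlonglongrightarrow> x"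
  and den: "(\<lambda>n. V n * (\<Sum>k\<le>N n. cycle_weight (V n) \<kappa> (q' n) (q' n) k * cycle_weight (V n) \<kappa> (q n) (q n) (N n - k))) \<longlonglongrightarrow> y"
  and y: "y \<noteq> 0"
 shows "(\<lambda>n. partition_function (\<lambda>j. a n j + b n j) (N n) / partition_function (\<lambda>j. q n j + q' n j) (N n)) \<longlonglongrightarrow> x / y"
proof -
 have "partition_function (\<lambda>j. a n j + b n j) (N n) / partition_function (\<lambda>j. q n j + q' n j) (N n) =
  (V n * (\<Sum>k\<le>N n. cycle_weight (V n) \<kappa> (q' n) (b n) k * cycle_weight (V n) \<kappa> (q n) (a n) (N n - k))) /
  (V n * (\<Sum>k\<le>N n. cycle_weight (V n) \<kappa> (q' n) (q' n) k * cycle_weight (V n) \<kappa> (q n) (q n) (N n - k)))" for n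
 proof -
  define c where "c = exp (\<kappa> / V n) ^ N n * exp (\<Sum>j. q n (Suc j) * exp (- \<kappa> / V n) ^ Suc j / real (Suc j)) *
   exp (\<Sum>j. q' n (Suc j) * exp (- \<kappa> / V n) ^ Suc j / real (Suc j))"
  have c: "c \<noteq> 0" unfolding c_def by simp
  show ?thesis
   unfolding partition_function_split_weights[of _ _ _ \<kappa> "V n" "q n" "q' n"] c_def[symmetric]
   using c V[of n] by simp
 qed
 then show ?thesis using tendsto_divide[OF num den y] by simp
qed

context background
begin

text \<open>In \<open>convolution_tendsto\<close> the concentrated factor is the background and the
  local one the effective factor. The uniform bound on the latter for all \<open>m \<le> N n\<close>
  is where the spectral criterion acts; \<open>\<rho> + 1\<close> eventually exceeds
  \<open>N / V\<close>.\<close>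

lemma weight_convolution_tendsto:
 fixes N :: "nat => nat" and qe qe' q' :: "nat => nat => real"
 assumes VT: "filterlim V at_top sequentially" and \<kappa>: "0 < \<kappa>"
  and N: "(\<lambda>n. real (N n) / V n) \<longlonglongrightarrow> \<rho>" and \<rho>: "\<rho>b < \<rho>"
  and K: "logarithmic_trace_bound V \<kappa> qe K"
  and qe: "\<And>n j. 1 \<le> j ==> 0 \<le> qe' n j" "\<And>n j. 1 \<le> j ==> qe' n j \<le> qe n j"
  and loc: "\<And>\<epsilon>. 0 < \<epsilon> ==> \<exists>\<eta>>0. \<forall>\<^sub>F n in sequentially. \<forall>m. \<bar>real m / V n - (\<rho> - \<rho>b)\<bar> < \<eta> \<longrightarrow>
   \<bar>V n * cycle_weight (V n) \<kappa> (qe n) (qe' n) m - \<gamma>\<bar> < \<epsilon>"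
  and q': "\<And>n j. 1 \<le> j ==> 0 \<le> q' n j" "\<And>n j. 1 \<le> j ==> q' n j \<le> q n j"
  and \<tau>: "(\<lambda>n. suminf (weight n (q' n))) \<longlonglongrightarrow> \<tau>"
 shows "(\<lambda>n. V n * (\<Sum>k\<le>N n. weight n (q' n) k * cycle_weight (V n) \<kappa> (qe n) (qe' n) (N n - k))) \<longlonglongrightarrow> \<tau> * \<gamma>"
proof (rule convolution_tendsto[where P = "\<lambda>n. weight n (q n)" and a = "\<rho> - \<rho>b" and \<rho>b = \<rho>b
   and K = "exp K * (K * exp 1 * 2 powr K * (\<rho> + 1) powr K)"])
 show "(\<lambda>n. real (N n) / V n) \<longlonglongrightarrow> \<rho>b + (\<rho> - \<rho>b)" using N by simp
 show "\<forall>\<^sub>F n in sequentially. \<forall>k. 0 \<le> weight n (q' n) k \<and> weight n (q' n) k \<le> weight n (q n) k"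
  using cycle_weight_nonneg[OF q'(1)] cycle_weight_mono[OF q'] by (intro always_eventually) auto
 show "0 \<le> cycle_weight (V n) \<kappa> (qe n) (qe' n) m" for n m by (rule cycle_weight_nonneg[OF qe(1)])
 have "\<forall>\<^sub>F n in sequentially. real (N n) / V n < \<rho> + 1" using N by (rule order_tendstoD) simp
 moreover have "\<forall>\<^sub>F n in sequentially. 1 \<le> V n" using VT by (simp add: filterlim_at_top)
 ultimately show "\<forall>\<^sub>F n in sequentially. \<forall>m\<le>N n. V n * cycle_weight (V n) \<kappa> (qe n) (qe' n) m \<le> exp K * (K * exp 1 * 2 powr K * (\<rho> + 1) powr K)"
  using K[unfolded logarithmic_trace_bound_def]
 proof eventually_elim
  case (elim n)
  from elim(3)[THEN conjunct2] obtain \<Theta> where \<Theta>: "1 \<le> \<Theta>" "\<Theta> \<le> K" "\<And>j. 1 \<le> j ==> qe n j \<le> \<Theta>"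
    "\<Theta> * ln (V n) \<le> K + (\<Sum>j. qe n (Suc j) * exp (- \<kappa> / V n) ^ Suc j / real (Suc j))" by blast
  have qe0: "0 \<le> qe n j" if "1 \<le> j" for j using qe(1)[OF that, of n] qe(2)[OF that, of n] by linarith
  show ?case
  proof (intro allI impI)
   fix m assume m: "m \<le> N n"
   have "real (N n) \<le> (\<rho> + 1) * V n" using elim(1) V[of n] by (simp add: divide_less_eq)
   then have m': "real m \<le> (\<rho> + 1) * V n" using m by linarith
   have "V n * cycle_weight (V n) \<kappa> (qe n) (qe' n) m \<le> V n * cycle_weight (V n) \<kappa> (qe n) (qe n) m"
    by (intro mult_left_mono cycle_weight_mono qe less_imp_le[OF V])
   also have "\<dots> \<le> exp K * (K * exp 1 * 2 powr K * (\<rho> + 1) powr K)"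
    by (rule cycle_weight_small_bound[OF elim(2) qe0 \<Theta>(3) \<Theta>(1,2) \<kappa> \<Theta>(4) _ m']) (use \<rho> \<rho>b in auto)
   finally show "V n * cycle_weight (V n) \<kappa> (qe n) (qe' n) m \<le> exp K * (K * exp 1 * 2 powr K * (\<rho> + 1) powr K)" .
  qed
 qed
qed (use V weight_sum_le weight_concentration \<tau> loc \<rho> in auto)

end

text \<open>Gives access to the lemmas on sections for a single measure, such as
  \<open>\<mu>eff n j\<close>.\<close>

lemma weak_kernel_constant: "finite_borel M ==> weak_kernel (\<lambda>_. M)"
 by unfold_locales auto

text \<open>The weight that replaces \<open>mass M\<close> for cycles of size \<open>x\<close> once
  each of them carries the factor \<open>exp (- h)\<close>.\<close>

definition laplace_weight :: "(real \<times> real \<times> 'm::polish_space => real) => real => 'm measure => real" where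
 "laplace_weight h x M = (LINT u:{0..1}|lborel. \<integral>m. exp (- h (u, x, m)) \<partial>M)"

lemma laplace_weight_bounds:
 fixes h :: "real \<times> real \<times> 'm::polish_space => real"
 assumes M: "finite_borel M" and h: "h \<in> nonneg_test_functions" and x: "0 < x"
 shows "0 \<le> laplace_weight h x M" "laplace_weight h x M \<le> mass M"
  "(\<And>u m. u \<in> {0..1} ==> h (u, x, m) = 0) ==> laplace_weight h x M = mass M"
proof -
 interpret finite_measure M using M by (simp add: finite_borel_def)
 have h0: "0 \<le> h z" if "z \<in> E" for z using h that by (auto simp: nonneg_test_functions_def)
 have c: "continuous_on E (\<lambda>z. exp (- h z))"
  using h by (intro continuous_intros) (auto simp: nonneg_test_functions_def test_functions_def)
 have b: "\<bar>exp (- h z)\<bar> \<le> 1" if "z \<in> E" for z using h0[OF that] by simp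
 note wk = weak_kernel_constant[OF M]
 have i: "integrable M (\<lambda>m. exp (- h (u, x, m)))" if "u \<in> {0..1}" for u
  by (rule weak_kernel.section_integrable[OF wk c b that x])
 show "0 \<le> laplace_weight h x M"
  unfolding laplace_weight_def set_lebesgue_integral_def
  by (intro integral_nonneg_AE AE_I2) (auto simp: indicator_def)
 have "laplace_weight h x M \<le> (LINT u:{0..1::real}|lborel. mass M)"
  unfolding laplace_weight_def
 proof (intro set_integral_mono)
  show "set_integrable lborel {0..1} (\<lambda>u. \<integral>m. exp (- h (u, x, m)) \<partial>M)"
   by (rule weak_kernel.averaged_integrable[OF wk c b x])
  show "set_integrable lborel {0..1::real} (\<lambda>u. mass M)"
   by (auto simp: set_integrable_def intro!: integrable_mult_left integrable_real_indicator)
  fix u :: real assume u: "u \<in> {0..1}"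
  have "(\<integral>m. exp (- h (u, x, m)) \<partial>M) \<le> (\<integral>m. 1 \<partial>M)"
   using u x by (intro integral_mono i[OF u]) (auto intro!: h0 simp: E_def)
  then show "(\<integral>m. exp (- h (u, x, m)) \<partial>M) \<le> mass M" by simp
 qed
 then show "laplace_weight h x M \<le> mass M" by (simp add: set_lebesgue_integral_def)
 assume z: "\<And>u m. u \<in> {0..1} ==> h (u, x, m) = 0"
 have "laplace_weight h x M = (LINT u:{0..1::real}|lborel. mass M)"
  unfolding laplace_weight_def by (intro set_lebesgue_integral_cong) (auto simp: z)
 then show "laplace_weight h x M = mass M" by (simp add: set_lebesgue_integral_def)
qed

text \<open>Chebyshev's inequality for \<open>exp (- X)\<close>, whose first two moments are values of the Laplace transform of \<open>X\<close>.\<close>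

lemma (in prob_space) deviation_laplace_bound:
 fixes X :: "'a => real"
 assumes X[measurable]: "X \<in> borel_measurable M" and X0: "\<And>\<omega>. \<omega> \<in> space M ==> 0 \<le> X \<omega>" and \<eta>: "0 < \<eta>"
 shows "prob {\<omega> \<in> space M. \<eta> < \<bar>X \<omega> - r\<bar>} \<le>
  ((\<integral>\<omega>. exp (- 2 * X \<omega>) \<partial>M) - 2 * exp (- r) * (\<integral>\<omega>. exp (- 1 * X \<omega>) \<partial>M) + exp (- 2 * r)) / (exp (- r) * (1 - exp (- \<eta>)))\<^sup>2"
proof -
 define c where "c = exp (- r)"
 define \<zeta> where "\<zeta> = c * (1 - exp (- \<eta>))"
 have c: "0 < c" by (simp add: c_def)
 have \<zeta>: "0 < \<zeta>" using c \<eta> by (simp add: \<zeta>_def)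
 have i1: "integrable M (\<lambda>\<omega>. exp (- s * X \<omega>))" if "0 \<le> s" for s
  by (rule integrable_const_bound[where B = 1]) (use X0 that in auto)
 have i: "integrable M (\<lambda>\<omega>. (exp (- X \<omega>) - c)\<^sup>2)"
  and v: "(\<integral>\<omega>. (exp (- X \<omega>) - c)\<^sup>2 \<partial>M) = (\<integral>\<omega>. exp (- 2 * X \<omega>) \<partial>M) - 2 * c * (\<integral>\<omega>. exp (- 1 * X \<omega>) \<partial>M) + c\<^sup>2"
 proof -
  have eq: "(exp (- X \<omega>) - c)\<^sup>2 = exp (- 2 * X \<omega>) - 2 * c * exp (- 1 * X \<omega>) + c\<^sup>2" for \<omega>
   by (simp add: power2_diff exp_double[symmetric] mult_ac)
  show "integrable M (\<lambda>\<omega>. (exp (- X \<omega>) - c)\<^sup>2)" unfolding eq using i1[of 2] i1[of 1] by simp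
  show "(\<integral>\<omega>. (exp (- X \<omega>) - c)\<^sup>2 \<partial>M) = (\<integral>\<omega>. exp (- 2 * X \<omega>) \<partial>M) - 2 * c * (\<integral>\<omega>. exp (- 1 * X \<omega>) \<partial>M) + c\<^sup>2"
   unfolding eq using i1[of 2] i1[of 1] by (simp add: prob_space)
 qed
 have sub: "\<zeta> \<le> \<bar>exp (- x) - c\<bar>" if "\<eta> < \<bar>x - r\<bar>" for x
 proof (cases "r < x")
  case True
  have "exp (- x) \<le> exp (- r - \<eta>)" using that True by simp
  also have "\<dots> = c * exp (- \<eta>)" by (simp add: c_def mult_exp_exp)
  finally show ?thesis by (simp add: \<zeta>_def algebra_simps)
 next
  case False
  have "c * exp \<eta> = exp (- r + \<eta>)" by (simp add: c_def mult_exp_exp)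
  also have "\<dots> \<le> exp (- x)" using that False by simp
  finally have 1: "c * exp \<eta> \<le> exp (- x)" .
  have "c * (2 - exp (- \<eta>)) \<le> c * exp \<eta>"
   using c exp_ge_add_one_self[of \<eta>] exp_ge_add_one_self[of "- \<eta>"] cosh_real_ge_1[of \<eta>]
   by (intro mult_left_mono) (auto simp: cosh_def)
  then show ?thesis using 1 by (simp add: \<zeta>_def algebra_simps)
 qed
 have "prob {\<omega> \<in> space M. \<eta> < \<bar>X \<omega> - r\<bar>} \<le> prob {\<omega> \<in> space M. \<zeta>\<^sup>2 \<le> (exp (- X \<omega>) - c)\<^sup>2}"
 proof (rule finite_measure_mono)
  show "{\<omega> \<in> space M. \<eta> < \<bar>X \<omega> - r\<bar>} \<subseteq> {\<omega> \<in> space M. \<zeta>\<^sup>2 \<le> (exp (- X \<omega>) - c)\<^sup>2}"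
   using sub \<zeta> by (auto simp: abs_le_square_iff[symmetric])
 qed measurable
 also have "\<dots> \<le> (\<integral>\<omega>. (exp (- X \<omega>) - c)\<^sup>2 \<partial>M) / \<zeta>\<^sup>2"
  by (rule integral_Markov_inequality_measure[OF i, where A = "{}"]) (use \<zeta> in auto)
 finally show ?thesis unfolding v unfolding \<zeta>_def c_def by (simp add: exp_double[symmetric] power2_eq_square mult_exp_exp)
qed

theorem theorem3p1:
  fixes V :: "nat \<Rightarrow> real" and \<beta> \<kappa> \<rho> \<rho>bg :: real
    and H D :: "nat \<Rightarrow> 'h::complex_hilbert_space set" and K :: "nat \<Rightarrow> 'h \<Rightarrow> 'h"
    and \<mu> \<mu>eff \<mu>bg :: "nat \<Rightarrow> nat \<Rightarrow> 'm::polish_space measure"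
    and \<eta> :: "real \<Rightarrow> 'm measure" and \<Sigma> :: "real measure"
    and P :: "real \<Rightarrow> (real \<times> real \<times> 'm) measure measure"
    and f0 :: "real \<Rightarrow> real \<Rightarrow> real"
    and Br :: "real \<Rightarrow> (real \<times> real \<times> 'm) measure measure"
    and N :: "nat \<Rightarrow> nat"
  assumes model: "finite_volume_model V \<beta> H D K \<mu> \<mu>eff \<mu>bg"
    and eta_finite: "\<And>x. 0 < x \<Longrightarrow> finite_borel (\<eta> x)"
    and poisson: "\<And>\<kappa>'. 0 < \<kappa>' \<Longrightarrow> poisson_process_law (intensity \<eta> \<kappa>') (P \<kappa>')"
    \<comment> \<open>limiting kernel\<close>
    and eta_continuous: "\<And>f :: 'm \<Rightarrow> real. continuous_on UNIV f \<Longrightarrow> bounded (range f) \<Longrightarrow>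
      continuous_on {0<..} (\<lambda>x. \<integral>m. f m \<partial>\<eta> x)"
    and Sigma_finite: "finite_borel_halfline \<Sigma>"
    and phi_laplace: "\<And>x. 0 < x \<Longrightarrow> mass (\<eta> x) = (\<integral>l. exp (- \<beta> * x * l) \<partial>\<Sigma>)"
    and phi_integrable: "\<And>\<kappa>'. 0 < \<kappa>' \<Longrightarrow>
      set_integrable lborel {0<..} (\<lambda>x. min 1 x * exp (- \<kappa>' * x) * (mass (\<eta> x) / x))"
    \<comment> \<open>density\<close>
    and density_nonneg: "\<And>\<kappa>' a. 0 < \<kappa>' \<Longrightarrow> 0 < a \<Longrightarrow> 0 \<le> f0 \<kappa>' a"
    and density: "\<And>\<kappa>'. 0 < \<kappa>' \<Longrightarrow>
      distributed (P \<kappa>') lborel total_size (\<lambda>a. ennreal (f0 \<kappa>' a) * indicator {0<..} a)"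
    and density_continuous: "\<And>\<kappa>'. 0 < \<kappa>' \<Longrightarrow> continuous_on {0<..} (f0 \<kappa>')"
    \<comment> \<open>effective trace convergence\<close>
    and trace_convergence: "\<And>\<delta> R (F :: real \<times> real \<times> 'm \<Rightarrow> real).
      0 < \<delta> \<Longrightarrow> \<delta> < R \<Longrightarrow> continuous_on (strip \<delta> R) F \<Longrightarrow> bounded (F ` strip \<delta> R) \<Longrightarrow>
      uniform_limit {\<delta>..R}
        (\<lambda>n x. LINT u:{0..1}|lborel. (\<integral>m. F (u, x, m) \<partial>\<mu>eff n (nat \<lfloor>x * V n\<rfloor>)))
        (\<lambda>x. LINT u:{0..1}|lborel. (\<integral>m. F (u, x, m) \<partial>\<eta> x)) sequentially"
    and trace_bounded: "\<exists>C. \<forall>n. \<forall>j\<ge>1. mass (\<mu>eff n j) \<le> C"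
    \<comment> \<open>spectral criterion\<close>
    and spectral: "spectral_criterion_A V \<beta> (\<lambda>n j. mass (\<mu>eff n j)) \<Sigma> \<or>
      spectral_criterion_B V \<beta> (\<lambda>n j. mass (\<mu>eff n j))"
    \<comment> \<open>background\<close>
    and kappa_pos: "0 < \<kappa>" and rho_bg_nonneg: "0 \<le> \<rho>bg"
    and background0: "(\<lambda>n. ennreal (1 / V n) *
      (\<Sum>j. ennreal (exp (- \<kappa> * real (Suc j) / V n) * mass (\<mu>bg n (Suc j))))) \<longlonglongrightarrow> ennreal \<rho>bg"
    and background1: "(\<lambda>n. ennreal (1 / (V n)\<^sup>2) *
      (\<Sum>j. ennreal (real (Suc j) * exp (- \<kappa> * real (Suc j) / V n) * mass (\<mu>bg n (Suc j))))) \<longlonglongrightarrow> 0"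
    \<comment> \<open>density regime\<close>
    and rho_lim: "(\<lambda>n. real (N n) / V n) \<longlonglongrightarrow> \<rho>" and rho_pos: "0 < \<rho>" and rho_gt: "\<rho>bg < \<rho>"
    and density_pos: "0 < f0 \<kappa> (\<rho> - \<rho>bg)"
    and bridge: "bridge_law (P \<kappa>) (f0 \<kappa>) Br"
  shows "weakly_converges point_topology
        (\<lambda>n. distr (canonical_space (\<mu> n) (\<mu>eff n) (\<mu>bg n) (N n)) borel_points
               (cycle_process (V n) UNIV))
        (Br (\<rho> - \<rho>bg)) \<and>
      (\<forall>\<delta> R. 0 < \<delta> \<longrightarrow> \<delta> < R \<longrightarrow>
        (\<lambda>n. measure (canonical_space (\<mu> n) (\<mu>eff n) (\<mu>bg n) (N n))
               {\<omega> \<in> space (canonical_space (\<mu> n) (\<mu>eff n) (\<mu>bg n) (N n)).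
                  0 < emeasure (cycle_process (V n) {Bg} \<omega>) (strip \<delta> R)}) \<longlonglongrightarrow> 0) \<and>
      (\<forall>\<epsilon>>0.
        (\<lambda>n. measure (canonical_space (\<mu> n) (\<mu>eff n) (\<mu>bg n) (N n))
               {\<omega> \<in> space (canonical_space (\<mu> n) (\<mu>eff n) (\<mu>bg n) (N n)).
                  \<epsilon> < dist (particle_number (V n) {Bg} \<omega> / V n,
                           particle_number (V n) {Eff} \<omega> / V n)
                          (\<rho>bg, \<rho> - \<rho>bg)}) \<longlonglongrightarrow> 0)"
proof -
 note V = finite_volume_model.V_pos[OF model] and VT = finite_volume_model.V_at_top[OF model]
  and \<beta> = finite_volume_model.beta_pos[OF model] and fb = finite_volume_model.finite_borel_mu[OF model]
  and split = finite_volume_model.mu_split[OF model]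
 define qe where "qe n j = mass (\<mu>eff n j)" for n j
 define qb where "qb n j = mass (\<mu>bg n j)" for n j
 define we where "we h n j = laplace_weight h (real j / V n) (\<mu>eff n j)" for h n j
 define wb where "wb h n j = laplace_weight h (real j / V n) (\<mu>bg n j)" for h n j
 define Z where "Z n = partition_function (\<lambda>j. mass (\<mu> n j)) (N n)" for n
 define L where "L h a = (\<integral>\<xi>. exp (- (\<integral>z. h z \<partial>\<xi>)) \<partial>Br a)" for h :: "real \<times> real \<times> 'm => real" and a
 let ?a = "\<rho> - \<rho>bg"
 let ?C = "\<lambda>n. canonical_space (\<mu> n) (\<mu>eff n) (\<mu>bg n) (N n)"
 have a: "0 < ?a" using rho_gt by simp
 have qe0: "0 \<le> qe n j" and qb0: "0 \<le> qb n j" for n j by (simp_all add: qe_def qb_def)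
 have mass_eq: "mass (\<mu> n j) = qe n j + qb n j" if "1 \<le> j" for n j
  unfolding qe_def qb_def by (rule mass_split[OF fb(1)[OF that] fb(2)[OF that] fb(3)[OF that] split[OF that]])
 have Z_eq: "Z n = partition_function (\<lambda>j. qe n j + qb n j) (N n)" for n
  unfolding Z_def by (rule partition_function_cong) (rule mass_eq)
 obtain C where C: "\<And>n j. 1 \<le> j ==> qe n j \<le> C" using trace_bounded unfolding qe_def by blast
 have "\<exists>K. logarithmic_trace_bound V \<kappa> qe K"
  using spectral spectral_criterion_A_bound[where V = V, OF V \<beta> kappa_pos] spectral_criterion_B_bound[where V = V, OF V \<beta> kappa_pos]
  unfolding qe_def[abs_def] by blast
 then obtain K0 where K0: "logarithmic_trace_bound V \<kappa> qe K0" by (rule exE)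
 \<comment> \<open>For small \<open>n\<close> the masses may vanish and the canonical law may fail
   to be a probability; positivity is part of the eventual trace bound.\<close>
 have cm: "\<forall>\<^sub>F n in sequentially. canonical_model (\<mu> n) (\<mu>eff n) (\<mu>bg n)"
  using K0[unfolded logarithmic_trace_bound_def]
 proof eventually_elim
  case (elim n)
  have "0 < mass (\<mu> n j)" if j: "1 \<le> j" for j
   unfolding mass_eq[OF j] using elim[THEN conjunct1] j qb0[of n j] by (intro add_pos_nonneg) auto
  then show ?case by unfold_locales (use fb split in auto)
 qed
 interpret weak_kernel \<eta>
  by unfold_locales (use eta_finite eta_continuous in auto)
 interpret background V \<kappa> \<rho>bg qb
  by (rule background.intro[OF V qb0 rho_bg_nonneg background0[folded qb_def] background1[folded qb_def]])
 note dens = density[OF kappa_pos] and phi = phi_integrable[OF kappa_pos] and law = poisson[OF kappa_pos]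
  and fc = density_continuous[OF kappa_pos] and fnn = density_nonneg[OF kappa_pos]
 have jx: "0 < real j / V n" if "1 \<le> j" for j n using that V[of n] by simp
 have zero_h: "laplace_weight (\<lambda>_. 0) x M = mass M" if "finite_borel M" "0 < x" for x and M :: "'m measure"
  by (rule laplace_weight_bounds(3)[OF that(1) zero_test_function that(2)]) simp
 have we: "0 \<le> we h n j" "we h n j \<le> qe n j" and wb: "0 \<le> wb h n j" "wb h n j \<le> qb n j"
  if "h \<in> nonneg_test_functions" "1 \<le> j" for h n j
  unfolding we_def wb_def qe_def qb_def
  using laplace_weight_bounds(1,2)[OF fb(2)[OF that(2)] that(1) jx[OF that(2)]]
   laplace_weight_bounds(1,2)[OF fb(3)[OF that(2)] that(1) jx[OF that(2)]] by auto
 have we_0: "we (\<lambda>_. 0) n j = qe n j" if "1 \<le> j" for n j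
  unfolding we_def qe_def by (rule zero_h[OF fb(2)[OF that] jx[OF that]])
 \<comment> \<open>\<open>h\<close> vanishes for sizes below some \<open>\<delta>\<close>, so
   neither the effective nor the background weights are modified there. Both
   \<open>effective_local_limit\<close> and \<open>weight_truncated\<close> rely on this.\<close>
 have small: "\<exists>\<delta>>0. \<forall>n j. 1 \<le> j \<longrightarrow> real j / V n < \<delta> \<longrightarrow> we h n j = qe n j \<and> wb h n j = qb n j"
  if h: "h \<in> nonneg_test_functions" for h
 proof -
  obtain \<delta> R where d: "0 < \<delta>" and z: "\<And>z. z \<in> E ==> z \<notin> strip \<delta> R ==> h z = 0"
   using h by (auto simp: nonneg_test_functions_def test_functions_def)
  have "we h n j = qe n j \<and> wb h n j = qb n j" if j: "1 \<le> j" and s: "real j / V n < \<delta>" for n j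
  proof -
   have "h (u, real j / V n, m) = 0" if "u \<in> {0..1}" for u m
    using that jx[OF j, of n] s by (intro z) (auto simp: E_def strip_def)
   then show ?thesis unfolding we_def wb_def qe_def qb_def
    using laplace_weight_bounds(3)[OF fb(2)[OF j] h jx[OF j]] laplace_weight_bounds(3)[OF fb(3)[OF j] h jx[OF j]] by blast
  qed
  with d show ?thesis by blast
 qed
 have h_cont: "continuous_on E (\<lambda>z. exp (- h z))" and h_bound: "\<And>z. z \<in> E ==> \<bar>exp (- h z)\<bar> \<le> 1"
  if "h \<in> nonneg_test_functions" for h :: "real \<times> real \<times> 'm => real"
  using that by (auto simp: nonneg_test_functions_def test_functions_def intro!: continuous_intros)
 define \<psi> where "\<psi> h x = laplace_weight h x (\<eta> x)" for h x
 have \<psi>_cont: "continuous_on {0<..} (\<psi> h)" if "h \<in> nonneg_test_functions" for h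
  unfolding \<psi>_def[abs_def] laplace_weight_def by (rule averaged_continuous[OF h_cont[OF that] h_bound[OF that]])
 have lim: "\<forall>\<^sub>F n in sequentially. \<forall>j. \<delta> \<le> real j / V n \<and> real j / V n \<le> R \<longrightarrow> \<bar>we h n j - \<psi> h (real j / V n)\<bar> < \<epsilon>"
  if h: "h \<in> nonneg_test_functions" and d: "0 < \<delta>" "\<delta> < R" "0 < \<epsilon>" for h \<delta> R \<epsilon>
 proof -
  have sub: "strip \<delta> R \<subseteq> (E :: (real \<times> real \<times> 'm) set)" using d by (auto simp: strip_def E_def)
  have "bounded ((\<lambda>z. exp (- h z)) ` strip \<delta> R)"
   unfolding bounded_iff using h_bound[OF h] sub by (intro exI[of _ 1]) auto
  from trace_convergence[OF d(1,2) continuous_on_subset[OF h_cont[OF h] sub] this]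
  have "uniform_limit {\<delta>..R} (\<lambda>n x. laplace_weight h x (\<mu>eff n (nat \<lfloor>x * V n\<rfloor>))) (\<psi> h) sequentially"
   unfolding laplace_weight_def \<psi>_def[abs_def] .
  from uniform_limit_at_lattice[where V = V and G = "\<lambda>n j x. laplace_weight h x (\<mu>eff n j)", OF V this d(3)] show ?thesis unfolding we_def .
 qed
 have \<psi>_0: "\<psi> (\<lambda>_. 0) x = mass (\<eta> x)" if "0 < x" for x unfolding \<psi>_def by (rule zero_h[OF eta_finite[OF that] that])
 \<comment> \<open>The candidate limit is the bridge weight \<open>G\<close>. It is continuous at
   \<open>?a\<close> because the density is positive there and \<open>bridge_law\<close> selects the
   continuous version of the conditional law.\<close>
 have eff: "\<exists>\<epsilon>'>0. \<forall>\<^sub>F n in sequentially. \<forall>m. \<bar>real m / V n - ?a\<bar> < \<epsilon>' \<longrightarrow>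
   \<bar>V n * cycle_weight (V n) \<kappa> (qe n) (we h n) m - L h ?a * f0 \<kappa> ?a\<bar> < \<epsilon>"
  if h: "h \<in> nonneg_test_functions" and \<epsilon>: "0 < \<epsilon>" for h \<epsilon>
 proof -
  define G where "G a = (if 0 < a \<and> 0 < f0 \<kappa> a then L h a * f0 \<kappa> a else 0)" for a
  note G = G_def[abs_def, unfolded L_def]
  obtain \<delta> where \<delta>: "0 < \<delta>" "\<And>n j. 1 \<le> j ==> real j / V n < \<delta> ==> we h n j = qe n j"
   using small[OF h] by blast
  have lq: "\<forall>\<^sub>F n in sequentially. \<forall>j. \<delta> \<le> real j / V n \<and> real j / V n \<le> R \<longrightarrow> \<bar>qe n j - mass (\<eta> (real j / V n))\<bar> < \<epsilon>"
   if d: "0 < \<delta>" "\<delta> < R" "0 < \<epsilon>" for \<delta> R \<epsilon>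
   using lim[OF zero_test_function d]
  proof eventually_elim
   case (elim n)
   show ?case
   proof (intro allI impI)
    fix j assume j: "\<delta> \<le> real j / V n \<and> real j / V n \<le> R"
    then have x: "0 < real j / V n" using d(1) by linarith
    then have "1 \<le> j" by (cases j) auto
    from elim[THEN spec, THEN mp, OF j] show "\<bar>qe n j - mass (\<eta> (real j / V n))\<bar> < \<epsilon>"
     unfolding we_0[OF \<open>1 \<le> j\<close>] \<psi>_0[OF x] .
   qed
  qed
  have lap: "(LINT x:{0<..}|lborel. G x * exp (- x) ^ k) =
    exp (- (LINT x:{0<..}|lborel. (mass (\<eta> x) - \<psi> h x * exp (- real k * x)) * exp (- \<kappa> * x) / x))" for k :: nat
   unfolding G \<psi>_def laplace_weight_def
   by (rule bridge_weight_laplace[OF law phi fnn fc dens bridge h])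
  have "\<exists>\<epsilon>'>0. \<forall>\<^sub>F n in sequentially. \<forall>m. \<bar>real m / V n - ?a\<bar> < \<epsilon>' \<longrightarrow> \<bar>V n * cycle_weight (V n) \<kappa> (qe n) (we h n) m - G ?a\<bar> < \<epsilon>"
  proof (rule effective_local_limit[OF V VT kappa_pos we(1)[OF h] we(2)[OF h] C \<delta> mass_continuous \<psi>_cont[OF h] lq lim[OF h] _ _ lap a \<epsilon>])
   show "set_integrable lborel {0<..} G" unfolding G by (rule bridge_weight_integrable[OF law phi fnn fc dens bridge h])
   show "isCont G ?a" unfolding G by (rule bridge_weight_isCont[OF law phi fnn fc dens bridge h a density_pos])
  qed
  then show ?thesis using a density_pos by (simp add: G_def)
 qed
 have Br: "prob_space (Br ?a)" "sets (Br ?a) = sets borel_points"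
  using bridge[unfolded bridge_law_def, THEN conjunct1, THEN spec, THEN mp, OF conjI[OF a density_pos]] by auto
 have L0: "L (\<lambda>_. 0) ?a = 1" unfolding L_def using prob_space.prob_space[OF Br(1)] by simp
 have conv: "(\<lambda>n. V n * (\<Sum>k\<le>N n. cycle_weight (V n) \<kappa> (qb n) (q' n) k * cycle_weight (V n) \<kappa> (qe n) (we h n) (N n - k))) \<longlonglongrightarrow> \<tau> * (L h ?a * f0 \<kappa> ?a)"
  if h: "h \<in> nonneg_test_functions" and q': "\<And>n j. 1 \<le> j ==> 0 \<le> q' n j" "\<And>n j. 1 \<le> j ==> q' n j \<le> qb n j"
   and \<tau>: "(\<lambda>n. suminf (weight n (q' n))) \<longlonglongrightarrow> \<tau>" for h q' \<tau>
  by (rule weight_convolution_tendsto[OF VT kappa_pos rho_lim rho_gt K0 we(1)[OF h] we(2)[OF h] eff[OF h] q' \<tau>])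
 \<comment> \<open>The two families agree for \<open>j \<ge> 1\<close>, which is all that a cycle
   weight depends on; monotonicity in both directions expresses this.\<close>
 have cw_0: "cycle_weight (V n) \<kappa> (qe n) (we (\<lambda>_. 0) n) m = cycle_weight (V n) \<kappa> (qe n) (qe n) m" for n m
  by (intro antisym cycle_weight_mono) (auto simp: we_0 qe0)
 \<comment> \<open>Nothing is modified here, so any cutoff serves, for instance 1.\<close>
 have full: "(\<lambda>n. suminf (weight n (qb n))) \<longlonglongrightarrow> 1" by (rule weight_truncated[of 1]) (auto simp: qb0)
 have den: "(\<lambda>n. V n * (\<Sum>k\<le>N n. cycle_weight (V n) \<kappa> (qb n) (qb n) k * cycle_weight (V n) \<kappa> (qe n) (qe n) (N n - k))) \<longlonglongrightarrow> 1 * (L (\<lambda>_. 0) ?a * f0 \<kappa> ?a)"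
  using conv[OF zero_test_function qb0 order_refl full] unfolding cw_0 .
 \<comment> \<open>The denominator tends to \<open>f0 \<kappa> ?a\<close>, which is positive, and
   this factor of the numerator cancels.\<close>
 have ratio: "(\<lambda>n. partition_function (\<lambda>j. we h n j + q' n j) (N n) / Z n) \<longlonglongrightarrow> \<tau> * L h ?a"
  if h: "h \<in> nonneg_test_functions" and q': "\<And>n j. 1 \<le> j ==> 0 \<le> q' n j" "\<And>n j. 1 \<le> j ==> q' n j \<le> qb n j"
   and \<tau>: "(\<lambda>n. suminf (weight n (q' n))) \<longlonglongrightarrow> \<tau>" for h q' \<tau>
  using partition_ratio_tendsto[OF V conv[OF h q' \<tau>] den] density_pos unfolding Z_eq L0 by simp
 have ratio_bg: "(\<lambda>n. partition_function (\<lambda>j. qe n j + q' n j) (N n) / Z n) \<longlonglongrightarrow> \<tau>"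
  if q': "\<And>n j. 1 \<le> j ==> 0 \<le> q' n j" "\<And>n j. 1 \<le> j ==> q' n j \<le> qb n j"
   and \<tau>: "(\<lambda>n. suminf (weight n (q' n))) \<longlonglongrightarrow> \<tau>" for q' \<tau>
 proof -
  have "partition_function (\<lambda>j. we (\<lambda>_. 0) n j + q' n j) (N n) = partition_function (\<lambda>j. qe n j + q' n j) (N n)" for n
   by (rule partition_function_cong) (simp add: we_0)
  then show ?thesis using ratio[OF zero_test_function q' \<tau>] unfolding L0 by simp
 qed

 \<comment> \<open>The background is invisible to test functions in the limit: its modified weights
   keep total mass 1, and the quotient tends to the Laplace functional of the bridge alone.\<close>
 have goal1: "weakly_converges point_topology (\<lambda>n. distr (?C n) borel_points (cycle_process (V n) UNIV)) (Br ?a)"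
 proof (rule weakly_convergesI)
  show "\<forall>\<^sub>F n in sequentially. prob_space (distr (?C n) borel_points (cycle_process (V n) UNIV))"
   using cm
  proof eventually_elim
   case (elim n)
   show ?case
    by (rule prob_space.prob_space_distr[OF canonical_model.prob_space_canonical[OF elim]
       canonical_model.cycle_process_measurable[OF elim V]])
  qed
  fix h :: "real \<times> real \<times> 'm => real" assume h: "h \<in> nonneg_test_functions"
  obtain \<delta> where \<delta>: "0 < \<delta>" "\<And>n j. 1 \<le> j ==> real j / V n < \<delta> ==> wb h n j = qb n j"
   using small[OF h] by blast
  have "(\<lambda>n. suminf (weight n (wb h n))) \<longlonglongrightarrow> 1"
   by (rule weight_truncated[OF \<delta>(1) wb(1)[OF h] wb(2)[OF h] \<delta>(2)])
  from ratio[OF h wb(1)[OF h] wb(2)[OF h] this]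
  have "(\<lambda>n. partition_function (\<lambda>j. we h n j + wb h n j) (N n) / Z n) \<longlonglongrightarrow> L h ?a" by simp
  then have "(\<lambda>n. \<integral>\<xi>. exp (- (\<integral>z. h z \<partial>\<xi>)) \<partial>distr (?C n) borel_points (cycle_process (V n) UNIV)) \<longlonglongrightarrow> L h ?a"
  proof (rule Lim_transform_eventually)
   show "\<forall>\<^sub>F n in sequentially. partition_function (\<lambda>j. we h n j + wb h n j) (N n) / Z n =
     (\<integral>\<xi>. exp (- (\<integral>z. h z \<partial>\<xi>)) \<partial>distr (?C n) borel_points (cycle_process (V n) UNIV))"
    using cm
   proof eventually_elim
    case (elim n)
    show ?case unfolding Z_def
     by (rule canonical_model.canonical_laplace[OF elim V h, symmetric]) (simp add: we_def wb_def laplace_weight_def)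
   qed
  qed
  then show "(\<lambda>n. \<integral>\<xi>. exp (- (\<integral>z. h z \<partial>\<xi>)) \<partial>distr (?C n) borel_points (cycle_process (V n) UNIV)) \<longlonglongrightarrow>
    (\<integral>\<xi>. exp (- (\<integral>z. h z \<partial>\<xi>)) \<partial>Br ?a)" unfolding L_def .
 qed (use Br in auto)

 \<comment> \<open>Deleting the background cycles in the strip leaves the partition function
   asymptotically unchanged, so the probability that there are none tends to 1.\<close>
 have goal2: "(\<lambda>n. measure (?C n) {\<omega> \<in> space (?C n). 0 < emeasure (cycle_process (V n) {Bg} \<omega>) (strip \<delta> R)}) \<longlonglongrightarrow> 0"
  if \<delta>: "0 < \<delta>" for \<delta> R
 proof -
  define q' where "q' n j = (if \<delta> \<le> real j / V n \<and> real j / V n \<le> R then 0 else qb n j)" for n j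
  have q': "0 \<le> q' n j" "q' n j \<le> qb n j" "real j / V n < \<delta> ==> q' n j = qb n j" for n j
   using qb0[of n j] by (auto simp: q'_def)
  have "(\<lambda>n. 1 - partition_function (\<lambda>j. qe n j + q' n j) (N n) / Z n) \<longlonglongrightarrow> 1 - 1"
   by (intro tendsto_diff tendsto_const ratio_bg weight_truncated[OF \<delta>] q')
  then have "(\<lambda>n. 1 - partition_function (\<lambda>j. qe n j + q' n j) (N n) / Z n) \<longlonglongrightarrow> 0" by simp
  then show ?thesis
  proof (rule Lim_transform_eventually)
   show "\<forall>\<^sub>F n in sequentially. 1 - partition_function (\<lambda>j. qe n j + q' n j) (N n) / Z n =
    measure (?C n) {\<omega> \<in> space (?C n). 0 < emeasure (cycle_process (V n) {Bg} \<omega>) (strip \<delta> R)}"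
    using cm
   proof eventually_elim
    case (elim n)
    show ?case unfolding Z_def q'_def qe_def qb_def
     by (rule canonical_model.canonical_strip[OF elim V \<delta>, symmetric])
   qed
  qed
 qed

 define X where "X n \<omega> = particle_number (V n) {Bg} \<omega> / V n"
  for n and \<omega> :: "(nat => nat) \<times> (nat \<times> nat => (label \<times> 'm) \<times> real)"
 \<comment> \<open>The limit is the Laplace transform of the point mass at \<open>\<rho>bg\<close>;
   the values at 1 and 2 are what \<open>deviation_laplace_bound\<close> uses.\<close>
 have moment: "(\<lambda>n. \<integral>\<omega>. exp (- s * X n \<omega>) \<partial>?C n) \<longlonglongrightarrow> exp (- s * \<rho>bg)" if s: "0 \<le> s" for s
 proof -
  have q': "0 \<le> exp (- s * (real j / V n)) * qb n j" "exp (- s * (real j / V n)) * qb n j \<le> qb n j" for n j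
   using qb0[of n j] s V[of n] by (auto intro!: mult_left_le_one_le)
  from ratio_bg[OF q' weight_laplace(2)[OF s]] show ?thesis
  proof (rule Lim_transform_eventually)
   show "\<forall>\<^sub>F n in sequentially. partition_function (\<lambda>j. qe n j + exp (- s * (real j / V n)) * qb n j) (N n) / Z n =
     (\<integral>\<omega>. exp (- s * X n \<omega>) \<partial>?C n)"
    using cm
   proof eventually_elim
    case (elim n)
    show ?case unfolding Z_def X_def qe_def qb_def
     by (rule canonical_model.particle_number_laplace[OF elim V s, symmetric])
   qed
  qed
 qed
 have goal3: "(\<lambda>n. measure (?C n) {\<omega> \<in> space (?C n).
   \<epsilon> < dist (particle_number (V n) {Bg} \<omega> / V n, particle_number (V n) {Eff} \<omega> / V n) (\<rho>bg, ?a)}) \<longlonglongrightarrow> 0" (is "(\<lambda>n. measure _ (?S n)) \<longlonglongrightarrow> 0")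
  if \<epsilon>: "0 < \<epsilon>" for \<epsilon>
 proof (rule tendsto_sandwich[OF _ _ tendsto_const])
  define b where "b n = ((\<integral>\<omega>. exp (- 2 * X n \<omega>) \<partial>?C n) - 2 * exp (- \<rho>bg) * (\<integral>\<omega>. exp (- 1 * X n \<omega>) \<partial>?C n) + exp (- 2 * \<rho>bg)) /
   (exp (- \<rho>bg) * (1 - exp (- (\<epsilon> / 4))))\<^sup>2" for n
  have "b \<longlonglongrightarrow> (exp (- 2 * \<rho>bg) - 2 * exp (- \<rho>bg) * exp (- 1 * \<rho>bg) + exp (- 2 * \<rho>bg)) / (exp (- \<rho>bg) * (1 - exp (- (\<epsilon> / 4))))\<^sup>2"
   unfolding b_def[abs_def] by (intro tendsto_intros moment) (use \<epsilon> in auto)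
  moreover have "exp (- 2 * \<rho>bg) - 2 * exp (- \<rho>bg) * exp (- 1 * \<rho>bg) + exp (- 2 * \<rho>bg) = 0"
   by (simp add: mult_exp_exp mult.assoc)
  ultimately show "b \<longlonglongrightarrow> 0" by simp
  show "\<forall>\<^sub>F n in sequentially. 0 \<le> measure (?C n) (?S n)" by simp
  have "\<forall>\<^sub>F n in sequentially. dist (real (N n) / V n) \<rho> < \<epsilon> / 2" using rho_lim \<epsilon> by (intro tendstoD) auto
  with cm show "\<forall>\<^sub>F n in sequentially. measure (?C n) (?S n) \<le> b n"
  proof eventually_elim
   case (elim n)
   interpret prob_space "?C n" by (rule canonical_model.prob_space_canonical[OF elim(1)])
   have Xm[measurable]: "X n \<in> borel_measurable (?C n)"
unfolding X_def[abs_def]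
    by (rule borel_measurable_divide[OF canonical_model.particle_number_measurable[OF elim(1) V] borel_measurable_const])
   have X0: "0 \<le> X n \<omega>" if "\<omega> \<in> space (?C n)" for \<omega>
    unfolding X_def using canonical_model.particle_number_nonneg[OF elim(1) V that] V[of n] by simp
   \<comment> \<open>The two particle numbers add up to \<open>N\<close>, so the effective deviation
     is at most the background deviation plus
     \<open>\<bar>N / V - \<rho>\<bar> < \<epsilon> / 2\<close>. A joint deviation beyond
     \<open>\<epsilon>\<close> therefore leaves more than \<open>\<epsilon> / 4\<close> for the
     background.\<close>
   have "measure (?C n) (?S n) \<le>
    prob {\<omega> \<in> space (?C n). \<epsilon> / 4 < \<bar>X n \<omega> - \<rho>bg\<bar>}"
   proof (rule finite_measure_mono)
    show "{\<omega> \<in> space (?C n). \<epsilon> / 4 < \<bar>X n \<omega> - \<rho>bg\<bar>} \<in> events" by measurable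
    show "?S n
     \<subseteq> {\<omega> \<in> space (?C n). \<epsilon> / 4 < \<bar>X n \<omega> - \<rho>bg\<bar>}"
    proof (intro Collect_mono impI)
     fix \<omega> assume *: "\<omega> \<in> space (?C n) \<and> \<epsilon> < dist (particle_number (V n) {Bg} \<omega> / V n, particle_number (V n) {Eff} \<omega> / V n) (\<rho>bg, ?a)"
     let ?Y = "particle_number (V n) {Eff} \<omega> / V n"
     have "?Y + X n \<omega> = real (N n) / V n"
      unfolding X_def add_divide_distrib[symmetric] canonical_model.particle_number_sum[OF elim(1) V *[THEN conjunct1]] ..
     moreover have "dist (X n \<omega>, ?Y) (\<rho>bg, ?a) \<le> \<bar>X n \<omega> - \<rho>bg\<bar> + \<bar>?Y - ?a\<bar>"
      unfolding dist_Pair_Pair dist_real_def by (rule order_trans[OF sqrt_sum_squares_le_sum_abs]) simp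
     moreover have "\<epsilon> < dist (X n \<omega>, ?Y) (\<rho>bg, ?a)" using * unfolding X_def by blast
     ultimately show "\<omega> \<in> space (?C n) \<and> \<epsilon> / 4 < \<bar>X n \<omega> - \<rho>bg\<bar>" using * elim(2) unfolding dist_real_def by linarith
    qed
   qed
   also have "\<dots> \<le> b n" unfolding b_def by (rule deviation_laplace_bound[OF Xm X0]) (use \<epsilon> in auto)
   finally show ?case .
  qed
 qed
 show ?thesis using goal1 goal2 goal3 by blast
qed

end
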